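(* Let $R$ be an approximately Gorenstein noetherian domain of arbitrary characteristic and let $\mathcal C$ be the collection of finite $R$-subalgebras of $R^+$. Then: (1) The ideal $\tau_R:=\bigcap_{S\in\mathcal C}\tau_{S/R}$ equals the big plus closure test ideal of $R$, which equals $\bigcap_I (I: IR^+\cap R)$, where the intersection ranges over all ideals $I$ of $R$. (2) If $R$ is complete local and $B$ is an $R$-algebra, then $\tau_{B/R}=\bigcap_I (I: IB\cap R)$, where the intersection ranges over all ideals $I$ of $R$.
   Context: $R^+$ is the integral closure of the domain $R$ in a fixed algebraic closure of $\mathrm{Frac}(R)$. For an $R$-algebra $B$, $\tau_{B/R}:=\mathrm{im}(\mathrm{Hom}_R(B,R)\xrightarrow{\text{evaluation at }1}R)$, and $IB\cap R$ denotes the preimage of $IB$ under $R\to B$. For ideals, $(I:J)=\{r\in R: rJ\subseteq I\}$. A noetherian local ring $(A,\mathfrak m)$ is approximately Gorenstein if for every $n>0$ there is an ideal $I\subseteq\mathfrak m^n$ with $A/I$ Gorenstein; a noetherian ring is approximately Gorenstein if its localizations at all maximal ideals are. For $R$-modules $N\subseteq M$ the plus closure of $N$ in $M$ is $N^{\mathrm{cl}_{R^+}}_M=\{m\in M: 1\otimes m\in\mathrm{im}(R^+\otimes_RN\to R^+\otimes_RM)\}$, and the big plus closure test ideal is $\bigcap_{N\subseteq M}(N:_RN^{\mathrm{cl}_{R^+}}_M)$ over all $R$-modules $M$ and submodules $N$. *)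

theory Defs
  imports "HOL-Algebra.Algebra"
begin

text \<open>
  A commutative algebra \<open>B\<close> over \<open>R\<close> is a record with \<^term>\<open>algebra R B\<close>; its structure map
  \<open>R \<rightarrow> B\<close> is \<open>r \<mapsto> r \<odot> \<one>\<close>. Sub-objects are obtained by shrinking the carrier of the
  ambient record.
\<close>

definition mod_hom ::
    "('a, 'x) ring_scheme \<Rightarrow> ('a, 'b, 'y) module_scheme \<Rightarrow> ('a, 'c, 'z) module_scheme \<Rightarrow> ('b \<Rightarrow> 'c) set"
  where "mod_hom R M N =
    {f \<in> carrier M \<rightarrow> carrier N.
      (\<forall>x\<in>carrier M. \<forall>y\<in>carrier M. f (x \<oplus>\<^bsub>M\<^esub> y) = f x \<oplus>\<^bsub>N\<^esub> f y) \<and>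
      (\<forall>r\<in>carrier R. \<forall>x\<in>carrier M. f (r \<odot>\<^bsub>M\<^esub> x) = r \<odot>\<^bsub>N\<^esub> f x)}"

definition self_module :: "('a, 'x) ring_scheme \<Rightarrow> ('a, 'a) module"
  where "self_module R =
    \<lparr>carrier = carrier R, monoid.mult = (\<otimes>\<^bsub>R\<^esub>), one = \<one>\<^bsub>R\<^esub>, ring.zero = \<zero>\<^bsub>R\<^esub>, add = (\<oplus>\<^bsub>R\<^esub>), smult = (\<otimes>\<^bsub>R\<^esub>)\<rparr>"

definition finite_module :: "('a, 'x) ring_scheme \<Rightarrow> ('a, 'b, 'y) module_scheme \<Rightarrow> bool"
  where "finite_module R M \<longleftrightarrow>
    module R M \<and>
    (\<exists>U. U \<subseteq> carrier M \<and> finite U \<and> (\<forall>N. submodule N R M \<and> U \<subseteq> N \<longrightarrow> N = carrier M))"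

definition algebra_map :: "('a, 'b, 'y) module_scheme \<Rightarrow> 'a \<Rightarrow> 'b"
  where "algebra_map B r = r \<odot>\<^bsub>B\<^esub> \<one>\<^bsub>B\<^esub>"

definition trace_ideal :: "('a, 'x) ring_scheme \<Rightarrow> ('a, 'b, 'y) module_scheme \<Rightarrow> 'a set"
  where "trace_ideal R B = (\<lambda>\<phi>. \<phi> \<one>\<^bsub>B\<^esub>) ` mod_hom R B (self_module R)"

definition colon :: "('a, 'x) ring_scheme \<Rightarrow> ('a, 'b, 'y) module_scheme \<Rightarrow> 'b set \<Rightarrow> 'b set \<Rightarrow> 'a set"
  where "colon R M N U = {r \<in> carrier R. \<forall>x\<in>U. r \<odot>\<^bsub>M\<^esub> x \<in> N}"

definition ext_contr :: "('a, 'x) ring_scheme \<Rightarrow> ('a, 'b, 'y) module_scheme \<Rightarrow> 'a set \<Rightarrow> 'a set"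
  where "ext_contr R B I = {r \<in> carrier R. algebra_map B r \<in> Idl\<^bsub>B\<^esub> (algebra_map B ` I)}"

definition local_ring :: "('a, 'x) ring_scheme \<Rightarrow> 'a set \<Rightarrow> bool"
  where "local_ring A \<mm> \<longleftrightarrow> cring A \<and> maximalideal \<mm> A \<and> (\<forall>J. maximalideal J A \<longrightarrow> J = \<mm>)"

definition ideal_power :: "('a, 'x) ring_scheme \<Rightarrow> 'a set \<Rightarrow> nat \<Rightarrow> 'a set"
  where "ideal_power A I n = I [^]\<^bsub>ideals_set A\<^esub> n"

text \<open>
  Bijectivity of \<open>A \<rightarrow> lim A/\<mm>\<^sup>n\<close>: an element of the inverse limit is represented by a sequence
  \<open>x\<close> in \<open>A\<close> whose consecutive terms satisfy \<open>x (Suc n) - x n \<in> \<mm>\<^sup>n\<close>.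
\<close>

definition complete_local_ring :: "('a, 'x) ring_scheme \<Rightarrow> bool"
  where "complete_local_ring A \<longleftrightarrow> (\<exists>\<mm>. local_ring A \<mm> \<and>
    (\<forall>x. (\<forall>n. x n \<in> carrier A) \<and> (\<forall>n. x (Suc n) \<ominus>\<^bsub>A\<^esub> x n \<in> ideal_power A \<mm> n) \<longrightarrow>
      (\<exists>!y. y \<in> carrier A \<and> (\<forall>n. x n \<ominus>\<^bsub>A\<^esub> y \<in> ideal_power A \<mm> n))))"

definition fraction_class :: "('a, 'x) ring_scheme \<Rightarrow> 'a set \<Rightarrow> 'a \<Rightarrow> 'a \<Rightarrow> ('a \<times> 'a) set"
  where "fraction_class R S a s =
    {(b, t). b \<in> carrier R \<and> t \<in> S \<and>
       (\<exists>u\<in>S. u \<otimes>\<^bsub>R\<^esub> (a \<otimes>\<^bsub>R\<^esub> t \<ominus>\<^bsub>R\<^esub> b \<otimes>\<^bsub>R\<^esub> s) = \<zero>\<^bsub>R\<^esub>)}"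

text \<open>The unions below are over equal classes; they express operations on representatives.\<close>

definition localization :: "('a, 'x) ring_scheme \<Rightarrow> 'a set \<Rightarrow> ('a \<times> 'a) set ring"
  where "localization R S =
    \<lparr>carrier = {fraction_class R S a s | a s. a \<in> carrier R \<and> s \<in> S},
     monoid.mult = (\<lambda>U V. \<Union>(a, s)\<in>U. \<Union>(b, t)\<in>V. fraction_class R S (a \<otimes>\<^bsub>R\<^esub> b) (s \<otimes>\<^bsub>R\<^esub> t)),
     one = fraction_class R S \<one>\<^bsub>R\<^esub> \<one>\<^bsub>R\<^esub>,
     ring.zero = fraction_class R S \<zero>\<^bsub>R\<^esub> \<one>\<^bsub>R\<^esub>,
     add = (\<lambda>U V. \<Union>(a, s)\<in>U. \<Union>(b, t)\<in>V.
              fraction_class R S (a \<otimes>\<^bsub>R\<^esub> t \<oplus>\<^bsub>R\<^esub> b \<otimes>\<^bsub>R\<^esub> s) (s \<otimes>\<^bsub>R\<^esub> t))\<rparr>"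

text \<open>
  HOL cannot quantify over all types inside a definition, so the test modules of an injective
  module live on the type of that module. As soon as this type is large enough to hold a copy
  of the ring, the test modules include the ring and its ideals, and by Baer's criterion the
  notion does not depend on the type.
\<close>

definition injective_module :: "('a, 'x) ring_scheme \<Rightarrow> ('a, 'e) module \<Rightarrow> bool"
  where "injective_module A E \<longleftrightarrow> module A E \<and>
    (\<forall>(M :: ('a, 'e) module) (N :: ('a, 'e) module) i g.
      module A M \<and> module A N \<and> i \<in> mod_hom A N M \<and> inj_on i (carrier N) \<and> g \<in> mod_hom A N E \<longrightarrow>
      (\<exists>h\<in>mod_hom A M E. \<forall>x\<in>carrier N. h (i x) = g x))"

text \<open>
  Existence of a finite injective resolution \<open>0 \<rightarrow> M \<rightarrow> E 0 \<rightarrow> E 1 \<rightarrow> \<dots> \<rightarrow> E n \<rightarrow> 0\<close> by modules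
  carried by the type given by the first argument.
\<close>

definition finite_injective_dim ::
    "'e itself \<Rightarrow> ('a, 'x) ring_scheme \<Rightarrow> ('a, 'b, 'y) module_scheme \<Rightarrow> bool"
  where "finite_injective_dim _ A M \<longleftrightarrow>
    (\<exists>(E :: nat \<Rightarrow> ('a, 'e) module) \<epsilon> d n.
      (\<forall>i. injective_module A (E i)) \<and>
      (\<forall>i>n. carrier (E i) = {\<zero>\<^bsub>E i\<^esub>}) \<and>
      \<epsilon> \<in> mod_hom A M (E 0) \<and> (\<forall>i. d i \<in> mod_hom A (E i) (E (Suc i))) \<and>
      inj_on \<epsilon> (carrier M) \<and>
      \<epsilon> ` carrier M = a_kernel (E 0) (E 1) (d 0) \<and>
      (\<forall>i. d i ` carrier (E i) = a_kernel (E (Suc i)) (E (Suc (Suc i))) (d (Suc i))))"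

text \<open>
  For a noetherian ring \<open>A\<close> on the type \<open>'a\<close>, the modules in the minimal injective resolution
  of \<open>A\<close> have at most \<open>max |A| \<aleph>\<^sub>0\<close> elements (each is a direct sum of copies of the hulls
  \<open>E(A/p)\<close>, finitely many for each prime \<open>p\<close>). Hence the type \<open>'a list\<close> loses no resolutions.
\<close>

definition gorenstein_local_ring :: "('a, 'x) ring_scheme \<Rightarrow> bool"
  where "gorenstein_local_ring A \<longleftrightarrow>
    noetherian_ring A \<and> (\<exists>\<mm>. local_ring A \<mm>) \<and>
    finite_injective_dim TYPE('a list) A (self_module A)"

definition approx_gorenstein_local :: "('a, 'x) ring_scheme \<Rightarrow> bool"
  where "approx_gorenstein_local A \<longleftrightarrow>
    noetherian_ring A \<and>
    (\<exists>\<mm>. local_ring A \<mm> \<and>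
      (\<forall>n>0. \<exists>I. ideal I A \<and> I \<subseteq> ideal_power A \<mm> n \<and> gorenstein_local_ring (A Quot I)))"

definition approx_gorenstein :: "('a, 'x) ring_scheme \<Rightarrow> bool"
  where "approx_gorenstein R \<longleftrightarrow>
    cring R \<and> noetherian_ring R \<and>
    (\<forall>\<mm>. maximalideal \<mm> R \<longrightarrow> approx_gorenstein_local (localization R (carrier R - \<mm>)))"

definition alg_closure_of_fractions :: "('a, 'x) ring_scheme \<Rightarrow> ('a, 'l) module \<Rightarrow> bool"
  where "alg_closure_of_fractions R L \<longleftrightarrow>
    algebra R L \<and> inj_on (algebra_map L) (carrier R) \<and>
    algebraic_closure L
      {algebra_map L a \<otimes>\<^bsub>L\<^esub> inv\<^bsub>L\<^esub> (algebra_map L b) | a b.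
        a \<in> carrier R \<and> b \<in> carrier R \<and> b \<noteq> \<zero>\<^bsub>R\<^esub>}"

definition integral_over :: "('a, 'x) ring_scheme \<Rightarrow> ('a, 'l) module \<Rightarrow> 'l \<Rightarrow> bool"
  where "integral_over R L x \<longleftrightarrow>
    (\<exists>p. polynomial\<^bsub>L\<^esub> (algebra_map L ` carrier R) p \<and> p \<noteq> [] \<and> lead_coeff p = \<one>\<^bsub>L\<^esub> \<and>
      ring.eval L p x = \<zero>\<^bsub>L\<^esub>)"

definition abs_int_closure :: "('a, 'x) ring_scheme \<Rightarrow> ('a, 'l) module \<Rightarrow> ('a, 'l) module"
  where "abs_int_closure R L = L\<lparr>carrier := {x \<in> carrier L. integral_over R L x}\<rparr>"

definition finite_subalgebras :: "('a, 'x) ring_scheme \<Rightarrow> ('a, 'l) module \<Rightarrow> ('a, 'l) module set"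
  where "finite_subalgebras R B =
    {B\<lparr>carrier := S\<rparr> | S.
      subring S B \<and> algebra_map B ` carrier R \<subseteq> S \<and> finite_module R (B\<lparr>carrier := S\<rparr>)}"

definition plus_trace_ideal :: "('a, 'x) ring_scheme \<Rightarrow> ('a, 'l) module \<Rightarrow> 'a set"
  where "plus_trace_ideal R L =
    (\<Inter>S\<in>finite_subalgebras R (abs_int_closure R L). trace_ideal R S)"

definition tensor_rel ::
    "('a, 'x) ring_scheme \<Rightarrow> ('a, 'b) module \<Rightarrow> ('a, 'c) module \<Rightarrow> ('b \<times> 'c \<Rightarrow>\<^sub>0 int) set"
  where "tensor_rel R P M = generate (free_Abelian_group (carrier P \<times> carrier M))
    ({frag_of (p \<oplus>\<^bsub>P\<^esub> q, m) - frag_of (p, m) - frag_of (q, m) | p q m.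
        p \<in> carrier P \<and> q \<in> carrier P \<and> m \<in> carrier M} \<union>
     {frag_of (p, m \<oplus>\<^bsub>M\<^esub> n) - frag_of (p, m) - frag_of (p, n) | p m n.
        p \<in> carrier P \<and> m \<in> carrier M \<and> n \<in> carrier M} \<union>
     {frag_of (r \<odot>\<^bsub>P\<^esub> p, m) - frag_of (p, r \<odot>\<^bsub>M\<^esub> m) | r p m.
        r \<in> carrier R \<and> p \<in> carrier P \<and> m \<in> carrier M})"

definition tensor_product ::
    "('a, 'x) ring_scheme \<Rightarrow> ('a, 'b) module \<Rightarrow> ('a, 'c) module \<Rightarrow> ('b \<times> 'c \<Rightarrow>\<^sub>0 int) set monoid"
  where "tensor_product R P M =
    free_Abelian_group (carrier P \<times> carrier M) Mod tensor_rel R P M"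

definition pure_tensor ::
    "('a, 'x) ring_scheme \<Rightarrow> ('a, 'b) module \<Rightarrow> ('a, 'c) module \<Rightarrow> 'b \<Rightarrow> 'c \<Rightarrow> ('b \<times> 'c \<Rightarrow>\<^sub>0 int) set"
  where "pure_tensor R P M p m =
    tensor_rel R P M #>\<^bsub>free_Abelian_group (carrier P \<times> carrier M)\<^esub> frag_of (p, m)"

text \<open>
  For a submodule \<open>N\<close> of \<open>M\<close>, the map \<open>P \<otimes> N \<rightarrow> P \<otimes> M\<close> induced by the inclusion sends the
  class of \<open>z\<close> modulo the relations over \<open>N\<close> to its class modulo the relations over \<open>M\<close>.
\<close>

definition tensor_incl ::
    "('a, 'x) ring_scheme \<Rightarrow> ('a, 'b) module \<Rightarrow> ('a, 'c) module \<Rightarrow>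
      ('b \<times> 'c \<Rightarrow>\<^sub>0 int) set \<Rightarrow> ('b \<times> 'c \<Rightarrow>\<^sub>0 int) set"
  where "tensor_incl R P M Z =
    tensor_rel R P M <#>\<^bsub>free_Abelian_group (carrier P \<times> carrier M)\<^esub> Z"

definition plus_closure ::
    "('a, 'x) ring_scheme \<Rightarrow> ('a, 'l) module \<Rightarrow> ('a, 'm) module \<Rightarrow> 'm set \<Rightarrow> 'm set"
  where "plus_closure R L M N = (let P = abs_int_closure R L in
    {m \<in> carrier M. pure_tensor R P M \<one>\<^bsub>P\<^esub> m \<in>
       tensor_incl R P M ` carrier (tensor_product R P (M\<lparr>carrier := N\<rparr>))})"

text \<open>
  The modules \<open>M\<close> range over all \<open>R\<close>-modules carried by (subsets of) the type in the first
  argument. For \<open>R\<close> on \<open>'a\<close>, the types \<open>'a + 'm\<close> with arbitrary \<open>'m\<close> cover every \<open>R\<close>-module,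
  and each of them has a copy of \<open>R\<close> itself among its modules.
\<close>

definition big_plus_test_ideal ::
    "'m itself \<Rightarrow> ('a, 'x) ring_scheme \<Rightarrow> ('a, 'l) module \<Rightarrow> 'a set"
  where "big_plus_test_ideal _ R L =
    \<Inter> {colon R M N (plus_closure R L M N) | (M :: ('a, 'm) module) N.
         module R M \<and> submodule N R M}"

end

theory Submission
  imports Defs
begin

text \<open>
  A finite injective resolution of \<open>A/I\<close> is improved step by step: a regular element is divided
  out, and when the depth is zero the last term splits off, since the top Ext groups vanish. At
  the end one has an \<open>\<mm>\<close>-primary ideal \<open>K \<supseteq> I\<close> with \<open>A/K\<close> self-injective. As the regular elements
  may be taken from any power of \<open>\<mm>\<close>, approximate Gorensteinness provides such \<open>K\<close> inside every
  \<open>\<mm>\<close>-primary ideal.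

  An element \<open>c\<close> of all the colon ideals makes \<open>r \<cdot> 1 \<mapsto> r c\<close> a partial map \<open>B \<rightarrow> R\<close> that is
  compatible with the reductions modulo all \<open>K\<close>, where it extends by self-injectivity. If \<open>R\<close>
  is complete, it extends to \<open>B\<close> by Zorn's lemma and linear compactness. If \<open>B\<close> is a finite
  module, the extensions are the solutions of a finite linear system, which by Krull's theorem
  only has to be solved modulo the ideals \<open>K\<close>.

  A relation in \<open>R\<^sup>+ \<otimes> M\<close> involves finitely many elements of \<open>R\<^sup>+\<close>, so it holds over a finite
  subalgebra \<open>S\<close>, and an \<open>R\<close>-linear map \<open>S \<rightarrow> R\<close> with \<open>1 \<mapsto> c\<close> carries it to \<open>M\<close>.
\<close>

section \<open>Noetherian rings and Baer's condition\<close>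

text \<open>The quotients supplied by the hypothesis are Gorenstein of unknown dimension, while
  extending maps requires quotients injective over themselves. The passage between the two must also
  control the ideal, which has to stay inside a prescribed \<open>\<mm>\<close>-primary one. To
  avoid a new ring at every division, no further quotient is formed after A/I: modules over R/J are
  submodules of R-modules killed by J, and maps into R/J are functions to R that are linear modulo
  J.

  A map to R/K is known only modulo K, and several K occur at once. Partial maps are therefore
  linear relations G in M x R such that (x, y) in G and x in N K force y in K. For an algebra B the
  submodule N K is KB. For a finite subalgebra S of R^+ it is the part of K R^+ in S, which can
  exceed KS, because the colon ideals know only contractions from R^+.

  In the complete case the compactness argument rests on double annihilators, D = (K : (K : D)) for
  ideals D above K: they give the descending chain condition modulo K, and they compare the
  conditions imposed by different K.\<close>

lemma (in cring) idealI_cring: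
  assumes "I \<subseteq> carrier R" "\<zero> \<in> I"
    and "\<And>a b. a \<in> I \<Longrightarrow> b \<in> I \<Longrightarrow> a \<oplus> b \<in> I"
    and mult: "\<And>a r. a \<in> I \<Longrightarrow> r \<in> carrier R \<Longrightarrow> r \<otimes> a \<in> I"
  shows "ideal I R"
proof (rule idealI[OF ring_axioms])
  have "\<ominus> a \<in> I" if "a \<in> I" for a
    using mult[OF that, of "\<ominus> \<one>"] that assms(1) by (auto simp: l_minus)
  then show "subgroup I (add_monoid R)"
    using assms by (intro add.subgroupI) (auto simp: a_inv_def)
  fix a x assume "a \<in> I" "x \<in> carrier R"
  then show "x \<otimes> a \<in> I" "a \<otimes> x \<in> I"
    using mult[of a x] assms(1) m_comm[of a x] by auto
qed

lemma (in ideal) minus_closed_ideal: "a \<in> I \<Longrightarrow> b \<in> I \<Longrightarrow> a \<ominus> b \<in> I"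
  by (simp add: minus_eq)

lemma (in module) submoduleI':
  assumes "H \<subseteq> carrier M" "\<zero>\<^bsub>M\<^esub> \<in> H"
    and "\<And>a b. a \<in> H \<Longrightarrow> b \<in> H \<Longrightarrow> a \<oplus>\<^bsub>M\<^esub> b \<in> H"
    and smult: "\<And>r a. r \<in> carrier R \<Longrightarrow> a \<in> H \<Longrightarrow> r \<odot>\<^bsub>M\<^esub> a \<in> H"
  shows "submodule H R M"
proof (rule submoduleI)
  fix a assume "a \<in> H"
  then show "\<ominus>\<^bsub>M\<^esub> a \<in> H"
    using smult[of "\<ominus> \<one>" a] assms(1) by (auto simp: smult_l_minus)
qed (use assms in auto)

lemma submoduleD:
  assumes "submodule H R M"
  shows "H \<subseteq> carrier M" "\<zero>\<^bsub>M\<^esub> \<in> H"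
    "\<And>a b. a \<in> H \<Longrightarrow> b \<in> H \<Longrightarrow> a \<oplus>\<^bsub>M\<^esub> b \<in> H"
    "\<And>r a. r \<in> carrier R \<Longrightarrow> a \<in> H \<Longrightarrow> r \<odot>\<^bsub>M\<^esub> a \<in> H"
proof -
  interpret submodule H R M by fact
  show "H \<subseteq> carrier M" "\<zero>\<^bsub>M\<^esub> \<in> H"
    "\<And>a b. a \<in> H \<Longrightarrow> b \<in> H \<Longrightarrow> a \<oplus>\<^bsub>M\<^esub> b \<in> H"
    "\<And>r a. r \<in> carrier R \<Longrightarrow> a \<in> H \<Longrightarrow> r \<odot>\<^bsub>M\<^esub> a \<in> H"
    using subset one_closed m_closed smult_closed by auto
qed

lemma (in module) submodule_minus:
  assumes "submodule H R M" "a \<in> H" "b \<in> H"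
  shows "a \<ominus>\<^bsub>M\<^esub> b \<in> H"
  using submoduleE(3,5)[OF assms(1)] assms(2,3) by (simp add: M.minus_eq)


lemma (in abelian_group) minus_eq_zero_iff:
  assumes "x \<in> carrier G" "y \<in> carrier G"
  shows "x \<ominus> y = \<zero> \<longleftrightarrow> x = y"
  using assms by (metis a_inv_closed minus_eq minus_equality minus_minus r_neg)

lemma (in abelian_group) add_cancel_left_minus:
  assumes "x \<in> carrier G" "y \<in> carrier G"
  shows "x \<oplus> (y \<oplus> \<ominus> x) = y" "\<ominus> x \<oplus> (y \<oplus> x) = y"
    "z \<in> carrier G \<Longrightarrow> x \<oplus> (y \<oplus> (\<ominus> x \<oplus> z)) = y \<oplus> z"
    "z \<in> carrier G \<Longrightarrow> \<ominus> x \<oplus> (y \<oplus> (x \<oplus> z)) = y \<oplus> z"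
  using assms by (simp_all add: a_lcomm[of _ y] r_neg l_neg r_neg1 r_neg2)

lemma (in module) smult_left_commute:
  assumes "a \<in> carrier R" "b \<in> carrier R" "x \<in> carrier M"
  shows "a \<odot>\<^bsub>M\<^esub> (b \<odot>\<^bsub>M\<^esub> x) = b \<odot>\<^bsub>M\<^esub> (a \<odot>\<^bsub>M\<^esub> x)"
  using assms m_comm[of a b] by (simp flip: smult_assoc1)

lemmas (in module) module_simps = smult_r_distr smult_l_distr smult_assoc1 M.minus_eq R.minus_eq
  smult_r_minus smult_l_minus smult_left_commute M.a_ac M.r_neg M.l_neg M.r_neg1 M.r_neg2
  M.minus_add M.minus_minus M.add_cancel_left_minus

section \<open>Noetherian induction and maximal ideals\<close>

lemma (in noetherian_ring) maximal_element_ideals: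
  assumes "\<A> \<noteq> {}" "\<And>I. I \<in> \<A> \<Longrightarrow> ideal I R"
  shows "\<exists>M\<in>\<A>. \<forall>I\<in>\<A>. M \<subseteq> I \<longrightarrow> I = M"
proof (rule subset_Zorn_nonempty[OF assms(1)])
  fix C assume C: "C \<noteq> {}" "subset.chain \<A> C"
  then have "subset.chain {I. ideal I R} C"
    using assms(2) by (simp add: pred_on.chain_def subset_iff)
  then have "\<Union>C \<in> C" using ideal_chain_is_trivial C(1) by blast
  then show "\<Union>C \<in> \<A>" using C(2) by (simp add: pred_on.chain_def subset_iff)
qed

lemma (in noetherian_ring) noetherian_induct [consumes 1, case_names step]:
  assumes "ideal I R"
    and "\<And>I. ideal I R \<Longrightarrow> (\<And>K. ideal K R \<Longrightarrow> I \<subset> K \<Longrightarrow> P K) \<Longrightarrow> P I"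
  shows "P I"
proof (rule ccontr)
  assume "\<not> P I"
  then obtain M where "ideal M R" "\<not> P M" "\<And>K. ideal K R \<Longrightarrow> \<not> P K \<Longrightarrow> M \<subseteq> K \<Longrightarrow> K = M"
    using maximal_element_ideals[of "{K. ideal K R \<and> \<not> P K}"] assms(1) by blast
  then show False using assms(2)[of M] by blast
qed

lemma (in noetherian_ring) exists_maximalideal:
  assumes "ideal I R" "\<one> \<notin> I"
  shows "\<exists>M. maximalideal M R \<and> I \<subseteq> M"
  using assms
proof (induction rule: noetherian_induct)
  case (step I)
  interpret I: ideal I R by fact
  show ?case
  proof (cases "\<exists>K. ideal K R \<and> I \<subset> K \<and> \<one> \<notin> K")
    case True
    then show ?thesis using step(2) by (meson dual_order.trans psubset_imp_subset)
  next
    case False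
    have "maximalideal I R"
    proof (rule maximalidealI[OF step(1)])
      show "carrier R \<noteq> I" using step.prems by auto
      fix J assume "ideal J R" "I \<subseteq> J" "J \<subseteq> carrier R"
      then show "J = I \<or> J = carrier R"
        using False ideal.one_imp_carrier by blast
    qed
    then show ?thesis by blast
  qed
qed

text \<open>\<open>adjoin_elt\<close> and \<open>quot_elt\<close> are I + Ra and (I : a). They are
  linked by the exact sequence 0 -> R/(I : a) -> R/I -> R/(I + Ra) -> 0, along which statements
  about R/I are reduced to larger ideals.\<close>

definition adjoin_elt :: "('a, 'x) ring_scheme \<Rightarrow> 'a set \<Rightarrow> 'a \<Rightarrow> 'a set"
  where "adjoin_elt R I a = {i \<oplus>\<^bsub>R\<^esub> r \<otimes>\<^bsub>R\<^esub> a | i r. i \<in> I \<and> r \<in> carrier R}"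

definition quot_elt :: "('a, 'x) ring_scheme \<Rightarrow> 'a set \<Rightarrow> 'a \<Rightarrow> 'a set"
  where "quot_elt R I a = {r \<in> carrier R. r \<otimes>\<^bsub>R\<^esub> a \<in> I}"

lemma (in cring) adjoin_elt:
  assumes "ideal I R" "a \<in> carrier R"
  shows "ideal (adjoin_elt R I a) R" "I \<subseteq> adjoin_elt R I a" "a \<in> adjoin_elt R I a"
    and "\<And>K. ideal K R \<Longrightarrow> I \<subseteq> K \<Longrightarrow> a \<in> K \<Longrightarrow> adjoin_elt R I a \<subseteq> K"
proof -
  interpret I: ideal I R by fact
  show "ideal (adjoin_elt R I a) R"
  proof (rule idealI_cring)
    have "\<zero> = \<zero> \<oplus> \<zero> \<otimes> a" using assms by simp
    then show "\<zero> \<in> adjoin_elt R I a" unfolding adjoin_elt_def using I.zero_closed by blast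
    show "adjoin_elt R I a \<subseteq> carrier R" unfolding adjoin_elt_def using assms by auto
  next
    fix x y assume "x \<in> adjoin_elt R I a" "y \<in> adjoin_elt R I a"
    then obtain i r j s where "i \<in> I" "r \<in> carrier R" "x = i \<oplus> r \<otimes> a"
      "j \<in> I" "s \<in> carrier R" "y = j \<oplus> s \<otimes> a" unfolding adjoin_elt_def by blast
    moreover from this have "x \<oplus> y = (i \<oplus> j) \<oplus> (r \<oplus> s) \<otimes> a"
      using assms I.Icarr by algebra
    ultimately show "x \<oplus> y \<in> adjoin_elt R I a" unfolding adjoin_elt_def by blast
  next
    fix x t assume "x \<in> adjoin_elt R I a" and t: "t \<in> carrier R"
    then obtain i r where "i \<in> I" "r \<in> carrier R" "x = i \<oplus> r \<otimes> a"
      unfolding adjoin_elt_def by blast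
    moreover from this have "t \<otimes> x = (t \<otimes> i) \<oplus> (t \<otimes> r) \<otimes> a"
      using assms I.Icarr t by algebra
    ultimately show "t \<otimes> x \<in> adjoin_elt R I a"
      unfolding adjoin_elt_def using t I.I_l_closed by blast
  qed
  show "I \<subseteq> adjoin_elt R I a"
  proof
    fix i assume "i \<in> I"
    moreover from this have "i = i \<oplus> \<zero> \<otimes> a" using assms I.Icarr by simp
    ultimately show "i \<in> adjoin_elt R I a" unfolding adjoin_elt_def by blast
  qed
  have "a = \<zero> \<oplus> \<one> \<otimes> a" using assms by simp
  then show "a \<in> adjoin_elt R I a" unfolding adjoin_elt_def using I.zero_closed by blast
  show "adjoin_elt R I a \<subseteq> K" if K: "ideal K R" and "I \<subseteq> K" "a \<in> K" for K
  proof -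
    interpret K: ideal K R by fact
    show ?thesis unfolding adjoin_elt_def using that K.I_l_closed K.a_closed by blast
  qed
qed

lemma (in cring) quot_elt:
  assumes "ideal I R" "a \<in> carrier R"
  shows "ideal (quot_elt R I a) R" "I \<subseteq> quot_elt R I a"
proof -
  interpret I: ideal I R by fact
  show "ideal (quot_elt R I a) R"
    by (rule idealI_cring) (use assms(2) I.I_l_closed in \<open>auto simp: quot_elt_def l_distr m_assoc\<close>)
  show "I \<subseteq> quot_elt R I a"
    using assms(2) I.I_r_closed I.Icarr by (auto simp: quot_elt_def)
qed

locale noetherian_local = noetherian_ring R + cring R for R (structure) +
  fixes \<mm>
  assumes local: "local_ring R \<mm>"
begin

lemma maximal: "maximalideal \<mm> R" using local by (simp add: local_ring_def)

sublocale m: maximalideal \<mm> R by (rule maximal)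

lemma one_notin: "\<one> \<notin> \<mm>" using m.one_imp_carrier m.I_notcarr by blast

lemma notin_Units:
  assumes "x \<in> carrier R" "x \<notin> \<mm>"
  shows "\<exists>y\<in>carrier R. x \<otimes> y = \<one>"
proof (rule ccontr)
  assume *: "\<not> ?thesis"
  \<comment> \<open>Adjoining x to the zero ideal gives the principal ideal Rx. If it were proper,
    it would lie in a maximal ideal, hence in \<open>\<mm>\<close>.\<close>
  have "\<one> \<notin> adjoin_elt R {\<zero>} x"
    using * assms(1) by (auto simp: adjoin_elt_def m_comm)
  then obtain M where "maximalideal M R" "adjoin_elt R {\<zero>} x \<subseteq> M"
    using exists_maximalideal adjoin_elt(1)[OF zeroideal assms(1)] by blast
  then show False using local assms adjoin_elt(3)[OF zeroideal assms(1)]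
    by (auto simp: local_ring_def)
qed

lemma one_minus_Units:
  assumes "x \<in> \<mm>" "c \<in> carrier R"
  shows "\<exists>y\<in>carrier R. (\<one> \<ominus> c \<otimes> x) \<otimes> y = \<one>"
proof (rule notin_Units)
  show "\<one> \<ominus> c \<otimes> x \<in> carrier R" using assms m.Icarr by simp
  show "\<one> \<ominus> c \<otimes> x \<notin> \<mm>"
  proof
    assume "\<one> \<ominus> c \<otimes> x \<in> \<mm>"
    then have "(\<one> \<ominus> c \<otimes> x) \<oplus> c \<otimes> x \<in> \<mm>" using assms m.I_l_closed m.a_closed by blast
    moreover have "(\<one> \<ominus> c \<otimes> x) \<oplus> c \<otimes> x = \<one>" using assms m.Icarr by algebra
    ultimately show False using one_notin by simp
  qed
qed

lemma proper_ideal_subset: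
  assumes "ideal I R" "\<one> \<notin> I"
  shows "I \<subseteq> \<mm>"
  using exists_maximalideal[OF assms] local by (auto simp: local_ring_def)

text \<open>Krull's intersection theorem for the module \<open>R/H\<close>.\<close>

lemma divisible_sequence_in_ideal:
  assumes "ideal H R" "x \<in> \<mm>" and b: "\<And>n. b n \<in> carrier R"
    and step: "\<And>n. b n \<ominus> x \<otimes> b (Suc n) \<in> H"
  shows "b 0 \<in> H"
proof -
  interpret H: ideal H R by fact
  have x: "x \<in> carrier R" using assms(2) m.Icarr by simp
  note adj = adjoin_elt[OF assms(1) b]
  \<comment> \<open>The ideals H + R b k ascend, since b k and x b (k + 1) agree modulo H. At a
    maximal member b (n + 1) = h + c b n, hence (1 - c x) b (n + 1) lies in H, and 1 - c x is a unit
    because x lies in \<open>\<mm>\<close>. From b (n + 1) in H one descends to b 0.\<close>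
  obtain n where n: "\<And>k. adjoin_elt R H (b n) \<subseteq> adjoin_elt R H (b k) \<Longrightarrow>
      adjoin_elt R H (b k) = adjoin_elt R H (b n)"
  proof -
    have "\<exists>M\<in>range (\<lambda>k. adjoin_elt R H (b k)). \<forall>I\<in>range (\<lambda>k. adjoin_elt R H (b k)). M \<subseteq> I \<longrightarrow> I = M"
      by (rule maximal_element_ideals) (use adj(1) in auto)
    then show ?thesis using that by auto
  qed
  have prev: "b n \<in> adjoin_elt R H (b (Suc n))" for n
  proof -
    have "b n = (b n \<ominus> x \<otimes> b (Suc n)) \<oplus> x \<otimes> b (Suc n)" using b x
      by (metis b m_closed minus_eq a_assoc l_neg r_zero a_inv_closed)
    then show ?thesis using step[of n] x unfolding adjoin_elt_def by blast
  qed
  have "adjoin_elt R H (b n) \<subseteq> adjoin_elt R H (b (Suc n))"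
    using adj(4)[OF adj(1) adj(2) prev] .
  then have "b (Suc n) \<in> adjoin_elt R H (b n)" using n[of "Suc n"] adj(3)[of "Suc n"] by simp
  then obtain h c where hc: "h \<in> H" "c \<in> carrier R" "b (Suc n) = h \<oplus> c \<otimes> b n"
    unfolding adjoin_elt_def by blast
  obtain y where y: "y \<in> carrier R" "(\<one> \<ominus> c \<otimes> x) \<otimes> y = \<one>"
    using one_minus_Units assms(2) hc(2) by blast
  have h: "h \<in> carrier R" using hc H.Icarr by simp
  have "(\<one> \<ominus> c \<otimes> x) \<otimes> b (Suc n) = b (Suc n) \<ominus> c \<otimes> (x \<otimes> b (Suc n))"
    using b[of "Suc n"] x hc(2) by algebra
  also have "\<dots> = h \<oplus> c \<otimes> (b n \<ominus> x \<otimes> b (Suc n))"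
    using hc(3) b[of n] b[of "Suc n"] x hc(2) h by algebra
  finally have "(\<one> \<ominus> c \<otimes> x) \<otimes> b (Suc n) \<in> H"
    using hc step[of n] H.I_l_closed H.a_closed by metis
  then have "y \<otimes> ((\<one> \<ominus> c \<otimes> x) \<otimes> b (Suc n)) \<in> H" using y H.I_l_closed by blast
  moreover have "y \<otimes> ((\<one> \<ominus> c \<otimes> x) \<otimes> b (Suc n)) = b (Suc n)"
  proof -
    have "y \<otimes> ((\<one> \<ominus> c \<otimes> x) \<otimes> b (Suc n)) = ((\<one> \<ominus> c \<otimes> x) \<otimes> y) \<otimes> b (Suc n)"
      using y(1) hc(2) x b[of "Suc n"] by algebra
    then show ?thesis using y b by simp
  qed
  ultimately have top: "b (Suc n) \<in> H" by simp
  have down: "b k \<in> H" if "b (Suc k) \<in> H" for k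
    using adj(4)[OF assms(1) subset_refl that] prev by blast
  have "b (Suc n - k) \<in> H" for k
  proof (induction k)
    case (Suc k)
    then show ?case by (cases "k \<le> n") (auto simp: Suc_diff_le intro: down)
  qed (use top in simp)
  from this[of "Suc n"] show ?thesis by simp
qed

end

text \<open>Baer's condition for the submodule \<open>V\<close> of \<open>M\<close>, regarded as a module over \<open>R/J\<close>.\<close>

definition baer_module :: "('a, 'x) ring_scheme \<Rightarrow> 'a set \<Rightarrow> ('a, 'b, 'y) module_scheme \<Rightarrow> 'b set \<Rightarrow> bool"
  where "baer_module R J M V \<longleftrightarrow>
    (\<forall>I f. ideal I R \<and> J \<subseteq> I \<and> f \<in> I \<rightarrow> V \<and>
      (\<forall>x\<in>I. \<forall>y\<in>I. f (x \<oplus>\<^bsub>R\<^esub> y) = f x \<oplus>\<^bsub>M\<^esub> f y) \<and>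
      (\<forall>r\<in>carrier R. \<forall>x\<in>I. f (r \<otimes>\<^bsub>R\<^esub> x) = r \<odot>\<^bsub>M\<^esub> f x) \<and>
      (\<forall>x\<in>J. f x = \<zero>\<^bsub>M\<^esub>) \<longrightarrow>
      (\<exists>v\<in>V. \<forall>x\<in>I. f x = x \<odot>\<^bsub>M\<^esub> v))"

lemma baer_moduleD:
  assumes "baer_module R J M V" "ideal I R" "J \<subseteq> I" "\<And>x. x \<in> I \<Longrightarrow> f x \<in> V"
    "\<And>x y. x \<in> I \<Longrightarrow> y \<in> I \<Longrightarrow> f (x \<oplus>\<^bsub>R\<^esub> y) = f x \<oplus>\<^bsub>M\<^esub> f y"
    "\<And>r x. r \<in> carrier R \<Longrightarrow> x \<in> I \<Longrightarrow> f (r \<otimes>\<^bsub>R\<^esub> x) = r \<odot>\<^bsub>M\<^esub> f x"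
    "\<And>x. x \<in> J \<Longrightarrow> f x = \<zero>\<^bsub>M\<^esub>"
  shows "\<exists>v\<in>V. \<forall>x\<in>I. f x = x \<odot>\<^bsub>M\<^esub> v"
  by (rule assms(1)[unfolded baer_module_def, rule_format]) (use assms(2-) in auto)

text \<open>On I + Ra the assignment i + r a |-> r y is well defined by \<open>ann\<close>, so
  Baer's condition makes it multiplication by some v. In terms of injectivity: R/(I : a) embeds into
  R/I by multiplication with a, and a map to V extends along it.\<close>

lemma (in module) baer_module_divide:
  assumes V: "submodule V R M" and baer: "baer_module R J M V"
    and I: "ideal I R" "J \<subseteq> I" and a: "a \<in> carrier R" and y: "y \<in> V"
    and ann: "\<And>r. r \<in> carrier R \<Longrightarrow> r \<otimes> a \<in> I \<Longrightarrow> r \<odot>\<^bsub>M\<^esub> y = \<zero>\<^bsub>M\<^esub>"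
  shows "\<exists>v\<in>V. a \<odot>\<^bsub>M\<^esub> v = y \<and> (\<forall>i\<in>I. i \<odot>\<^bsub>M\<^esub> v = \<zero>\<^bsub>M\<^esub>)"
proof -
  interpret I: ideal I R by fact
  note adj = adjoin_elt[OF I(1) a]
  have yc: "y \<in> carrier M" using submoduleD(1)[OF V] y by blast
  define f where "f x = (SOME r. r \<in> carrier R \<and> (\<exists>i\<in>I. x = i \<oplus> r \<otimes> a)) \<odot>\<^bsub>M\<^esub> y" for x
  have f: "f (i \<oplus> r \<otimes> a) = r \<odot>\<^bsub>M\<^esub> y" if "i \<in> I" and r: "r \<in> carrier R" for i r
  proof -
    define s where "s = (SOME s. s \<in> carrier R \<and> (\<exists>j\<in>I. i \<oplus> r \<otimes> a = j \<oplus> s \<otimes> a))"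
    have "s \<in> carrier R \<and> (\<exists>j\<in>I. i \<oplus> r \<otimes> a = j \<oplus> s \<otimes> a)"
      unfolding s_def by (rule someI[of _ r]) (use that in blast)
    then obtain j where s: "s \<in> carrier R" and j: "j \<in> I" "i \<oplus> r \<otimes> a = j \<oplus> s \<otimes> a" by blast
    have "(s \<ominus> r) \<otimes> a = i \<ominus> j"
    proof -
      have ic: "i \<in> carrier R" "j \<in> carrier R" using that j I.Icarr by auto
      have "(s \<ominus> r) \<otimes> a = (j \<oplus> s \<otimes> a) \<ominus> j \<ominus> r \<otimes> a" using ic s r a by algebra
      also have "\<dots> = (i \<oplus> r \<otimes> a) \<ominus> j \<ominus> r \<otimes> a" using j by simp
      also have "\<dots> = i \<ominus> j" using ic s r a by algebra
      finally show ?thesis .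
    qed
    then have "(s \<ominus> r) \<odot>\<^bsub>M\<^esub> y = \<zero>\<^bsub>M\<^esub>"
      using ann[of "s \<ominus> r"] I.minus_closed_ideal[OF that(1) j(1)] s r by simp
    then have "s \<odot>\<^bsub>M\<^esub> y \<ominus>\<^bsub>M\<^esub> r \<odot>\<^bsub>M\<^esub> y = \<zero>\<^bsub>M\<^esub>" using s r yc by (simp add: module_simps)
    then have "s \<odot>\<^bsub>M\<^esub> y = r \<odot>\<^bsub>M\<^esub> y" using s r yc by (simp add: M.minus_eq_zero_iff)
    then show ?thesis unfolding f_def s_def by simp
  qed
  have "\<exists>v\<in>V. \<forall>x\<in>adjoin_elt R I a. f x = x \<odot>\<^bsub>M\<^esub> v"
  proof (rule baer_moduleD[OF baer adj(1)])
    show "J \<subseteq> adjoin_elt R I a" using I adj(2) by blast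
    fix x assume "x \<in> adjoin_elt R I a"
    then obtain i r where x: "i \<in> I" "r \<in> carrier R" "x = i \<oplus> r \<otimes> a"
      unfolding adjoin_elt_def by blast
    show "f x \<in> V" using x f submoduleD(4)[OF V] y by simp
    show "f (s \<otimes> x) = s \<odot>\<^bsub>M\<^esub> f x" if s: "s \<in> carrier R" for s
    proof -
      have "s \<otimes> x = s \<otimes> i \<oplus> (s \<otimes> r) \<otimes> a" using x s a I.Icarr by algebra
      then have "f (s \<otimes> x) = (s \<otimes> r) \<odot>\<^bsub>M\<^esub> y" using f x s I.I_l_closed by simp
      then show ?thesis using f x s yc by (simp add: smult_assoc1)
    qed
    fix x' assume "x' \<in> adjoin_elt R I a"
    then obtain i' r' where x': "i' \<in> I" "r' \<in> carrier R" "x' = i' \<oplus> r' \<otimes> a"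
      unfolding adjoin_elt_def by blast
    have "x \<oplus> x' = (i \<oplus> i') \<oplus> (r \<oplus> r') \<otimes> a" using x x' a I.Icarr by algebra
    then have "f (x \<oplus> x') = (r \<oplus> r') \<odot>\<^bsub>M\<^esub> y" using f x x' by simp
    then show "f (x \<oplus> x') = f x \<oplus>\<^bsub>M\<^esub> f x'" using f x x' yc by (simp add: smult_l_distr)
  next
    fix x assume "x \<in> J"
    then have "x \<in> I" "x = x \<oplus> \<zero> \<otimes> a" using I a I.Icarr by auto
    then show "f x = \<zero>\<^bsub>M\<^esub>" using f[of x \<zero>] yc by simp
  qed
  then obtain v where v: "v \<in> V" "\<And>x. x \<in> adjoin_elt R I a \<Longrightarrow> f x = x \<odot>\<^bsub>M\<^esub> v" by blast
  have "a = \<zero> \<oplus> \<one> \<otimes> a" using a by simp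
  then have "a \<odot>\<^bsub>M\<^esub> v = y" using v(2)[OF adj(3)] f[of \<zero> \<one>] yc by simp
  moreover have "i \<odot>\<^bsub>M\<^esub> v = \<zero>\<^bsub>M\<^esub>" if "i \<in> I" for i
  proof -
    have "i = i \<oplus> \<zero> \<otimes> a" using a that I.Icarr by simp
    then have "f i = \<zero>\<^bsub>M\<^esub>" using f[OF that, of \<zero>] yc by simp
    then show ?thesis using v(2)[of i] adj(2) that by auto
  qed
  ultimately show ?thesis using v(1) by blast
qed

text \<open>Partial linear maps are given by their graphs, which may be multivalued.\<close>

definition linear_graph ::
    "('a, 'x) ring_scheme \<Rightarrow> ('a, 'b, 'y) module_scheme \<Rightarrow> ('a, 'c, 'z) module_scheme \<Rightarrow> ('b \<times> 'c) set \<Rightarrow> bool"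
  where "linear_graph R M N G \<longleftrightarrow> (\<zero>\<^bsub>M\<^esub>, \<zero>\<^bsub>N\<^esub>) \<in> G \<and>
    (\<forall>x y x' y'. (x, y) \<in> G \<longrightarrow> (x', y') \<in> G \<longrightarrow> (x \<oplus>\<^bsub>M\<^esub> x', y \<oplus>\<^bsub>N\<^esub> y') \<in> G) \<and>
    (\<forall>r x y. r \<in> carrier R \<longrightarrow> (x, y) \<in> G \<longrightarrow> (r \<odot>\<^bsub>M\<^esub> x, r \<odot>\<^bsub>N\<^esub> y) \<in> G)"

lemma linear_graphD:
  assumes "linear_graph R M N G"
  shows "(\<zero>\<^bsub>M\<^esub>, \<zero>\<^bsub>N\<^esub>) \<in> G"
    "\<And>x y x' y'. (x, y) \<in> G \<Longrightarrow> (x', y') \<in> G \<Longrightarrow> (x \<oplus>\<^bsub>M\<^esub> x', y \<oplus>\<^bsub>N\<^esub> y') \<in> G"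
    "\<And>r x y. r \<in> carrier R \<Longrightarrow> (x, y) \<in> G \<Longrightarrow> (r \<odot>\<^bsub>M\<^esub> x, r \<odot>\<^bsub>N\<^esub> y) \<in> G"
  using assms by (auto simp: linear_graph_def)

lemma linear_graph_minus:
  assumes "module R M" "module R N" "linear_graph R M N G" "G \<subseteq> carrier M \<times> carrier N"
    "(x, y) \<in> G" "(x', y') \<in> G"
  shows "(x \<ominus>\<^bsub>M\<^esub> x', y \<ominus>\<^bsub>N\<^esub> y') \<in> G"
proof -
  interpret M: module R M by fact
  interpret N: module R N by fact
  have "x' \<in> carrier M" "y' \<in> carrier N" using assms by auto
  then show ?thesis
    using linear_graphD(2)[OF assms(3,5) linear_graphD(3)[OF assms(3) _ assms(6), of "\<ominus>\<^bsub>R\<^esub> \<one>\<^bsub>R\<^esub>"]]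
    by (simp add: M.smult_l_minus N.smult_l_minus M.minus_eq N.minus_eq)
qed

text \<open>Zorn's lemma for linear relations subject to a condition P on their pairs. P is used in
  two forms: "x = 0 implies y = 0", which makes the relation single valued, and "x in N implies y in
  K", which makes it single valued modulo K. The hypothesis \<open>step\<close> says that a value at
  one more element b can be chosen so that P survives on all sums with multiples of b.\<close>

lemma linear_graph_extension:
  assumes M: "module R M" and N: "module R N" and A: "submodule A R M" and B: "submodule B R N"
    and G0: "linear_graph R M N G0" "G0 \<subseteq> A \<times> B" "\<And>x y. (x, y) \<in> G0 \<Longrightarrow> P x y"
    and step: "\<And>G b. linear_graph R M N G \<Longrightarrow> G \<subseteq> A \<times> B \<Longrightarrow> G0 \<subseteq> G \<Longrightarrow>
      (\<And>x y. (x, y) \<in> G \<Longrightarrow> P x y) \<Longrightarrow> b \<in> A \<Longrightarrow>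
      \<exists>y\<in>B. \<forall>(x', y')\<in>G. \<forall>r\<in>carrier R. P (x' \<oplus>\<^bsub>M\<^esub> r \<odot>\<^bsub>M\<^esub> b) (y' \<oplus>\<^bsub>N\<^esub> r \<odot>\<^bsub>N\<^esub> y)"
  obtains G where "linear_graph R M N G" "G \<subseteq> A \<times> B" "G0 \<subseteq> G" "\<And>x y. (x, y) \<in> G \<Longrightarrow> P x y"
    "\<And>b. b \<in> A \<Longrightarrow> \<exists>y. (b, y) \<in> G"
proof -
  interpret M: module R M by fact
  interpret N: module R N by fact
  note A' = submoduleD[OF A] and B' = submoduleD[OF B]
  define \<A> where "\<A> = {G. linear_graph R M N G \<and> G \<subseteq> A \<times> B \<and> G0 \<subseteq> G \<and> (\<forall>(x, y)\<in>G. P x y)}"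
  have "\<exists>G\<in>\<A>. \<forall>H\<in>\<A>. G \<subseteq> H \<longrightarrow> H = G"
  proof (rule subset_Zorn_nonempty)
    show "\<A> \<noteq> {}" using G0 unfolding \<A>_def by blast
    fix C assume C: "C \<noteq> {}" "subset.chain \<A> C"
    have CA: "c \<in> \<A>" if "c \<in> C" for c using C(2) that by (auto simp: pred_on.chain_def)
    have tot: "c \<subseteq> c' \<or> c' \<subseteq> c" if "c \<in> C" "c' \<in> C" for c c'
      using C(2) that unfolding pred_on.chain_def by blast
    have lin: "linear_graph R M N c" if "c \<in> C" for c using CA[OF that] by (simp add: \<A>_def)
    have "linear_graph R M N (\<Union>C)"
      unfolding linear_graph_def
    proof (intro conjI allI impI, goal_cases)
      case 1
      then show ?case using C(1) lin linear_graphD(1) by blast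
    next
      case (2 x y x' y')
      then obtain c c' where "c \<in> C" "(x, y) \<in> c" "c' \<in> C" "(x', y') \<in> c'" by blast
      then obtain c where "c \<in> C" "(x, y) \<in> c" "(x', y') \<in> c" using tot by blast
      then show ?case using linear_graphD(2)[OF lin] by blast
    next
      case (3 r x y)
      then show ?case using linear_graphD(3)[OF lin] by blast
    qed
    moreover have "\<Union>C \<subseteq> A \<times> B" "G0 \<subseteq> \<Union>C" "\<forall>(x, y)\<in>\<Union>C. P x y"
      using CA C(1) unfolding \<A>_def by blast+
    ultimately show "\<Union>C \<in> \<A>" by (simp add: \<A>_def)
  qed
  then obtain G where G: "G \<in> \<A>" and max: "\<And>H. H \<in> \<A> \<Longrightarrow> G \<subseteq> H \<Longrightarrow> H = G" by blast
  have linG: "linear_graph R M N G" and GAB: "G \<subseteq> A \<times> B" and G0G: "G0 \<subseteq> G"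
    and PG: "\<And>x y. (x, y) \<in> G \<Longrightarrow> P x y" using G by (auto simp: \<A>_def)
  have "\<exists>y. (b, y) \<in> G" if b: "b \<in> A" for b
  proof -
    obtain y where y: "y \<in> B" and
      Py: "\<And>x' y' r. (x', y') \<in> G \<Longrightarrow> r \<in> carrier R \<Longrightarrow> P (x' \<oplus>\<^bsub>M\<^esub> r \<odot>\<^bsub>M\<^esub> b) (y' \<oplus>\<^bsub>N\<^esub> r \<odot>\<^bsub>N\<^esub> y)"
      using step[OF linG GAB G0G PG b] by blast
    have bc: "b \<in> carrier M" and yc: "y \<in> carrier N" using b y A' B' by auto
    define H where "H = {(x' \<oplus>\<^bsub>M\<^esub> r \<odot>\<^bsub>M\<^esub> b, y' \<oplus>\<^bsub>N\<^esub> r \<odot>\<^bsub>N\<^esub> y) | x' y' r. (x', y') \<in> G \<and> r \<in> carrier R}"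
    have HI: "(x' \<oplus>\<^bsub>M\<^esub> r \<odot>\<^bsub>M\<^esub> b, y' \<oplus>\<^bsub>N\<^esub> r \<odot>\<^bsub>N\<^esub> y) \<in> H" if "(x', y') \<in> G" "r \<in> carrier R" for x' y' r
      using that unfolding H_def by blast
    have Gc: "x' \<in> carrier M" "y' \<in> carrier N" if "(x', y') \<in> G" for x' y'
      using that GAB A'(1) B'(1) by auto
    have GH: "G \<subseteq> H"
    proof
      fix p assume p: "p \<in> G"
      obtain x' y' where xy: "p = (x', y')" by (cases p)
      then show "p \<in> H" using HI[of x' y' "\<zero>\<^bsub>R\<^esub>"] p Gc[of x' y'] bc yc by simp
    qed
    have "linear_graph R M N H"
      unfolding linear_graph_def
    proof (intro conjI allI impI, goal_cases)
      case 1
      then show ?case using GH linear_graphD(1)[OF linG] by blast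
    next
      case (2 p p' q q')
      then obtain x1 y1 r1 x2 y2 r2 where
        p: "(p, p') = (x1 \<oplus>\<^bsub>M\<^esub> r1 \<odot>\<^bsub>M\<^esub> b, y1 \<oplus>\<^bsub>N\<^esub> r1 \<odot>\<^bsub>N\<^esub> y)" "(x1, y1) \<in> G" "r1 \<in> carrier R" and
        q: "(q, q') = (x2 \<oplus>\<^bsub>M\<^esub> r2 \<odot>\<^bsub>M\<^esub> b, y2 \<oplus>\<^bsub>N\<^esub> r2 \<odot>\<^bsub>N\<^esub> y)" "(x2, y2) \<in> G" "r2 \<in> carrier R"
        unfolding H_def by blast
      have "((x1 \<oplus>\<^bsub>M\<^esub> x2) \<oplus>\<^bsub>M\<^esub> (r1 \<oplus>\<^bsub>R\<^esub> r2) \<odot>\<^bsub>M\<^esub> b, (y1 \<oplus>\<^bsub>N\<^esub> y2) \<oplus>\<^bsub>N\<^esub> (r1 \<oplus>\<^bsub>R\<^esub> r2) \<odot>\<^bsub>N\<^esub> y) \<in> H"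
        using HI linear_graphD(2)[OF linG] p q by simp
      then show ?case using p q Gc[OF p(2)] Gc[OF q(2)] bc yc
        by (simp add: M.smult_l_distr N.smult_l_distr M.M.a_ac N.M.a_ac)
    next
      case (3 r p p')
      then obtain x1 y1 r1 where
        p: "(p, p') = (x1 \<oplus>\<^bsub>M\<^esub> r1 \<odot>\<^bsub>M\<^esub> b, y1 \<oplus>\<^bsub>N\<^esub> r1 \<odot>\<^bsub>N\<^esub> y)" "(x1, y1) \<in> G" "r1 \<in> carrier R"
        unfolding H_def by blast
      have "(r \<odot>\<^bsub>M\<^esub> x1 \<oplus>\<^bsub>M\<^esub> (r \<otimes>\<^bsub>R\<^esub> r1) \<odot>\<^bsub>M\<^esub> b, r \<odot>\<^bsub>N\<^esub> y1 \<oplus>\<^bsub>N\<^esub> (r \<otimes>\<^bsub>R\<^esub> r1) \<odot>\<^bsub>N\<^esub> y) \<in> H"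
        using HI linear_graphD(3)[OF linG] p 3 by simp
      then show ?case using p 3 Gc[OF p(2)] bc yc
        by (simp add: M.smult_r_distr N.smult_r_distr M.smult_assoc1 N.smult_assoc1)
    qed
    moreover have "H \<subseteq> A \<times> B"
      using GAB A'(3,4) B'(3,4) b y unfolding H_def by blast
    moreover have "\<forall>(x, y)\<in>H. P x y" using Py unfolding H_def by blast
    ultimately have "H \<in> \<A>" using GH G0G unfolding \<A>_def by blast
    then have "H = G" using max GH by blast
    moreover have "(\<zero>\<^bsub>M\<^esub> \<oplus>\<^bsub>M\<^esub> \<one>\<^bsub>R\<^esub> \<odot>\<^bsub>M\<^esub> b, \<zero>\<^bsub>N\<^esub> \<oplus>\<^bsub>N\<^esub> \<one>\<^bsub>R\<^esub> \<odot>\<^bsub>N\<^esub> y) \<in> H"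
      using HI linear_graphD(1)[OF linG] by simp
    ultimately show ?thesis using bc yc by auto
  qed
  then show ?thesis using that linG GAB G0G PG by blast
qed

text \<open>Among the ideals between J and I that satisfy P, a maximal one must contain every a in
  I. This is induction on the number of generators of I over J, without choosing generators.\<close>

lemma (in noetherian_ring) noetherian_grow [consumes 4, case_names base step]:
  assumes "cring R" "ideal I R" "J \<subseteq> I"
    and "ideal J R" "P J"
    and step: "\<And>L a. ideal L R \<Longrightarrow> J \<subseteq> L \<Longrightarrow> L \<subseteq> I \<Longrightarrow> a \<in> I \<Longrightarrow> P L \<Longrightarrow> P (adjoin_elt R L a)"
  shows "P I"
proof -
  interpret cring R by fact
  interpret I: ideal I R by fact
  obtain M where M: "ideal M R" "J \<subseteq> M" "M \<subseteq> I" "P M"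
    and max: "\<And>K. ideal K R \<Longrightarrow> J \<subseteq> K \<Longrightarrow> K \<subseteq> I \<Longrightarrow> P K \<Longrightarrow> M \<subseteq> K \<Longrightarrow> K = M"
  proof -
    have "\<exists>M\<in>{K. ideal K R \<and> J \<subseteq> K \<and> K \<subseteq> I \<and> P K}. \<forall>K\<in>{K. ideal K R \<and> J \<subseteq> K \<and> K \<subseteq> I \<and> P K}. M \<subseteq> K \<longrightarrow> K = M"
      by (rule maximal_element_ideals) (use assms in auto)
    then show ?thesis using that by auto
  qed
  have "a \<in> M" if a: "a \<in> I" for a
  proof -
    note adj = adjoin_elt[OF M(1) I.Icarr[OF a]]
    have "adjoin_elt R M a = M"
      by (rule max) (use adj(1,2) adj(4)[OF assms(2) M(3) a] M step a in auto)
    then show ?thesis using adj(3) by simp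
  qed
  then show ?thesis using M by (metis subset_antisym subsetI)
qed

section \<open>Prime avoidance and elements annihilated by the maximal ideal\<close>

lemma (in primeideal) Inter_not_subset:
  assumes "finite \<F>" "\<And>K. K \<in> \<F> \<Longrightarrow> ideal K R" "\<And>K. K \<in> \<F> \<Longrightarrow> \<not> K \<subseteq> I"
    and "ideal K0 R" "\<not> K0 \<subseteq> I"
  shows "\<exists>y\<in>K0. y \<notin> I \<and> (\<forall>K\<in>\<F>. y \<in> K)"
  using assms(1-3)
proof (induction \<F>)
  case empty
  then show ?case using assms(5) by blast
next
  case (insert K \<F>)
  then obtain y where y: "y \<in> K0" "y \<notin> I" "\<forall>K\<in>\<F>. y \<in> K" by auto
  obtain z where z: "z \<in> K" "z \<notin> I" using insert.prems(2)[of K] by blast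
  have carr: "y \<in> carrier R" "z \<in> carrier R"
    using ideal.Icarr[OF assms(4) y(1)] ideal.Icarr[OF insert.prems(1) z(1)] by auto
  have "y \<otimes> z \<notin> I" using I_prime[OF carr] y z by blast
  moreover have "y \<otimes> z \<in> K0" using ideal.I_r_closed[OF assms(4) y(1) carr(2)] .
  moreover have "y \<otimes> z \<in> K'" if "K' \<in> \<F>" for K'
    using ideal.I_r_closed[OF insert.prems(1) _ carr(2)] y(3) that by blast
  moreover have "y \<otimes> z \<in> K" using ideal.I_l_closed[OF insert.prems(1) z(1) carr(1)] by simp
  ultimately show ?case by blast
qed

text \<open>An x in K avoiding the earlier primes may lie in the new prime P. It is then replaced by
  x + y with y in K outside P and inside all earlier primes. Such a y exists because no earlier
  prime is contained in P, the family being incomparable.\<close>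

lemma (in cring) prime_avoidance:
  assumes "finite \<F>" "\<And>P. P \<in> \<F> \<Longrightarrow> primeideal P R"
    and "\<And>P P'. P \<in> \<F> \<Longrightarrow> P' \<in> \<F> \<Longrightarrow> P \<subseteq> P' \<Longrightarrow> P = P'"
    and K: "ideal K R" and "\<And>P. P \<in> \<F> \<Longrightarrow> \<not> K \<subseteq> P"
  shows "\<exists>x\<in>K. \<forall>P\<in>\<F>. x \<notin> P"
  using assms(1-3,5)
proof (induction \<F>)
  case empty
  have "\<zero> \<in> K" by (rule additive_subgroup.zero_closed[OF ideal.axioms(1)[OF K]])
  then show ?case by auto
next
  case (insert P \<F>)
  interpret K: ideal K R by fact
  interpret P: primeideal P R using insert.prems by blast
  obtain x where x: "x \<in> K" "\<forall>P\<in>\<F>. x \<notin> P"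
    using insert.IH insert.prems by (metis insert_iff)
  show ?case
  proof (cases "x \<in> P")
    case False
    then show ?thesis using x by auto
  next
    case True
    obtain y where y: "y \<in> K" "y \<notin> P" "\<forall>P'\<in>\<F>. y \<in> P'"
    proof -
      have "\<exists>y\<in>K. y \<notin> P \<and> (\<forall>P'\<in>\<F>. y \<in> P')"
      proof (rule P.Inter_not_subset)
        show "ideal P' R" if "P' \<in> \<F>" for P'
          using insert.prems(1) that by (meson insertI2 primeideal.axioms(1))
        show "\<not> P' \<subseteq> P" if "P' \<in> \<F>" for P'
          using insert.prems(2)[of P' P] insert.hyps(2) that by blast
      qed (use insert.hyps(1) K insert.prems(3) in auto)
      then show ?thesis using that by blast
    qed
    have carr: "x \<in> carrier R" "y \<in> carrier R" using x y K.Icarr by auto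
    have 1: "x \<oplus> y \<notin> P"
    proof
      assume "x \<oplus> y \<in> P"
      then have "(x \<oplus> y) \<ominus> x \<in> P" using True P.minus_closed_ideal by blast
      moreover have "(x \<oplus> y) \<ominus> x = y" using carr by algebra
      ultimately show False using y by simp
    qed
    have 2: "x \<oplus> y \<notin> P'" if P': "P' \<in> \<F>" for P'
    proof
      interpret P': primeideal P' R using insert.prems P' by blast
      assume "x \<oplus> y \<in> P'"
      then have "(x \<oplus> y) \<ominus> y \<in> P'" using y(3) P' P'.minus_closed_ideal by blast
      moreover have "(x \<oplus> y) \<ominus> y = x" using carr by algebra
      ultimately show False using x P' by simp
    qed
    show ?thesis using 1 2 x(1) y(1) K.a_closed by (intro bexI[of _ "x \<oplus> y"]) auto
  qed
qed

text \<open>The maximal annihilators \<open>(J : s)\<close> are primes; they are finitely many, because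
  \<open>(J : \<Inter>(J : s))\<close>, the intersection being over a finite set of such \<open>s\<close>, can be taken maximal.\<close>

lemma (in noetherian_local) regular_element_or_socle:
  assumes J: "ideal J R" "\<one> \<notin> J"
    and zd: "\<And>x. x \<in> \<mm> \<Longrightarrow> \<exists>a\<in>carrier R. a \<notin> J \<and> x \<otimes> a \<in> J"
  shows "\<exists>s\<in>carrier R. s \<notin> J \<and> (\<forall>x\<in>\<mm>. x \<otimes> s \<in> J)"
proof -
  interpret J: ideal J R by fact
  note q = quot_elt[OF J(1)]
  \<comment> \<open>The elements whose annihilator in R/J is maximal among annihilators of nonzero
    elements; these annihilators are prime.\<close>
  define S where "S = {s \<in> carrier R. s \<notin> J \<and>
    (\<forall>t\<in>carrier R. t \<notin> J \<longrightarrow> quot_elt R J s \<subseteq> quot_elt R J t \<longrightarrow> quot_elt R J t = quot_elt R J s)}"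
  have S: "s \<in> carrier R" "s \<notin> J" if "s \<in> S" for s using that by (auto simp: S_def)
  have Smax: "quot_elt R J t = quot_elt R J s"
    if "s \<in> S" "t \<in> carrier R" "t \<notin> J" "quot_elt R J s \<subseteq> quot_elt R J t" for s t
    using that by (auto simp: S_def)
  have prime: "primeideal (quot_elt R J s) R" if s: "s \<in> S" for s
  proof (rule primeidealI[OF q(1)[OF S(1)[OF s]] is_cring])
    have "\<one> \<notin> quot_elt R J s" using S[OF s] by (simp add: quot_elt_def)
    then show "carrier R \<noteq> quot_elt R J s" using one_closed by metis
    fix a b assume ab: "a \<in> carrier R" "b \<in> carrier R" "a \<otimes> b \<in> quot_elt R J s"
    show "a \<in> quot_elt R J s \<or> b \<in> quot_elt R J s"
    proof (rule disjCI)
      assume b: "b \<notin> quot_elt R J s"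
      have bs: "b \<otimes> s \<in> carrier R" "b \<otimes> s \<notin> J" using S[OF s] ab b by (auto simp: quot_elt_def)
      have "quot_elt R J s \<subseteq> quot_elt R J (b \<otimes> s)"
      proof
        fix c assume "c \<in> quot_elt R J s"
        then have c: "c \<in> carrier R" "c \<otimes> s \<in> J" by (auto simp: quot_elt_def)
        have "c \<otimes> (b \<otimes> s) = b \<otimes> (c \<otimes> s)" using c ab S[OF s] m_lcomm by auto
        then show "c \<in> quot_elt R J (b \<otimes> s)" using c ab J.I_l_closed by (simp add: quot_elt_def)
      qed
      then have "quot_elt R J (b \<otimes> s) = quot_elt R J s" using Smax s bs by blast
      moreover have "a \<in> quot_elt R J (b \<otimes> s)" using ab S[OF s] by (simp add: quot_elt_def m_assoc)
      ultimately show "a \<in> quot_elt R J s" by simp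
    qed
  qed
  have above: "\<exists>s\<in>S. quot_elt R J t \<subseteq> quot_elt R J s" if t: "t \<in> carrier R" "t \<notin> J" for t
  proof -
    define \<A> where "\<A> = {quot_elt R J s | s. s \<in> carrier R \<and> s \<notin> J \<and> quot_elt R J t \<subseteq> quot_elt R J s}"
    have "\<exists>M\<in>\<A>. \<forall>I\<in>\<A>. M \<subseteq> I \<longrightarrow> I = M"
      by (rule maximal_element_ideals) (use t q(1) in \<open>auto simp: \<A>_def\<close>)
    then obtain M where M: "M \<in> \<A>" and max: "\<And>I. I \<in> \<A> \<Longrightarrow> M \<subseteq> I \<Longrightarrow> I = M" by auto
    then obtain s where s: "s \<in> carrier R" "s \<notin> J" "quot_elt R J t \<subseteq> quot_elt R J s"
      and M_eq: "M = quot_elt R J s" by (auto simp: \<A>_def)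
    have "quot_elt R J u = quot_elt R J s"
      if "u \<in> carrier R" "u \<notin> J" "quot_elt R J s \<subseteq> quot_elt R J u" for u
    proof -
      have "quot_elt R J u \<in> \<A>" using that s(3) unfolding \<A>_def by auto
      then show ?thesis using max that(3) M_eq by simp
    qed
    then have "s \<in> S" using s by (auto simp: S_def)
    then show ?thesis using s by blast
  qed
  define ann where "ann F = {a \<in> carrier R. \<forall>s\<in>F. a \<otimes> s \<in> J}" for F
  have annE: "a \<otimes> s \<in> J" if "a \<in> ann F" "s \<in> F" for a s F using that by (simp add: ann_def)
  have annI: "a \<in> ann F" if "a \<in> carrier R" "\<And>s. s \<in> F \<Longrightarrow> a \<otimes> s \<in> J" for a F
    using that by (simp add: ann_def)
  have ann: "ideal (ann F) R" if "F \<subseteq> carrier R" for F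
    by (rule idealI_cring)
      (use that in \<open>auto simp: ann_def l_distr m_assoc subset_iff intro: J.I_l_closed\<close>)
  \<comment> \<open>\<open>ann F\<close> shrinks and \<open>ann (ann F)\<close> grows with F.
    Adjoining any further s from S leaves a maximal double annihilator unchanged, so each such s
    lies in \<open>ann (ann F)\<close>.\<close>
  obtain F where F: "finite F" "F \<subseteq> S"
    and Fmax: "\<And>F'. finite F' \<Longrightarrow> F' \<subseteq> S \<Longrightarrow> ann (ann F) \<subseteq> ann (ann F') \<Longrightarrow> ann (ann F') = ann (ann F)"
  proof -
    have "\<exists>M\<in>{ann (ann F) | F. finite F \<and> F \<subseteq> S}. \<forall>I\<in>{ann (ann F) | F. finite F \<and> F \<subseteq> S}. M \<subseteq> I \<longrightarrow> I = M"
    proof (rule maximal_element_ideals)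
      show "ideal K R" if "K \<in> {ann (ann F) | F. finite F \<and> F \<subseteq> S}" for K
      proof -
        have "ann F' \<subseteq> carrier R" for F' by (auto simp: ann_def)
        then show ?thesis using that ann by auto
      qed
    qed auto
    then obtain M where M: "M \<in> {ann (ann F) | F. finite F \<and> F \<subseteq> S}"
      and max: "\<And>I. I \<in> {ann (ann F) | F. finite F \<and> F \<subseteq> S} \<Longrightarrow> M \<subseteq> I \<Longrightarrow> I = M" by auto
    then obtain F where "finite F" "F \<subseteq> S" "M = ann (ann F)" by auto
    then show ?thesis using that[of F] max by blast
  qed
  have fin: "\<exists>f\<in>F. quot_elt R J s = quot_elt R J f" if s: "s \<in> S" for s
  proof -
    interpret P: primeideal "quot_elt R J s" R by (rule prime[OF s])
    have "ann (ann F) \<subseteq> ann (ann (insert s F))" by (auto simp: ann_def)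
    then have "ann (ann (insert s F)) = ann (ann F)" using Fmax[of "insert s F"] F s by simp
    moreover have "s \<in> ann (ann (insert s F))"
    proof -
      have "s \<otimes> a \<in> J" if "a \<in> ann (insert s F)" for a
        using annE[OF that, of s] m_comm[OF S(1)[OF s], of a] that ann_def by auto
      then show ?thesis by (intro annI S(1)[OF s])
    qed
    ultimately have sF: "s \<in> ann (ann F)" by simp
    \<comment> \<open>\<open>ann F\<close> is the intersection of the (J : f) with f in F, and it is
      contained in the prime (J : s). A prime containing a finite intersection of ideals contains
      one of them; maximality then turns the inclusion into an equality.\<close>
    have "\<exists>f\<in>F. quot_elt R J f \<subseteq> quot_elt R J s"
    proof (rule ccontr)
      assume *: "\<not> ?thesis"
      have "\<exists>y\<in>carrier R. y \<notin> quot_elt R J s \<and> (\<forall>K\<in>quot_elt R J ` F. y \<in> K)"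
      proof (rule P.Inter_not_subset)
        show "\<not> carrier R \<subseteq> quot_elt R J s"
          using P.I_notcarr P.a_subset by (metis subset_antisym)
      qed (use F S q(1) * oneideal in auto)
      then obtain y where y: "y \<in> carrier R" "y \<notin> quot_elt R J s" "\<And>f. f \<in> F \<Longrightarrow> y \<in> quot_elt R J f"
        by blast
      have yf: "y \<otimes> f \<in> J" if "f \<in> F" for f
      proof -
        have "y \<in> quot_elt R J f" by (rule y(3)[OF that])
        then show ?thesis by (simp only: quot_elt_def mem_Collect_eq)
      qed
      have "y \<in> ann F" by (rule annI[OF y(1) yf])
      have "s \<otimes> y \<in> J" by (rule annE[OF sF \<open>y \<in> ann F\<close>])
      then have "y \<otimes> s \<in> J" by (subst m_comm[OF y(1) S(1)[OF s]])
      then show False using y(1,2) by (simp only: quot_elt_def mem_Collect_eq simp_thms)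
    qed
    then obtain f where "f \<in> F" "quot_elt R J f \<subseteq> quot_elt R J s" by blast
    then have "quot_elt R J s = quot_elt R J f" using Smax[of f s] S[OF s] F(2) by auto
    then show ?thesis using \<open>f \<in> F\<close> by blast
  qed
  \<comment> \<open>Otherwise prime avoidance gives an x in \<open>\<mm>\<close> outside all maximal
    annihilators. Such an x is not a zero divisor on R/J, against \<open>zd\<close>.\<close>
  have "\<exists>f\<in>F. \<mm> \<subseteq> quot_elt R J f"
  proof (rule ccontr)
    assume *: "\<not> ?thesis"
    have "\<exists>x\<in>\<mm>. \<forall>P\<in>quot_elt R J ` F. x \<notin> P"
    proof (rule prime_avoidance)
      fix P P' assume "P \<in> quot_elt R J ` F" "P' \<in> quot_elt R J ` F" "P \<subseteq> P'"
      then obtain f f' where "f \<in> F" "f' \<in> F" "P = quot_elt R J f" "P' = quot_elt R J f'" by blast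
      moreover from this have "f \<in> S" "f' \<in> S" using F(2) by auto
      ultimately show "P = P'" using Smax[of f f'] S[of f'] \<open>P \<subseteq> P'\<close> by simp
    qed (use F prime * m.is_ideal in auto)
    then obtain x where x: "x \<in> \<mm>" "\<And>f. f \<in> F \<Longrightarrow> x \<notin> quot_elt R J f" by blast
    obtain a where a: "a \<in> carrier R" "a \<notin> J" "x \<otimes> a \<in> J" using zd x by blast
    then have "x \<in> quot_elt R J a" using m.Icarr x by (simp add: quot_elt_def)
    moreover obtain s where "s \<in> S" "quot_elt R J a \<subseteq> quot_elt R J s" using above[OF a(1,2)] by blast
    moreover from this obtain f where "f \<in> F" "quot_elt R J s = quot_elt R J f" using fin by blast
    ultimately show False using x(2)[of f] by auto
  qed
  then obtain f where "f \<in> F" "\<mm> \<subseteq> quot_elt R J f" by blast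
  moreover from this have "f \<in> carrier R" "f \<notin> J" using F(2) S by auto
  ultimately show ?thesis by (intro bexI[of _ f]) (auto simp: quot_elt_def)
qed

section \<open>Finite injective resolutions\<close>

text \<open>A finite injective resolution of the cyclic module \<open>R/J\<close> over the ring \<open>R/J\<close>. The
  terms are submodules \<open>V i\<close> of \<open>R\<close>-modules, and \<open>R/J\<close> is realised as \<open>R e\<close>.\<close>

locale baer_resolution = noetherian_local R \<mm> for R (structure) and \<mm> +
  fixes J :: "'a set" and E :: "nat \<Rightarrow> ('a, 'e) module" and V :: "nat \<Rightarrow> 'e set"
    and d :: "nat \<Rightarrow> 'e \<Rightarrow> 'e" and e :: 'e and r :: nat
  assumes J: "ideal J R"
    and E: "\<And>i. module R (E i)"
    and V: "\<And>i. submodule (V i) R (E i)"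
    and baer: "\<And>i. baer_module R J (E i) (V i)"
    and J_V: "\<And>i j v. j \<in> J \<Longrightarrow> v \<in> V i \<Longrightarrow> j \<odot>\<^bsub>E i\<^esub> v = \<zero>\<^bsub>E i\<^esub>"
    and d_closed: "\<And>i v. v \<in> V i \<Longrightarrow> d i v \<in> V (Suc i)"
    and d_add: "\<And>i u v. u \<in> V i \<Longrightarrow> v \<in> V i \<Longrightarrow> d i (u \<oplus>\<^bsub>E i\<^esub> v) = d i u \<oplus>\<^bsub>E (Suc i)\<^esub> d i v"
    and d_smult: "\<And>i a v. a \<in> carrier R \<Longrightarrow> v \<in> V i \<Longrightarrow> d i (a \<odot>\<^bsub>E i\<^esub> v) = a \<odot>\<^bsub>E (Suc i)\<^esub> d i v"
    and e: "e \<in> V 0"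
    and ann_e: "\<And>a. a \<in> carrier R \<Longrightarrow> a \<odot>\<^bsub>E 0\<^esub> e = \<zero>\<^bsub>E 0\<^esub> \<longleftrightarrow> a \<in> J"
    and exact_0: "\<And>v. v \<in> V 0 \<Longrightarrow> d 0 v = \<zero>\<^bsub>E (Suc 0)\<^esub> \<longleftrightarrow> (\<exists>a\<in>carrier R. v = a \<odot>\<^bsub>E 0\<^esub> e)"
    and exact_Suc: "\<And>i v. v \<in> V (Suc i) \<Longrightarrow>
      d (Suc i) v = \<zero>\<^bsub>E (Suc (Suc i))\<^esub> \<longleftrightarrow> (\<exists>u\<in>V i. v = d i u)"
    and V_zero: "\<And>i. r < i \<Longrightarrow> V i = {\<zero>\<^bsub>E i\<^esub>}"
begin

sublocale J: ideal J R by (rule J)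

lemma E_abelian_group: "abelian_group (E i)" using E by (simp add: module_def)

lemma V_carrier: "v \<in> V i \<Longrightarrow> v \<in> carrier (E i)" using submoduleD(1)[OF V] by blast

lemma V_zero_closed: "\<zero>\<^bsub>E i\<^esub> \<in> V i" by (rule submoduleD(2)[OF V])

lemma V_add: "u \<in> V i \<Longrightarrow> v \<in> V i \<Longrightarrow> u \<oplus>\<^bsub>E i\<^esub> v \<in> V i" by (rule submoduleD(3)[OF V])

lemma V_smult: "a \<in> carrier R \<Longrightarrow> v \<in> V i \<Longrightarrow> a \<odot>\<^bsub>E i\<^esub> v \<in> V i" by (rule submoduleD(4)[OF V])

lemma V_minus: "u \<in> V i \<Longrightarrow> v \<in> V i \<Longrightarrow> u \<ominus>\<^bsub>E i\<^esub> v \<in> V i"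
  by (rule module.submodule_minus[OF E V])

lemma minus_smult: "v \<in> V i \<Longrightarrow> u \<in> V i \<Longrightarrow> u \<ominus>\<^bsub>E i\<^esub> v = u \<oplus>\<^bsub>E i\<^esub> (\<ominus> \<one>) \<odot>\<^bsub>E i\<^esub> v"
  using V_carrier[of v i] V_carrier[of u i] abelian_group.minus_eq[OF E_abelian_group, of i]
    module.smult_l_minus[OF E, of \<one> v i] module.smult_one[OF E, of v i] by simp

lemma d_minus: "u \<in> V i \<Longrightarrow> v \<in> V i \<Longrightarrow> d i (u \<ominus>\<^bsub>E i\<^esub> v) = d i u \<ominus>\<^bsub>E (Suc i)\<^esub> d i v"
  by (simp add: minus_smult d_closed d_add d_smult V_smult)

lemma d_zero: "d i \<zero>\<^bsub>E i\<^esub> = \<zero>\<^bsub>E (Suc i)\<^esub>"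
  using d_smult[OF zero_closed V_zero_closed, of i] V_carrier[OF d_closed[OF V_zero_closed], of i]
    module.smult_r_null[OF E zero_closed, of i] module.smult_l_null[OF E, of _ "Suc i"] by simp

lemma d_d: "v \<in> V i \<Longrightarrow> d (Suc i) (d i v) = \<zero>\<^bsub>E (Suc (Suc i))\<^esub>"
  using exact_Suc[OF d_closed] by blast

lemma divide:
  assumes "ideal I R" "J \<subseteq> I" "a \<in> carrier R" "y \<in> V i"
    and "\<And>s. s \<in> carrier R \<Longrightarrow> s \<otimes> a \<in> I \<Longrightarrow> s \<odot>\<^bsub>E i\<^esub> y = \<zero>\<^bsub>E i\<^esub>"
  obtains v where "v \<in> V i" "a \<odot>\<^bsub>E i\<^esub> v = y" "\<And>j. j \<in> I \<Longrightarrow> j \<odot>\<^bsub>E i\<^esub> v = \<zero>\<^bsub>E i\<^esub>"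
  using module.baer_module_divide[OF E V baer assms] by blast

text \<open>For J contained in I this is Hom(R/I, V i) over R/J, a homomorphism being determined by
  the image of 1.\<close>

definition torsion :: "nat \<Rightarrow> 'a set \<Rightarrow> 'e set"
  where "torsion i I = {v \<in> V i. \<forall>a\<in>I. a \<odot>\<^bsub>E i\<^esub> v = \<zero>\<^bsub>E i\<^esub>}"

lemma torsionD: "v \<in> torsion i I \<Longrightarrow> v \<in> V i" "v \<in> torsion i I \<Longrightarrow> a \<in> I \<Longrightarrow> a \<odot>\<^bsub>E i\<^esub> v = \<zero>\<^bsub>E i\<^esub>"
  by (auto simp: torsion_def)

lemma torsion_submodule:
  assumes "I \<subseteq> carrier R"
  shows "submodule (torsion i I) R (E i)"
proof -
  interpret Ei: module R "E i" by (rule E)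
  show ?thesis
  proof (rule Ei.submoduleI')
    show "torsion i I \<subseteq> carrier (E i)" using V_carrier by (auto simp: torsion_def)
    show "\<zero>\<^bsub>E i\<^esub> \<in> torsion i I" using V_zero_closed assms by (auto simp: torsion_def)
    show "u \<oplus>\<^bsub>E i\<^esub> v \<in> torsion i I" if "u \<in> torsion i I" "v \<in> torsion i I" for u v
      using that V_add V_carrier assms by (auto simp: torsion_def Ei.smult_r_distr subset_iff)
    show "s \<odot>\<^bsub>E i\<^esub> v \<in> torsion i I" if "s \<in> carrier R" "v \<in> torsion i I" for s v
      using that V_smult V_carrier assms
      by (auto simp: torsion_def subset_iff Ei.smult_left_commute[of _ s])
  qed
qed

lemma torsion_adjoin_elt:
  assumes "v \<in> V i" "a \<in> carrier R" "I \<subseteq> carrier R" "\<And>b. b \<in> I \<Longrightarrow> b \<odot>\<^bsub>E i\<^esub> v = \<zero>\<^bsub>E i\<^esub>" "a \<odot>\<^bsub>E i\<^esub> v = \<zero>\<^bsub>E i\<^esub>"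
  shows "v \<in> torsion i (adjoin_elt R I a)"
proof -
  interpret Ei: module R "E i" by (rule E)
  have "(b \<oplus> s \<otimes> a) \<odot>\<^bsub>E i\<^esub> v = \<zero>\<^bsub>E i\<^esub>" if "b \<in> I" "s \<in> carrier R" for b s
    using assms that V_carrier[OF assms(1)] by (auto simp: Ei.smult_l_distr Ei.smult_assoc1)
  then show ?thesis using assms(1) unfolding torsion_def adjoin_elt_def by blast
qed

lemma d_torsion: "v \<in> torsion i I \<Longrightarrow> I \<subseteq> carrier R \<Longrightarrow> d i v \<in> torsion (Suc i) I"
  using d_closed d_zero d_smult[symmetric] by (auto simp: torsion_def subset_iff)

text \<open>\<open>Ext\<^sup>i(R/I, R/J)\<close> is the cohomology of the subcomplex killed by \<open>I\<close>. Being finitely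
  generated, none of its quotients contains an \<open>x\<close>-divisible sequence. The induction uses the
  exact sequence \<open>Ext\<^sup>i(R/(L:a)) \<rightarrow> Ext\<^sup>i\<^sup>+\<^sup>1(R/(L+aR)) \<rightarrow> Ext\<^sup>i\<^sup>+\<^sup>1(R/L)\<close>.\<close>

lemma ext_no_divisible_sequence:
  assumes "ideal I R" "J \<subseteq> I" "x \<in> \<mm>" "submodule T R (E i)"
    and "\<And>k v. i = Suc k \<Longrightarrow> v \<in> torsion k I \<Longrightarrow> d k v \<in> T"
    and "\<And>n. y n \<in> torsion i I" "\<And>n. d i (y n) = \<zero>\<^bsub>E (Suc i)\<^esub>"
    and "\<And>n. y n \<ominus>\<^bsub>E i\<^esub> x \<odot>\<^bsub>E i\<^esub> y (Suc n) \<in> T"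
  shows "y 0 \<in> T"
  using assms
proof (induction i arbitrary: I T y)
  case 0
  interpret E0: module R "E 0" by (rule E)
  have x: "x \<in> carrier R" using 0(3) m.Icarr by simp
  have ec: "e \<in> carrier (E 0)" using e V_carrier by simp
  have "\<exists>a\<in>carrier R. y n = a \<odot>\<^bsub>E 0\<^esub> e" for n
    using exact_0[OF torsionD(1)[OF 0(6)]] 0(7) by simp
  then obtain b where b: "\<And>n. b n \<in> carrier R" "\<And>n. y n = b n \<odot>\<^bsub>E 0\<^esub> e" by metis
  \<comment> \<open>Cocycles of degree 0 are multiples of e, so T is pulled back along a |-> a e,
    and Krull's theorem for ideals applies to the coefficients b n.\<close>
  define H where "H = {a \<in> carrier R. a \<odot>\<^bsub>E 0\<^esub> e \<in> T}"
  have "ideal H R"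
    by (rule idealI_cring)
      (use submoduleD[OF 0(4)] ec in \<open>auto simp: H_def E0.smult_l_distr E0.smult_assoc1\<close>)
  moreover have "b n \<ominus> x \<otimes> b (Suc n) \<in> H" for n
  proof -
    have "(b n \<ominus> x \<otimes> b (Suc n)) \<odot>\<^bsub>E 0\<^esub> e = y n \<ominus>\<^bsub>E 0\<^esub> x \<odot>\<^bsub>E 0\<^esub> y (Suc n)"
      using b x ec by (simp add: E0.module_simps)
    then show ?thesis using 0(8) b x by (simp add: H_def)
  qed
  ultimately have "b 0 \<in> H" using divisible_sequence_in_ideal 0(3) b(1) by blast
  then show ?case using b by (simp add: H_def)
next
  case (Suc i)
  interpret Ei: module R "E i" by (rule E)
  interpret Es: module R "E (Suc i)" by (rule E)
  have x: "x \<in> carrier R" using Suc.prems(3) m.Icarr by simp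
  \<comment> \<open>A second induction climbs from J to I by adjoining single elements. The claim is
    quantified over T and y because T is enlarged and the sequence shifted when passing from L + Ra
    down to L.\<close>
  have "\<forall>T y. submodule T R (E (Suc i)) \<longrightarrow> (\<forall>v\<in>torsion i I. d i v \<in> T) \<longrightarrow>
      (\<forall>n. y n \<in> torsion (Suc i) I) \<longrightarrow> (\<forall>n. d (Suc i) (y n) = \<zero>\<^bsub>E (Suc (Suc i))\<^esub>) \<longrightarrow>
      (\<forall>n. y n \<ominus>\<^bsub>E (Suc i)\<^esub> x \<odot>\<^bsub>E (Suc i)\<^esub> y (Suc n) \<in> T) \<longrightarrow> y 0 \<in> T"
    using is_cring Suc.prems(1,2) J
  proof (induction rule: noetherian_grow)
    \<comment> \<open>All of V i is killed by J. Hence T contains every coboundary, and by exactness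
      every cocycle.\<close>
    case base
    show ?case
    proof (intro allI impI)
      fix T and y :: "nat \<Rightarrow> 'e" assume T: "\<forall>v\<in>torsion i J. d i v \<in> T"
        and y: "\<forall>n. y n \<in> torsion (Suc i) J" "\<forall>n. d (Suc i) (y n) = \<zero>\<^bsub>E (Suc (Suc i))\<^esub>"
      have "y 0 \<in> V (Suc i)" using y torsionD(1) by blast
      then obtain u where "u \<in> V i" "y 0 = d i u" using exact_Suc y(2) by blast
      then show "y 0 \<in> T" using T J_V by (auto simp: torsion_def)
    qed
  next
    case (step L a)
    have L_sub: "L \<subseteq> carrier R" using ideal.Icarr[OF step(1)] by (rule subsetI)
    have a: "a \<in> carrier R" using ideal.Icarr[OF Suc.prems(1) step(4)] .
    have adj_sub: "adjoin_elt R L a \<subseteq> carrier R"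
      using ideal.Icarr[OF adjoin_elt(1)[OF step(1) a]] by (rule subsetI)
    note adj = adjoin_elt[OF step(1) a] and q = quot_elt[OF step(1) a]
    show ?case
    proof (intro allI impI)
      fix T and y :: "nat \<Rightarrow> 'e" assume T: "submodule T R (E (Suc i))"
        and T_d: "\<forall>v\<in>torsion i (adjoin_elt R L a). d i v \<in> T"
        and y: "\<forall>n. y n \<in> torsion (Suc i) (adjoin_elt R L a)"
        and dy: "\<forall>n. d (Suc i) (y n) = \<zero>\<^bsub>E (Suc (Suc i))\<^esub>"
        and yT: "\<forall>n. y n \<ominus>\<^bsub>E (Suc i)\<^esub> x \<odot>\<^bsub>E (Suc i)\<^esub> y (Suc n) \<in> T"
      define Z where "Z = torsion (Suc i) (adjoin_elt R L a)"
      have Z: "submodule Z R (E (Suc i))" unfolding Z_def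
        by (rule torsion_submodule[OF adj_sub])
      have tL: "submodule (torsion i L) R (E i)" by (rule torsion_submodule) (rule L_sub)
      \<comment> \<open>Adding the coboundaries of elements killed by L corresponds to mapping
        Ext(R/(L + Ra)) to Ext(R/L). The summand from T is restricted to Z, the elements killed by L
        + Ra, so that a annihilates it later.\<close>
      define T' where "T' = {t \<oplus>\<^bsub>E (Suc i)\<^esub> d i v | t v. t \<in> T \<inter> Z \<and> v \<in> torsion i L}"
      have T'I: "t \<oplus>\<^bsub>E (Suc i)\<^esub> d i v \<in> T'" if "t \<in> T" "t \<in> Z" "v \<in> torsion i L" for t v
        using that unfolding T'_def by blast
      have Tc: "t \<in> carrier (E (Suc i))" if "t \<in> T" for t using submoduleD(1)[OF T] that by blast
      have dc: "d i v \<in> carrier (E (Suc i))" if "v \<in> torsion i L" for v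
        using V_carrier[OF d_closed[OF torsionD(1)[OF that]]] .
      have T': "submodule T' R (E (Suc i))"
      proof (rule Es.submoduleI')
        show "T' \<subseteq> carrier (E (Suc i))" using Tc dc unfolding T'_def by auto
        show "\<zero>\<^bsub>E (Suc i)\<^esub> \<in> T'"
          using T'I[OF submoduleD(2)[OF T] submoduleD(2)[OF Z] submoduleD(2)[OF tL]] d_zero by simp
      next
        fix p p' assume "p \<in> T'" "p' \<in> T'"
        then obtain t v t' v' where p: "p = t \<oplus>\<^bsub>E (Suc i)\<^esub> d i v" "t \<in> T" "t \<in> Z" "v \<in> torsion i L"
          and p': "p' = t' \<oplus>\<^bsub>E (Suc i)\<^esub> d i v'" "t' \<in> T" "t' \<in> Z" "v' \<in> torsion i L"
          unfolding T'_def by blast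
        have "(t \<oplus>\<^bsub>E (Suc i)\<^esub> t') \<oplus>\<^bsub>E (Suc i)\<^esub> d i (v \<oplus>\<^bsub>E i\<^esub> v') \<in> T'"
          by (rule T'I[OF submoduleD(3)[OF T p(2) p'(2)] submoduleD(3)[OF Z p(3) p'(3)] submoduleD(3)[OF tL p(4) p'(4)]])
        then show "p \<oplus>\<^bsub>E (Suc i)\<^esub> p' \<in> T'"
          using p p' Tc dc d_add torsionD(1) by (simp add: Es.M.a_ac)
      next
        fix s p assume s: "s \<in> carrier R" and "p \<in> T'"
        then obtain t v where p: "p = t \<oplus>\<^bsub>E (Suc i)\<^esub> d i v" "t \<in> T" "t \<in> Z" "v \<in> torsion i L"
          unfolding T'_def by blast
        have "s \<odot>\<^bsub>E (Suc i)\<^esub> t \<oplus>\<^bsub>E (Suc i)\<^esub> d i (s \<odot>\<^bsub>E i\<^esub> v) \<in> T'"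
          by (rule T'I[OF submoduleD(4)[OF T s p(2)] submoduleD(4)[OF Z s p(3)] submoduleD(4)[OF tL s p(4)]])
        then show "s \<odot>\<^bsub>E (Suc i)\<^esub> p \<in> T'"
          using p Tc dc d_smult torsionD(1) s by (simp add: Es.smult_r_distr)
      qed
      have T'_d: "\<forall>v\<in>torsion i L. d i v \<in> T'"
        using T'I[OF submoduleD(2)[OF T] submoduleD(2)[OF Z]] dc by simp
      have yL: "y n \<in> torsion (Suc i) L" for n using y adj(2) by (auto simp: torsion_def)
      have "y n \<in> T'" for n
      proof -
        \<comment> \<open>The statement for L concerns only the first term of a sequence; applied to
          all shifted sequences it gives every term.\<close>
        have "y (n + k) \<ominus>\<^bsub>E (Suc i)\<^esub> x \<odot>\<^bsub>E (Suc i)\<^esub> y (Suc (n + k)) \<in> T'" for k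
        proof -
          let ?t = "y (n + k) \<ominus>\<^bsub>E (Suc i)\<^esub> x \<odot>\<^bsub>E (Suc i)\<^esub> y (Suc (n + k))"
          have yZ: "y k \<in> Z" for k using y by (simp add: Z_def)
          have tT: "?t \<in> T" using yT by simp
          have "?t \<in> Z" by (rule Es.submodule_minus[OF Z yZ submoduleD(4)[OF Z x yZ]])
          then have "?t \<oplus>\<^bsub>E (Suc i)\<^esub> d i \<zero>\<^bsub>E i\<^esub> \<in> T'" by (rule T'I[OF tT _ submoduleD(2)[OF tL]])
          then show ?thesis using d_zero Tc[OF tT] by simp
        qed
        then show ?thesis
          using step(5)[rule_format, of T' "\<lambda>k. y (n + k)"] T' T'_d yL dy by simp
      qed
      then have "\<exists>t v. y n = t \<oplus>\<^bsub>E (Suc i)\<^esub> d i v \<and> t \<in> T \<and> t \<in> Z \<and> v \<in> torsion i L" for n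
        unfolding T'_def by blast
      then obtain t v where tv: "\<And>n. y n = t n \<oplus>\<^bsub>E (Suc i)\<^esub> d i (v n)" "\<And>n. t n \<in> T" "\<And>n. t n \<in> Z"
        "\<And>n. v n \<in> torsion i L" by metis
      \<comment> \<open>Since a kills both y n and t n, also d (a v n) = 0. The elements a v n are
        therefore cocycles, killed by (L : a), one degree lower: preimages of the y n under the
        connecting map. T'' consists of the a w whose w has its coboundary in T.\<close>
      define u where "u n = a \<odot>\<^bsub>E i\<^esub> v n" for n
      define T'' where "T'' = {a \<odot>\<^bsub>E i\<^esub> w | w. w \<in> torsion i L \<and> d i w \<in> T}"
      have T''I: "a \<odot>\<^bsub>E i\<^esub> w \<in> T''" if "w \<in> torsion i L" "d i w \<in> T" for w
        using that unfolding T''_def by blast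
      have tLc: "w \<in> carrier (E i)" "w \<in> V i" if "w \<in> torsion i L" for w
        using that torsionD(1) V_carrier by auto
      have "u 0 \<in> T''"
      proof (rule Suc.IH)
        show "ideal (quot_elt R L a) R" "J \<subseteq> quot_elt R L a" "x \<in> \<mm>"
          using q step(2) Suc.prems(3) by auto
        show "submodule T'' R (E i)"
        proof (rule Ei.submoduleI')
          show "T'' \<subseteq> carrier (E i)" using tLc a unfolding T''_def by auto
          show "\<zero>\<^bsub>E i\<^esub> \<in> T''"
            using T''I[OF submoduleD(2)[OF tL]] d_zero submoduleD(2)[OF T] a by simp
        next
          fix p p' assume "p \<in> T''" "p' \<in> T''"
          then obtain w w' where w: "p = a \<odot>\<^bsub>E i\<^esub> w" "w \<in> torsion i L" "d i w \<in> T"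
            and w': "p' = a \<odot>\<^bsub>E i\<^esub> w'" "w' \<in> torsion i L" "d i w' \<in> T" unfolding T''_def by blast
          have "a \<odot>\<^bsub>E i\<^esub> (w \<oplus>\<^bsub>E i\<^esub> w') \<in> T''"
            using T''I submoduleD(3)[OF tL] submoduleD(3)[OF T] w w' tLc d_add by simp
          then show "p \<oplus>\<^bsub>E i\<^esub> p' \<in> T''" using w w' tLc a by (simp add: Ei.smult_r_distr)
        next
          fix s p assume s: "s \<in> carrier R" and "p \<in> T''"
          then obtain w where w: "p = a \<odot>\<^bsub>E i\<^esub> w" "w \<in> torsion i L" "d i w \<in> T" unfolding T''_def by blast
          have "a \<odot>\<^bsub>E i\<^esub> (s \<odot>\<^bsub>E i\<^esub> w) \<in> T''"
            using T''I submoduleD(4)[OF tL s] submoduleD(4)[OF T s] w tLc d_smult s by simp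
          then show "s \<odot>\<^bsub>E i\<^esub> p \<in> T''" using w tLc a s by (simp add: Ei.smult_left_commute[of s a])
        qed
      next
        fix k w assume k: "i = Suc k" and w: "w \<in> torsion k (quot_elt R L a)"
        have "s \<odot>\<^bsub>E k\<^esub> w = \<zero>\<^bsub>E k\<^esub>" if "s \<in> carrier R" "s \<otimes> a \<in> L" for s
          using torsionD(2)[OF w, of s] that by (simp add: quot_elt_def)
        \<comment> \<open>An element killed by (L : a) is a times an element w' killed by L. Thus d
          w = a d w', and d (d w') = 0 lies in T, which puts d w in T''.\<close>
        then obtain w' where w': "w' \<in> V k" "a \<odot>\<^bsub>E k\<^esub> w' = w" "\<And>j. j \<in> L \<Longrightarrow> j \<odot>\<^bsub>E k\<^esub> w' = \<zero>\<^bsub>E k\<^esub>"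
          using divide[OF step(1,2) a torsionD(1)[OF w]] by metis
        have w'L: "w' \<in> torsion k L" using w' by (simp add: torsion_def)
        have "d k w = a \<odot>\<^bsub>E i\<^esub> d k w'" using w' d_smult a k by auto
        moreover have "d k w' \<in> torsion i L" using d_torsion[OF w'L] L_sub k by simp
        moreover have "d i (d k w') = \<zero>\<^bsub>E (Suc i)\<^esub>" using d_d[OF w'(1)] k by simp
        ultimately show "d k w \<in> T''" using T''I submoduleD(2)[OF T] by simp
      next
        fix n
        have "s \<odot>\<^bsub>E i\<^esub> u n = \<zero>\<^bsub>E i\<^esub>" if "s \<in> quot_elt R L a" for s
        proof -
          have s: "s \<in> carrier R" "s \<otimes> a \<in> L" using that by (auto simp: quot_elt_def)
          then have "s \<odot>\<^bsub>E i\<^esub> u n = (s \<otimes> a) \<odot>\<^bsub>E i\<^esub> v n"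
            using a tLc(1)[OF tv(4)] by (simp add: u_def Ei.smult_assoc1)
          then show ?thesis using torsionD(2)[OF tv(4) s(2)] by simp
        qed
        moreover have "u n \<in> V i" unfolding u_def by (rule V_smult[OF a tLc(2)[OF tv(4)]])
        ultimately show "u n \<in> torsion i (quot_elt R L a)" by (simp add: torsion_def)
        have c: "t n \<in> carrier (E (Suc i))" "d i (v n) \<in> carrier (E (Suc i))" using tv Tc dc by auto
        have "a \<odot>\<^bsub>E (Suc i)\<^esub> y n = \<zero>\<^bsub>E (Suc i)\<^esub>" "a \<odot>\<^bsub>E (Suc i)\<^esub> t n = \<zero>\<^bsub>E (Suc i)\<^esub>"
          using torsionD(2)[OF _ adj(3)] y tv(3) by (auto simp: Z_def)
        then have "a \<odot>\<^bsub>E (Suc i)\<^esub> d i (v n) = \<zero>\<^bsub>E (Suc i)\<^esub>"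
          unfolding tv(1)[of n] using c a by (simp add: Es.smult_r_distr)
        then show "d i (u n) = \<zero>\<^bsub>E (Suc i)\<^esub>" unfolding u_def using d_smult a tLc(2)[OF tv(4)] by simp
        have c': "t (Suc n) \<in> carrier (E (Suc i))" "d i (v (Suc n)) \<in> carrier (E (Suc i))" using tv Tc dc by auto
        have "d i (v n \<ominus>\<^bsub>E i\<^esub> x \<odot>\<^bsub>E i\<^esub> v (Suc n)) = d i (v n) \<ominus>\<^bsub>E (Suc i)\<^esub> x \<odot>\<^bsub>E (Suc i)\<^esub> d i (v (Suc n))"
          using tLc(2)[OF tv(4)] x by (simp add: d_minus d_smult V_smult)
        also have "\<dots> = (y n \<ominus>\<^bsub>E (Suc i)\<^esub> x \<odot>\<^bsub>E (Suc i)\<^esub> y (Suc n)) \<ominus>\<^bsub>E (Suc i)\<^esub> (t n \<ominus>\<^bsub>E (Suc i)\<^esub> x \<odot>\<^bsub>E (Suc i)\<^esub> t (Suc n))"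
          unfolding tv(1)[of n] tv(1)[of "Suc n"] using c c' x by (simp add: Es.module_simps)
        also have "\<dots> \<in> T"
          by (rule Es.submodule_minus[OF T yT[rule_format] Es.submodule_minus[OF T tv(2) submoduleD(4)[OF T x tv(2)]]])
        finally have "d i (v n \<ominus>\<^bsub>E i\<^esub> x \<odot>\<^bsub>E i\<^esub> v (Suc n)) \<in> T" .
        moreover have "v n \<ominus>\<^bsub>E i\<^esub> x \<odot>\<^bsub>E i\<^esub> v (Suc n) \<in> torsion i L"
          by (rule Ei.submodule_minus[OF tL tv(4) submoduleD(4)[OF tL x tv(4)]])
        ultimately have "a \<odot>\<^bsub>E i\<^esub> (v n \<ominus>\<^bsub>E i\<^esub> x \<odot>\<^bsub>E i\<^esub> v (Suc n)) \<in> T''" by (intro T''I)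
        then show "u n \<ominus>\<^bsub>E i\<^esub> x \<odot>\<^bsub>E i\<^esub> u (Suc n) \<in> T''"
          using a x tLc(1)[OF tv(4)] by (simp add: u_def Ei.module_simps)
      qed
      then obtain w where w: "u 0 = a \<odot>\<^bsub>E i\<^esub> w" "w \<in> torsion i L" "d i w \<in> T" unfolding T''_def by blast
      \<comment> \<open>Since a v 0 = a w, the difference v 0 - w is killed by L + Ra, and its
        coboundary lies in T by \<open>T_d\<close>. As d w is in T too, so is d (v 0).\<close>
      have "v 0 \<ominus>\<^bsub>E i\<^esub> w \<in> torsion i (adjoin_elt R L a)"
      proof (rule torsion_adjoin_elt[OF _ a L_sub])
        have "v 0 \<ominus>\<^bsub>E i\<^esub> w \<in> torsion i L" by (rule Ei.submodule_minus[OF tL tv(4) w(2)])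
        then show "v 0 \<ominus>\<^bsub>E i\<^esub> w \<in> V i" "\<And>b. b \<in> L \<Longrightarrow> b \<odot>\<^bsub>E i\<^esub> (v 0 \<ominus>\<^bsub>E i\<^esub> w) = \<zero>\<^bsub>E i\<^esub>"
          by (auto simp: torsion_def)
        have "a \<odot>\<^bsub>E i\<^esub> (v 0 \<ominus>\<^bsub>E i\<^esub> w) = u 0 \<ominus>\<^bsub>E i\<^esub> a \<odot>\<^bsub>E i\<^esub> w"
          using a tLc(1)[OF tv(4)] tLc(1)[OF w(2)] by (simp add: u_def Ei.module_simps)
        then show "a \<odot>\<^bsub>E i\<^esub> (v 0 \<ominus>\<^bsub>E i\<^esub> w) = \<zero>\<^bsub>E i\<^esub>"
          using w(1) a tLc(1)[OF w(2)] by (simp add: Ei.M.minus_eq_zero_iff)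
      qed
      then have "d i (v 0 \<ominus>\<^bsub>E i\<^esub> w) \<in> T" using T_d by blast
      then have "d i (v 0) \<ominus>\<^bsub>E (Suc i)\<^esub> d i w \<in> T" using d_minus tLc(2)[OF tv(4)] tLc(2)[OF w(2)] by simp
      then have "(d i (v 0) \<ominus>\<^bsub>E (Suc i)\<^esub> d i w) \<oplus>\<^bsub>E (Suc i)\<^esub> d i w \<in> T"
        using submoduleD(3)[OF T] w(3) by blast
      moreover have "(d i (v 0) \<ominus>\<^bsub>E (Suc i)\<^esub> d i w) \<oplus>\<^bsub>E (Suc i)\<^esub> d i w = d i (v 0)"
        using dc[OF tv(4)] dc[OF w(2)] by (simp add: Es.M.minus_eq Es.M.a_assoc Es.M.l_neg)
      ultimately show "y 0 \<in> T" using tv(1)[of 0] submoduleD(3)[OF T tv(2)] by simp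
    qed
  qed
  then show ?case using Suc.prems(4-) by blast
qed

end

section \<open>Vanishing of the top Ext groups at depth zero, and truncation\<close>

context baer_resolution
begin

text \<open>This is Ext^r(R/I, R/J) = 0 for a resolution of positive length r. The element s spans a
  copy of the residue field in R/J, and Ext^r(R/J, R/J) = 0 maps onto Ext^r of that copy, since
  nothing lies beyond degree r. The other I follow by noetherian induction, where a prime below
  \<open>\<mm>\<close> is handled by divisibility.\<close>

lemma top_vanishing:
  assumes r: "r = Suc q"
    and s: "s \<in> carrier R" "s \<notin> J" "\<And>x. x \<in> \<mm> \<Longrightarrow> x \<otimes> s \<in> J"
    and I: "ideal I R" "J \<subseteq> I" and y: "y \<in> torsion r I"
  shows "\<exists>v\<in>torsion q I. d q v = y"
  using I y
proof (induction arbitrary: y rule: noetherian_induct)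
  case (step I)
  interpret Eq: module R "E q" by (rule E)
  interpret Er: module R "E r" by (rule E)
  interpret Es: module R "E (Suc q)" by (rule E)
  have I_sub: "I \<subseteq> carrier R" using ideal.Icarr[OF step(1)] by (rule subsetI)
  have surj: "\<exists>u\<in>V q. d q u = y" if "y \<in> V r" for y
  proof -
    have "d r y \<in> V (Suc r)" by (rule d_closed[OF that])
    then have "d r y = \<zero>\<^bsub>E (Suc r)\<^esub>" using V_zero[of "Suc r"] by simp
    then show ?thesis using exact_Suc[of y q] that r by auto
  qed
  have yV: "y \<in> V r" and yI: "\<And>a. a \<in> I \<Longrightarrow> a \<odot>\<^bsub>E r\<^esub> y = \<zero>\<^bsub>E r\<^esub>"
    using step.prems(2) by (auto simp: torsion_def)
  have yc: "y \<in> carrier (E r)" by (rule V_carrier[OF yV])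
  \<comment> \<open>A proper ideal that is not prime has a product a b with both factors outside,
    which makes (I : a) and I + Ra strictly larger than I.\<close>
  consider "\<one> \<in> I" | "I = \<mm>" | "\<one> \<notin> I" "I \<noteq> \<mm>" "primeideal I R"
    | a b where "a \<in> carrier R" "b \<in> carrier R" "a \<otimes> b \<in> I" "a \<notin> I" "b \<notin> I"
  proof -
    assume *: "\<one> \<in> I \<Longrightarrow> thesis" "I = \<mm> \<Longrightarrow> thesis" "\<one> \<notin> I \<Longrightarrow> I \<noteq> \<mm> \<Longrightarrow> primeideal I R \<Longrightarrow> thesis"
      "\<And>a b. a \<in> carrier R \<Longrightarrow> b \<in> carrier R \<Longrightarrow> a \<otimes> b \<in> I \<Longrightarrow> a \<notin> I \<Longrightarrow> b \<notin> I \<Longrightarrow> thesis"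
    show thesis
    proof (cases "\<one> \<in> I \<or> (\<exists>a b. a \<in> carrier R \<and> b \<in> carrier R \<and> a \<otimes> b \<in> I \<and> a \<notin> I \<and> b \<notin> I)")
      case True
      then show ?thesis using *(1,4) by blast
    next
      case False
      then have "primeideal I R"
        by (intro primeidealI step(1) is_cring) (use one_closed in auto)
      then show ?thesis using False *(2,3) by blast
    qed
  qed
  then show ?case
  proof cases
    case 1
    then have "y = \<zero>\<^bsub>E r\<^esub>" using yI yc Er.smult_one by metis
    then have "d q \<zero>\<^bsub>E q\<^esub> = y" using d_zero[of q] r by simp
    then show ?thesis using submoduleD(2)[OF torsion_submodule[OF I_sub]] by blast
  next
    \<comment> \<open>As (J : s) is contained in \<open>\<mm>\<close> and y is killed by
      \<open>\<mm>\<close>, y is divisible by s, say y = s y' with y' = d u. Then y = d (s u), and s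
      u is killed by \<open>\<mm>\<close> because \<open>\<mm>\<close> s lies in J.\<close>
    case 2
    have "t \<odot>\<^bsub>E r\<^esub> y = \<zero>\<^bsub>E r\<^esub>" if t: "t \<in> carrier R" "t \<otimes> s \<in> J" for t
    proof -
      have "t \<in> \<mm>"
      proof (rule ccontr)
        assume "t \<notin> \<mm>"
        then obtain u where u: "u \<in> carrier R" "t \<otimes> u = \<one>" using notin_Units t(1) by blast
        have "u \<otimes> (t \<otimes> s) = (t \<otimes> u) \<otimes> s" using u(1) t(1) s(1) by algebra
        then show False using J.I_l_closed[OF t(2) u(1)] u s by simp
      qed
      then show ?thesis using yI 2 by simp
    qed
    then obtain y' where y': "y' \<in> V r" "s \<odot>\<^bsub>E r\<^esub> y' = y"
      using divide[OF J subset_refl s(1) yV] by metis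
    obtain u where u: "u \<in> V q" "d q u = y'" using surj y' by blast
    have uc: "u \<in> carrier (E q)" by (rule V_carrier[OF u(1)])
    have "a \<odot>\<^bsub>E q\<^esub> (s \<odot>\<^bsub>E q\<^esub> u) = \<zero>\<^bsub>E q\<^esub>" if "a \<in> I" for a
    proof -
      have "a \<odot>\<^bsub>E q\<^esub> (s \<odot>\<^bsub>E q\<^esub> u) = (a \<otimes> s) \<odot>\<^bsub>E q\<^esub> u"
        using that I_sub s(1) uc Eq.smult_assoc1 by auto
      then show ?thesis using J_V[OF s(3) u(1)] that 2 by simp
    qed
    then have "s \<odot>\<^bsub>E q\<^esub> u \<in> torsion q I" using V_smult[OF s(1) u(1)] by (simp add: torsion_def)
    moreover have "d q (s \<odot>\<^bsub>E q\<^esub> u) = y" using d_smult[OF s(1) u(1)] u(2) y'(2) r by simp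
    ultimately show ?thesis by blast
  next
    case 3
    then obtain x where x: "x \<in> \<mm>" "x \<notin> I"
      using proper_ideal_subset[OF step(1)] by blast
    have xc: "x \<in> carrier R" using x m.Icarr by simp
    \<comment> \<open>Since x is regular modulo the prime I, division by x stays inside the elements
      killed by I. Iterating it gives an x-divisible sequence of cocycles, so y is a coboundary of
      an element killed by I.\<close>
    have "\<exists>y'\<in>torsion r I. x \<odot>\<^bsub>E r\<^esub> y' = y" if y: "y \<in> torsion r I" for y
    proof -
      have "t \<odot>\<^bsub>E r\<^esub> y = \<zero>\<^bsub>E r\<^esub>" if "t \<in> carrier R" "t \<otimes> x \<in> I" for t
        using torsionD(2)[OF y] primeideal.I_prime[OF 3(3) that(1) xc that(2)] x(2) by blast
      then obtain y' where "y' \<in> V r" "x \<odot>\<^bsub>E r\<^esub> y' = y" "\<And>j. j \<in> I \<Longrightarrow> j \<odot>\<^bsub>E r\<^esub> y' = \<zero>\<^bsub>E r\<^esub>"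
        using divide[OF step(1) step.prems(1) xc torsionD(1)[OF y]] by metis
      then show ?thesis by (intro bexI[of _ y']) (auto simp: torsion_def)
    qed
    then obtain g where g: "\<And>y. y \<in> torsion r I \<Longrightarrow> g y \<in> torsion r I"
      "\<And>y. y \<in> torsion r I \<Longrightarrow> x \<odot>\<^bsub>E r\<^esub> g y = y" by metis
    define Y where "Y n = (g ^^ n) y" for n
    have Y: "Y n \<in> torsion r I" for n
      by (induction n) (use step.prems(2) g in \<open>auto simp: Y_def\<close>)
    define T where "T = d q ` torsion q I"
    have "Y 0 \<in> T"
    proof (rule ext_no_divisible_sequence[OF step(1) step.prems(1) x(1)])
      show T: "submodule T R (E r)"
        unfolding T_def
      proof (rule Er.submoduleI')
        note sub = submoduleD[OF torsion_submodule[OF I_sub]]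
        show "d q ` torsion q I \<subseteq> carrier (E r)" using V_carrier d_closed torsionD(1) r by fast
        show "\<zero>\<^bsub>E r\<^esub> \<in> d q ` torsion q I"
          using d_zero[of q] r by (intro rev_image_eqI[OF sub(2)]) simp
        show "u \<oplus>\<^bsub>E r\<^esub> v \<in> d q ` torsion q I" if uv: "u \<in> d q ` torsion q I" "v \<in> d q ` torsion q I" for u v
        proof -
          obtain u' v' where "u' \<in> torsion q I" "u = d q u'" "v' \<in> torsion q I" "v = d q v'" using uv by blast
          then show ?thesis using d_add[of u' q v'] torsionD(1) sub(3) r
            by (intro image_eqI[of _ _ "u' \<oplus>\<^bsub>E q\<^esub> v'"]) auto
        qed
        show "a \<odot>\<^bsub>E r\<^esub> u \<in> d q ` torsion q I" if a: "a \<in> carrier R" and u: "u \<in> d q ` torsion q I" for a u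
        proof -
          obtain u' where "u' \<in> torsion q I" "u = d q u'" using u by blast
          then show ?thesis using d_smult[OF a, of u' q] torsionD(1) sub(4)[OF a] r
            by (intro image_eqI[of _ _ "a \<odot>\<^bsub>E q\<^esub> u'"]) auto
        qed
      qed
      show "d k v \<in> T" if "r = Suc k" "v \<in> torsion k I" for k v using that r by (simp add: T_def)
      show "Y n \<in> torsion r I" for n by (rule Y)
      show "d r (Y n) = \<zero>\<^bsub>E (Suc r)\<^esub>" for n
        using d_closed[OF torsionD(1)[OF Y]] V_zero[of "Suc r"] by simp
      show "Y n \<ominus>\<^bsub>E r\<^esub> x \<odot>\<^bsub>E r\<^esub> Y (Suc n) \<in> T" for n
      proof -
        have "x \<odot>\<^bsub>E r\<^esub> Y (Suc n) = Y n" using g(2)[OF Y] by (simp add: Y_def)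
        then show ?thesis using submoduleD(2)[OF T] V_carrier[OF torsionD(1)[OF Y]]
          by (simp add: Er.M.minus_eq Er.M.r_neg)
      qed
    qed
    then show ?thesis by (auto simp: T_def Y_def)
  next
    case (4 a b)
    \<comment> \<open>The induction is used twice: for a y, which is killed by (I : a), and, once a
      suitable d v' has been subtracted from y, for the remainder, which is killed by I +
      Ra.\<close>
    note adj = adjoin_elt[OF step(1) 4(1)] and quo = quot_elt[OF step(1) 4(1)]
    have "b \<in> quot_elt R I a" using 4 m_comm by (simp add: quot_elt_def)
    then have "I \<subset> quot_elt R I a" using quo(2) 4(5) by blast
    moreover have "a \<odot>\<^bsub>E r\<^esub> y \<in> torsion r (quot_elt R I a)"
    proof -
      have "c \<odot>\<^bsub>E r\<^esub> (a \<odot>\<^bsub>E r\<^esub> y) = \<zero>\<^bsub>E r\<^esub>" if "c \<in> carrier R" "c \<otimes> a \<in> I" for c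
        using yI[OF that(2)] that(1) 4(1) yc by (simp add: Er.smult_assoc1)
      then show ?thesis using V_smult[OF 4(1) yV] by (auto simp: torsion_def quot_elt_def)
    qed
    ultimately obtain v where v: "v \<in> torsion q (quot_elt R I a)" "d q v = a \<odot>\<^bsub>E r\<^esub> y"
      using step(2)[OF quo(1)] step.prems(1) by blast
    have "t \<odot>\<^bsub>E q\<^esub> v = \<zero>\<^bsub>E q\<^esub>" if "t \<in> carrier R" "t \<otimes> a \<in> I" for t
      using torsionD(2)[OF v(1), of t] that by (simp add: quot_elt_def)
    then obtain v' where v': "v' \<in> V q" "a \<odot>\<^bsub>E q\<^esub> v' = v" "\<And>j. j \<in> I \<Longrightarrow> j \<odot>\<^bsub>E q\<^esub> v' = \<zero>\<^bsub>E q\<^esub>"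
      using divide[OF step(1) step.prems(1) 4(1) torsionD(1)[OF v(1)]] by metis
    have v'I: "v' \<in> torsion q I" using v' by (simp add: torsion_def)
    have dv'I: "d q v' \<in> torsion r I" using d_torsion[OF v'I I_sub] r by simp
    have dv'c: "d q v' \<in> carrier (E r)" by (rule V_carrier[OF torsionD(1)[OF dv'I]])
    have "y \<ominus>\<^bsub>E r\<^esub> d q v' \<in> torsion r (adjoin_elt R I a)"
    proof (rule torsion_adjoin_elt[OF _ 4(1) I_sub])
      have *: "y \<ominus>\<^bsub>E r\<^esub> d q v' \<in> torsion r I"
        by (rule Er.submodule_minus[OF torsion_submodule[OF I_sub] step.prems(2) dv'I])
      then show "y \<ominus>\<^bsub>E r\<^esub> d q v' \<in> V r" "\<And>c. c \<in> I \<Longrightarrow> c \<odot>\<^bsub>E r\<^esub> (y \<ominus>\<^bsub>E r\<^esub> d q v') = \<zero>\<^bsub>E r\<^esub>"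
        by (auto simp: torsion_def)
      have "a \<odot>\<^bsub>E r\<^esub> d q v' = a \<odot>\<^bsub>E r\<^esub> y" using d_smult[OF 4(1) v'(1)] v'(2) v(2) r by simp
      then show "a \<odot>\<^bsub>E r\<^esub> (y \<ominus>\<^bsub>E r\<^esub> d q v') = \<zero>\<^bsub>E r\<^esub>"
        using 4(1) yc dv'c by (simp add: Er.smult_r_distr Er.M.minus_eq Er.smult_r_minus Er.M.r_neg)
    qed
    moreover have "I \<subset> adjoin_elt R I a" using adj(2,3) 4(4) by blast
    ultimately obtain v'' where v'': "v'' \<in> torsion q (adjoin_elt R I a)" "d q v'' = y \<ominus>\<^bsub>E r\<^esub> d q v'"
      using step(2)[OF adj(1)] step.prems(1) by blast
    have v''I: "v'' \<in> torsion q I" using v''(1) adj(2) by (auto simp: torsion_def)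
    have "v'' \<oplus>\<^bsub>E q\<^esub> v' \<in> torsion q I"
      by (rule submoduleD(3)[OF torsion_submodule[OF I_sub] v''I v'I])
    moreover have "d q (v'' \<oplus>\<^bsub>E q\<^esub> v') = y"
      using d_add[OF torsionD(1)[OF v''I] v'(1)] v''(2) yc dv'c r
      by (simp add: Es.M.minus_eq Es.M.a_assoc Es.M.l_neg)
    ultimately show ?thesis by blast
  qed
qed

text \<open>By \<open>top_vanishing\<close> the last map d : V q -> V r stays surjective on the
  parts killed by any I above J. This makes its kernel injective over R/J, so that the kernel can
  serve as the last term.\<close>

lemma truncate:
  assumes r: "r = Suc q"
    and s: "s \<in> carrier R" "s \<notin> J" "\<And>x. x \<in> \<mm> \<Longrightarrow> x \<otimes> s \<in> J"
  obtains V' where "baer_resolution R \<mm> J E V' d e q"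
proof
  define Z where "Z = {v \<in> V q. d q v = \<zero>\<^bsub>E r\<^esub>}"
  define V' where "V' i = (if i < q then V i else if i = q then Z else {\<zero>\<^bsub>E i\<^esub>})" for i
  interpret Eq: module R "E q" by (rule E)
  interpret Er: module R "E r" by (rule E)
  interpret Es: module R "E (Suc q)" by (rule E)
  have Z: "submodule Z R (E q)"
  proof (rule Eq.submoduleI')
    show "Z \<subseteq> carrier (E q)" using V_carrier by (auto simp: Z_def)
    show "\<zero>\<^bsub>E q\<^esub> \<in> Z" using V_zero_closed d_zero r by (simp add: Z_def)
    show "u \<oplus>\<^bsub>E q\<^esub> v \<in> Z" if "u \<in> Z" "v \<in> Z" for u v
      using that V_add d_add r by (simp add: Z_def)
    show "a \<odot>\<^bsub>E q\<^esub> v \<in> Z" if "a \<in> carrier R" "v \<in> Z" for a v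
      using that V_smult d_smult r by (simp add: Z_def)
  qed
  have baerZ: "baer_module R J (E q) Z"
    unfolding baer_module_def
  proof (intro allI impI, elim conjE)
    fix I f assume I: "ideal I R" "J \<subseteq> I" and f: "f \<in> I \<rightarrow> Z"
      "\<forall>x\<in>I. \<forall>y\<in>I. f (x \<oplus> y) = f x \<oplus>\<^bsub>E q\<^esub> f y" "\<forall>a\<in>carrier R. \<forall>x\<in>I. f (a \<otimes> x) = a \<odot>\<^bsub>E q\<^esub> f x"
      "\<forall>x\<in>J. f x = \<zero>\<^bsub>E q\<^esub>"
    have I_sub: "I \<subseteq> carrier R" using ideal.Icarr[OF I(1)] by (rule subsetI)
    have fZ: "f x \<in> V q" "d q (f x) = \<zero>\<^bsub>E r\<^esub>" if "x \<in> I" for x using f(1) that by (auto simp: Z_def)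
    have "\<exists>v\<in>V q. \<forall>x\<in>I. f x = x \<odot>\<^bsub>E q\<^esub> v"
      by (rule baer_moduleD[OF baer I]) (use f fZ in auto)
    then obtain v where v: "v \<in> V q" "\<And>x. x \<in> I \<Longrightarrow> f x = x \<odot>\<^bsub>E q\<^esub> v" by blast
    have "a \<odot>\<^bsub>E r\<^esub> d q v = \<zero>\<^bsub>E r\<^esub>" if "a \<in> I" for a
      using fZ(2)[OF that] v(2)[OF that] d_smult[of a v q] v(1) that I_sub r by auto
    then have "d q v \<in> torsion r I" using d_closed[OF v(1)] r by (simp add: torsion_def)
    \<comment> \<open>The element v represents f but need not be a cocycle. Subtracting w, which is
      killed by I and has the same coboundary, leaves the products with I unchanged.\<close>
    then obtain w where w: "w \<in> torsion q I" "d q w = d q v"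
      using top_vanishing[OF r s I] by blast
    have wV: "w \<in> V q" by (rule torsionD(1)[OF w(1)])
    have "v \<ominus>\<^bsub>E q\<^esub> w \<in> Z"
      using V_minus[OF v(1) wV] d_minus[OF v(1) wV] w(2) V_carrier[OF d_closed[OF v(1)]] r
      by (simp add: Z_def Es.M.minus_eq_zero_iff)
    moreover have "f x = x \<odot>\<^bsub>E q\<^esub> (v \<ominus>\<^bsub>E q\<^esub> w)" if x: "x \<in> I" for x
    proof -
      have "x \<in> carrier R" using x I_sub by blast
      then have "x \<odot>\<^bsub>E q\<^esub> (v \<ominus>\<^bsub>E q\<^esub> w) = x \<odot>\<^bsub>E q\<^esub> v \<ominus>\<^bsub>E q\<^esub> x \<odot>\<^bsub>E q\<^esub> w"
        using V_carrier[OF v(1)] V_carrier[OF wV] by (simp add: Eq.module_simps)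
      then show ?thesis using torsionD(2)[OF w(1) x] v(2)[OF x] V_carrier[OF V_smult[OF \<open>x \<in> carrier R\<close> v(1)]]
        by (simp add: Eq.M.minus_eq)
    qed
    ultimately show "\<exists>v\<in>Z. \<forall>x\<in>I. f x = x \<odot>\<^bsub>E q\<^esub> v" by blast
  qed
  have zero_sub: "submodule {\<zero>\<^bsub>E i\<^esub>} R (E i)" for i
  proof -
    interpret Ei: module R "E i" by (rule E)
    show ?thesis by (rule Ei.submoduleI') auto
  qed
  have baer0: "baer_module R J (E i) {\<zero>\<^bsub>E i\<^esub>}" for i
  proof -
    interpret Ei: module R "E i" by (rule E)
    show ?thesis unfolding baer_module_def
      using ideal.Icarr by (fastforce simp: Pi_iff)
  qed
  have V'V: "V' i \<subseteq> V i" for i using V_zero_closed by (auto simp: V'_def Z_def)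
  show "baer_resolution R \<mm> J E V' d e q"
  proof (intro baer_resolution.intro baer_resolution_axioms.intro noetherian_local_axioms J E)
    show "submodule (V' i) R (E i)" for i using V Z zero_sub by (simp add: V'_def)
    show "baer_module R J (E i) (V' i)" for i using baer baerZ baer0 by (simp add: V'_def)
    show "j \<odot>\<^bsub>E i\<^esub> v = \<zero>\<^bsub>E i\<^esub>" if "j \<in> J" "v \<in> V' i" for i j v using that V'V J_V by blast
    show "d i v \<in> V' (Suc i)" if v: "v \<in> V' i" for i v
    proof -
      have vV: "v \<in> V i" using v V'V by blast
      consider "Suc i < q" | "Suc i = q" | "i = q" | "q < i" by linarith
      then show ?thesis
      proof cases
        case 2
        then show ?thesis using d_closed[OF vV] d_d[OF vV] r by (auto simp: V'_def Z_def)
      qed (use v d_closed[OF vV] d_zero[of i] r in \<open>auto simp: V'_def Z_def\<close>)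
    qed
    show "d i (u \<oplus>\<^bsub>E i\<^esub> v) = d i u \<oplus>\<^bsub>E (Suc i)\<^esub> d i v" if "u \<in> V' i" "v \<in> V' i" for i u v
      using that V'V d_add by blast
    show "d i (a \<odot>\<^bsub>E i\<^esub> v) = a \<odot>\<^bsub>E (Suc i)\<^esub> d i v" if "a \<in> carrier R" "v \<in> V' i" for i a v
      using that V'V d_smult by blast
    have "d 0 e = \<zero>\<^bsub>E (Suc 0)\<^esub>"
      using exact_0[OF e] module.smult_one[OF E V_carrier[OF e]] one_closed by metis
    then show "e \<in> V' 0" using e r by (auto simp: V'_def Z_def)
    show "a \<odot>\<^bsub>E 0\<^esub> e = \<zero>\<^bsub>E 0\<^esub> \<longleftrightarrow> a \<in> J" if "a \<in> carrier R" for a using ann_e that .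
    show "d 0 v = \<zero>\<^bsub>E (Suc 0)\<^esub> \<longleftrightarrow> (\<exists>a\<in>carrier R. v = a \<odot>\<^bsub>E 0\<^esub> e)" if "v \<in> V' 0" for v
      using that V'V exact_0 by blast
    show "V' i = {\<zero>\<^bsub>E i\<^esub>}" if "q < i" for i using that by (simp add: V'_def)
    show "d (Suc i) v = \<zero>\<^bsub>E (Suc (Suc i))\<^esub> \<longleftrightarrow> (\<exists>u\<in>V' i. v = d i u)" if v: "v \<in> V' (Suc i)" for i v
    proof -
      consider "Suc i \<le> q" | "i = q" | "q < i" by linarith
      then show ?thesis
      proof cases
        case 1
        then have "V' i = V i" by (simp add: V'_def)
        then show ?thesis using exact_Suc v V'V by blast
      next
        case 2
        have "v = \<zero>\<^bsub>E (Suc i)\<^esub>" using v 2 by (simp add: V'_def)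
        moreover have "\<zero>\<^bsub>E q\<^esub> \<in> V' i" using submoduleD(2)[OF Z] 2 by (simp add: V'_def)
        ultimately show ?thesis using d_zero[of "Suc i"] d_zero[of q, symmetric] 2 by auto
      next
        case 3
        then have "v = \<zero>\<^bsub>E (Suc i)\<^esub>" using v by (simp add: V'_def)
        then show ?thesis using d_zero 3 by (auto simp: V'_def)
      qed
    qed
  qed
qed

end

section \<open>Division of the resolution by a regular element\<close>

context baer_resolution
begin

text \<open>The elements W i of V i killed by x form a complex of injectives over R/(J + Rx). Its
  cohomology is Ext^i(R/(J + Rx), R/J), which for regular x is R/(J + Rx) in degree 1 and zero
  elsewhere. The injection W 0 -> W 1 splits since W 0 is injective; a complement C of its image,
  followed by W 2, W 3 and so on, resolves R/(J + Rx) and is shorter by one term.\<close>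

lemma regular_quotient:
  assumes r: "r = Suc q" and x: "x \<in> carrier R"
    and reg: "\<And>a. a \<in> carrier R \<Longrightarrow> x \<otimes> a \<in> J \<Longrightarrow> a \<in> J"
  obtains E' :: "nat \<Rightarrow> ('a, 'e) module" and V' d' e' where "baer_resolution R \<mm> (adjoin_elt R J x) E' V' d' e' q"
proof -
  define J' where "J' = adjoin_elt R J x"
  note adj = adjoin_elt[OF J x, folded J'_def]
  have J'_sub: "J' \<subseteq> carrier R" using ideal.Icarr[OF adj(1)] by (rule subsetI)
  define W where "W i = torsion i J'" for i
  have W: "submodule (W i) R (E i)" for i unfolding W_def by (rule torsion_submodule[OF J'_sub])
  have WV: "v \<in> V i" and Wx: "x \<odot>\<^bsub>E i\<^esub> v = \<zero>\<^bsub>E i\<^esub>" if "v \<in> W i" for v i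
    using torsionD(1) torsionD(2)[OF _ adj(3)] that unfolding W_def by auto
  have Wc: "v \<in> carrier (E i)" if "v \<in> W i" for v i using V_carrier[OF WV[OF that]] .
  have WI: "v \<in> W i" if "v \<in> V i" "x \<odot>\<^bsub>E i\<^esub> v = \<zero>\<^bsub>E i\<^esub>" for v i
    unfolding W_def J'_def using torsion_adjoin_elt[OF that(1) x J.a_subset J_V[OF _ that(1)] that(2)] .
  have dW: "d i v \<in> W (Suc i)" if "v \<in> W i" for i v
    using d_torsion that J'_sub unfolding W_def by blast
  have baerW: "baer_module R J' (E i) (W i)" for i
    unfolding baer_module_def
  proof (intro allI impI, elim conjE)
    fix I f assume I: "ideal I R" "J' \<subseteq> I" and f: "f \<in> I \<rightarrow> W i"
      "\<forall>x\<in>I. \<forall>y\<in>I. f (x \<oplus> y) = f x \<oplus>\<^bsub>E i\<^esub> f y" "\<forall>a\<in>carrier R. \<forall>x\<in>I. f (a \<otimes> x) = a \<odot>\<^bsub>E i\<^esub> f x"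
      "\<forall>x\<in>J'. f x = \<zero>\<^bsub>E i\<^esub>"
    have "J \<subseteq> I" using adj(2) I(2) by blast
    have "\<exists>v\<in>V i. \<forall>x\<in>I. f x = x \<odot>\<^bsub>E i\<^esub> v"
      by (rule baer_moduleD[OF baer I(1) \<open>J \<subseteq> I\<close>]) (use f(2-4) WV funcset_mem[OF f(1)] adj(2) in auto)
    then obtain v where v: "v \<in> V i" "\<And>x. x \<in> I \<Longrightarrow> f x = x \<odot>\<^bsub>E i\<^esub> v" by blast
    \<comment> \<open>The representing element v is killed by x automatically, because x v = f x and
      f vanishes on J'.\<close>
    have "x \<in> I" using adj(3) I(2) by blast
    then have "v \<in> W i" using WI[OF v(1)] v(2)[of x] f(4) adj(3) by simp
    then show "\<exists>v\<in>W i. \<forall>x\<in>I. f x = x \<odot>\<^bsub>E i\<^esub> v" using v(2) by blast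
  qed
  \<comment> \<open>Regularity means (J : x) = J, and J kills V i, so nothing obstructs division by
    x.\<close>
  have divx: "\<exists>v\<in>V i. x \<odot>\<^bsub>E i\<^esub> v = y" if y: "y \<in> V i" for i y
  proof -
    have "s \<odot>\<^bsub>E i\<^esub> y = \<zero>\<^bsub>E i\<^esub>" if "s \<in> carrier R" "s \<otimes> x \<in> J" for s
      using J_V[OF reg[OF that(1)] y] that m_comm[OF that(1) x] by simp
    then show ?thesis using divide[OF J subset_refl x y] by metis
  qed
  \<comment> \<open>Exactness of W in degrees at least 2. A preimage z in V has x z as a cocycle,
    say x z = d u with u = x u'. Then z - d u' is killed by x and has the same coboundary.\<close>
  have lift: "\<exists>z\<in>W (Suc i). d (Suc i) z = v"
    if v: "v \<in> W (Suc (Suc i))" "d (Suc (Suc i)) v = \<zero>\<^bsub>E (Suc (Suc (Suc i)))\<^esub>" for i v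
  proof -
    interpret Ei: module R "E (Suc i)" by (rule E)
    obtain z where z: "z \<in> V (Suc i)" "v = d (Suc i) z" using exact_Suc[OF WV[OF v(1)]] v(2) by blast
    have "d (Suc i) (x \<odot>\<^bsub>E (Suc i)\<^esub> z) = \<zero>\<^bsub>E (Suc (Suc i))\<^esub>"
      using d_smult[OF x z(1)] Wx[OF v(1)] z(2) by simp
    then obtain u where u: "u \<in> V i" "x \<odot>\<^bsub>E (Suc i)\<^esub> z = d i u"
      using exact_Suc[OF V_smult[OF x z(1)]] by blast
    obtain u' where u': "u' \<in> V i" "x \<odot>\<^bsub>E i\<^esub> u' = u" using divx[OF u(1)] by blast
    have du': "d i u' \<in> V (Suc i)" by (rule d_closed[OF u'(1)])
    have "x \<odot>\<^bsub>E (Suc i)\<^esub> (z \<ominus>\<^bsub>E (Suc i)\<^esub> d i u') = x \<odot>\<^bsub>E (Suc i)\<^esub> z \<ominus>\<^bsub>E (Suc i)\<^esub> x \<odot>\<^bsub>E (Suc i)\<^esub> d i u'"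
      using x V_carrier[OF z(1)] V_carrier[OF du'] by (simp add: Ei.module_simps)
    also have "x \<odot>\<^bsub>E (Suc i)\<^esub> d i u' = x \<odot>\<^bsub>E (Suc i)\<^esub> z" using d_smult[OF x u'(1)] u'(2) u(2) by simp
    finally have "x \<odot>\<^bsub>E (Suc i)\<^esub> (z \<ominus>\<^bsub>E (Suc i)\<^esub> d i u') = \<zero>\<^bsub>E (Suc i)\<^esub>"
      using x V_carrier[OF z(1)] by (simp add: Ei.M.minus_eq Ei.M.r_neg)
    then have "z \<ominus>\<^bsub>E (Suc i)\<^esub> d i u' \<in> W (Suc i)" using WI V_minus[OF z(1) du'] by blast
    moreover have "d (Suc i) (z \<ominus>\<^bsub>E (Suc i)\<^esub> d i u') = v"
      using d_minus[OF z(1) du'] d_d[OF u'(1)] z(2) Wc[OF v(1)] E_abelian_group[of "Suc (Suc i)"]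
      by (simp add: abelian_group.minus_eq abelian_group.a_inv_closed
          abelian_monoid.r_zero[OF abelian_group.axioms(1)] abelian_group.a_inv_closed
          abelian_group.minus_minus flip: minus_smult)
        (metis abelian_group.axioms(1) abelian_group.minus_equality abelian_monoid.l_zero abelian_monoid.r_zero abelian_monoid.zero_closed)
    ultimately show ?thesis by blast
  qed
  interpret E0: module R "E 0" by (rule E)
  interpret E1: module R "E (Suc 0)" by (rule E)
  have d_add0: "d 0 (u \<oplus>\<^bsub>E 0\<^esub> v) = d 0 u \<oplus>\<^bsub>E (Suc 0)\<^esub> d 0 v" if "u \<in> V 0" "v \<in> V 0" for u v
    using d_add[OF that] by simp
  have d_smult0: "d 0 (a \<odot>\<^bsub>E 0\<^esub> v) = a \<odot>\<^bsub>E (Suc 0)\<^esub> d 0 v" if "a \<in> carrier R" "v \<in> V 0" for a v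
    using d_smult[OF that] by simp
  have d_minus0: "d 0 (u \<ominus>\<^bsub>E 0\<^esub> v) = d 0 u \<ominus>\<^bsub>E (Suc 0)\<^esub> d 0 v" if "u \<in> V 0" "v \<in> V 0" for u v
    using d_minus[OF that] by simp
  have d_zero0: "d 0 \<zero>\<^bsub>E 0\<^esub> = \<zero>\<^bsub>E (Suc 0)\<^esub>" using d_zero[of 0] by simp
  have dW0: "d 0 v \<in> W (Suc 0)" if "v \<in> W 0" for v using dW[OF that] by simp
  have dV0: "d 0 v \<in> V (Suc 0)" if "v \<in> V 0" for v using d_closed[OF that] by simp
  have inj0: "v = \<zero>\<^bsub>E 0\<^esub>" if v: "v \<in> W 0" "d 0 v = \<zero>\<^bsub>E (Suc 0)\<^esub>" for v
  proof -
    obtain a where a: "a \<in> carrier R" "v = a \<odot>\<^bsub>E 0\<^esub> e" using exact_0[OF WV[OF v(1)]] v(2) by blast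
    have "(x \<otimes> a) \<odot>\<^bsub>E 0\<^esub> e = \<zero>\<^bsub>E 0\<^esub>"
      using Wx[OF v(1)] a x V_carrier[OF e] by (simp add: E0.smult_assoc1)
    then have "a \<in> J" using ann_e reg a(1) x by blast
    then show ?thesis using a ann_e by simp
  qed
  \<comment> \<open>The inverse of the injective map \<open>d 0\<close> on its image. It is extended
    to a retraction of W 1 onto W 0 with graph G.\<close>
  define G0 where "G0 = {(d 0 v, v) | v. v \<in> W 0}"
  have G0I: "(d 0 v, v) \<in> G0" if "v \<in> W 0" for v using that by (simp add: G0_def)
  obtain G where G: "linear_graph R (E (Suc 0)) (E 0) G" "G \<subseteq> W (Suc 0) \<times> W 0" "G0 \<subseteq> G"
    "\<And>b y. (b, y) \<in> G \<Longrightarrow> b = \<zero>\<^bsub>E (Suc 0)\<^esub> \<longrightarrow> y = \<zero>\<^bsub>E 0\<^esub>" "\<And>b. b \<in> W (Suc 0) \<Longrightarrow> \<exists>y. (b, y) \<in> G"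
  proof (rule linear_graph_extension[OF E[of "Suc 0"] E[of 0] W[of "Suc 0"] W[of 0], where P = "\<lambda>b y. b = \<zero>\<^bsub>E (Suc 0)\<^esub> \<longrightarrow> y = \<zero>\<^bsub>E 0\<^esub>" and ?G0.0 = G0])
    show "linear_graph R (E (Suc 0)) (E 0) G0"
      unfolding linear_graph_def
    proof (intro conjI allI impI)
      show "(\<zero>\<^bsub>E (Suc 0)\<^esub>, \<zero>\<^bsub>E 0\<^esub>) \<in> G0" using G0I[OF submoduleD(2)[OF W]] d_zero0 by simp
      show "(b \<oplus>\<^bsub>E (Suc 0)\<^esub> b', y \<oplus>\<^bsub>E 0\<^esub> y') \<in> G0" if "(b, y) \<in> G0" "(b', y') \<in> G0" for b y b' y'
        using that G0I[OF submoduleD(3)[OF W, of y 0 y']] d_add0[OF WV WV, of y y'] by (auto simp: G0_def)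
      show "(a \<odot>\<^bsub>E (Suc 0)\<^esub> b, a \<odot>\<^bsub>E 0\<^esub> y) \<in> G0" if "a \<in> carrier R" "(b, y) \<in> G0" for a b y
        using that G0I[OF submoduleD(4)[OF W, of a y 0]] d_smult0[OF _ WV, of a y] by (auto simp: G0_def)
    qed
    show "G0 \<subseteq> W (Suc 0) \<times> W 0" using dW0 by (auto simp: G0_def)
    show "b = \<zero>\<^bsub>E (Suc 0)\<^esub> \<longrightarrow> y = \<zero>\<^bsub>E 0\<^esub>" if "(b, y) \<in> G0" for b y
      using that inj0 by (auto simp: G0_def)
  next
    fix G b assume G: "linear_graph R (E (Suc 0)) (E 0) G" "G \<subseteq> W (Suc 0) \<times> W 0"
      and P: "\<And>b y. (b, y) \<in> G \<Longrightarrow> b = \<zero>\<^bsub>E (Suc 0)\<^esub> \<longrightarrow> y = \<zero>\<^bsub>E 0\<^esub>" and b: "b \<in> W (Suc 0)"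
    have Gc: "b' \<in> carrier (E (Suc 0))" "y' \<in> carrier (E 0)" "y' \<in> W 0" if "(b', y') \<in> G" for b' y'
      using that G(2) Wc by auto
    have G_carr: "G \<subseteq> carrier (E (Suc 0)) \<times> carrier (E 0)" using Gc by auto
    have uniq: "y1 = y2" if "(b', y1) \<in> G" "(b', y2) \<in> G" for b' y1 y2
    proof -
      have "(b' \<ominus>\<^bsub>E (Suc 0)\<^esub> b', y1 \<ominus>\<^bsub>E 0\<^esub> y2) \<in> G"
        by (rule linear_graph_minus[OF E E G(1) G_carr that])
      from P[OF this] show ?thesis
        using Gc[OF that(1)] Gc[OF that(2)] by (simp add: E0.M.minus_eq_zero_iff E1.M.minus_eq_zero_iff)
    qed
    \<comment> \<open>I collects the coefficients a for which a b is already in the domain, and f a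
      is the value at a b. Baer's condition gives f a = a w, so w is a consistent value at
      b.\<close>
    define I where "I = {a \<in> carrier R. \<exists>y. (a \<odot>\<^bsub>E (Suc 0)\<^esub> b, y) \<in> G}"
    define f where "f a = (SOME y. (a \<odot>\<^bsub>E (Suc 0)\<^esub> b, y) \<in> G)" for a
    have f: "(a \<odot>\<^bsub>E (Suc 0)\<^esub> b, f a) \<in> G" if "a \<in> I" for a
      using that unfolding I_def f_def by (auto intro: someI)
    have f_eq: "f a = y" if "a \<in> I" "(a \<odot>\<^bsub>E (Suc 0)\<^esub> b, y) \<in> G" for a y using uniq[OF f[OF that(1)] that(2)] .
    have bc: "b \<in> carrier (E (Suc 0))" by (rule Wc[OF b])
    have I_add: "((a \<oplus> a') \<odot>\<^bsub>E (Suc 0)\<^esub> b, f a \<oplus>\<^bsub>E 0\<^esub> f a') \<in> G" if "a \<in> I" "a' \<in> I" for a a'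
      using linear_graphD(2)[OF G(1) f[OF that(1)] f[OF that(2)]] that bc
      by (simp add: I_def E1.smult_l_distr)
    have I_smult: "((s \<otimes> a) \<odot>\<^bsub>E (Suc 0)\<^esub> b, s \<odot>\<^bsub>E 0\<^esub> f a) \<in> G" if "s \<in> carrier R" "a \<in> I" for s a
      using linear_graphD(3)[OF G(1) that(1) f[OF that(2)]] that bc
      by (simp add: I_def E1.smult_assoc1)
    have I_zero: "a \<in> I" "f a = \<zero>\<^bsub>E 0\<^esub>" if "a \<in> J'" for a
    proof -
      have "a \<odot>\<^bsub>E (Suc 0)\<^esub> b = \<zero>\<^bsub>E (Suc 0)\<^esub>" using b that torsionD(2) unfolding W_def by blast
      then have *: "(a \<odot>\<^bsub>E (Suc 0)\<^esub> b, \<zero>\<^bsub>E 0\<^esub>) \<in> G" using linear_graphD(1)[OF G(1)] by simp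
      then show "a \<in> I" using that J'_sub unfolding I_def by blast
      then show "f a = \<zero>\<^bsub>E 0\<^esub>" using f_eq * by blast
    qed
    have I: "ideal I R"
    proof (rule idealI_cring)
      show "I \<subseteq> carrier R" by (auto simp: I_def)
      show "\<zero> \<in> I" using I_zero(1) adj(1) ideal.axioms(1) additive_subgroup.zero_closed by blast
      show "a \<oplus> a' \<in> I" if "a \<in> I" "a' \<in> I" for a a'
        using I_add[OF that] that unfolding I_def by blast
      show "s \<otimes> a \<in> I" if "a \<in> I" "s \<in> carrier R" for a s
        using I_smult[OF that(2,1)] that unfolding I_def by blast
    qed
    have "\<exists>w\<in>W 0. \<forall>a\<in>I. f a = a \<odot>\<^bsub>E 0\<^esub> w"
    proof (rule baer_moduleD[OF baerW I])
      show "J' \<subseteq> I" using I_zero(1) by blast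
      show "f a \<in> W 0" if "a \<in> I" for a using Gc(3)[OF f[OF that]] .
      show "f (a \<oplus> a') = f a \<oplus>\<^bsub>E 0\<^esub> f a'" if "a \<in> I" "a' \<in> I" for a a'
        using f_eq[OF _ I_add[OF that]] additive_subgroup.a_closed[OF ideal.axioms(1)[OF I] that] by blast
      show "f (s \<otimes> a) = s \<odot>\<^bsub>E 0\<^esub> f a" if "s \<in> carrier R" "a \<in> I" for s a
        using f_eq[OF _ I_smult[OF that]] ideal.I_l_closed[OF I that(2,1)] by blast
    qed (rule I_zero(2))
    then obtain w where w: "w \<in> W 0" "\<And>a. a \<in> I \<Longrightarrow> f a = a \<odot>\<^bsub>E 0\<^esub> w" by blast
    show "\<exists>y\<in>W 0. \<forall>(x', y')\<in>G. \<forall>s\<in>carrier R.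
        x' \<oplus>\<^bsub>E (Suc 0)\<^esub> s \<odot>\<^bsub>E (Suc 0)\<^esub> b = \<zero>\<^bsub>E (Suc 0)\<^esub> \<longrightarrow> y' \<oplus>\<^bsub>E 0\<^esub> s \<odot>\<^bsub>E 0\<^esub> y = \<zero>\<^bsub>E 0\<^esub>"
    proof (rule bexI[OF _ w(1)], clarify)
      fix b' y' s assume by': "(b', y') \<in> G" and s: "s \<in> carrier R" and 0: "b' \<oplus>\<^bsub>E (Suc 0)\<^esub> s \<odot>\<^bsub>E (Suc 0)\<^esub> b = \<zero>\<^bsub>E (Suc 0)\<^esub>"
      note c = Gc[OF by']
      have eq: "\<ominus>\<^bsub>E (Suc 0)\<^esub> b' = s \<odot>\<^bsub>E (Suc 0)\<^esub> b" using 0 c s bc by (simp add: E1.M.minus_equality E1.M.a_comm)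
      have "((\<ominus> \<one>) \<odot>\<^bsub>E (Suc 0)\<^esub> b', (\<ominus> \<one>) \<odot>\<^bsub>E 0\<^esub> y') \<in> G" using linear_graphD(3)[OF G(1) _ by'] by simp
      then have *: "(s \<odot>\<^bsub>E (Suc 0)\<^esub> b, \<ominus>\<^bsub>E 0\<^esub> y') \<in> G" using c eq by (simp add: E0.smult_l_minus E1.smult_l_minus)
      then have "s \<in> I" using s unfolding I_def by blast
      then have "\<ominus>\<^bsub>E 0\<^esub> y' = s \<odot>\<^bsub>E 0\<^esub> w" using w(2) f_eq * by metis
      then show "y' \<oplus>\<^bsub>E 0\<^esub> s \<odot>\<^bsub>E 0\<^esub> w = \<zero>\<^bsub>E 0\<^esub>" using c by (metis E0.M.r_neg)
    qed
  qed (rule that; assumption)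
  have G_carr: "G \<subseteq> carrier (E (Suc 0)) \<times> carrier (E 0)" using G(2) Wc by auto
  define C where "C = {b \<in> W (Suc 0). (b, \<zero>\<^bsub>E 0\<^esub>) \<in> G}"
  have CW: "b \<in> W (Suc 0)" if "b \<in> C" for b using that by (simp add: C_def)
  have C: "submodule C R (E (Suc 0))"
  proof (rule E1.submoduleI')
    show "C \<subseteq> carrier (E (Suc 0))" using CW Wc by blast
    show "\<zero>\<^bsub>E (Suc 0)\<^esub> \<in> C" using linear_graphD(1)[OF G(1)] submoduleD(2)[OF W] by (simp add: C_def)
    show "b \<oplus>\<^bsub>E (Suc 0)\<^esub> b' \<in> C" if "b \<in> C" "b' \<in> C" for b b'
      using linear_graphD(2)[OF G(1), of b "\<zero>\<^bsub>E 0\<^esub>" b' "\<zero>\<^bsub>E 0\<^esub>"] that submoduleD(3)[OF W] by (simp add: C_def)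
    show "a \<odot>\<^bsub>E (Suc 0)\<^esub> b \<in> C" if "a \<in> carrier R" "b \<in> C" for a b
      using linear_graphD(3)[OF G(1), of a b "\<zero>\<^bsub>E 0\<^esub>"] that submoduleD(4)[OF W] by (simp add: C_def)
  qed
  have retract: "b \<ominus>\<^bsub>E (Suc 0)\<^esub> d 0 y \<in> C" if "(b, y) \<in> G" for b y
  proof -
    have byW: "b \<in> W (Suc 0)" "y \<in> W 0" using that G(2) by auto
    have "(d 0 y, y) \<in> G" using G0I[OF byW(2)] G(3) by blast
    then have "(b \<ominus>\<^bsub>E (Suc 0)\<^esub> d 0 y, y \<ominus>\<^bsub>E 0\<^esub> y) \<in> G"
      using linear_graph_minus[OF E E G(1) G_carr that] by blast
    moreover have "y \<ominus>\<^bsub>E 0\<^esub> y = \<zero>\<^bsub>E 0\<^esub>" using Wc[OF byW(2)] by (simp add: E0.M.minus_eq_zero_iff)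
    ultimately show ?thesis using E1.submodule_minus[OF W byW(1) dW0[OF byW(2)]] by (simp add: C_def)
  qed
  have C_zero: "w = \<zero>\<^bsub>E 0\<^esub>" if "w \<in> W 0" "d 0 w \<in> C" for w
  proof -
    have "(d 0 w, w) \<in> G" using G0I[OF that(1)] G(3) by blast
    moreover have "(d 0 w, \<zero>\<^bsub>E 0\<^esub>) \<in> G" using that(2) by (simp add: C_def)
    ultimately have "(d 0 w \<ominus>\<^bsub>E (Suc 0)\<^esub> d 0 w, w \<ominus>\<^bsub>E 0\<^esub> \<zero>\<^bsub>E 0\<^esub>) \<in> G"
      by (rule linear_graph_minus[OF E E G(1) G_carr])
    from G(4)[OF this] show ?thesis
      using Wc[OF that(1)] Wc[OF dW0[OF that(1)]] 
      by (simp add: E1.M.minus_eq_zero_iff E0.M.minus_eq_zero_iff)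
  qed
  \<comment> \<open>A direct summand of an injective module is injective: the projection to C of a
    representing element still represents f, because a v already lies in C and C meets the image of
    W 0 in zero.\<close>
  have baerC: "baer_module R J' (E (Suc 0)) C"
    unfolding baer_module_def
  proof (intro allI impI, elim conjE)
    fix I f assume I: "ideal I R" "J' \<subseteq> I" and f: "f \<in> I \<rightarrow> C"
      "\<forall>x\<in>I. \<forall>y\<in>I. f (x \<oplus> y) = f x \<oplus>\<^bsub>E (Suc 0)\<^esub> f y" "\<forall>a\<in>carrier R. \<forall>x\<in>I. f (a \<otimes> x) = a \<odot>\<^bsub>E (Suc 0)\<^esub> f x"
      "\<forall>x\<in>J'. f x = \<zero>\<^bsub>E (Suc 0)\<^esub>"
    have fC: "f a \<in> C" if "a \<in> I" for a using f(1) that by auto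
    have "\<exists>v\<in>W (Suc 0). \<forall>x\<in>I. f x = x \<odot>\<^bsub>E (Suc 0)\<^esub> v"
      by (rule baer_moduleD[OF baerW I]) (use f CW fC in auto)
    then obtain v where v: "v \<in> W (Suc 0)" "\<And>a. a \<in> I \<Longrightarrow> f a = a \<odot>\<^bsub>E (Suc 0)\<^esub> v" by blast
    obtain y where y: "(v, y) \<in> G" using G(5) v(1) by blast
    have yW: "y \<in> W 0" using y G(2) by auto
    have "f a = a \<odot>\<^bsub>E (Suc 0)\<^esub> (v \<ominus>\<^bsub>E (Suc 0)\<^esub> d 0 y)" if a: "a \<in> I" for a
    proof -
      have ac: "a \<in> carrier R" using ideal.Icarr[OF I(1) a] .
      have ret: "v \<ominus>\<^bsub>E (Suc 0)\<^esub> d 0 y \<in> C" by (rule retract[OF y])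
      have vc: "v \<in> carrier (E (Suc 0))" "d 0 y \<in> carrier (E (Suc 0))" using Wc v(1) dW0[OF yW] by auto
      have "a \<odot>\<^bsub>E (Suc 0)\<^esub> v \<ominus>\<^bsub>E (Suc 0)\<^esub> a \<odot>\<^bsub>E (Suc 0)\<^esub> (v \<ominus>\<^bsub>E (Suc 0)\<^esub> d 0 y) \<in> C"
        using E1.submodule_minus[OF C _ submoduleD(4)[OF C ac ret]] fC[OF a] v(2)[OF a] by simp
      also have "a \<odot>\<^bsub>E (Suc 0)\<^esub> v \<ominus>\<^bsub>E (Suc 0)\<^esub> a \<odot>\<^bsub>E (Suc 0)\<^esub> (v \<ominus>\<^bsub>E (Suc 0)\<^esub> d 0 y) = d 0 (a \<odot>\<^bsub>E 0\<^esub> y)"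
        using ac vc d_smult0[OF ac WV[OF yW]] by (simp add: E1.module_simps)
      finally have "a \<odot>\<^bsub>E 0\<^esub> y = \<zero>\<^bsub>E 0\<^esub>" using C_zero submoduleD(4)[OF W ac yW] by blast
      then have "a \<odot>\<^bsub>E (Suc 0)\<^esub> d 0 y = \<zero>\<^bsub>E (Suc 0)\<^esub>" using d_smult0[OF ac WV[OF yW]] d_zero0 by simp
      then show ?thesis using v(2)[OF a] ac vc by (simp add: E1.smult_r_distr E1.M.minus_eq E1.smult_r_minus)
    qed
    then show "\<exists>v\<in>C. \<forall>x\<in>I. f x = x \<odot>\<^bsub>E (Suc 0)\<^esub> v" using retract[OF y] by blast
  qed
  \<comment> \<open>The generator of the first cohomology comes from the connecting map: e is
    divided by x, d is applied, and the result is projected to C. Its coset does not depend on the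
    choice of e'.\<close>
  obtain e' where e': "e' \<in> V 0" "x \<odot>\<^bsub>E 0\<^esub> e' = e" using divx[OF e] by blast
  have e'c: "e' \<in> carrier (E 0)" by (rule V_carrier[OF e'(1)])
  define e1 where "e1 = d 0 e'"
  have "d 0 e = \<zero>\<^bsub>E (Suc 0)\<^esub>" using exact_0[OF e] E0.smult_one[OF V_carrier[OF e]] one_closed by metis
  then have "x \<odot>\<^bsub>E (Suc 0)\<^esub> e1 = \<zero>\<^bsub>E (Suc 0)\<^esub>" using d_smult0[OF x e'(1)] e'(2) by (simp add: e1_def)
  then have e1W: "e1 \<in> W (Suc 0)" using WI dV0[OF e'(1)] by (simp add: e1_def)
  obtain y1 where y1: "(e1, y1) \<in> G" using G(5) e1W by blast
  have y1W: "y1 \<in> W 0" using y1 G(2) by auto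
  define e2 where "e2 = e1 \<ominus>\<^bsub>E (Suc 0)\<^esub> d 0 y1"
  have e2C: "e2 \<in> C" unfolding e2_def by (rule retract[OF y1])
  have e2_eq: "e2 = d 0 (e' \<ominus>\<^bsub>E 0\<^esub> y1)" using d_minus0[OF e'(1) WV[OF y1W]] by (simp add: e2_def e1_def)
  have ez: "e' \<ominus>\<^bsub>E 0\<^esub> y1 \<in> V 0" by (rule V_minus[OF e'(1) WV[OF y1W]])
  define V' where "V' i = (case i of 0 \<Rightarrow> C | Suc k \<Rightarrow> W (Suc i))" for i
  have V'W: "v \<in> W (Suc i)" if "v \<in> V' i" for v i using that CW by (auto simp: V'_def split: nat.splits)
  have V'V: "v \<in> V (Suc i)" if "v \<in> V' i" for v i by (rule WV[OF V'W[OF that]])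
  have "baer_resolution R \<mm> (adjoin_elt R J x) (\<lambda>i. E (Suc i)) V' (\<lambda>i. d (Suc i)) e2 q"
    unfolding J'_def[symmetric]
  proof (intro baer_resolution.intro baer_resolution_axioms.intro noetherian_local_axioms adj(1) E)
    show "submodule (V' i) R (E (Suc i))" for i using C W by (auto simp: V'_def split: nat.splits)
    show "baer_module R J' (E (Suc i)) (V' i)" for i
      using baerC baerW by (auto simp: V'_def split: nat.splits)
    show "j \<odot>\<^bsub>E (Suc i)\<^esub> v = \<zero>\<^bsub>E (Suc i)\<^esub>" if "j \<in> J'" "v \<in> V' i" for i j v
      using V'W[OF that(2)] torsionD(2) that(1) unfolding W_def by blast
    show "d (Suc i) v \<in> V' (Suc i)" if "v \<in> V' i" for i v
      using dW[OF V'W[OF that]] by (simp add: V'_def)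
    show "d (Suc i) (u \<oplus>\<^bsub>E (Suc i)\<^esub> v) = d (Suc i) u \<oplus>\<^bsub>E (Suc (Suc i))\<^esub> d (Suc i) v"
      if "u \<in> V' i" "v \<in> V' i" for i u v by (rule d_add[OF V'V[OF that(1)] V'V[OF that(2)]])
    show "d (Suc i) (a \<odot>\<^bsub>E (Suc i)\<^esub> v) = a \<odot>\<^bsub>E (Suc (Suc i))\<^esub> d (Suc i) v"
      if "a \<in> carrier R" "v \<in> V' i" for i a v by (rule d_smult[OF that(1) V'V[OF that(2)]])
    show "e2 \<in> V' 0" using e2C by (simp add: V'_def)
    show "a \<odot>\<^bsub>E (Suc 0)\<^esub> e2 = \<zero>\<^bsub>E (Suc 0)\<^esub> \<longleftrightarrow> a \<in> J'" if a: "a \<in> carrier R" for a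
    proof
      assume "a \<in> J'"
      then show "a \<odot>\<^bsub>E (Suc 0)\<^esub> e2 = \<zero>\<^bsub>E (Suc 0)\<^esub>" using CW[OF e2C] torsionD(2) unfolding W_def by simp
    next
      assume "a \<odot>\<^bsub>E (Suc 0)\<^esub> e2 = \<zero>\<^bsub>E (Suc 0)\<^esub>"
      then have "d 0 (a \<odot>\<^bsub>E 0\<^esub> (e' \<ominus>\<^bsub>E 0\<^esub> y1)) = \<zero>\<^bsub>E (Suc 0)\<^esub>"
        using d_smult0[OF a ez] by (simp add: e2_eq)
      \<comment> \<open>Multiplying by x, which sends e' - y1 to e, turns this into a e = b x e.
        Hence a - b x lies in J and a in J + Rx.\<close>
      then obtain b where b: "b \<in> carrier R" "a \<odot>\<^bsub>E 0\<^esub> (e' \<ominus>\<^bsub>E 0\<^esub> y1) = b \<odot>\<^bsub>E 0\<^esub> e"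
        using exact_0[OF V_smult[OF a ez]] by blast
      have y1c: "y1 \<in> carrier (E 0)" by (rule Wc[OF y1W])
      have "x \<odot>\<^bsub>E 0\<^esub> (a \<odot>\<^bsub>E 0\<^esub> (e' \<ominus>\<^bsub>E 0\<^esub> y1)) = a \<odot>\<^bsub>E 0\<^esub> (x \<odot>\<^bsub>E 0\<^esub> e') \<ominus>\<^bsub>E 0\<^esub> a \<odot>\<^bsub>E 0\<^esub> (x \<odot>\<^bsub>E 0\<^esub> y1)"
        using x a e'c y1c by (simp add: E0.module_simps)
      also have "\<dots> = a \<odot>\<^bsub>E 0\<^esub> e"
        using e'(2) Wx[OF y1W] a V_carrier[OF e] by (simp add: E0.M.minus_eq)
      finally have "(a \<ominus> b \<otimes> x) \<odot>\<^bsub>E 0\<^esub> e = \<zero>\<^bsub>E 0\<^esub>"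
        using b x a V_carrier[OF e] by (simp add: E0.module_simps)
      then have "a \<ominus> b \<otimes> x \<in> J" using ann_e a b(1) x by simp
      moreover have "a = (a \<ominus> b \<otimes> x) \<oplus> b \<otimes> x" using a b(1) x by algebra
      ultimately show "a \<in> J'" using b(1) unfolding J'_def adjoin_elt_def by blast
    qed
    show "d (Suc 0) v = \<zero>\<^bsub>E (Suc (Suc 0))\<^esub> \<longleftrightarrow> (\<exists>a\<in>carrier R. v = a \<odot>\<^bsub>E (Suc 0)\<^esub> e2)" if v: "v \<in> V' 0" for v
    proof
      assume "\<exists>a\<in>carrier R. v = a \<odot>\<^bsub>E (Suc 0)\<^esub> e2"
      then obtain a where a: "a \<in> carrier R" "v = a \<odot>\<^bsub>E (Suc 0)\<^esub> e2" by blast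
      then have "v = d 0 (a \<odot>\<^bsub>E 0\<^esub> (e' \<ominus>\<^bsub>E 0\<^esub> y1))" using d_smult0[OF a(1) ez] by (simp add: e2_eq)
      then show "d (Suc 0) v = \<zero>\<^bsub>E (Suc (Suc 0))\<^esub>" using d_d[OF V_smult[OF a(1) ez]] by simp
    next
      assume "d (Suc 0) v = \<zero>\<^bsub>E (Suc (Suc 0))\<^esub>"
      then obtain z where z: "z \<in> V 0" "v = d 0 z" using exact_Suc[OF V'V[OF v]] by auto
      have vC: "v \<in> C" using v by (simp add: V'_def)
      have "d 0 (x \<odot>\<^bsub>E 0\<^esub> z) = \<zero>\<^bsub>E (Suc 0)\<^esub>" using d_smult0[OF x z(1)] z(2) Wx[OF CW[OF vC]] by simp
      then obtain a where a: "a \<in> carrier R" "x \<odot>\<^bsub>E 0\<^esub> z = a \<odot>\<^bsub>E 0\<^esub> e"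
        using exact_0[OF V_smult[OF x z(1)]] by blast
      have zc: "z \<in> carrier (E 0)" by (rule V_carrier[OF z(1)])
      have y1c: "y1 \<in> carrier (E 0)" by (rule Wc[OF y1W])
      \<comment> \<open>The multiple a of e' - y1 is chosen so that x w = 0. Then w lies in W 0
        while d w lies in C, which forces d w = 0, that is, v = a e2.\<close>
      define w where "w = z \<ominus>\<^bsub>E 0\<^esub> a \<odot>\<^bsub>E 0\<^esub> (e' \<ominus>\<^bsub>E 0\<^esub> y1)"
      have "x \<odot>\<^bsub>E 0\<^esub> w = x \<odot>\<^bsub>E 0\<^esub> z \<ominus>\<^bsub>E 0\<^esub> a \<odot>\<^bsub>E 0\<^esub> (x \<odot>\<^bsub>E 0\<^esub> e') \<oplus>\<^bsub>E 0\<^esub> a \<odot>\<^bsub>E 0\<^esub> (x \<odot>\<^bsub>E 0\<^esub> y1)"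
        unfolding w_def using x a(1) e'c y1c zc by (simp add: E0.module_simps)
      also have "\<dots> = \<zero>\<^bsub>E 0\<^esub>"
        using e'(2) Wx[OF y1W] a V_carrier[OF e] by (simp add: E0.M.minus_eq E0.M.r_neg)
      finally have wW: "w \<in> W 0" using WI V_minus[OF z(1) V_smult[OF a(1) ez]] by (simp add: w_def)
      have dw: "d 0 w = v \<ominus>\<^bsub>E (Suc 0)\<^esub> a \<odot>\<^bsub>E (Suc 0)\<^esub> e2"
        unfolding w_def using d_minus0[OF z(1) V_smult[OF a(1) ez]] d_smult0[OF a(1) ez] z(2) e2_eq by simp
      have ae2: "a \<odot>\<^bsub>E (Suc 0)\<^esub> e2 \<in> C" by (rule submoduleD(4)[OF C a(1) e2C])
      have "d 0 w \<in> C" unfolding dw by (rule E1.submodule_minus[OF C vC ae2])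
      then have "v \<ominus>\<^bsub>E (Suc 0)\<^esub> a \<odot>\<^bsub>E (Suc 0)\<^esub> e2 = \<zero>\<^bsub>E (Suc 0)\<^esub>" using C_zero[OF wW] d_zero0 dw by simp
      then have "v = a \<odot>\<^bsub>E (Suc 0)\<^esub> e2"
        using E1.M.minus_eq_zero_iff Wc[OF CW[OF vC]] Wc[OF CW[OF ae2]] by blast
      then show "\<exists>a\<in>carrier R. v = a \<odot>\<^bsub>E (Suc 0)\<^esub> e2" using a(1) by auto
    qed
    show "d (Suc (Suc i)) v = \<zero>\<^bsub>E (Suc (Suc (Suc i)))\<^esub> \<longleftrightarrow> (\<exists>u\<in>V' i. v = d (Suc i) u)" if v: "v \<in> V' (Suc i)" for i v
    proof
      assume "\<exists>u\<in>V' i. v = d (Suc i) u"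
      then show "d (Suc (Suc i)) v = \<zero>\<^bsub>E (Suc (Suc (Suc i)))\<^esub>" using d_d V'V by blast
    next
      assume "d (Suc (Suc i)) v = \<zero>\<^bsub>E (Suc (Suc (Suc i)))\<^esub>"
      then obtain z where z: "z \<in> W (Suc i)" "d (Suc i) z = v" using lift V'W[OF v] by blast
      show "\<exists>u\<in>V' i. v = d (Suc i) u"
      proof (cases i)
        case (Suc k)
        then show ?thesis using z by (auto simp: V'_def)
      next
        \<comment> \<open>In this degree the preimage must lie in C and not merely in W 1;
          projecting z to C subtracts a coboundary and leaves d z unchanged.\<close>
        case 0
        then obtain y where y: "(z, y) \<in> G" using G(5) z(1) by auto
        have yV: "y \<in> V 0" using y G(2) WV by auto
        have zV: "z \<in> V (Suc 0)" using WV z(1) 0 by simp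
        have "d (Suc 0) (z \<ominus>\<^bsub>E (Suc 0)\<^esub> d 0 y) = v \<ominus>\<^bsub>E (Suc (Suc 0))\<^esub> \<zero>\<^bsub>E (Suc (Suc 0))\<^esub>"
          using d_minus[OF zV d_closed[OF yV]] d_d[OF yV] z(2) 0 by simp
        also have "\<dots> = v"
        proof -
          interpret E2: module R "E (Suc (Suc 0))" by (rule E)
          have "v \<in> carrier (E (Suc (Suc 0)))" using V_carrier[OF V'V[OF v]] 0 by simp
          then show ?thesis by (simp add: E2.M.minus_eq)
        qed
        finally show ?thesis using retract[OF y] 0 by (intro bexI[of _ "z \<ominus>\<^bsub>E (Suc 0)\<^esub> d 0 y"]) (auto simp: V'_def)
      qed
    qed
    show "V' i = {\<zero>\<^bsub>E (Suc i)\<^esub>}" if i: "q < i" for i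
    proof -
      obtain k where k: "i = Suc k" using i by (cases i) auto
      have "V (Suc i) = {\<zero>\<^bsub>E (Suc i)\<^esub>}" using V_zero[of "Suc i"] i r by simp
      moreover have "V' i = W (Suc i)" using k by (simp add: V'_def)
      ultimately show ?thesis using submoduleD(2)[OF W, of "Suc i"] WV[of _ "Suc i"] by blast
    qed
  qed
  then show thesis by (rule that)
qed

end

section \<open>Self-injective quotients\<close>

text \<open>Self-injectivity of \<open>R/J\<close> (Baer's criterion), with maps to \<open>R/J\<close> lifted to \<open>R\<close>.\<close>

definition self_injective_quotient :: "('a, 'x) ring_scheme \<Rightarrow> 'a set \<Rightarrow> bool"
  where "self_injective_quotient R J \<longleftrightarrow> ideal J R \<and>
    (\<forall>I f. ideal I R \<and> J \<subseteq> I \<and> f \<in> I \<rightarrow> carrier R \<and>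
      (\<forall>x\<in>I. \<forall>y\<in>I. f (x \<oplus>\<^bsub>R\<^esub> y) \<ominus>\<^bsub>R\<^esub> (f x \<oplus>\<^bsub>R\<^esub> f y) \<in> J) \<and>
      (\<forall>r\<in>carrier R. \<forall>x\<in>I. f (r \<otimes>\<^bsub>R\<^esub> x) \<ominus>\<^bsub>R\<^esub> r \<otimes>\<^bsub>R\<^esub> f x \<in> J) \<and>
      (\<forall>x\<in>J. f x \<in> J) \<longrightarrow>
      (\<exists>y\<in>carrier R. \<forall>x\<in>I. f x \<ominus>\<^bsub>R\<^esub> x \<otimes>\<^bsub>R\<^esub> y \<in> J))"

lemma self_injective_quotientD:
  assumes "self_injective_quotient R J" "ideal I R" "J \<subseteq> I" "\<And>x. x \<in> I \<Longrightarrow> f x \<in> carrier R"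
    "\<And>x y. x \<in> I \<Longrightarrow> y \<in> I \<Longrightarrow> f (x \<oplus>\<^bsub>R\<^esub> y) \<ominus>\<^bsub>R\<^esub> (f x \<oplus>\<^bsub>R\<^esub> f y) \<in> J"
    "\<And>r x. r \<in> carrier R \<Longrightarrow> x \<in> I \<Longrightarrow> f (r \<otimes>\<^bsub>R\<^esub> x) \<ominus>\<^bsub>R\<^esub> r \<otimes>\<^bsub>R\<^esub> f x \<in> J"
    "\<And>x. x \<in> J \<Longrightarrow> f x \<in> J"
  shows "\<exists>y\<in>carrier R. \<forall>x\<in>I. f x \<ominus>\<^bsub>R\<^esub> x \<otimes>\<^bsub>R\<^esub> y \<in> J"
  by (rule assms(1)[unfolded self_injective_quotient_def, THEN conjunct2, rule_format])
    (use assms(2-) in auto)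

context baer_resolution
begin

lemma V_0_cyclic:
  assumes "r = 0" "v \<in> V 0"
  shows "\<exists>a\<in>carrier R. v = a \<odot>\<^bsub>E 0\<^esub> e"
  using exact_0[OF assms(2)] d_closed[OF assms(2)] V_zero[of "Suc 0"] assms(1) by simp

lemma smult_e_eq_iff:
  assumes "a \<in> carrier R" "b \<in> carrier R"
  shows "a \<odot>\<^bsub>E 0\<^esub> e = b \<odot>\<^bsub>E 0\<^esub> e \<longleftrightarrow> a \<ominus> b \<in> J"
proof -
  interpret E0: module R "E 0" by (rule E)
  have ec: "e \<in> carrier (E 0)" by (rule V_carrier[OF e])
  have "a \<ominus> b \<in> J \<longleftrightarrow> (a \<ominus> b) \<odot>\<^bsub>E 0\<^esub> e = \<zero>\<^bsub>E 0\<^esub>" using ann_e assms by simp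
  also have "(a \<ominus> b) \<odot>\<^bsub>E 0\<^esub> e = a \<odot>\<^bsub>E 0\<^esub> e \<ominus>\<^bsub>E 0\<^esub> b \<odot>\<^bsub>E 0\<^esub> e"
    using assms ec by (simp add: E0.module_simps)
  finally show ?thesis using assms ec by (simp add: E0.M.minus_eq_zero_iff)
qed

text \<open>For a resolution of length 0 the map a |-> a e identifies R/J with V 0, so Baer's
  condition for V 0 is self-injectivity of R/J.\<close>

lemma self_injective_quotient_if_length_0:
  assumes "r = 0"
  shows "self_injective_quotient R J"
  unfolding self_injective_quotient_def
proof (intro conjI J allI impI, elim conjE)
  interpret E0: module R "E 0" by (rule E)
  have ec: "e \<in> carrier (E 0)" by (rule V_carrier[OF e])
  fix I f assume I: "ideal I R" "J \<subseteq> I" and f: "f \<in> I \<rightarrow> carrier R"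
    and add: "\<forall>x\<in>I. \<forall>y\<in>I. f (x \<oplus> y) \<ominus> (f x \<oplus> f y) \<in> J"
    and mult: "\<forall>r\<in>carrier R. \<forall>x\<in>I. f (r \<otimes> x) \<ominus> r \<otimes> f x \<in> J"
    and fJ: "\<forall>x\<in>J. f x \<in> J"
  have fc: "f x \<in> carrier R" if "x \<in> I" for x using f that by auto
  have I_add: "x \<oplus> y \<in> I" if "x \<in> I" "y \<in> I" for x y
    using additive_subgroup.a_closed[OF ideal.axioms(1)[OF I(1)] that] .
  have I_mult: "a \<otimes> x \<in> I" if "a \<in> carrier R" "x \<in> I" for a x using ideal.I_l_closed[OF I(1) that(2,1)] .
  have "\<exists>v\<in>V 0. \<forall>x\<in>I. f x \<odot>\<^bsub>E 0\<^esub> e = x \<odot>\<^bsub>E 0\<^esub> v"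
  proof (rule baer_moduleD[OF baer I])
    show "f x \<odot>\<^bsub>E 0\<^esub> e \<in> V 0" if "x \<in> I" for x by (rule V_smult[OF fc[OF that] e])
    show "f (x \<oplus> y) \<odot>\<^bsub>E 0\<^esub> e = f x \<odot>\<^bsub>E 0\<^esub> e \<oplus>\<^bsub>E 0\<^esub> f y \<odot>\<^bsub>E 0\<^esub> e" if "x \<in> I" "y \<in> I" for x y
    proof -
      have "f (x \<oplus> y) \<odot>\<^bsub>E 0\<^esub> e = (f x \<oplus> f y) \<odot>\<^bsub>E 0\<^esub> e"
        using smult_e_eq_iff[OF fc[OF I_add[OF that]] a_closed[OF fc[OF that(1)] fc[OF that(2)]]] add that by blast
      then show ?thesis using fc that ec by (simp add: E0.smult_l_distr)
    qed
    show "f (a \<otimes> x) \<odot>\<^bsub>E 0\<^esub> e = a \<odot>\<^bsub>E 0\<^esub> (f x \<odot>\<^bsub>E 0\<^esub> e)" if "a \<in> carrier R" "x \<in> I" for a x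
    proof -
      have "f (a \<otimes> x) \<odot>\<^bsub>E 0\<^esub> e = (a \<otimes> f x) \<odot>\<^bsub>E 0\<^esub> e"
        using smult_e_eq_iff[OF fc[OF I_mult[OF that]] m_closed[OF that(1) fc[OF that(2)]]] mult that by blast
      then show ?thesis using fc that ec by (simp add: E0.smult_assoc1)
    qed
    show "f x \<odot>\<^bsub>E 0\<^esub> e = \<zero>\<^bsub>E 0\<^esub>" if "x \<in> J" for x using J_V[OF _ e] fJ that by blast
  qed
  then obtain v where v: "v \<in> V 0" "\<And>x. x \<in> I \<Longrightarrow> f x \<odot>\<^bsub>E 0\<^esub> e = x \<odot>\<^bsub>E 0\<^esub> v" by blast
  then obtain y where y: "y \<in> carrier R" "v = y \<odot>\<^bsub>E 0\<^esub> e" using V_0_cyclic[OF assms] by blast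
  have "f x \<ominus> x \<otimes> y \<in> J" if "x \<in> I" for x
  proof -
    have xc: "x \<in> carrier R" using ideal.Icarr[OF I(1) that] .
    have "f x \<odot>\<^bsub>E 0\<^esub> e = (x \<otimes> y) \<odot>\<^bsub>E 0\<^esub> e" using v(2)[OF that] y ec xc by (simp add: E0.smult_assoc1)
    then show ?thesis using smult_e_eq_iff[OF fc[OF that] m_closed[OF xc y(1)]] by blast
  qed
  then show "\<exists>y\<in>carrier R. \<forall>x\<in>I. f x \<ominus> x \<otimes> y \<in> J" using y(1) by blast
qed

text \<open>When the annihilators (J : x^n) are stationary at n and z = x^n, the sum of (J : z) and
  Rz is direct modulo J. The map that is zero on the first summand and the inclusion on the second
  is multiplication by some b. Since x is a zero divisor, b is not a unit; hence 1 - b is a unit,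
  and z (1 - b) in J gives z in J.\<close>

lemma nilpotent_if_length_0:
  assumes r: "r = 0" and J1: "\<one> \<notin> J" and x: "x \<in> \<mm>"
  shows "\<exists>k::nat. x [^] k \<in> J"
proof -
  interpret E0: module R "E 0" by (rule E)
  have ec: "e \<in> carrier (E 0)" by (rule V_carrier[OF e])
  have xc: "x \<in> carrier R" using x m.Icarr by simp
  have J_m: "J \<subseteq> \<mm>" by (rule proper_ideal_subset[OF J J1])
  \<comment> \<open>For regular x the generator e would be divisible by x, making x a unit modulo
    J.\<close>
  have zd: "\<exists>a\<in>carrier R. a \<notin> J \<and> a \<otimes> x \<in> J"
  proof (rule ccontr)
    assume *: "\<not> ?thesis"
    have "s \<odot>\<^bsub>E 0\<^esub> e = \<zero>\<^bsub>E 0\<^esub>" if "s \<in> carrier R" "s \<otimes> x \<in> J" for s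
      using * that ann_e by blast
    then obtain v where v: "v \<in> V 0" "x \<odot>\<^bsub>E 0\<^esub> v = e" using divide[OF J subset_refl xc e] by metis
    then obtain b where b: "b \<in> carrier R" "v = b \<odot>\<^bsub>E 0\<^esub> e" using V_0_cyclic[OF r] by blast
    have "\<one> \<odot>\<^bsub>E 0\<^esub> e = (x \<otimes> b) \<odot>\<^bsub>E 0\<^esub> e" using v b xc ec by (simp add: E0.smult_assoc1)
    then have "\<one> \<ominus> x \<otimes> b \<in> \<mm>" using smult_e_eq_iff b(1) xc J_m by blast
    moreover have "x \<otimes> b \<in> \<mm>" using m.I_r_closed[OF x b(1)] .
    ultimately have "(\<one> \<ominus> x \<otimes> b) \<oplus> x \<otimes> b \<in> \<mm>" by (rule m.a_closed)
    moreover have "(\<one> \<ominus> x \<otimes> b) \<oplus> x \<otimes> b = \<one>" using xc b(1) by algebra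
    ultimately show False using one_notin by simp
  qed
  define q where "q n = quot_elt R J (x [^] (n::nat))" for n
  have q: "ideal (q n) R" for n unfolding q_def by (rule quot_elt(1)[OF J]) (simp add: xc)
  have qI: "s \<in> q n \<longleftrightarrow> s \<in> carrier R \<and> s \<otimes> x [^] n \<in> J" for s n by (simp add: q_def quot_elt_def)
  have q_mono: "q n \<subseteq> q (n + k)" for n k
  proof
    fix s assume s: "s \<in> q n"
    have "s \<otimes> x [^] (n + k) = (s \<otimes> x [^] n) \<otimes> x [^] k"
      using s xc by (simp add: qI m_assoc nat_pow_mult)
    then show "s \<in> q (n + k)" using s xc J.I_r_closed[of "s \<otimes> x [^] n" "x [^] k"] by (simp add: qI)
  qed
  have "\<exists>M\<in>range q. \<forall>I\<in>range q. M \<subseteq> I \<longrightarrow> I = M"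
    by (rule maximal_element_ideals) (use q in auto)
  then obtain n where n: "\<And>k. q n \<subseteq> q k \<Longrightarrow> q k = q n" by auto
  \<comment> \<open>At a stationary n, s z in (J : z) means s in (J : x^(2n)) = (J : z). This is the
    directness of the sum of (J : z) and Rz modulo J.\<close>
  define z where "z = x [^] n"
  have zc: "z \<in> carrier R" using xc by (simp add: z_def)
  have z2: "s \<otimes> z \<in> J" if s: "s \<in> carrier R" "s \<otimes> z \<in> q n" for s
  proof -
    have "s \<otimes> x [^] (n + n) = (s \<otimes> z) \<otimes> x [^] n" using s(1) xc by (simp add: z_def m_assoc nat_pow_mult)
    then have "s \<in> q (n + n)" using s by (simp add: qI)
    then show ?thesis using n[OF q_mono[of n n]] s(1) by (simp add: qI z_def)
  qed
  have ze: "z \<odot>\<^bsub>E 0\<^esub> e \<in> V 0" by (rule V_smult[OF zc e])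
  have "s \<odot>\<^bsub>E 0\<^esub> (z \<odot>\<^bsub>E 0\<^esub> e) = \<zero>\<^bsub>E 0\<^esub>" if "s \<in> carrier R" "s \<otimes> z \<in> q n" for s
    using J_V[OF z2[OF that] e] that zc ec by (simp add: E0.smult_assoc1)
  moreover have "J \<subseteq> q n" unfolding q_def by (rule quot_elt(2)[OF J]) (simp add: xc)
  ultimately obtain v where v: "v \<in> V 0" "z \<odot>\<^bsub>E 0\<^esub> v = z \<odot>\<^bsub>E 0\<^esub> e" "\<And>j. j \<in> q n \<Longrightarrow> j \<odot>\<^bsub>E 0\<^esub> v = \<zero>\<^bsub>E 0\<^esub>"
    using divide[OF q _ zc ze, of n] by metis
  obtain b where b: "b \<in> carrier R" "v = b \<odot>\<^bsub>E 0\<^esub> e" using V_0_cyclic[OF r v(1)] by blast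
  \<comment> \<open>The element b annihilates (J : z) modulo J, and (J : z) contains an a outside J
    with a x in J; so b cannot be a unit.\<close>
  have b_in_m: "b \<in> \<mm>"
  proof (rule ccontr)
    assume "b \<notin> \<mm>"
    then obtain u where u: "u \<in> carrier R" "b \<otimes> u = \<one>" using notin_Units b(1) by blast
    obtain a where a: "a \<in> carrier R" "a \<notin> J" "a \<otimes> x \<in> J" using zd by blast
    have "a \<in> q 1" using a xc by (simp add: qI)
    then have "a \<in> q n" using q_mono[of 1 n] n[OF q_mono[of n 1]] by (auto simp: add.commute)
    then have "(a \<otimes> b) \<odot>\<^bsub>E 0\<^esub> e = \<zero>\<^bsub>E 0\<^esub>" using v(3) b a(1) ec by (simp add: E0.smult_assoc1)
    then have "(a \<otimes> b) \<otimes> u \<in> J" using ann_e a(1) b(1) u(1) J.I_r_closed by simp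
    then show False using a b(1) u by (simp add: m_assoc)
  qed
  obtain u where u: "u \<in> carrier R" "(\<one> \<ominus> \<one> \<otimes> b) \<otimes> u = \<one>" using one_minus_Units[OF b_in_m one_closed] by blast
  have "z \<odot>\<^bsub>E 0\<^esub> e = (z \<otimes> b) \<odot>\<^bsub>E 0\<^esub> e" using v(2) b zc ec by (simp add: E0.smult_assoc1)
  then have "z \<ominus> z \<otimes> b \<in> J" using smult_e_eq_iff[OF zc] zc b(1) by simp
  then have "(z \<ominus> z \<otimes> b) \<otimes> u \<in> J" using J.I_r_closed u(1) by blast
  moreover have "(z \<ominus> z \<otimes> b) \<otimes> u = z \<otimes> ((\<one> \<ominus> \<one> \<otimes> b) \<otimes> u)" using zc b(1) u(1) by algebra
  ultimately have "z \<in> J" using u zc by simp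
  then show ?thesis by (auto simp: z_def)
qed

end

text \<open>Every step shortens the resolution by one. At positive depth J is enlarged by a power of
  a regular element inside Q; at depth zero J stays and the last term is dropped. At length 0 the
  current J is the required ideal.\<close>

lemma (in noetherian_local) self_injective_quotient_in_ideal:
  assumes res: "baer_resolution R \<mm> J (E :: nat \<Rightarrow> ('a, 'e) module) V d e r"
    and J: "J \<subseteq> Q" "\<one> \<notin> J"
    and Q: "ideal Q R" "\<And>x. x \<in> \<mm> \<Longrightarrow> \<exists>k::nat. x [^] k \<in> Q"
  shows "\<exists>K. ideal K R \<and> K \<subseteq> Q \<and> \<one> \<notin> K \<and> self_injective_quotient R K \<and> (\<forall>x\<in>\<mm>. \<exists>k::nat. x [^] k \<in> K)"
  using res J
proof (induction r arbitrary: J E V d e)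
  case 0
  interpret baer_resolution R \<mm> J E V d e 0 by fact
  show ?case
    using J 0(2,3) self_injective_quotient_if_length_0 nilpotent_if_length_0 by blast
next
  case (Suc q)
  interpret res: baer_resolution R \<mm> J E V d e "Suc q" by fact
  have J_m: "J \<subseteq> \<mm>" by (rule proper_ideal_subset[OF res.J Suc.prems(3)])
  show ?case
  proof (cases "\<exists>x\<in>\<mm>. \<forall>a\<in>carrier R. x \<otimes> a \<in> J \<longrightarrow> a \<in> J")
    case True
    then obtain x where x: "x \<in> \<mm>" "\<And>a. a \<in> carrier R \<Longrightarrow> x \<otimes> a \<in> J \<Longrightarrow> a \<in> J" by auto
    have xc: "x \<in> carrier R" using x m.Icarr by simp
    obtain k :: nat where k: "x [^] k \<in> Q" using Q(2) x(1) by blast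
    \<comment> \<open>The exponent \<open>Suc k\<close> places z in \<open>\<mm>\<close> as well as
      in Q even for k = 0, so that the enlarged ideal stays proper.\<close>
    define z where "z = x [^] Suc k"
    have zc: "z \<in> carrier R" using xc by (simp add: z_def)
    have zQ: "z \<in> Q" using ideal.I_r_closed[OF Q(1) k xc] by (simp add: z_def)
    have zm: "z \<in> \<mm>" using m.I_l_closed[OF x(1)] xc by (simp add: z_def)
    have pow_reg: "a \<in> J" if "a \<in> carrier R" "x [^] n \<otimes> a \<in> J" for a and n :: nat
      using that
    proof (induction n arbitrary: a)
      case (Suc n)
      have "x [^] n \<otimes> (x \<otimes> a) \<in> J" using Suc.prems xc by (simp add: m_assoc)
      then have "x \<otimes> a \<in> J" using Suc.IH[of "x \<otimes> a"] Suc.prems(1) xc by simp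
      then show ?case by (rule x(2)[OF Suc.prems(1)])
    qed simp
    obtain E' :: "nat \<Rightarrow> ('a, 'e) module" and V' d' e' where
      res': "baer_resolution R \<mm> (adjoin_elt R J z) E' V' d' e' q"
      using res.regular_quotient[OF refl zc] pow_reg[of _ "Suc k"] unfolding z_def by blast
    note adj = adjoin_elt[OF res.J zc]
    show ?thesis
    proof (rule Suc.IH[OF res'])
      show "adjoin_elt R J z \<subseteq> Q" by (rule adj(4)[OF Q(1) Suc.prems(2) zQ])
      have "adjoin_elt R J z \<subseteq> \<mm>" by (rule adj(4)[OF m.is_ideal J_m zm])
      then show "\<one> \<notin> adjoin_elt R J z" using one_notin by blast
    qed
  next
    case False
    then obtain s where s: "s \<in> carrier R" "s \<notin> J" "\<And>x. x \<in> \<mm> \<Longrightarrow> x \<otimes> s \<in> J"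
      using regular_element_or_socle[OF res.J Suc.prems(3)] by blast
    obtain V' where "baer_resolution R \<mm> J E V' d e q" using res.truncate[OF refl s] by blast
    then show ?thesis using Suc.IH Suc.prems(2,3) by blast
  qed
qed

text \<open>The test modules in the definition of injectivity live on lists; the ring and its ideals
  are found there as sets of singleton lists.\<close>

lemma injective_module_baer:
  assumes "cring R" and inj: "injective_module R (E :: ('a, 'a list) module)"
  shows "baer_module R {\<zero>\<^bsub>R\<^esub>} E (carrier E)"
  unfolding baer_module_def
proof (intro allI impI, elim conjE)
  interpret cring R by fact
  interpret E: module R E using inj by (simp add: injective_module_def)
  fix I f assume I: "ideal I R" and f: "f \<in> I \<rightarrow> carrier E"
    "\<forall>x\<in>I. \<forall>y\<in>I. f (x \<oplus>\<^bsub>R\<^esub> y) = f x \<oplus>\<^bsub>E\<^esub> f y" "\<forall>a\<in>carrier R. \<forall>x\<in>I. f (a \<otimes>\<^bsub>R\<^esub> x) = a \<odot>\<^bsub>E\<^esub> f x"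
  interpret I: ideal I R by fact
  define M :: "'a set \<Rightarrow> ('a, 'a list) module" where "M A = \<lparr>carrier = (\<lambda>a. [a]) ` A,
    monoid.mult = (\<lambda>u v. u), one = [], ring.zero = [\<zero>\<^bsub>R\<^esub>], add = (\<lambda>u v. [hd u \<oplus>\<^bsub>R\<^esub> hd v]),
    smult = (\<lambda>a u. [a \<otimes>\<^bsub>R\<^esub> hd u])\<rparr>" for A
  have M: "module R (M A)" if "ideal A R" for A
  proof -
    interpret A: ideal A R by fact
    show ?thesis
    proof (rule moduleI[OF assms(1)])
      show "abelian_group (M A)"
      proof (rule abelian_groupI)
        fix u assume "u \<in> carrier (M A)"
        then obtain a where "u = [a]" "a \<in> A" by (auto simp: M_def)
        then show "\<exists>v\<in>carrier (M A). v \<oplus>\<^bsub>M A\<^esub> u = \<zero>\<^bsub>M A\<^esub>"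
          using A.Icarr by (intro bexI[of _ "[\<ominus>\<^bsub>R\<^esub> a]"]) (auto simp: M_def l_neg)
      qed (use A.Icarr A.a_closed in \<open>auto simp: M_def a_ac\<close>)
    qed (use A.Icarr A.I_l_closed in \<open>auto simp: M_def l_distr r_distr m_assoc\<close>)
  qed
  have "\<exists>h\<in>mod_hom R (M (carrier R)) E. \<forall>x\<in>carrier (M I). h x = f (hd x)"
    using inj[unfolded injective_module_def, THEN conjunct2, rule_format, of "M (carrier R)" "M I" "\<lambda>x. x" "\<lambda>x. f (hd x)"]
      M[OF oneideal] M[OF I] f I.Icarr by (force simp: mod_hom_def M_def inj_on_def)
  then obtain h where h: "h \<in> mod_hom R (M (carrier R)) E" "\<And>x. x \<in> I \<Longrightarrow> h [x] = f x"
    by (auto simp: M_def)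
  have "f x = x \<odot>\<^bsub>E\<^esub> h [\<one>\<^bsub>R\<^esub>]" if "x \<in> I" for x
  proof -
    have "h (x \<odot>\<^bsub>M (carrier R)\<^esub> [\<one>\<^bsub>R\<^esub>]) = x \<odot>\<^bsub>E\<^esub> h [\<one>\<^bsub>R\<^esub>]"
    proof -
      have "\<forall>r\<in>carrier R. \<forall>u\<in>carrier (M (carrier R)). h (r \<odot>\<^bsub>M (carrier R)\<^esub> u) = r \<odot>\<^bsub>E\<^esub> h u"
        using h(1) by (simp add: mod_hom_def)
      moreover have "[\<one>\<^bsub>R\<^esub>] \<in> carrier (M (carrier R))" by (simp add: M_def)
      ultimately show ?thesis using I.Icarr[OF that] by blast
    qed
    moreover have "x \<odot>\<^bsub>M (carrier R)\<^esub> [\<one>\<^bsub>R\<^esub>] = [x]" using I.Icarr[OF that] by (simp add: M_def)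
    ultimately show ?thesis using h(2)[OF that] by simp
  qed
  moreover have "h [\<one>\<^bsub>R\<^esub>] \<in> carrier E" using h(1) by (auto simp: mod_hom_def M_def)
  ultimately show "\<exists>v\<in>carrier E. \<forall>x\<in>I. f x = x \<odot>\<^bsub>E\<^esub> v" by blast
qed

text \<open>The start of the induction on the length: J = 0, the V i are the full modules, and e is
  the image of 1 under the augmentation.\<close>

lemma gorenstein_local_ring_baer_resolution:
  fixes R :: "('a, 'x) ring_scheme" (structure)
  assumes "cring R" "gorenstein_local_ring R" "local_ring R \<mm>"
  shows "\<exists>(E :: nat \<Rightarrow> ('a, 'a list) module) V d e r. baer_resolution R \<mm> {\<zero>} E V d e r"
proof -
  interpret noetherian_local R \<mm>
    using assms by (intro noetherian_local.intro noetherian_local_axioms.intro) (auto simp: gorenstein_local_ring_def)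
  obtain E :: "nat \<Rightarrow> ('a, 'a list) module" and \<epsilon> d n where
    inj: "\<forall>i. injective_module R (E i)" and zero: "\<forall>i>n. carrier (E i) = {\<zero>\<^bsub>E i\<^esub>}" and
    \<epsilon>: "\<epsilon> \<in> mod_hom R (self_module R) (E 0)" and d: "\<forall>i. d i \<in> mod_hom R (E i) (E (Suc i))" and
    inj_\<epsilon>: "inj_on \<epsilon> (carrier (self_module R))" and
    ex0: "\<epsilon> ` carrier (self_module R) = a_kernel (E 0) (E 1) (d 0)" and
    exS: "\<forall>i. d i ` carrier (E i) = a_kernel (E (Suc i)) (E (Suc (Suc i))) (d (Suc i))"
    using assms(2) unfolding gorenstein_local_ring_def finite_injective_dim_def by (elim conjE exE) (rule that)
  have E: "module R (E i)" for i using inj by (simp add: injective_module_def)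
  interpret E0: module R "E 0" by (rule E)
  have \<epsilon>_smult: "\<epsilon> (a \<otimes> b) = a \<odot>\<^bsub>E 0\<^esub> \<epsilon> b" if "a \<in> carrier R" "b \<in> carrier R" for a b
    using \<epsilon> that by (auto simp: mod_hom_def self_module_def)
  have \<epsilon>1: "\<epsilon> \<one> \<in> carrier (E 0)" using \<epsilon> by (auto simp: mod_hom_def self_module_def)
  have \<epsilon>_eq: "\<epsilon> a = a \<odot>\<^bsub>E 0\<^esub> \<epsilon> \<one>" if "a \<in> carrier R" for a using \<epsilon>_smult[OF that one_closed] that by simp
  have "baer_resolution R \<mm> {\<zero>} E (\<lambda>i. carrier (E i)) d (\<epsilon> \<one>) n"
  proof (intro baer_resolution.intro baer_resolution_axioms.intro noetherian_local_axioms zeroideal E)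
    show "submodule (carrier (E i)) R (E i)" for i by (rule module.carrier_is_submodule[OF E])
    show "baer_module R {\<zero>} (E i) (carrier (E i))" for i
      using injective_module_baer is_cring inj by blast
    show "j \<odot>\<^bsub>E i\<^esub> v = \<zero>\<^bsub>E i\<^esub>" if "j \<in> {\<zero>}" "v \<in> carrier (E i)" for i j v
      using that module.smult_l_null[OF E] by simp
    show "d i v \<in> carrier (E (Suc i))" if "v \<in> carrier (E i)" for i v
      using d that by (auto simp: mod_hom_def)
    show "d i (u \<oplus>\<^bsub>E i\<^esub> v) = d i u \<oplus>\<^bsub>E (Suc i)\<^esub> d i v" if "u \<in> carrier (E i)" "v \<in> carrier (E i)" for i u v
      using d that by (simp add: mod_hom_def)
    show "d i (a \<odot>\<^bsub>E i\<^esub> v) = a \<odot>\<^bsub>E (Suc i)\<^esub> d i v" if "a \<in> carrier R" "v \<in> carrier (E i)" for i a v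
      using d that by (simp add: mod_hom_def)
    show "\<epsilon> \<one> \<in> carrier (E 0)" by (rule \<epsilon>1)
    show "a \<odot>\<^bsub>E 0\<^esub> \<epsilon> \<one> = \<zero>\<^bsub>E 0\<^esub> \<longleftrightarrow> a \<in> {\<zero>}" if a: "a \<in> carrier R" for a
    proof -
      have "\<epsilon> \<zero> = \<zero>\<^bsub>E 0\<^esub>" using \<epsilon>_eq[OF zero_closed] \<epsilon>1 by simp
      then show ?thesis using inj_onD[OF inj_\<epsilon>, of a \<zero>] a \<epsilon>_eq[OF a] \<epsilon>1 by (auto simp: self_module_def)
    qed
    show "d 0 v = \<zero>\<^bsub>E (Suc 0)\<^esub> \<longleftrightarrow> (\<exists>a\<in>carrier R. v = a \<odot>\<^bsub>E 0\<^esub> \<epsilon> \<one>)" if v: "v \<in> carrier (E 0)" for v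
    proof -
      have "d 0 v = \<zero>\<^bsub>E (Suc 0)\<^esub> \<longleftrightarrow> v \<in> \<epsilon> ` carrier R"
        using ex0 v by (simp add: self_module_def a_kernel_def')
      also have "\<epsilon> ` carrier R = (\<lambda>a. a \<odot>\<^bsub>E 0\<^esub> \<epsilon> \<one>) ` carrier R"
        by (rule image_cong[OF refl]) (rule \<epsilon>_eq)
      finally show ?thesis by blast
    qed
    show "d (Suc i) v = \<zero>\<^bsub>E (Suc (Suc i))\<^esub> \<longleftrightarrow> (\<exists>u\<in>carrier (E i). v = d i u)"
      if v: "v \<in> carrier (E (Suc i))" for i v
    proof -
      have "d (Suc i) v = \<zero>\<^bsub>E (Suc (Suc i))\<^esub> \<longleftrightarrow> v \<in> d i ` carrier (E i)"
        unfolding exS[rule_format] using v by (simp add: a_kernel_def')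
      then show ?thesis by blast
    qed
  qed (use zero in auto)
  then show ?thesis by blast
qed

section \<open>Congruences modulo an ideal and transport of self-injectivity\<close>

context ideal
begin

lemma diff_sym:
  assumes "a \<in> carrier R" "b \<in> carrier R" "a \<ominus> b \<in> I"
  shows "b \<ominus> a \<in> I"
proof -
  have "\<ominus> (a \<ominus> b) \<in> I" using assms(3) by simp
  moreover have "\<ominus> (a \<ominus> b) = b \<ominus> a" using assms by algebra
  ultimately show ?thesis by simp
qed

lemma diff_trans:
  assumes "a \<in> carrier R" "b \<in> carrier R" "c \<in> carrier R" "a \<ominus> b \<in> I" "b \<ominus> c \<in> I"
  shows "a \<ominus> c \<in> I"
proof -
  have "(a \<ominus> b) \<oplus> (b \<ominus> c) \<in> I" using assms by simp
  moreover have "(a \<ominus> b) \<oplus> (b \<ominus> c) = a \<ominus> c" using assms by algebra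
  ultimately show ?thesis by simp
qed

lemma diff_add:
  assumes "a \<in> carrier R" "b \<in> carrier R" "c \<in> carrier R" "e \<in> carrier R" "a \<ominus> b \<in> I" "c \<ominus> e \<in> I"
  shows "(a \<oplus> c) \<ominus> (b \<oplus> e) \<in> I"
proof -
  have "(a \<ominus> b) \<oplus> (c \<ominus> e) \<in> I" using assms by simp
  moreover have "(a \<ominus> b) \<oplus> (c \<ominus> e) = (a \<oplus> c) \<ominus> (b \<oplus> e)" using assms by algebra
  ultimately show ?thesis by simp
qed

lemma diff_mult:
  assumes "a \<in> carrier R" "b \<in> carrier R" "c \<in> carrier R" "e \<in> carrier R" "a \<ominus> b \<in> I" "c \<ominus> e \<in> I"
  shows "a \<otimes> c \<ominus> b \<otimes> e \<in> I"
proof -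
  have "(a \<ominus> b) \<otimes> c \<oplus> b \<otimes> (c \<ominus> e) \<in> I" using assms I_l_closed I_r_closed by simp
  moreover have "(a \<ominus> b) \<otimes> c \<oplus> b \<otimes> (c \<ominus> e) = a \<otimes> c \<ominus> b \<otimes> e" using assms by algebra
  ultimately show ?thesis by simp
qed

lemma diff_mem:
  assumes "a \<in> carrier R" "b \<in> I" "a \<ominus> b \<in> I"
  shows "a \<in> I"
proof -
  have "(a \<ominus> b) \<oplus> b \<in> I" using assms by simp
  moreover have "(a \<ominus> b) \<oplus> b = a" using assms(1) Icarr[OF assms(2)] by algebra
  ultimately show ?thesis by simp
qed

lemma diff_refl: "a \<in> carrier R \<Longrightarrow> a \<ominus> a \<in> I"
  by (simp add: minus_eq r_neg)

end

text \<open>The ring R modulo the preimage of K is isomorphic to C/K as soon as h is surjective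
  modulo K. The weak form of \<open>onto\<close> is essential for the composite of localization and
  quotient map, where denominators can be removed only up to K.\<close>

lemma self_injective_quotient_pullback:
  assumes "cring R" "cring C" and h: "h \<in> ring_hom R C" and K: "self_injective_quotient C K"
    and onto: "\<And>c. c \<in> carrier C \<Longrightarrow> \<exists>r\<in>carrier R. c \<ominus>\<^bsub>C\<^esub> h r \<in> K"
  shows "self_injective_quotient R {r \<in> carrier R. h r \<in> K}"
proof -
  interpret R: cring R by fact
  interpret C: cring C by fact
  interpret h: ring_hom_cring R C h by (intro ring_hom_cring.intro ring_hom_cring_axioms.intro) fact+
  have Kid: "ideal K C" using K by (simp add: self_injective_quotient_def)
  interpret K: ideal K C by (rule Kid)
  define J where "J = {r \<in> carrier R. h r \<in> K}"
  have hm: "h (a \<ominus>\<^bsub>R\<^esub> b) = h a \<ominus>\<^bsub>C\<^esub> h b" if "a \<in> carrier R" "b \<in> carrier R" for a b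
    using that by (simp add: R.minus_eq C.minus_eq)
  have J: "ideal J R"
  proof (rule R.idealI_cring)
    show "J \<subseteq> carrier R" "\<zero>\<^bsub>R\<^esub> \<in> J" by (auto simp: J_def)
    show "a \<oplus>\<^bsub>R\<^esub> b \<in> J" if "a \<in> J" "b \<in> J" for a b using that by (simp add: J_def)
    show "r \<otimes>\<^bsub>R\<^esub> a \<in> J" if "a \<in> J" "r \<in> carrier R" for a r
      using that K.I_l_closed[of "h a" "h r"] by (simp add: J_def)
  qed
  have J_iff: "r \<in> J \<longleftrightarrow> r \<in> carrier R \<and> h r \<in> K" for r by (simp add: J_def)
  interpret J: ideal J R by (rule J)
  have hJ: "h a \<ominus>\<^bsub>C\<^esub> h b \<in> K" if "a \<ominus>\<^bsub>R\<^esub> b \<in> J" "a \<in> carrier R" "b \<in> carrier R" for a b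
    using that hm by (simp add: J_iff)
  show ?thesis
    unfolding self_injective_quotient_def J_def[symmetric]
  proof (intro conjI J allI impI, elim conjE)
    fix I f assume I: "ideal I R" "J \<subseteq> I" and f: "f \<in> I \<rightarrow> carrier R"
      and add: "\<forall>x\<in>I. \<forall>y\<in>I. f (x \<oplus>\<^bsub>R\<^esub> y) \<ominus>\<^bsub>R\<^esub> (f x \<oplus>\<^bsub>R\<^esub> f y) \<in> J"
      and mult: "\<forall>r\<in>carrier R. \<forall>x\<in>I. f (r \<otimes>\<^bsub>R\<^esub> x) \<ominus>\<^bsub>R\<^esub> r \<otimes>\<^bsub>R\<^esub> f x \<in> J"
      and fJ: "\<forall>x\<in>J. f x \<in> J"
    interpret I: ideal I R by (rule I(1))
    have fc: "f x \<in> carrier R" if "x \<in> I" for x using f that by auto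
    have Ic: "x \<in> carrier R" if "x \<in> I" for x using I.Icarr[OF that] .
    \<comment> \<open>I' is h(I) + K, and g c is h (f i) for some i in I with h i congruent to c.
      Another choice of i changes f i by an element of J, because f maps J into J and is additive
      modulo J.\<close>
    define I' where "I' = {c \<in> carrier C. \<exists>i\<in>I. c \<ominus>\<^bsub>C\<^esub> h i \<in> K}"
    define g where "g c = h (f (SOME i. i \<in> I \<and> c \<ominus>\<^bsub>C\<^esub> h i \<in> K))" for c
    have g: "g c \<ominus>\<^bsub>C\<^esub> h (f i) \<in> K" "g c \<in> carrier C" if c: "c \<in> carrier C" and i: "i \<in> I" "c \<ominus>\<^bsub>C\<^esub> h i \<in> K" for c i
    proof -
      define j where "j = (SOME i. i \<in> I \<and> c \<ominus>\<^bsub>C\<^esub> h i \<in> K)"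
      have j: "j \<in> I" "c \<ominus>\<^bsub>C\<^esub> h j \<in> K"
        using someI[of "\<lambda>i. i \<in> I \<and> c \<ominus>\<^bsub>C\<^esub> h i \<in> K" i] i unfolding j_def by auto
      have gc: "g c = h (f j)" by (simp add: g_def j_def)
      then show "g c \<in> carrier C" using fc[OF j(1)] by simp
      have "h j \<ominus>\<^bsub>C\<^esub> h i \<in> K"
        using K.diff_trans[OF _ c _ K.diff_sym[OF c _ j(2)] i(2)] Ic i(1) j(1) by simp
      then have ji: "j \<ominus>\<^bsub>R\<^esub> i \<in> J" using hm Ic i(1) j(1) by (simp add: J_iff)
      then have ji_I: "j \<ominus>\<^bsub>R\<^esub> i \<in> I" using I(2) by blast
      have eq: "(j \<ominus>\<^bsub>R\<^esub> i) \<oplus>\<^bsub>R\<^esub> i = j" using Ic[OF i(1)] Ic[OF j(1)] by (simp add: R.minus_eq R.a_assoc R.l_neg)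
      have "f j \<ominus>\<^bsub>R\<^esub> (f (j \<ominus>\<^bsub>R\<^esub> i) \<oplus>\<^bsub>R\<^esub> f i) \<in> J" using add ji_I i(1) eq by metis
      moreover have "f (j \<ominus>\<^bsub>R\<^esub> i) \<in> J" using fJ ji by blast
      ultimately have "(f j \<ominus>\<^bsub>R\<^esub> (f (j \<ominus>\<^bsub>R\<^esub> i) \<oplus>\<^bsub>R\<^esub> f i)) \<oplus>\<^bsub>R\<^esub> f (j \<ominus>\<^bsub>R\<^esub> i) \<in> J" by simp
      moreover have "(f j \<ominus>\<^bsub>R\<^esub> (f (j \<ominus>\<^bsub>R\<^esub> i) \<oplus>\<^bsub>R\<^esub> f i)) \<oplus>\<^bsub>R\<^esub> f (j \<ominus>\<^bsub>R\<^esub> i) = f j \<ominus>\<^bsub>R\<^esub> f i"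
        using fc[OF j(1)] fc[OF i(1)] fc[OF ji_I] by (simp add: R.minus_eq R.minus_add R.a_ac R.r_neg R.r_neg1 R.r_neg2 R.add_cancel_left_minus)
      ultimately have "f j \<ominus>\<^bsub>R\<^esub> f i \<in> J" by simp
      then show "g c \<ominus>\<^bsub>C\<^esub> h (f i) \<in> K" using hJ fc i(1) j(1) gc by simp
    qed
    have I'I: "c \<in> I'" if "c \<in> carrier C" "i \<in> I" "c \<ominus>\<^bsub>C\<^esub> h i \<in> K" for c i
      using that unfolding I'_def by blast
    have hI: "h i \<in> carrier C" if "i \<in> I" for i using Ic[OF that] by simp
    have I': "ideal I' C"
    proof (rule C.idealI_cring)
      show "I' \<subseteq> carrier C" by (auto simp: I'_def)
      show "\<zero>\<^bsub>C\<^esub> \<in> I'"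
        by (rule I'I[OF C.zero_closed I.zero_closed]) (simp add: K.diff_refl)
      show "a \<oplus>\<^bsub>C\<^esub> b \<in> I'" if ab: "a \<in> I'" "b \<in> I'" for a b
      proof -
        obtain i j where i: "i \<in> I" "j \<in> I" "a \<ominus>\<^bsub>C\<^esub> h i \<in> K" "b \<ominus>\<^bsub>C\<^esub> h j \<in> K" "a \<in> carrier C" "b \<in> carrier C"
          using ab unfolding I'_def by blast
        have "(a \<oplus>\<^bsub>C\<^esub> b) \<ominus>\<^bsub>C\<^esub> h (i \<oplus>\<^bsub>R\<^esub> j) \<in> K"
          using K.diff_add[OF i(5) hI[OF i(1)] i(6) hI[OF i(2)] i(3,4)] Ic[OF i(1)] Ic[OF i(2)] by simp
        then show ?thesis by (rule I'I[OF C.a_closed[OF i(5,6)] I.a_closed[OF i(1,2)]])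
      qed
      show "s \<otimes>\<^bsub>C\<^esub> a \<in> I'" if a: "a \<in> I'" and s: "s \<in> carrier C" for a s
      proof -
        obtain i where i: "i \<in> I" "a \<ominus>\<^bsub>C\<^esub> h i \<in> K" "a \<in> carrier C" using a unfolding I'_def by blast
        obtain r where r: "r \<in> carrier R" "s \<ominus>\<^bsub>C\<^esub> h r \<in> K" using onto[OF s] by blast
        have "(s \<otimes>\<^bsub>C\<^esub> a) \<ominus>\<^bsub>C\<^esub> h (r \<otimes>\<^bsub>R\<^esub> i) \<in> K"
          using K.diff_mult[OF s _ i(3) hI[OF i(1)] r(2) i(2)] Ic[OF i(1)] r(1) by simp
        then show ?thesis by (rule I'I[OF C.m_closed[OF s i(3)] I.I_l_closed[OF i(1) r(1)]])
      qed
    qed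
    have "\<exists>y\<in>carrier C. \<forall>c\<in>I'. g c \<ominus>\<^bsub>C\<^esub> c \<otimes>\<^bsub>C\<^esub> y \<in> K"
    proof (rule self_injective_quotientD[OF K I'])
      show "K \<subseteq> I'"
      proof
        fix c assume c: "c \<in> K"
        then have "c \<ominus>\<^bsub>C\<^esub> h \<zero>\<^bsub>R\<^esub> \<in> K" using K.minus_closed_ideal[OF c K.zero_closed] by simp
        then show "c \<in> I'" by (rule I'I[OF K.Icarr[OF c] I.zero_closed])
      qed
      show "g c \<in> carrier C" if "c \<in> I'" for c using that g(2) unfolding I'_def by blast
      show "g c \<in> K" if c: "c \<in> K" for c
      proof -
        have "c \<ominus>\<^bsub>C\<^esub> h \<zero>\<^bsub>R\<^esub> \<in> K" using K.minus_closed_ideal[OF c K.zero_closed] by simp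
        note g0 = g[OF K.Icarr[OF c] I.zero_closed this]
        have "f \<zero>\<^bsub>R\<^esub> \<in> J" using fJ J.zero_closed by blast
        then have "h (f \<zero>\<^bsub>R\<^esub>) \<in> K" by (simp add: J_iff)
        then show ?thesis by (rule K.diff_mem[OF g0(2) _ g0(1)])
      qed
    next
      fix a b assume "a \<in> I'" "b \<in> I'"
      then obtain i j where i: "i \<in> I" "j \<in> I" "a \<ominus>\<^bsub>C\<^esub> h i \<in> K" "b \<ominus>\<^bsub>C\<^esub> h j \<in> K" "a \<in> carrier C" "b \<in> carrier C"
        unfolding I'_def by blast
      have ab: "(a \<oplus>\<^bsub>C\<^esub> b) \<ominus>\<^bsub>C\<^esub> h (i \<oplus>\<^bsub>R\<^esub> j) \<in> K"
        using K.diff_add[OF i(5) hI[OF i(1)] i(6) hI[OF i(2)] i(3,4)] Ic[OF i(1)] Ic[OF i(2)] by simp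
      note ga = g[OF i(5,1,3)] and gb = g[OF i(6,2,4)] and gab = g[OF C.a_closed[OF i(5,6)] I.a_closed[OF i(1,2)] ab]
      have "h (f (i \<oplus>\<^bsub>R\<^esub> j)) \<ominus>\<^bsub>C\<^esub> h (f i \<oplus>\<^bsub>R\<^esub> f j) \<in> K"
        by (rule hJ[OF add[rule_format, OF i(1,2)] fc[OF I.a_closed[OF i(1,2)]] R.a_closed[OF fc[OF i(1)] fc[OF i(2)]]])
      then have 1: "h (f (i \<oplus>\<^bsub>R\<^esub> j)) \<ominus>\<^bsub>C\<^esub> (h (f i) \<oplus>\<^bsub>C\<^esub> h (f j)) \<in> K" using fc i by simp
      have hc: "h (f i) \<in> carrier C" "h (f j) \<in> carrier C" "h (f (i \<oplus>\<^bsub>R\<^esub> j)) \<in> carrier C"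
        using fc[OF i(1)] fc[OF i(2)] fc[OF I.a_closed[OF i(1,2)]] by (blast intro: h.hom_closed)+
      have 2: "(g a \<oplus>\<^bsub>C\<^esub> g b) \<ominus>\<^bsub>C\<^esub> (h (f i) \<oplus>\<^bsub>C\<^esub> h (f j)) \<in> K"
        by (rule K.diff_add[OF ga(2) hc(1) gb(2) hc(2) ga(1) gb(1)])
      have "g (a \<oplus>\<^bsub>C\<^esub> b) \<ominus>\<^bsub>C\<^esub> (h (f i) \<oplus>\<^bsub>C\<^esub> h (f j)) \<in> K"
        by (rule K.diff_trans[OF gab(2) hc(3) C.a_closed[OF hc(1,2)] gab(1) 1])
      then show "g (a \<oplus>\<^bsub>C\<^esub> b) \<ominus>\<^bsub>C\<^esub> (g a \<oplus>\<^bsub>C\<^esub> g b) \<in> K"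
        using K.diff_trans[OF gab(2) C.a_closed[OF hc(1,2)] C.a_closed[OF ga(2) gb(2)]]
          K.diff_sym[OF C.a_closed[OF ga(2) gb(2)] C.a_closed[OF hc(1,2)] 2] by blast
    next
      fix s a assume s: "s \<in> carrier C" and "a \<in> I'"
      then obtain i where i: "i \<in> I" "a \<ominus>\<^bsub>C\<^esub> h i \<in> K" "a \<in> carrier C" unfolding I'_def by blast
      obtain r where r: "r \<in> carrier R" "s \<ominus>\<^bsub>C\<^esub> h r \<in> K" using onto[OF s] by blast
      have sa: "(s \<otimes>\<^bsub>C\<^esub> a) \<ominus>\<^bsub>C\<^esub> h (r \<otimes>\<^bsub>R\<^esub> i) \<in> K"
        using K.diff_mult[OF s _ i(3) hI[OF i(1)] r(2) i(2)] Ic[OF i(1)] r(1) by simp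
      have ri: "r \<otimes>\<^bsub>R\<^esub> i \<in> I" by (rule I.I_l_closed[OF i(1) r(1)])
      note ga = g[OF i(3,1,2)] and gsa = g[OF C.m_closed[OF s i(3)] ri sa]
      have "h (f (r \<otimes>\<^bsub>R\<^esub> i)) \<ominus>\<^bsub>C\<^esub> h (r \<otimes>\<^bsub>R\<^esub> f i) \<in> K"
        by (rule hJ[OF mult[rule_format, OF r(1) i(1)] fc[OF ri] R.m_closed[OF r(1) fc[OF i(1)]]])
      then have 1: "h (f (r \<otimes>\<^bsub>R\<^esub> i)) \<ominus>\<^bsub>C\<^esub> h r \<otimes>\<^bsub>C\<^esub> h (f i) \<in> K" using fc i r by simp
      have hc: "h r \<in> carrier C" "h (f i) \<in> carrier C" "h (f (r \<otimes>\<^bsub>R\<^esub> i)) \<in> carrier C"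
        using fc[OF i(1)] fc[OF ri] r(1) by (blast intro: h.hom_closed)+
      have 2: "s \<otimes>\<^bsub>C\<^esub> g a \<ominus>\<^bsub>C\<^esub> h r \<otimes>\<^bsub>C\<^esub> h (f i) \<in> K"
        by (rule K.diff_mult[OF s hc(1) ga(2) hc(2) r(2) ga(1)])
      have "g (s \<otimes>\<^bsub>C\<^esub> a) \<ominus>\<^bsub>C\<^esub> h r \<otimes>\<^bsub>C\<^esub> h (f i) \<in> K"
        by (rule K.diff_trans[OF gsa(2) hc(3) C.m_closed[OF hc(1,2)] gsa(1) 1])
      then show "g (s \<otimes>\<^bsub>C\<^esub> a) \<ominus>\<^bsub>C\<^esub> s \<otimes>\<^bsub>C\<^esub> g a \<in> K"
        using K.diff_trans[OF gsa(2) C.m_closed[OF hc(1,2)] C.m_closed[OF s ga(2)]]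
          K.diff_sym[OF C.m_closed[OF s ga(2)] C.m_closed[OF hc(1,2)] 2] by blast
    qed
    then obtain y' where y': "y' \<in> carrier C" "\<And>c. c \<in> I' \<Longrightarrow> g c \<ominus>\<^bsub>C\<^esub> c \<otimes>\<^bsub>C\<^esub> y' \<in> K" by blast
    obtain y where y: "y \<in> carrier R" "y' \<ominus>\<^bsub>C\<^esub> h y \<in> K" using onto[OF y'(1)] by blast
    have "f i \<ominus>\<^bsub>R\<^esub> i \<otimes>\<^bsub>R\<^esub> y \<in> J" if i: "i \<in> I" for i
    proof -
      have hi: "h i \<in> carrier C" "h i \<ominus>\<^bsub>C\<^esub> h i \<in> K" using Ic[OF i] K.diff_refl by auto
      note gi = g[OF hi(1) i hi(2)]
      have "h i \<in> I'" by (rule I'I[OF hi(1) i hi(2)])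
      then have 1: "g (h i) \<ominus>\<^bsub>C\<^esub> h i \<otimes>\<^bsub>C\<^esub> y' \<in> K" by (rule y'(2))
      have 2: "h i \<otimes>\<^bsub>C\<^esub> y' \<ominus>\<^bsub>C\<^esub> h i \<otimes>\<^bsub>C\<^esub> h y \<in> K"
        using K.diff_mult[OF hi(1) hi(1) y'(1) _ hi(2) y(2)] y(1) by simp
      have hf: "h (f i) \<in> carrier C" "h y \<in> carrier C" using fc[OF i] y(1) by auto
      have 3: "h (f i) \<ominus>\<^bsub>C\<^esub> g (h i) \<in> K" by (rule K.diff_sym[OF gi(2) hf(1) gi(1)])
      have "h (f i) \<ominus>\<^bsub>C\<^esub> h i \<otimes>\<^bsub>C\<^esub> h y \<in> K"
        using K.diff_trans[OF hf(1) gi(2) C.m_closed[OF hi(1) hf(2)] 3]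
          K.diff_trans[OF gi(2) C.m_closed[OF hi(1) y'(1)] C.m_closed[OF hi(1) hf(2)] 1 2] by blast
      then show ?thesis using hm fc[OF i] Ic[OF i] y(1) by (simp add: J_iff)
    qed
    then show "\<exists>y\<in>carrier R. \<forall>x\<in>I. f x \<ominus>\<^bsub>R\<^esub> x \<otimes>\<^bsub>R\<^esub> y \<in> J" using y(1) by blast
  qed
qed

section \<open>Powers of an ideal\<close>

lemma ideal_power_0: "ideal_power A I 0 = carrier A"
  by (simp add: ideal_power_def nat_pow_def ideals_set_def)

lemma ideal_power_Suc: "ideal_power A I (Suc n) = ideal_prod A (ideal_power A I n) I"
  by (simp add: ideal_power_def nat_pow_def ideals_set_def)

context cring
begin

lemma ideal_power_ideal: "ideal I R \<Longrightarrow> ideal (ideal_power R I n) R"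
  by (induction n) (simp_all add: ideal_power_0 ideal_power_Suc oneideal ideal_prod_is_ideal)

lemma ideal_power_Suc_subset: "ideal I R \<Longrightarrow> ideal_power R I (Suc n) \<subseteq> ideal_power R I n \<inter> I"
  unfolding ideal_power_Suc by (intro ideal_prod_inter ideal_power_ideal)

lemma ideal_power_subset: "ideal I R \<Longrightarrow> 0 < n \<Longrightarrow> ideal_power R I n \<subseteq> I"
  using ideal_power_Suc_subset by (cases n) auto

lemma ideal_power_antimono: "ideal I R \<Longrightarrow> m \<le> n \<Longrightarrow> ideal_power R I n \<subseteq> ideal_power R I m"
  by (rule lift_Suc_antimono_le[of "ideal_power R I"]) (use ideal_power_Suc_subset in auto)

lemma ideal_power_add:
  assumes "ideal I R"
  shows "ideal_power R I (m + n) = ideal_prod R (ideal_power R I m) (ideal_power R I n)"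
proof -
  interpret M: comm_monoid "ideals_set R" by (rule ideals_set_is_comm_monoid)
  have "I \<in> carrier (ideals_set R)" using assms by (simp add: ideals_set_def)
  from M.nat_pow_mult[OF this, of m n] show ?thesis by (simp add: ideal_power_def ideals_set_def)
qed

lemma pow_in_ideal_power: "ideal I R \<Longrightarrow> x \<in> I \<Longrightarrow> x [^] n \<in> ideal_power R I n"
  by (induction n) (auto simp: ideal_power_0 ideal_power_Suc ideal.Icarr intro: ideal_prod.prod)

end

text \<open>Noetherian induction on Q. If a b is in Q with a and b outside, then (Q + Ra)(Q + Rb) is
  contained in Q, and the exponents for the two factors add up. If there is no such pair, Q is prime
  or the whole ring, and the nil condition already puts \<open>\<mm>\<close> inside Q.\<close>

lemma (in noetherian_ring) ideal_power_subset_if_nil: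
  assumes "cring R" "ideal \<mm> R" and "ideal Q R" "\<And>x. x \<in> \<mm> \<Longrightarrow> \<exists>k::nat. x [^] k \<in> Q"
  shows "\<exists>n. ideal_power R \<mm> n \<subseteq> Q"
  using assms(3,4)
proof (induction rule: noetherian_induct)
  case (step Q)
  interpret cring R by fact
  interpret Q: ideal Q R by fact
  show ?case
  proof (cases "\<exists>a b. a \<in> carrier R \<and> b \<in> carrier R \<and> a \<otimes> b \<in> Q \<and> a \<notin> Q \<and> b \<notin> Q")
    case True
    then obtain a b where ab: "a \<in> carrier R" "b \<in> carrier R" "a \<otimes> b \<in> Q" "a \<notin> Q" "b \<notin> Q" by blast
    note adja = adjoin_elt[OF step(1) ab(1)] and adjb = adjoin_elt[OF step(1) ab(2)]
    have "\<exists>n. ideal_power R \<mm> n \<subseteq> adjoin_elt R Q a"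
    proof (rule step(2)[OF adja(1)])
      show "Q \<subset> adjoin_elt R Q a" using adja(2,3) ab(4) by blast
      show "\<exists>k::nat. x [^] k \<in> adjoin_elt R Q a" if "x \<in> \<mm>" for x using step.prems[OF that] adja(2) by blast
    qed
    then obtain m where m: "ideal_power R \<mm> m \<subseteq> adjoin_elt R Q a" by blast
    have "\<exists>n. ideal_power R \<mm> n \<subseteq> adjoin_elt R Q b"
    proof (rule step(2)[OF adjb(1)])
      show "Q \<subset> adjoin_elt R Q b" using adjb(2,3) ab(5) by blast
      show "\<exists>k::nat. x [^] k \<in> adjoin_elt R Q b" if "x \<in> \<mm>" for x using step.prems[OF that] adjb(2) by blast
    qed
    then obtain n where n: "ideal_power R \<mm> n \<subseteq> adjoin_elt R Q b" by blast
    have prod: "x \<otimes> y \<in> Q" if xy: "x \<in> adjoin_elt R Q a" "y \<in> adjoin_elt R Q b" for x y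
    proof -
      obtain i r where x: "i \<in> Q" "r \<in> carrier R" "x = i \<oplus> r \<otimes> a" using xy(1) unfolding adjoin_elt_def by blast
      obtain j s where y: "j \<in> Q" "s \<in> carrier R" "y = j \<oplus> s \<otimes> b" using xy(2) unfolding adjoin_elt_def by blast
      have "x \<otimes> y = i \<otimes> y \<oplus> ((r \<otimes> a) \<otimes> j \<oplus> (r \<otimes> s) \<otimes> (a \<otimes> b))"
        using x y Q.Icarr[OF x(1)] Q.Icarr[OF y(1)] ab(1,2) by algebra
      moreover have "y \<in> carrier R" using y Q.Icarr ab(2) by simp
      ultimately show ?thesis using x y ab Q.I_l_closed Q.I_r_closed by simp
    qed
    have "ideal_power R \<mm> (m + n) \<subseteq> Q"
    proof
      fix z assume "z \<in> ideal_power R \<mm> (m + n)"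
      then have "z \<in> ideal_prod R (ideal_power R \<mm> m) (ideal_power R \<mm> n)"
        by (simp add: ideal_power_add[OF assms(2)])
      then show "z \<in> Q" by induction (use m n prod Q.a_closed in auto)
    qed
    then show ?thesis by blast
  next
    case False
    have pow: "x \<in> Q" if "x \<in> \<mm>" "x [^] k \<in> Q" for x and k :: nat
      using that(2)
    proof (induction k)
      case 0
      then show ?case using Q.one_imp_carrier ideal.Icarr[OF assms(2) that(1)] by simp
    next
      case (Suc k)
      then show ?case using False ideal.Icarr[OF assms(2) that(1)] by (metis nat_pow_Suc nat_pow_closed)
    qed
    have "\<mm> \<subseteq> Q" using pow step.prems by blast
    then have "ideal_power R \<mm> 1 \<subseteq> Q" using ideal_power_subset[OF assms(2), of 1] by auto
    then show ?thesis by blast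
  qed
qed

section \<open>Localization of approximately Gorenstein domains\<close>

locale domain_localization = domain R for R (structure) +
  fixes S
  assumes S_carrier: "S \<subseteq> carrier R" and one_S: "\<one> \<in> S" and mult_S: "\<And>s t. s \<in> S \<Longrightarrow> t \<in> S \<Longrightarrow> s \<otimes> t \<in> S"
    and zero_S: "\<zero> \<notin> S"
begin

abbreviation frac where "frac \<equiv> fraction_class R S"

lemma S_closed: "s \<in> S \<Longrightarrow> s \<in> carrier R" "s \<in> S \<Longrightarrow> s \<noteq> \<zero>"
  using S_carrier zero_S by auto

text \<open>In a domain the factor u in the definition of a fraction class is nonzero and
  cancels.\<close>

lemma frac_mem_iff:
  assumes "a \<in> carrier R" "s \<in> S"
  shows "(b, t) \<in> frac a s \<longleftrightarrow> b \<in> carrier R \<and> t \<in> S \<and> a \<otimes> t = b \<otimes> s"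
proof -
  have "(\<exists>u\<in>S. u \<otimes> (a \<otimes> t \<ominus> b \<otimes> s) = \<zero>) \<longleftrightarrow> a \<otimes> t = b \<otimes> s" if bt: "b \<in> carrier R" "t \<in> S"
  proof
    assume "\<exists>u\<in>S. u \<otimes> (a \<otimes> t \<ominus> b \<otimes> s) = \<zero>"
    then obtain u where "u \<in> S" "u \<otimes> (a \<otimes> t \<ominus> b \<otimes> s) = \<zero>" by blast
    then have "a \<otimes> t \<ominus> b \<otimes> s = \<zero>"
      using integral_iff[of u "a \<otimes> t \<ominus> b \<otimes> s"] S_closed bt assms by simp
    then show "a \<otimes> t = b \<otimes> s" using S_closed bt assms minus_eq_zero_iff by simp
  next
    assume "a \<otimes> t = b \<otimes> s"
    then have "\<one> \<otimes> (a \<otimes> t \<ominus> b \<otimes> s) = \<zero>" using S_closed bt assms minus_eq_zero_iff by simp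
    then show "\<exists>u\<in>S. u \<otimes> (a \<otimes> t \<ominus> b \<otimes> s) = \<zero>" using one_S by blast
  qed
  then show ?thesis by (auto simp: fraction_class_def)
qed

lemma frac_eq_iff:
  assumes "a \<in> carrier R" "s \<in> S" "b \<in> carrier R" "t \<in> S"
  shows "frac a s = frac b t \<longleftrightarrow> a \<otimes> t = b \<otimes> s"
proof
  assume "frac a s = frac b t"
  moreover have "(a, s) \<in> frac a s" using frac_mem_iff assms by simp
  ultimately show "a \<otimes> t = b \<otimes> s" using frac_mem_iff[OF assms(3,4)] by simp
next
  have sub: "frac a s \<subseteq> frac b t"
    if "a \<in> carrier R" "s \<in> S" "b \<in> carrier R" "t \<in> S" and eq: "a \<otimes> t = b \<otimes> s" for a s b t
  proof
    fix p assume "p \<in> frac a s"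
    moreover obtain c w where p: "p = (c, w)" by (cases p)
    ultimately have cw: "c \<in> carrier R" "w \<in> S" "a \<otimes> w = c \<otimes> s" using frac_mem_iff that by auto
    note c = S_closed(1)[OF cw(2)] S_closed(1)[OF that(2)] S_closed(1)[OF that(4)]
    have "s \<otimes> (b \<otimes> w) = (b \<otimes> s) \<otimes> w" using c that(3) by algebra
    also have "\<dots> = (a \<otimes> w) \<otimes> t" unfolding eq[symmetric] using c that(1) by algebra
    also have "\<dots> = s \<otimes> (c \<otimes> t)" unfolding cw(3) using c cw(1) by algebra
    finally have "b \<otimes> w = c \<otimes> t"
      using m_lcancel[OF S_closed(2)[OF that(2)] c(2) m_closed[OF that(3) c(1)] m_closed[OF cw(1) c(3)]] by blast
    then show "p \<in> frac b t" using frac_mem_iff that cw p by simp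
  qed
  assume "a \<otimes> t = b \<otimes> s"
  then show "frac a s = frac b t" using sub[of a s b t] sub[of b t a s] assms by auto
qed

lemma frac_self: "a \<in> carrier R \<Longrightarrow> s \<in> S \<Longrightarrow> (a, s) \<in> frac a s"
  by (simp add: frac_mem_iff)

lemma UN_frac_const:
  assumes "a \<in> carrier R" "s \<in> S" "\<And>a' s'. a' \<in> carrier R \<Longrightarrow> s' \<in> S \<Longrightarrow> a \<otimes> s' = a' \<otimes> s \<Longrightarrow> g a' s' = c"
  shows "(\<Union>(a', s')\<in>frac a s. g a' s') = c"
  by (rule UN_constant_eq[OF frac_self[OF assms(1,2)]]) (use frac_mem_iff assms in auto)

lemma add_frac:
  assumes a: "a \<in> carrier R" "s \<in> S" and b: "b \<in> carrier R" "t \<in> S"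
  shows "frac a s \<oplus>\<^bsub>localization R S\<^esub> frac b t = frac (a \<otimes> t \<oplus> b \<otimes> s) (s \<otimes> t)"
proof -
  have "(\<Union>(b', t')\<in>frac b t. frac (a' \<otimes> t' \<oplus> b' \<otimes> s') (s' \<otimes> t')) = frac (a \<otimes> t \<oplus> b \<otimes> s) (s \<otimes> t)"
    if a': "a' \<in> carrier R" "s' \<in> S" "a \<otimes> s' = a' \<otimes> s" for a' s'
  proof (rule UN_frac_const[OF b])
    fix b' t' assume b': "b' \<in> carrier R" "t' \<in> S" "b \<otimes> t' = b' \<otimes> t"
    note c = S_closed(1)[OF a(2)] S_closed(1)[OF a'(2)] S_closed(1)[OF b(2)] S_closed(1)[OF b'(2)]
    have "(a' \<otimes> t' \<oplus> b' \<otimes> s') \<otimes> (s \<otimes> t) = (a' \<otimes> s) \<otimes> (t' \<otimes> t) \<oplus> (b' \<otimes> t) \<otimes> (s' \<otimes> s)"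
      using c a(1) a'(1) b(1) b'(1) by algebra
    also have "\<dots> = (a \<otimes> s') \<otimes> (t' \<otimes> t) \<oplus> (b \<otimes> t') \<otimes> (s' \<otimes> s)" using a'(3) b'(3) by simp
    also have "\<dots> = (a \<otimes> t \<oplus> b \<otimes> s) \<otimes> (s' \<otimes> t')"
      using c a(1) a'(1) b(1) b'(1) by algebra
    finally show "frac (a' \<otimes> t' \<oplus> b' \<otimes> s') (s' \<otimes> t') = frac (a \<otimes> t \<oplus> b \<otimes> s) (s \<otimes> t)"
      using frac_eq_iff c a a' b b' mult_S by simp
  qed
  then show ?thesis unfolding localization_def by (simp add: UN_frac_const[OF a])
qed

lemma mult_frac:
  assumes a: "a \<in> carrier R" "s \<in> S" and b: "b \<in> carrier R" "t \<in> S"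
  shows "frac a s \<otimes>\<^bsub>localization R S\<^esub> frac b t = frac (a \<otimes> b) (s \<otimes> t)"
proof -
  have "(\<Union>(b', t')\<in>frac b t. frac (a' \<otimes> b') (s' \<otimes> t')) = frac (a \<otimes> b) (s \<otimes> t)"
    if a': "a' \<in> carrier R" "s' \<in> S" "a \<otimes> s' = a' \<otimes> s" for a' s'
  proof (rule UN_frac_const[OF b])
    fix b' t' assume b': "b' \<in> carrier R" "t' \<in> S" "b \<otimes> t' = b' \<otimes> t"
    note c = S_closed(1)[OF a(2)] S_closed(1)[OF a'(2)] S_closed(1)[OF b(2)] S_closed(1)[OF b'(2)]
    have "(a' \<otimes> b') \<otimes> (s \<otimes> t) = (a' \<otimes> s) \<otimes> (b' \<otimes> t)" using c a(1) a'(1) b(1) b'(1) by algebra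
    also have "\<dots> = (a \<otimes> s') \<otimes> (b \<otimes> t')" using a'(3) b'(3) by simp
    also have "\<dots> = (a \<otimes> b) \<otimes> (s' \<otimes> t')" using c a(1) a'(1) b(1) b'(1) by algebra
    finally show "frac (a' \<otimes> b') (s' \<otimes> t') = frac (a \<otimes> b) (s \<otimes> t)"
      using frac_eq_iff c a a' b b' mult_S by simp
  qed
  then show ?thesis unfolding localization_def by (simp add: UN_frac_const[OF a])
qed

lemma carrier_localization: "carrier (localization R S) = {frac a s | a s. a \<in> carrier R \<and> s \<in> S}"
  by (simp add: localization_def)

lemma frac_closed: "a \<in> carrier R \<Longrightarrow> s \<in> S \<Longrightarrow> frac a s \<in> carrier (localization R S)"
  unfolding carrier_localization by blast

lemma one_localization: "\<one>\<^bsub>localization R S\<^esub> = frac \<one> \<one>"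
  by (simp add: localization_def)

lemma frac_ring_hom: "(\<lambda>r. frac r \<one>) \<in> ring_hom R (localization R S)"
  by (rule ring_hom_memI) (simp_all add: frac_closed add_frac mult_frac one_S one_localization)

end

text \<open>The witness is the geometric series 1 + y + ... + y^(n-1). It shows that 1 - y is a unit
  modulo every ideal containing a power of y.\<close>

lemma (in cring) geometric_multiple:
  assumes "y \<in> carrier R"
  shows "\<exists>g\<in>carrier R. (\<one> \<ominus> y) \<otimes> g = \<one> \<ominus> y [^] (n::nat)"
proof (induction n)
  case 0
  then show ?case using assms by (intro bexI[of _ \<zero>]) (simp_all add: minus_eq r_neg)
next
  case (Suc n)
  then obtain g where g: "g \<in> carrier R" "(\<one> \<ominus> y) \<otimes> g = \<one> \<ominus> y [^] n" by blast
  have yn: "y [^] n \<in> carrier R" using assms by simp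
  have "(\<one> \<ominus> y) \<otimes> (g \<oplus> y [^] n) = (\<one> \<ominus> y) \<otimes> g \<oplus> (\<one> \<ominus> y) \<otimes> y [^] n"
    using assms g(1) yn by algebra
  also have "\<dots> = (\<one> \<ominus> y [^] n) \<oplus> (\<one> \<ominus> y) \<otimes> y [^] n" by (simp add: g(2))
  also have "\<dots> = \<one> \<ominus> y [^] n \<otimes> y" using assms yn by algebra
  finally show ?case using g(1) yn by (intro bexI[of _ "g \<oplus> y [^] n"]) simp_all
qed

text \<open>Modulo \<open>\<mm>\<close> the element s is a unit, and y is the error. When a power of
  y lies in K, the geometric series improves this to a unit modulo K; in this way denominators are
  removed without leaving R.\<close>

lemma (in cring) maximalideal_inverse:
  assumes "maximalideal \<mm> R" "s \<in> carrier R" "s \<notin> \<mm>"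
  obtains u y where "u \<in> carrier R" "y \<in> \<mm>" "s \<otimes> u = \<one> \<ominus> y"
proof -
  interpret m: maximalideal \<mm> R by fact
  note adj = adjoin_elt[OF m.is_ideal assms(2)]
  have "adjoin_elt R \<mm> s = carrier R"
    using m.I_maximal[OF adj(1,2)] adj(3) assms(3) ideal.Icarr[OF adj(1)] by blast
  then have "\<one> \<in> adjoin_elt R \<mm> s" by simp
  then obtain y u where yu: "y \<in> \<mm>" "u \<in> carrier R" "\<one> = y \<oplus> u \<otimes> s" unfolding adjoin_elt_def by blast
  have yc: "y \<in> carrier R" using m.Icarr yu(1) .
  have "\<one> \<ominus> y = (y \<oplus> u \<otimes> s) \<ominus> y" using yu(3) by simp
  also have "\<dots> = s \<otimes> u" using yc yu(2) assms(2) by algebra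
  finally show ?thesis using that yu(1,2) by simp
qed

text \<open>Along R -> A -> C, with A the localization at \<open>\<mm>\<close> and C = A/I
  Gorenstein, a self-injective ideal of C is found inside the image of a power of the maximal ideal
  of A and pulled back to R. The later arguments draw on approximate Gorensteinness through this
  statement alone.\<close>

lemma approx_gorenstein_self_injective_quotient:
  fixes R :: "('a, 'x) ring_scheme" (structure)
  assumes "noetherian_domain R" "approx_gorenstein R" "maximalideal \<mm> R" "ideal Q R"
    and nil: "\<And>x. x \<in> \<mm> \<Longrightarrow> \<exists>k::nat. x [^] k \<in> Q"
  shows "\<exists>K. ideal K R \<and> K \<subseteq> Q \<and> \<one> \<notin> K \<and> self_injective_quotient R K \<and> (\<forall>x\<in>\<mm>. \<exists>k::nat. x [^] k \<in> K)"
proof -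
  interpret noetherian_domain R by fact
  interpret m: maximalideal \<mm> R by fact
  interpret Q: ideal Q R by fact
  interpret mp: primeideal \<mm> R by (rule maximalideal_prime[OF assms(3)])
  have one_m: "\<one> \<notin> \<mm>" using m.one_imp_carrier m.I_notcarr by blast
  interpret domain_localization R "carrier R - \<mm>"
    by unfold_locales (use one_m mp.I_prime m.zero_closed in auto)
  define S where "S = carrier R - \<mm>"
  have S: "s \<in> S \<longleftrightarrow> s \<in> carrier R \<and> s \<notin> \<mm>" for s by (simp add: S_def)
  define A where "A = localization R S"
  have A_approx: "approx_gorenstein_local A"
    using assms(2,3) by (simp add: approx_gorenstein_def A_def S_def)
  then obtain \<nn> where \<nn>: "local_ring A \<nn>"
    and approx: "\<And>n. n > 0 \<Longrightarrow> \<exists>I. ideal I A \<and> I \<subseteq> ideal_power A \<nn> n \<and> gorenstein_local_ring (A Quot I)"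
    unfolding approx_gorenstein_local_def by blast
  interpret A: cring A using \<nn> by (simp add: local_ring_def)
  interpret AN: noetherian_local A \<nn>
    using A_approx \<nn> A.cring_axioms
    by (intro noetherian_local.intro noetherian_local_axioms.intro) (simp_all add: approx_gorenstein_local_def)
  have nid: "ideal \<nn> A" by (rule AN.m.is_ideal)
  have fc: "fraction_class R S a s \<in> carrier A" if "a \<in> carrier R" "s \<in> S" for a s
    using frac_closed that by (simp add: A_def S_def)
  have carrier_A: "\<exists>a s. x = fraction_class R S a s \<and> a \<in> carrier R \<and> s \<in> S" if "x \<in> carrier A" for x
    using that by (auto simp: A_def S_def carrier_localization)
  have fadd: "fraction_class R S a s \<oplus>\<^bsub>A\<^esub> fraction_class R S b t = fraction_class R S (a \<otimes> t \<oplus> b \<otimes> s) (s \<otimes> t)"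
    and fmult: "fraction_class R S a s \<otimes>\<^bsub>A\<^esub> fraction_class R S b t = fraction_class R S (a \<otimes> b) (s \<otimes> t)"
    and feq: "fraction_class R S a s = fraction_class R S b t \<longleftrightarrow> a \<otimes> t = b \<otimes> s"
    if "a \<in> carrier R" "s \<in> S" "b \<in> carrier R" "t \<in> S" for a s b t
    using add_frac mult_frac frac_eq_iff that by (simp_all add: A_def S_def)
  have fone: "\<one>\<^bsub>A\<^esub> = fraction_class R S \<one> \<one>" using one_localization by (simp add: A_def S_def)
  have S_mult: "s \<otimes> t \<in> S" if "s \<in> S" "t \<in> S" for s t
    using mult_S that by (auto simp: S_def)
  have S1: "\<one> \<in> S" using one_S by (simp add: S_def)
  define h0 where "h0 = (\<lambda>r. fraction_class R S r \<one>)"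
  have h0: "h0 \<in> ring_hom R A" using frac_ring_hom by (simp add: h0_def A_def S_def)
  interpret h0: ring_hom_cring R A h0 by (intro ring_hom_cring.intro ring_hom_cring_axioms.intro is_cring A.is_cring h0)
  have frac_unit: "\<exists>a\<in>\<mm>. \<exists>s\<in>S. x = fraction_class R S a s" if x: "x \<in> \<nn>" for x
  proof -
    obtain a s where as: "x = fraction_class R S a s" "a \<in> carrier R" "s \<in> S"
      using carrier_A AN.m.Icarr[OF x] by blast
    have "a \<in> \<mm>"
    proof (rule ccontr)
      assume "a \<notin> \<mm>"
      then have aS: "a \<in> S" using as by (simp add: S)
      have sc: "s \<in> carrier R" using as(3) by (simp add: S)
      have "x \<otimes>\<^bsub>A\<^esub> fraction_class R S s a = \<one>\<^bsub>A\<^esub>"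
        unfolding fone as(1) fmult[OF as(2,3) sc aS] 
        using feq[OF m_closed[OF as(2) sc] _ one_closed S1, of "s \<otimes> a"] S_mult[OF as(3) aS] as(2) sc
        by (simp add: m_comm)
      moreover have "x \<otimes>\<^bsub>A\<^esub> fraction_class R S s a \<in> \<nn>" by (rule AN.m.I_r_closed[OF x fc[OF sc aS]])
      ultimately show False using AN.one_notin by simp
    qed
    then show ?thesis using as by blast
  qed
  have h0_m: "h0 x \<in> \<nn>" if x: "x \<in> \<mm>" for x
  proof (rule ccontr)
    assume "h0 x \<notin> \<nn>"
    have xc: "x \<in> carrier R" using m.Icarr[OF x] .
    then obtain z where z: "z \<in> carrier A" "h0 x \<otimes>\<^bsub>A\<^esub> z = \<one>\<^bsub>A\<^esub>" using AN.notin_Units \<open>h0 x \<notin> \<nn>\<close> h0.hom_closed by blast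
    obtain a s where as: "z = fraction_class R S a s" "a \<in> carrier R" "s \<in> S" using carrier_A z(1) by blast
    have sc: "s \<in> carrier R" "s \<notin> \<mm>" using as(3) by (simp_all add: S)
    have "fraction_class R S (x \<otimes> a) (\<one> \<otimes> s) = fraction_class R S \<one> \<one>"
      using z(2) fmult[OF xc S1 as(2,3)] unfolding h0_def as(1) fone by simp
    then have "x \<otimes> a = s" using feq[of "x \<otimes> a" "\<one> \<otimes> s" \<one> \<one>] xc as(2,3) sc S1 by simp
    then show False using m.I_r_closed[OF x as(2)] sc(2) by simp
  qed
  have power_frac: "\<exists>b\<in>ideal_power R \<mm> n. \<exists>s\<in>S. x = fraction_class R S b s" if "x \<in> ideal_power A \<nn> n" for x n
    using that
  proof (induction n arbitrary: x)
    case 0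
    then show ?case using carrier_A[of x] unfolding ideal_power_0 by blast
  next
    case (Suc n)
    interpret P: ideal "ideal_power R \<mm> (Suc n)" R by (rule ideal_power_ideal[OF m.is_ideal])
    have Pn: "b \<in> carrier R" if "b \<in> ideal_power R \<mm> n" for b
      using ideal.Icarr[OF ideal_power_ideal[OF m.is_ideal] that] .
    from Suc.prems have "x \<in> ideal_prod A (ideal_power A \<nn> n) \<nn>" by (simp add: ideal_power_Suc)
    then show ?case
    proof induction
      case (prod i j)
      obtain b s where b: "b \<in> ideal_power R \<mm> n" "s \<in> S" "i = fraction_class R S b s" using Suc.IH[OF prod(1)] by blast
      obtain a t where a: "a \<in> \<mm>" "t \<in> S" "j = fraction_class R S a t" using frac_unit[OF prod(2)] by blast
      have "b \<otimes> a \<in> ideal_power R \<mm> (Suc n)" unfolding ideal_power_Suc by (rule ideal_prod.prod[OF b(1) a(1)])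
      moreover have "i \<otimes>\<^bsub>A\<^esub> j = fraction_class R S (b \<otimes> a) (s \<otimes> t)"
        unfolding b(3) a(3) by (rule fmult[OF Pn[OF b(1)] b(2) m.Icarr[OF a(1)] a(2)])
      ultimately show ?case using S_mult[OF b(2) a(2)] by blast
    next
      case (sum x1 x2)
      obtain b s where b: "b \<in> ideal_power R \<mm> (Suc n)" "s \<in> S" "x1 = fraction_class R S b s" using sum(3) by blast
      obtain a t where a: "a \<in> ideal_power R \<mm> (Suc n)" "t \<in> S" "x2 = fraction_class R S a t" using sum(4) by blast
      have "s \<in> carrier R" "t \<in> carrier R" using a b by (auto simp: S)
      then have "b \<otimes> t \<oplus> a \<otimes> s \<in> ideal_power R \<mm> (Suc n)" using P.I_r_closed a(1) b(1) P.a_closed by blast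
      moreover have "x1 \<oplus>\<^bsub>A\<^esub> x2 = fraction_class R S (b \<otimes> t \<oplus> a \<otimes> s) (s \<otimes> t)"
        unfolding b(3) a(3) by (rule fadd[OF P.Icarr[OF b(1)] b(2) P.Icarr[OF a(1)] a(2)])
      ultimately show ?case using S_mult[OF b(2) a(2)] by blast
    qed
  qed
  obtain n0 where n0: "ideal_power R \<mm> n0 \<subseteq> Q" using ideal_power_subset_if_nil[OF is_cring m.is_ideal assms(4) nil] by blast
  \<comment> \<open>Approximate Gorensteinness speaks of positive exponents; enlarging the exponent
    keeps the power inside Q.\<close>
  define n where "n = Suc n0"
  have mn: "ideal_power R \<mm> n \<subseteq> Q" using n0 ideal_power_Suc_subset[OF m.is_ideal, of n0] by (auto simp: n_def)
  have n_pos: "n > 0" by (simp add: n_def)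
  obtain I where I: "ideal I A" "I \<subseteq> ideal_power A \<nn> n" "gorenstein_local_ring (A Quot I)" using approx[OF n_pos] by blast
  have n_sub: "ideal_power A \<nn> n \<subseteq> \<nn>" by (rule A.ideal_power_subset[OF nid n_pos])
  define C where "C = A Quot I"
  have cringC: "cring C" unfolding C_def by (rule ideal.quotient_is_cring[OF I(1) A.is_cring])
  obtain \<mm>' where \<mm>': "local_ring C \<mm>'" using I(3) by (auto simp: gorenstein_local_ring_def C_def)
  obtain E :: "nat \<Rightarrow> (('a \<times> 'a) set set, ('a \<times> 'a) set set list) module" and V d e r where
    res: "baer_resolution C \<mm>' {\<zero>\<^bsub>C\<^esub>} E V d e r"
    using gorenstein_local_ring_baer_resolution[OF cringC _ \<mm>'] I(3) unfolding C_def by blast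
  interpret C: noetherian_local C \<mm>' using res by (rule baer_resolution.axioms)
  define p where "p = (\<lambda>a. I +>\<^bsub>A\<^esub> a)"
  have p: "p \<in> ring_hom A C" unfolding p_def C_def by (rule ideal.rcos_ring_hom[OF I(1)])
  interpret p: ring_hom_cring A C p by (intro ring_hom_cring.intro ring_hom_cring_axioms.intro A.is_cring C.is_cring p)
  have p_eq: "a \<ominus>\<^bsub>A\<^esub> b \<in> I" if "a \<in> carrier A" "b \<in> carrier A" "p a = p b" for a b
    using A.quotient_eq_iff_same_a_r_cos[OF I(1) that(1,2)] that(3) by (simp add: p_def)
  have p_surj: "\<exists>a\<in>carrier A. c = p a" if "c \<in> carrier C" for c
    using that by (auto simp: C_def FactRing_def A_RCOSETS_def' p_def)
  have I_n: "I \<subseteq> \<nn>" using I(2) n_sub by blast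
  have p_n: "p x \<in> \<mm>'" if x: "x \<in> \<nn>" for x
  proof (rule ccontr)
    have xc: "x \<in> carrier A" using AN.m.Icarr[OF x] .
    assume "p x \<notin> \<mm>'"
    then obtain c where c: "c \<in> carrier C" "p x \<otimes>\<^bsub>C\<^esub> c = \<one>\<^bsub>C\<^esub>" using C.notin_Units p.hom_closed[OF xc] by blast
    obtain z where z: "z \<in> carrier A" "c = p z" using p_surj[OF c(1)] by blast
    have "p \<one>\<^bsub>A\<^esub> = p (x \<otimes>\<^bsub>A\<^esub> z)" using c(2) z xc by simp
    then have "\<one>\<^bsub>A\<^esub> \<ominus>\<^bsub>A\<^esub> x \<otimes>\<^bsub>A\<^esub> z \<in> \<nn>" using p_eq[of "\<one>\<^bsub>A\<^esub>" "x \<otimes>\<^bsub>A\<^esub> z"] xc z(1) I_n by auto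
    then show False
      using ideal.diff_mem[OF nid A.one_closed AN.m.I_r_closed[OF x z(1)]] AN.one_notin by blast
  qed
  have n_p: "a \<in> \<nn>" if a: "a \<in> carrier A" "p a \<in> \<mm>'" for a
  proof (rule ccontr)
    assume "a \<notin> \<nn>"
    then obtain z where z: "z \<in> carrier A" "a \<otimes>\<^bsub>A\<^esub> z = \<one>\<^bsub>A\<^esub>" using AN.notin_Units a(1) by blast
    have "p a \<otimes>\<^bsub>C\<^esub> p z = \<one>\<^bsub>C\<^esub>" using z a(1) p.hom_mult[OF a(1) z(1)] by simp
    then show False using C.m.I_r_closed[OF a(2) p.hom_closed[OF z(1)]] C.one_notin by simp
  qed
  \<comment> \<open>The image in C of the n-th power of \<open>\<nn>\<close>. Since I lies in that
    power, membership of p a in \<open>QC\<close> gives membership of a in the power itself.\<close>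
  define QC where "QC = p ` ideal_power A \<nn> n"
  have P: "ideal (ideal_power A \<nn> n) A" by (rule A.ideal_power_ideal[OF nid])
  have Pc: "a \<in> carrier A" if "a \<in> ideal_power A \<nn> n" for a using ideal.Icarr[OF P that] .
  have QC: "ideal QC C"
  proof (rule C.idealI_cring)
    show "QC \<subseteq> carrier C" using Pc by (auto simp: QC_def)
    have "\<zero>\<^bsub>C\<^esub> = p \<zero>\<^bsub>A\<^esub>" by simp
    then show "\<zero>\<^bsub>C\<^esub> \<in> QC"
      using additive_subgroup.zero_closed[OF ideal.axioms(1)[OF P]] unfolding QC_def by blast
    show "a \<oplus>\<^bsub>C\<^esub> b \<in> QC" if ab: "a \<in> QC" "b \<in> QC" for a b
    proof -
      obtain a' b' where *: "a' \<in> ideal_power A \<nn> n" "a = p a'" "b' \<in> ideal_power A \<nn> n" "b = p b'" using ab unfolding QC_def by blast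
      then have "a \<oplus>\<^bsub>C\<^esub> b = p (a' \<oplus>\<^bsub>A\<^esub> b')" using Pc by simp
      then show ?thesis unfolding QC_def using additive_subgroup.a_closed[OF ideal.axioms(1)[OF P] *(1,3)] by blast
    qed
    show "s \<otimes>\<^bsub>C\<^esub> a \<in> QC" if as: "a \<in> QC" "s \<in> carrier C" for a s
    proof -
      obtain a' where *: "a' \<in> ideal_power A \<nn> n" "a = p a'" using as unfolding QC_def by blast
      obtain s' where s: "s' \<in> carrier A" "s = p s'" using p_surj[OF as(2)] by blast
      have "s \<otimes>\<^bsub>C\<^esub> a = p (s' \<otimes>\<^bsub>A\<^esub> a')" using * s Pc by simp
      then show ?thesis unfolding QC_def using ideal.I_l_closed[OF P *(1) s(1)] by blast
    qed
  qed
  have pow_p: "p (a [^]\<^bsub>A\<^esub> k) = p a [^]\<^bsub>C\<^esub> k" if "a \<in> carrier A" for a and k :: nat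
    by (induction k) (simp_all add: that)
  have pow_h0: "h0 (a [^] k) = h0 a [^]\<^bsub>A\<^esub> k" if "a \<in> carrier R" for a and k :: nat
    by (induction k) (simp_all add: that)
  have "\<exists>K. ideal K C \<and> K \<subseteq> QC \<and> \<one>\<^bsub>C\<^esub> \<notin> K \<and> self_injective_quotient C K \<and> (\<forall>x\<in>\<mm>'. \<exists>k::nat. x [^]\<^bsub>C\<^esub> k \<in> K)"
  proof (rule C.self_injective_quotient_in_ideal[OF res])
    show "{\<zero>\<^bsub>C\<^esub>} \<subseteq> QC" using additive_subgroup.zero_closed[OF ideal.axioms(1)[OF QC]] by blast
    have "\<zero>\<^bsub>C\<^esub> \<in> \<mm>'" by (rule C.m.zero_closed)
    then show "\<one>\<^bsub>C\<^esub> \<notin> {\<zero>\<^bsub>C\<^esub>}" using C.one_notin by auto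
    show "ideal QC C" by (rule QC)
    show "\<exists>k::nat. x [^]\<^bsub>C\<^esub> k \<in> QC" if x: "x \<in> \<mm>'" for x
    proof -
      obtain a where a: "a \<in> carrier A" "x = p a" using p_surj[OF C.m.Icarr[OF x]] by blast
      have "a [^]\<^bsub>A\<^esub> n \<in> ideal_power A \<nn> n" by (rule A.pow_in_ideal_power[OF nid]) (use n_p a x in simp)
      then have "x [^]\<^bsub>C\<^esub> n \<in> QC" unfolding QC_def a(2) pow_p[OF a(1), symmetric] by blast
      then show ?thesis by blast
    qed
  qed
  then obtain K where K: "ideal K C" "K \<subseteq> QC" "\<one>\<^bsub>C\<^esub> \<notin> K" "self_injective_quotient C K"
    "\<And>x. x \<in> \<mm>' \<Longrightarrow> \<exists>k::nat. x [^]\<^bsub>C\<^esub> k \<in> K" by blast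
  define h where "h = p \<circ> h0"
  have h: "h \<in> ring_hom R C" unfolding h_def by (rule ring_hom_trans[OF h0 p])
  define K' where "K' = {r \<in> carrier R. h r \<in> K}"
  have pow_h: "h (a [^] k) = h a [^]\<^bsub>C\<^esub> k" if "a \<in> carrier R" for a and k :: nat
    using pow_h0[OF that] pow_p[OF h0.hom_closed[OF that]] by (simp add: h_def)
  have nilK: "\<exists>k::nat. y [^] k \<in> carrier R \<and> h (y [^] k) \<in> K" if y: "y \<in> \<mm>" for y
  proof -
    have yc: "y \<in> carrier R" using m.Icarr[OF y] .
    have "h y \<in> \<mm>'" using p_n[OF h0_m[OF y]] by (simp add: h_def)
    then show ?thesis using K(5) pow_h[OF yc] yc by fastforce
  qed
  have "self_injective_quotient R K'"
    unfolding K'_def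
  proof (rule self_injective_quotient_pullback[OF is_cring C.is_cring h K(4)])
    fix c assume c: "c \<in> carrier C"
    obtain x where x: "x \<in> carrier A" "c = p x" using p_surj[OF c] by blast
    obtain a s where as: "x = fraction_class R S a s" "a \<in> carrier R" "s \<in> S" using carrier_A[OF x(1)] by blast
    have sc: "s \<in> carrier R" "s \<notin> \<mm>" using as(3) by (simp_all add: S)
    \<comment> \<open>For c represented by a/s, the product s u g equals 1 - w with w = y^k and h w
      in K. The element v = a u g of R then has image c (1 - h w), congruent to c modulo K.\<close>
    obtain u y where uy: "u \<in> carrier R" "y \<in> \<mm>" "s \<otimes> u = \<one> \<ominus> y" using maximalideal_inverse[OF assms(3) sc] by blast
    have yc: "y \<in> carrier R" using m.Icarr[OF uy(2)] .
    obtain k :: nat where k: "h (y [^] k) \<in> K" using nilK[OF uy(2)] by blast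
    obtain g where g: "g \<in> carrier R" "(\<one> \<ominus> y) \<otimes> g = \<one> \<ominus> y [^] k" using geometric_multiple[OF yc] by blast
    define w where "w = y [^] k"
    have wc: "w \<in> carrier R" using yc by (simp add: w_def)
    have sug: "s \<otimes> (u \<otimes> g) = \<one> \<ominus> w" using g uy sc(1) m_assoc[of s u g] by (simp add: w_def)
    define v where "v = a \<otimes> (u \<otimes> g)"
    have vc: "v \<in> carrier R" using as(2) uy(1) g(1) by (simp add: v_def)
    have "h0 v = x \<otimes>\<^bsub>A\<^esub> h0 (\<one> \<ominus> w)"
    proof -
      have "v \<otimes> (s \<otimes> \<one>) = a \<otimes> (s \<otimes> (u \<otimes> g)) \<otimes> \<one>" unfolding v_def using as(2) sc(1) uy(1) g(1) by algebra
      then have "fraction_class R S v \<one> = fraction_class R S (a \<otimes> (\<one> \<ominus> w)) (s \<otimes> \<one>)"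
        using feq[OF vc S1, of "a \<otimes> (\<one> \<ominus> w)" "s \<otimes> \<one>"] as(2,3) sc(1) wc sug by simp
      then show ?thesis using fmult[OF as(2,3) _ S1, of "\<one> \<ominus> w"] wc by (simp add: h0_def as(1))
    qed
    then have "h v = c \<otimes>\<^bsub>C\<^esub> (\<one>\<^bsub>C\<^esub> \<ominus>\<^bsub>C\<^esub> h w)"
      using x wc by (simp add: h_def minus_eq A.minus_eq C.minus_eq)
    also have "\<dots> = c \<ominus>\<^bsub>C\<^esub> c \<otimes>\<^bsub>C\<^esub> h w"
      using c ring_hom_closed[OF h wc] by (simp add: C.minus_eq C.r_distr C.r_minus)
    finally have "c \<ominus>\<^bsub>C\<^esub> h v = c \<otimes>\<^bsub>C\<^esub> h w"
      using c ring_hom_closed[OF h wc] by (simp add: C.minus_eq C.minus_add C.r_neg1 C.r_neg2)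
    moreover have "c \<otimes>\<^bsub>C\<^esub> h w \<in> K" using ideal.I_l_closed[OF K(1) _ c] k by (simp add: w_def)
    ultimately have "c \<ominus>\<^bsub>C\<^esub> h v \<in> K" by (simp only:)
    then show "\<exists>r\<in>carrier R. c \<ominus>\<^bsub>C\<^esub> h r \<in> K" using vc by blast
  qed
  moreover have "K' \<subseteq> Q"
  proof
    fix r assume "r \<in> K'"
    then have r: "r \<in> carrier R" "h r \<in> QC" using K(2) by (auto simp: K'_def)
    then obtain a where a: "a \<in> ideal_power A \<nn> n" "p (h0 r) = p a" unfolding QC_def h_def by auto
    have "h0 r \<ominus>\<^bsub>A\<^esub> a \<in> ideal_power A \<nn> n" using p_eq[OF h0.hom_closed[OF r(1)] Pc[OF a(1)] a(2)] I(2) by blast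
    then have "h0 r \<in> ideal_power A \<nn> n" using ideal.diff_mem[OF P h0.hom_closed[OF r(1)] a(1)] by blast
    \<comment> \<open>Elements of the n-th power of \<open>\<nn>\<close> have numerators in the n-th
      power of \<open>\<mm>\<close>. Hence r s lies in Q for some s outside \<open>\<mm>\<close>;
      such an s is a unit modulo Q, so r lies in Q.\<close>
    then obtain b s where b: "b \<in> ideal_power R \<mm> n" "s \<in> S" "h0 r = fraction_class R S b s" using power_frac by blast
    have bc: "b \<in> carrier R" using mn b(1) Q.Icarr by blast
    have sc: "s \<in> carrier R" "s \<notin> \<mm>" using b(2) by (simp_all add: S)
    have "r \<otimes> s = b" using feq[OF r(1) S1 bc b(2)] b(3) bc by (simp add: h0_def)
    then have rs: "r \<otimes> s \<in> Q" using b(1) mn by blast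
    obtain u y where uy: "u \<in> carrier R" "y \<in> \<mm>" "s \<otimes> u = \<one> \<ominus> y" using maximalideal_inverse[OF assms(3) sc] by blast
    have yc: "y \<in> carrier R" using m.Icarr[OF uy(2)] .
    obtain k :: nat where k: "y [^] k \<in> Q" using nil[OF uy(2)] by blast
    obtain g where g: "g \<in> carrier R" "(\<one> \<ominus> y) \<otimes> g = \<one> \<ominus> y [^] k" using geometric_multiple[OF yc] by blast
    have "r \<otimes> s \<otimes> (u \<otimes> g) \<oplus> r \<otimes> y [^] k \<in> Q"
      using rs k r(1) uy(1) g(1) Q.I_l_closed Q.I_r_closed by simp
    moreover have "r \<otimes> s \<otimes> (u \<otimes> g) = r \<otimes> (\<one> \<ominus> y [^] k)"
    proof -
      have "r \<otimes> s \<otimes> (u \<otimes> g) = r \<otimes> ((s \<otimes> u) \<otimes> g)" using r(1) sc(1) uy(1) g(1) by algebra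
      then show ?thesis using uy(3) g(2) by simp
    qed
    moreover have "r \<otimes> (\<one> \<ominus> z) \<oplus> r \<otimes> z = r" if "z \<in> carrier R" for z using r(1) that by algebra
    ultimately show "r \<in> Q" using yc by simp
  qed
  moreover have "\<one> \<notin> K'" using K(3) ring_hom_one[OF h] by (simp add: K'_def)
  moreover have "\<forall>x\<in>\<mm>. \<exists>k::nat. x [^] k \<in> K'" using nilK by (simp add: K'_def)
  moreover have "ideal K' R" using calculation(1) by (simp add: self_injective_quotient_def)
  ultimately show ?thesis by blast
qed

section \<open>Trace ideals over complete local rings\<close>

lemma self_module_simps [simp]:
  "carrier (self_module R) = carrier R" "\<zero>\<^bsub>self_module R\<^esub> = \<zero>\<^bsub>R\<^esub>"
  "x \<oplus>\<^bsub>self_module R\<^esub> y = x \<oplus>\<^bsub>R\<^esub> y" "x \<odot>\<^bsub>self_module R\<^esub> y = x \<otimes>\<^bsub>R\<^esub> y"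
  by (simp_all add: self_module_def)

lemma (in cring) self_module: "module R (self_module R)"
proof (rule moduleI[OF is_cring])
  show "abelian_group (self_module R)"
    by (rule abelian_groupI) (auto simp: a_ac intro: exI[of _ "\<ominus> x" for x] l_neg)
qed (simp_all add: l_distr r_distr m_assoc)

text \<open>Because K carries M into N, the quotient M/N is a module over R/K, and G induces a map
  to R/K on a submodule of it. One step of Baer's criterion extends this map to the class of b; y
  lifts the value there.\<close>

lemma self_injective_quotient_extend:
  fixes R (structure)
  assumes "module R M" and K: "self_injective_quotient R K"
    and N: "submodule N R M" "\<And>j x. j \<in> K \<Longrightarrow> x \<in> carrier M \<Longrightarrow> j \<odot>\<^bsub>M\<^esub> x \<in> N"
    and G: "linear_graph R M (self_module R) G" "G \<subseteq> carrier M \<times> carrier R"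
      "\<And>x y. (x, y) \<in> G \<Longrightarrow> x \<in> N \<Longrightarrow> y \<in> K"
    and b: "b \<in> carrier M"
  shows "\<exists>y\<in>carrier R. \<forall>x' y' r. (x', y') \<in> G \<longrightarrow> r \<in> carrier R \<longrightarrow> x' \<oplus>\<^bsub>M\<^esub> r \<odot>\<^bsub>M\<^esub> b \<in> N \<longrightarrow> y' \<oplus> r \<otimes> y \<in> K"
proof -
  interpret module R M by fact
  have Kid: "ideal K R" using K by (simp add: self_injective_quotient_def)
  note N' = submoduleD[OF N(1)]
  have Gc: "x \<in> carrier M" "y \<in> carrier R" if "(x, y) \<in> G" for x y using G(2) that by auto
  have K_minus: "a \<ominus> c \<in> K" if "a \<in> K" "c \<in> K" for a c by (rule ideal.minus_closed_ideal[OF Kid that])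
  have G_minus: "(x \<ominus>\<^bsub>M\<^esub> x', y \<ominus> y') \<in> G" if "(x, y) \<in> G" "(x', y') \<in> G" for x y x' y'
  proof -
    have "(x \<oplus>\<^bsub>M\<^esub> (\<ominus> \<one>) \<odot>\<^bsub>M\<^esub> x', y \<oplus> (\<ominus> \<one>) \<otimes> y') \<in> G"
      using linear_graphD(2)[OF G(1) that(1) linear_graphD(3)[OF G(1) _ that(2), of "\<ominus> \<one>"]] by simp
    then show ?thesis using Gc[OF that(1)] Gc[OF that(2)]
      by (simp add: smult_l_minus l_minus M.minus_eq R.minus_eq)
  qed
  \<comment> \<open>If x + r b lies in N, then r b agrees with -x in M/N, so the value at r b has to
    be -y modulo K. This accounts for the sign in the definition of f.\<close>
  define adm where "adm r x y \<longleftrightarrow> (x, y) \<in> G \<and> x \<oplus>\<^bsub>M\<^esub> r \<odot>\<^bsub>M\<^esub> b \<in> N" for r x y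
  have uniq: "y \<ominus> y' \<in> K" if "adm r x y" "adm r x' y'" "r \<in> carrier R" for r x y x' y'
  proof -
    have xy: "(x, y) \<in> G" "(x', y') \<in> G" using that by (auto simp: adm_def)
    have "(x \<oplus>\<^bsub>M\<^esub> r \<odot>\<^bsub>M\<^esub> b) \<ominus>\<^bsub>M\<^esub> (x' \<oplus>\<^bsub>M\<^esub> r \<odot>\<^bsub>M\<^esub> b) \<in> N"
      using submodule_minus[OF N(1)] that by (simp add: adm_def)
    moreover have "(x \<oplus>\<^bsub>M\<^esub> r \<odot>\<^bsub>M\<^esub> b) \<ominus>\<^bsub>M\<^esub> (x' \<oplus>\<^bsub>M\<^esub> r \<odot>\<^bsub>M\<^esub> b) = x \<ominus>\<^bsub>M\<^esub> x'"
      using Gc[OF xy(1)] Gc[OF xy(2)] that(3) b by (simp add: module_simps)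
    ultimately show ?thesis using G(3)[OF G_minus[OF xy]] by simp
  qed
  have adm_carr: "y \<in> carrier R" if "adm r x y" for r x y
  proof -
    have "(x, y) \<in> G" using that by (simp add: adm_def)
    then show ?thesis by (rule Gc(2))
  qed
  define I where "I = {r \<in> carrier R. \<exists>x y. adm r x y}"
  define f where "f r = \<ominus> (SOME y. \<exists>x. adm r x y)" for r
  have f: "\<exists>x y. adm r x y \<and> f r = \<ominus> y \<and> y \<in> carrier R" if "r \<in> I" for r
  proof -
    have "\<exists>x. adm r x (SOME y. \<exists>x. adm r x y)"
      by (rule someI_ex) (use that in \<open>auto simp: I_def\<close>)
    then obtain x where x: "adm r x (SOME y. \<exists>x. adm r x y)" by blast
    then have "(SOME y. \<exists>x. adm r x y) \<in> carrier R" by (rule adm_carr)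
    then show ?thesis unfolding f_def using x by blast
  qed
  have fc: "f r \<in> carrier R" if "r \<in> I" for r using f[OF that] by auto
  have f_eq: "f r \<oplus> y \<in> K" if r: "r \<in> carrier R" and y: "adm r x y" for r x y
  proof -
    have "r \<in> I" using that by (auto simp: I_def)
    then obtain x' y' where "adm r x' y'" "f r = \<ominus> y'" "y' \<in> carrier R" using f by blast
    moreover have "y \<in> carrier R" by (rule adm_carr[OF y])
    moreover have "y \<ominus> y' \<in> K" by (rule uniq[OF y calculation(1) r])
    ultimately show ?thesis by (simp add: R.minus_eq R.a_comm)
  qed
  have adm_add: "adm (r \<oplus> r') (x \<oplus>\<^bsub>M\<^esub> x') (y \<oplus> y')" if "r \<in> carrier R" "r' \<in> carrier R" "adm r x y" "adm r' x' y'" for r r' x y x' y'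
  proof -
    have xy: "(x, y) \<in> G" "(x', y') \<in> G" using that by (auto simp: adm_def)
    have "(x \<oplus>\<^bsub>M\<^esub> r \<odot>\<^bsub>M\<^esub> b) \<oplus>\<^bsub>M\<^esub> (x' \<oplus>\<^bsub>M\<^esub> r' \<odot>\<^bsub>M\<^esub> b) \<in> N" using that N'(3) by (simp add: adm_def)
    moreover have "(x \<oplus>\<^bsub>M\<^esub> r \<odot>\<^bsub>M\<^esub> b) \<oplus>\<^bsub>M\<^esub> (x' \<oplus>\<^bsub>M\<^esub> r' \<odot>\<^bsub>M\<^esub> b) = (x \<oplus>\<^bsub>M\<^esub> x') \<oplus>\<^bsub>M\<^esub> (r \<oplus> r') \<odot>\<^bsub>M\<^esub> b"
      using Gc[OF xy(1)] Gc[OF xy(2)] that(1,2) b by (simp add: module_simps)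
    ultimately show ?thesis using linear_graphD(2)[OF G(1) xy] by (simp add: adm_def)
  qed
  have adm_smult: "adm (s \<otimes> r) (s \<odot>\<^bsub>M\<^esub> x) (s \<otimes> y)" if "r \<in> carrier R" "s \<in> carrier R" "adm r x y" for r s x y
  proof -
    have xy: "(x, y) \<in> G" using that by (auto simp: adm_def)
    have "s \<odot>\<^bsub>M\<^esub> (x \<oplus>\<^bsub>M\<^esub> r \<odot>\<^bsub>M\<^esub> b) \<in> N" using that N'(4) by (simp add: adm_def)
    moreover have "s \<odot>\<^bsub>M\<^esub> (x \<oplus>\<^bsub>M\<^esub> r \<odot>\<^bsub>M\<^esub> b) = s \<odot>\<^bsub>M\<^esub> x \<oplus>\<^bsub>M\<^esub> (s \<otimes> r) \<odot>\<^bsub>M\<^esub> b"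
      using Gc[OF xy] that(1,2) b by (simp add: smult_r_distr smult_assoc1)
    ultimately show ?thesis using linear_graphD(3)[OF G(1) that(2) xy] by (simp add: adm_def)
  qed
  have adm_0: "adm r \<zero>\<^bsub>M\<^esub> \<zero>" if "r \<in> K" for r
    using linear_graphD(1)[OF G(1)] N(2)[OF that b] ideal.Icarr[OF Kid that] b by (simp add: adm_def)
  have I: "ideal I R"
  proof (rule idealI_cring)
    show "I \<subseteq> carrier R" by (auto simp: I_def)
    show "\<zero> \<in> I" using adm_0 additive_subgroup.zero_closed[OF ideal.axioms(1)[OF Kid]] by (auto simp: I_def)
    show "r \<oplus> r' \<in> I" if "r \<in> I" "r' \<in> I" for r r' using that adm_add unfolding I_def by blast
    show "s \<otimes> r \<in> I" if "r \<in> I" "s \<in> carrier R" for r s using that adm_smult unfolding I_def by blast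
  qed
  have "\<exists>y\<in>carrier R. \<forall>r\<in>I. f r \<ominus> r \<otimes> y \<in> K"
  proof (rule self_injective_quotientD[OF K I])
    show "K \<subseteq> I" using adm_0 ideal.Icarr[OF Kid] by (auto simp: I_def)
    show "f r \<in> carrier R" if "r \<in> I" for r by (rule fc[OF that])
    show "f r \<in> K" if "r \<in> K" for r
    proof -
      have "r \<in> I" using that \<open>K \<subseteq> I\<close> by blast
      then show ?thesis using f_eq[OF ideal.Icarr[OF Kid that] adm_0[OF that]] fc by simp
    qed
  next
    fix r r' assume r: "r \<in> I" and r': "r' \<in> I"
    obtain x y where xy: "adm r x y" "f r = \<ominus> y" "y \<in> carrier R" using f[OF r] by blast
    obtain x' y' where xy': "adm r' x' y'" "f r' = \<ominus> y'" "y' \<in> carrier R" using f[OF r'] by blast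
    have rc: "r \<in> carrier R" "r' \<in> carrier R" using r r' by (auto simp: I_def)
    have "f (r \<oplus> r') \<oplus> (y \<oplus> y') \<in> K" using f_eq[OF _ adm_add[OF rc xy(1) xy'(1)]] rc by simp
    moreover have "f (r \<oplus> r') \<in> carrier R"
      by (rule fc[OF additive_subgroup.a_closed[OF ideal.axioms(1)[OF I] r r']])
    ultimately show "f (r \<oplus> r') \<ominus> (f r \<oplus> f r') \<in> K"
      using xy(2,3) xy'(2,3) by (simp add: R.minus_eq R.minus_add)
  next
    fix s r assume s: "s \<in> carrier R" and r: "r \<in> I"
    obtain x y where xy: "adm r x y" "f r = \<ominus> y" "y \<in> carrier R" using f[OF r] by blast
    have rc: "r \<in> carrier R" using r by (auto simp: I_def)
    have "f (s \<otimes> r) \<oplus> s \<otimes> y \<in> K" using f_eq[OF _ adm_smult[OF rc s xy(1)]] rc s by simp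
    moreover have "f (s \<otimes> r) \<in> carrier R" by (rule fc[OF ideal.I_l_closed[OF I r s]])
    ultimately show "f (s \<otimes> r) \<ominus> s \<otimes> f r \<in> K" using xy(2,3) s by (simp add: R.minus_eq R.r_minus)
  qed
  then obtain y where y: "y \<in> carrier R" "\<And>r. r \<in> I \<Longrightarrow> f r \<ominus> r \<otimes> y \<in> K" by blast
  have "y' \<oplus> r \<otimes> y \<in> K" if xy: "(x', y') \<in> G" and r: "r \<in> carrier R" and xN: "x' \<oplus>\<^bsub>M\<^esub> r \<odot>\<^bsub>M\<^esub> b \<in> N" for x' y' r
  proof -
    have adm: "adm r x' y'" using that by (simp add: adm_def)
    then have rI: "r \<in> I" using r by (auto simp: I_def)
    have "(f r \<oplus> y') \<ominus> (f r \<ominus> r \<otimes> y) \<in> K" by (rule K_minus[OF f_eq[OF r adm] y(2)[OF rI]])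
    moreover have "(f r \<oplus> y') \<ominus> (f r \<ominus> r \<otimes> y) = y' \<oplus> r \<otimes> y"
      using fc[OF rI] Gc(2)[OF xy] r y(1) by algebra
    ultimately show ?thesis by simp
  qed
  then show ?thesis using y(1) by blast
qed

section \<open>Annihilators and descending chains modulo a self-injective ideal\<close>

context noetherian_local
begin

text \<open>If a is outside D, then D + Ra -> R/K with D |-> 0 and a |-> s, for a socle element s,
  is well defined because (D : a) lies in \<open>\<mm>\<close>. Its extension to R is multiplication
  by some y that carries D into K but not a.\<close>

lemma self_injective_double_annihilator:
  assumes K: "self_injective_quotient R K" "\<one> \<notin> K" and nil: "\<And>x. x \<in> \<mm> \<Longrightarrow> \<exists>k::nat. x [^] k \<in> K"
    and D: "ideal D R" "K \<subseteq> D" and a: "a \<in> carrier R"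
    and ann: "\<And>s. s \<in> carrier R \<Longrightarrow> (\<And>x. x \<in> D \<Longrightarrow> s \<otimes> x \<in> K) \<Longrightarrow> s \<otimes> a \<in> K"
  shows "a \<in> D"
proof (rule ccontr)
  assume aD: "a \<notin> D"
  have Kid: "ideal K R" using K(1) by (simp add: self_injective_quotient_def)
  have K_minus: "x \<ominus> y \<in> K" if "x \<in> K" "y \<in> K" for x y by (rule ideal.minus_closed_ideal[OF Kid that])
  have "\<exists>s\<in>carrier R. s \<notin> K \<and> (\<forall>x\<in>\<mm>. x \<otimes> s \<in> K)"
  proof (rule regular_element_or_socle[OF Kid K(2)])
    fix x assume x: "x \<in> \<mm>"
    have xc: "x \<in> carrier R" using m.Icarr[OF x] .
    \<comment> \<open>The last power of x outside K is killed by x modulo K. So each x in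
      \<open>\<mm>\<close> is a zero divisor on R/K, and a socle element exists.\<close>
    define k where "k = (LEAST k::nat. x [^] k \<in> K)"
    have k: "x [^] k \<in> K" unfolding k_def using nil[OF x] by (rule LeastI_ex)
    then obtain k' where k': "k = Suc k'" using K(2) by (cases k) auto
    then have "x [^] k' \<notin> K" using not_less_Least[of k' "\<lambda>k. x [^] k \<in> K"] by (simp add: k_def)
    moreover have "x \<otimes> x [^] k' \<in> K" using k k' xc by (simp add: m_comm)
    ultimately show "\<exists>a\<in>carrier R. a \<notin> K \<and> x \<otimes> a \<in> K" using xc by (intro bexI[of _ "x [^] k'"]) auto
  qed
  then obtain s where s: "s \<in> carrier R" "s \<notin> K" "\<And>x. x \<in> \<mm> \<Longrightarrow> x \<otimes> s \<in> K" by blast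
  interpret Rm: module R "self_module R" by (rule self_module)
  \<comment> \<open>The extension lemma is applied with M = R, N = D and b = 1. It yields t s + r y
    in K whenever t a + r lies in D; taking t = 0 and t = -1 gives the two properties of y.\<close>
  define G where "G = {(r \<otimes> a, r \<otimes> s) | r. r \<in> carrier R}"
  have "\<exists>y\<in>carrier R. \<forall>x' y' r. (x', y') \<in> G \<longrightarrow> r \<in> carrier R \<longrightarrow> x' \<oplus>\<^bsub>self_module R\<^esub> r \<odot>\<^bsub>self_module R\<^esub> \<one> \<in> D \<longrightarrow> y' \<oplus> r \<otimes> y \<in> K"
  proof (rule self_injective_quotient_extend[OF self_module K(1)])
    show "submodule D R (self_module R)"
      by (rule Rm.submoduleI')
        (use D(1) ideal.Icarr ideal.I_l_closed additive_subgroup.zero_closed[OF ideal.axioms(1)]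
          additive_subgroup.a_closed[OF ideal.axioms(1)] in auto)
    show "j \<odot>\<^bsub>self_module R\<^esub> x \<in> D" if "j \<in> K" "x \<in> carrier (self_module R)" for j x
      using that D(2) ideal.I_r_closed[OF D(1)] by auto
    show "linear_graph R (self_module R) (self_module R) G"
      unfolding linear_graph_def
    proof (intro conjI allI impI)
      have "(\<zero> \<otimes> a, \<zero> \<otimes> s) \<in> G" unfolding G_def by blast
      then show "(\<zero>\<^bsub>self_module R\<^esub>, \<zero>\<^bsub>self_module R\<^esub>) \<in> G" using a s by simp
      fix x y assume "(x, y) \<in> G"
      then obtain r where r: "r \<in> carrier R" "x = r \<otimes> a" "y = r \<otimes> s" unfolding G_def by blast
      show "(t \<odot>\<^bsub>self_module R\<^esub> x, t \<odot>\<^bsub>self_module R\<^esub> y) \<in> G" if "t \<in> carrier R" for t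
      proof -
        have "((t \<otimes> r) \<otimes> a, (t \<otimes> r) \<otimes> s) \<in> G" unfolding G_def using that r by blast
        then show ?thesis using that r a s by (simp add: m_assoc)
      qed
      fix x' y' assume "(x', y') \<in> G"
      then obtain r' where r': "r' \<in> carrier R" "x' = r' \<otimes> a" "y' = r' \<otimes> s" unfolding G_def by blast
      have "((r \<oplus> r') \<otimes> a, (r \<oplus> r') \<otimes> s) \<in> G" unfolding G_def using r' r by blast
      then show "(x \<oplus>\<^bsub>self_module R\<^esub> x', y \<oplus>\<^bsub>self_module R\<^esub> y') \<in> G" using r r' a s by (simp add: l_distr)
    qed
    show "G \<subseteq> carrier (self_module R) \<times> carrier R" using a s by (auto simp: G_def)
    show "y \<in> K" if xy: "(x, y) \<in> G" "x \<in> D" for x y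
    proof -
      obtain r where r: "r \<in> carrier R" "x = r \<otimes> a" "y = r \<otimes> s" using xy unfolding G_def by blast
      have "quot_elt R D a \<subseteq> \<mm>"
        by (rule proper_ideal_subset[OF quot_elt(1)[OF D(1) a]]) (use aD a in \<open>simp add: quot_elt_def\<close>)
      then have "r \<in> \<mm>" using r xy(2) by (auto simp: quot_elt_def)
      then show ?thesis using s(3) r by simp
    qed
  qed simp
  then obtain y where y: "y \<in> carrier R"
    "\<And>t r. t \<in> carrier R \<Longrightarrow> r \<in> carrier R \<Longrightarrow> t \<otimes> a \<oplus> r \<in> D \<Longrightarrow> t \<otimes> s \<oplus> r \<otimes> y \<in> K"
    unfolding G_def by auto
  have "y \<otimes> x \<in> K" if "x \<in> D" for x
    using y(2)[of \<zero> x] ideal.Icarr[OF D(1) that] that a s(1) y(1) by (simp add: m_comm)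
  then have ya: "y \<otimes> a \<in> K" by (rule ann[OF y(1)])
  have "\<ominus> \<one> \<otimes> a \<oplus> a \<in> D"
    using a additive_subgroup.zero_closed[OF ideal.axioms(1)[OF D(1)]] by (simp add: l_minus l_neg)
  then have 1: "\<ominus> \<one> \<otimes> s \<oplus> a \<otimes> y \<in> K" using y(2)[of "\<ominus> \<one>" a] a by simp
  have "y \<otimes> a \<ominus> (\<ominus> \<one> \<otimes> s \<oplus> a \<otimes> y) \<in> K" by (rule K_minus[OF ya 1])
  moreover have "y \<otimes> a \<ominus> (\<ominus> \<one> \<otimes> s \<oplus> a \<otimes> y) = s" using y(1) a s(1) by algebra
  ultimately show False using s(2) by simp
qed

text \<open>The annihilators of a descending chain ascend and become stationary; the double
  annihilator recovers the chain from them.\<close>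

lemma self_injective_dcc:
  assumes K: "self_injective_quotient R K" "\<one> \<notin> K" and nil: "\<And>x. x \<in> \<mm> \<Longrightarrow> \<exists>k::nat. x [^] k \<in> K"
    and D: "\<And>n. ideal (D n) R" "\<And>n. K \<subseteq> D n" and anti: "\<And>m n. m \<le> n \<Longrightarrow> D n \<subseteq> D (m::nat)"
  shows "\<exists>T. \<forall>n\<ge>T. D n = D T"
proof -
  have Kid: "ideal K R" using K(1) by (simp add: self_injective_quotient_def)
  define ann where "ann n = {s \<in> carrier R. \<forall>x\<in>D n. s \<otimes> x \<in> K}" for n
  have ann: "ideal (ann n) R" for n
  proof (rule idealI_cring)
    show "ann n \<subseteq> carrier R" by (auto simp: ann_def)
    have Dc: "x \<in> carrier R" if "x \<in> D n" for x using ideal.Icarr[OF D(1) that] .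
    show "\<zero> \<in> ann n" using Dc additive_subgroup.zero_closed[OF ideal.axioms(1)[OF Kid]] by (simp add: ann_def)
    show "s \<oplus> t \<in> ann n" if "s \<in> ann n" "t \<in> ann n" for s t
      using that Dc additive_subgroup.a_closed[OF ideal.axioms(1)[OF Kid]] by (simp add: ann_def l_distr)
    show "r \<otimes> s \<in> ann n" if "s \<in> ann n" "r \<in> carrier R" for s r
      using that Dc ideal.I_l_closed[OF Kid] by (simp add: ann_def m_assoc)
  qed
  have "\<exists>M\<in>range ann. \<forall>I\<in>range ann. M \<subseteq> I \<longrightarrow> I = M"
    by (rule maximal_element_ideals) (use ann in auto)
  then obtain T where T: "\<And>n. ann T \<subseteq> ann n \<Longrightarrow> ann n = ann T" by auto
  have "D n = D T" if n: "n \<ge> T" for n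
  proof
    show "D n \<subseteq> D T" by (rule anti[OF n])
    have "ann T \<subseteq> ann n" using anti[OF n] by (auto simp: ann_def)
    then have eq: "ann n = ann T" by (rule T)
    show "D T \<subseteq> D n"
    proof
      fix a assume a: "a \<in> D T"
      show "a \<in> D n"
      proof (rule self_injective_double_annihilator[OF K nil D])
        show "a \<in> carrier R" using ideal.Icarr[OF D(1) a] .
        fix s assume "s \<in> carrier R" "\<And>x. x \<in> D n \<Longrightarrow> s \<otimes> x \<in> K"
        then have "s \<in> ann T" unfolding eq[symmetric] by (simp add: ann_def)
        then show "s \<otimes> a \<in> K" using a by (simp add: ann_def)
      qed
    qed
  qed
  then show ?thesis by blast
qed

end

text \<open>The values at \<open>b\<close> compatible modulo \<open>K t\<close> form a descending sequence of cosets; modulo each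
  \<open>K n\<close> it stabilises because \<open>R/K n\<close> is artinian, so completeness gives a common element.\<close>

lemma (in noetherian_local) complete_graph_extend:
  assumes complete: "\<And>x. (\<And>n. x n \<in> carrier R) \<Longrightarrow> (\<And>n. x (Suc n) \<ominus> x n \<in> ideal_power R \<mm> n) \<Longrightarrow>
      \<exists>y\<in>carrier R. \<forall>n. x n \<ominus> y \<in> ideal_power R \<mm> n"
    and K: "\<And>t. self_injective_quotient R (K t)" "\<And>t. \<one> \<notin> K t" "\<And>t x. x \<in> \<mm> \<Longrightarrow> \<exists>k::nat. x [^] k \<in> K t"
    and K_power: "\<And>t. K t \<subseteq> ideal_power R \<mm> t" and K_anti: "\<And>t. K (Suc t) \<subseteq> K (t::nat)"
    and M: "module R M" and N: "\<And>t. submodule (N t) R M" "\<And>t j x. j \<in> K t \<Longrightarrow> x \<in> carrier M \<Longrightarrow> j \<odot>\<^bsub>M\<^esub> x \<in> N t"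
    and N_Suc: "\<And>t s x. s \<in> carrier R \<Longrightarrow> (\<And>a. a \<in> K t \<Longrightarrow> s \<otimes> a \<in> K (Suc t)) \<Longrightarrow> x \<in> N t \<Longrightarrow> s \<odot>\<^bsub>M\<^esub> x \<in> N (Suc t)"
    and G: "linear_graph R M (self_module R) G" "G \<subseteq> carrier M \<times> carrier R"
      "\<And>x y t. (x, y) \<in> G \<Longrightarrow> x \<in> N t \<Longrightarrow> y \<in> K t"
    and b: "b \<in> carrier M"
  shows "\<exists>y\<in>carrier R. \<forall>(x', y')\<in>G. \<forall>r\<in>carrier R. \<forall>t. x' \<oplus>\<^bsub>M\<^esub> r \<odot>\<^bsub>M\<^esub> b \<in> N t \<longrightarrow> y' \<oplus> r \<otimes> y \<in> K t"
proof -
  interpret M: module R M by fact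
  have Kid: "ideal (K t) R" for t using K(1) by (simp add: self_injective_quotient_def)
  have Kc: "a \<in> carrier R" if "a \<in> K t" for a t using ideal.Icarr[OF Kid that] .
  have K_add: "a \<oplus> c \<in> K t" if "a \<in> K t" "c \<in> K t" for a c t
    by (rule additive_subgroup.a_closed[OF ideal.axioms(1)[OF Kid] that])
  have K_mult: "s \<otimes> a \<in> K t" if "s \<in> carrier R" "a \<in> K t" for s a t by (rule ideal.I_l_closed[OF Kid that(2,1)])
  have K_le: "K t' \<subseteq> K t" if "t \<le> t'" for t t' by (rule lift_Suc_antimono_le[of K, OF K_anti that])
  have Gc: "x \<in> carrier M" "y \<in> carrier R" if "(x, y) \<in> G" for x y using G(2) that by auto
  define adm where "adm t r z \<longleftrightarrow> r \<in> carrier R \<and> (\<exists>x. (x, z) \<in> G \<and> x \<oplus>\<^bsub>M\<^esub> r \<odot>\<^bsub>M\<^esub> b \<in> N t)" for t r z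
  have admc: "r \<in> carrier R" "z \<in> carrier R" if "adm t r z" for t r z using that Gc(2) unfolding adm_def by blast+
  \<comment> \<open>\<open>Y t\<close> consists of the values at b that are compatible with G modulo
    K t; \<open>adm t r z\<close> says that r b must be sent to -z at that level.\<close>
  define Y where "Y t = {y \<in> carrier R. \<forall>r z. adm t r z \<longrightarrow> z \<oplus> r \<otimes> y \<in> K t}" for t
  have YI: "y \<in> Y t" if "y \<in> carrier R" "\<And>r z. adm t r z \<Longrightarrow> z \<oplus> r \<otimes> y \<in> K t" for y t
    using that by (simp add: Y_def)
  have Yc: "y \<in> carrier R" if "y \<in> Y t" for y t using that by (simp add: Y_def)
  have YD: "z \<oplus> r \<otimes> y \<in> K t" if "y \<in> Y t" "adm t r z" for y t r z using that by (simp add: Y_def)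
  have Y_nonempty: "\<exists>y. y \<in> Y t" for t
  proof -
    have "\<exists>y\<in>carrier R. \<forall>x' y' r. (x', y') \<in> G \<longrightarrow> r \<in> carrier R \<longrightarrow> x' \<oplus>\<^bsub>M\<^esub> r \<odot>\<^bsub>M\<^esub> b \<in> N t \<longrightarrow> y' \<oplus> r \<otimes> y \<in> K t"
      by (rule self_injective_quotient_extend[OF M K(1) N(1,2) G(1,2,3) b])
    then show ?thesis unfolding Y_def adm_def by blast
  qed
  have Y_Suc: "Y (Suc t) \<subseteq> Y t" for t
  proof
    fix y assume y: "y \<in> Y (Suc t)"
    show "y \<in> Y t"
    proof (rule YI[OF Yc[OF y]])
      fix r z assume rz: "adm t r z"
      then obtain x where x: "(x, z) \<in> G" "x \<oplus>\<^bsub>M\<^esub> r \<odot>\<^bsub>M\<^esub> b \<in> N t" and r: "r \<in> carrier R" unfolding adm_def by blast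
      have zc: "z \<in> carrier R" by (rule Gc(2)[OF x(1)])
      show "z \<oplus> r \<otimes> y \<in> K t"
      \<comment> \<open>Compatibility at level t + 1 does not formally contain compatibility at
        level t, since N t is larger than N (t + 1). An s with s K t inside K (t + 1) carries N t
        into N (t + 1), hence relations of level t to level t + 1. As K t is its own double
        annihilator modulo K (t + 1), multiplication by these s detects membership in K t.\<close>
      proof (rule self_injective_double_annihilator[OF K(1)[of "Suc t"] K(2)[of "Suc t"] K(3)[of _ "Suc t"] Kid K_anti])
        show "z \<oplus> r \<otimes> y \<in> carrier R" using zc r Yc[OF y] by simp
        fix s assume s: "s \<in> carrier R" "\<And>a. a \<in> K t \<Longrightarrow> s \<otimes> a \<in> K (Suc t)"
        have "s \<odot>\<^bsub>M\<^esub> (x \<oplus>\<^bsub>M\<^esub> r \<odot>\<^bsub>M\<^esub> b) \<in> N (Suc t)" by (rule N_Suc[OF s x(2)])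
        moreover have "s \<odot>\<^bsub>M\<^esub> (x \<oplus>\<^bsub>M\<^esub> r \<odot>\<^bsub>M\<^esub> b) = s \<odot>\<^bsub>M\<^esub> x \<oplus>\<^bsub>M\<^esub> (s \<otimes> r) \<odot>\<^bsub>M\<^esub> b"
          using s(1) r b Gc(1)[OF x(1)] by (simp add: M.smult_r_distr M.smult_assoc1)
        moreover have "(s \<odot>\<^bsub>M\<^esub> x, s \<otimes> z) \<in> G" using linear_graphD(3)[OF G(1) s(1) x(1)] by simp
        ultimately have "adm (Suc t) (s \<otimes> r) (s \<otimes> z)" using s(1) r unfolding adm_def by auto
        then have "s \<otimes> z \<oplus> (s \<otimes> r) \<otimes> y \<in> K (Suc t)" by (rule YD[OF y])
        moreover have "s \<otimes> z \<oplus> (s \<otimes> r) \<otimes> y = s \<otimes> (z \<oplus> r \<otimes> y)" using s(1) zc r Yc[OF y] by algebra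
        ultimately show "s \<otimes> (z \<oplus> r \<otimes> y) \<in> K (Suc t)" by simp
      qed
    qed
  qed
  have Y_le: "Y t' \<subseteq> Y t" if "t \<le> t'" for t t' by (rule lift_Suc_antimono_le[of Y, OF Y_Suc that])
  \<comment> \<open>The homogeneous solutions: \<open>Y t\<close> is a coset of the ideal
    \<open>L t\<close>.\<close>
  define L where "L t = {c \<in> carrier R. \<forall>r z. adm t r z \<longrightarrow> r \<otimes> c \<in> K t}" for t
  have LD: "r \<otimes> c \<in> K t" if "c \<in> L t" "adm t r z" for c t r z using that by (auto simp: L_def)
  have LI: "c \<in> L t" if "c \<in> carrier R" "\<And>r z. adm t r z \<Longrightarrow> r \<otimes> c \<in> K t" for c t
    using that by (auto simp: L_def)
  have L: "ideal (L t) R" for t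
  proof (rule idealI_cring)
    show "L t \<subseteq> carrier R" by (auto simp: L_def)
    show "\<zero> \<in> L t" using admc(1) additive_subgroup.zero_closed[OF ideal.axioms(1)[OF Kid]] by (auto simp: L_def)
    show "u \<oplus> v \<in> L t" if uv: "u \<in> L t" "v \<in> L t" for u v
    proof -
      have "r \<otimes> (u \<oplus> v) \<in> K t" if "adm t r z" for r z
      proof -
        have "r \<otimes> u \<oplus> r \<otimes> v \<in> K t" by (rule K_add[OF LD[OF uv(1) that] LD[OF uv(2) that]])
        then show ?thesis using admc[OF that] uv by (simp add: L_def r_distr)
      qed
      then show ?thesis using uv by (intro LI) (auto simp: L_def)
    qed
    show "s \<otimes> u \<in> L t" if u: "u \<in> L t" and s: "s \<in> carrier R" for u s
    proof -
      have "r \<otimes> (s \<otimes> u) \<in> K t" if "adm t r z" for r z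
      proof -
        have "s \<otimes> (r \<otimes> u) \<in> K t" by (rule K_mult[OF s LD[OF u that]])
        moreover have "s \<otimes> (r \<otimes> u) = r \<otimes> (s \<otimes> u)" using admc(1)[OF that] u s by (intro m_lcomm) (auto simp: L_def)
        ultimately show ?thesis by simp
      qed
      then show ?thesis using u s by (intro LI) (auto simp: L_def)
    qed
  qed
  have Lc: "c \<in> carrier R" if "c \<in> L t" for c t using that by (simp add: L_def)
  have K_L: "K t \<subseteq> L t" for t using K_mult Kc admc(1) by (auto simp: L_def)
  have Y_L: "y \<oplus> c \<in> Y t" if y: "y \<in> Y t" and c: "c \<in> L t" for y c t
  proof (rule YI)
    show "y \<oplus> c \<in> carrier R" using Yc[OF y] Lc[OF c] by simp
    fix r z assume rz: "adm t r z"
    have "(z \<oplus> r \<otimes> y) \<oplus> r \<otimes> c \<in> K t" by (rule K_add[OF YD[OF y rz] LD[OF c rz]])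
    moreover have "(z \<oplus> r \<otimes> y) \<oplus> r \<otimes> c = z \<oplus> r \<otimes> (y \<oplus> c)" using admc[OF rz] Yc[OF y] Lc[OF c] by algebra
    ultimately show "z \<oplus> r \<otimes> (y \<oplus> c) \<in> K t" by simp
  qed
  have Y_diff: "y \<ominus> y' \<in> L t" if y: "y \<in> Y t" "y' \<in> Y t" for y y' t
  proof -
    have "r \<otimes> (y \<ominus> y') \<in> K t" if rz: "adm t r z" for r z
    proof -
      have "(z \<oplus> r \<otimes> y) \<ominus> (z \<oplus> r \<otimes> y') \<in> K t"
        by (rule ideal.minus_closed_ideal[OF Kid YD[OF y(1) rz] YD[OF y(2) rz]])
      moreover have "(z \<oplus> r \<otimes> y) \<ominus> (z \<oplus> r \<otimes> y') = r \<otimes> (y \<ominus> y')"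
        using admc[OF rz] Yc[OF y(1)] Yc[OF y(2)] by algebra
      ultimately show ?thesis by simp
    qed
    then show ?thesis using Yc[OF y(1)] Yc[OF y(2)] by (intro LI) auto
  qed
  have L_Suc: "L (Suc t) \<subseteq> L t" for t
  proof
    fix c assume c: "c \<in> L (Suc t)"
    obtain y where y: "y \<in> Y (Suc t)" using Y_nonempty by blast
    have "(y \<oplus> c) \<ominus> y \<in> L t" using Y_diff Y_L[OF y c] y Y_Suc by blast
    moreover have "(y \<oplus> c) \<ominus> y = c" using Yc[OF y] Lc[OF c] by algebra
    ultimately show "c \<in> L t" by simp
  qed
  have L_le: "L t' \<subseteq> L t" if "t \<le> t'" for t t' by (rule lift_Suc_antimono_le[of L, OF L_Suc that])
  \<comment> \<open>The elements that every \<open>Y t\<close> approximates modulo K n.\<close>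
  define C where "C n = {y \<in> carrier R. \<forall>t. \<exists>y'\<in>Y t. y \<ominus> y' \<in> K n}" for n
  have stable: "\<exists>T. Y T \<subseteq> C n" for n
  proof -
    \<comment> \<open>The image of \<open>Y t\<close> modulo K n is a coset of D t modulo K n. The D
      t descend and are eventually constant, say from T on, and then \<open>Y T\<close> is contained
      in \<open>C n\<close>.\<close>
    define D where "D t = L t <+>\<^bsub>R\<^esub> K n" for t
    have D: "ideal (D t) R" for t unfolding D_def by (rule add_ideals[OF L Kid])
    have D_iff: "c \<in> D t \<longleftrightarrow> (\<exists>l\<in>L t. \<exists>k\<in>K n. c = l \<oplus> k)" for c t
      by (auto simp: D_def set_add_def')
    have "\<exists>T. \<forall>t\<ge>T. D t = D T"
    proof (rule self_injective_dcc[OF K(1)[of n] K(2)[of n] K(3)[of _ n] D])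
      show "K n \<subseteq> D t" for t
      proof
        fix k assume k: "k \<in> K n"
        have "k = \<zero> \<oplus> k" using Kc[OF k] by simp
        then show "k \<in> D t" using k additive_subgroup.zero_closed[OF ideal.axioms(1)[OF L]] D_iff by blast
      qed
      show "D t' \<subseteq> D t" if "t \<le> t'" for t t' using L_le[OF that] D_iff by blast
    qed
    then obtain T where T: "\<And>t. t \<ge> T \<Longrightarrow> D t = D T" by blast
    have "y \<in> C n" if y: "y \<in> Y T" for y
    proof -
      have "\<exists>y'\<in>Y t. y \<ominus> y' \<in> K n" for t
      proof (cases "t \<ge> T")
        case False
        then have "y \<in> Y t" using Y_le[of t T] y by auto
        then show ?thesis using ideal.diff_refl[OF Kid Yc[OF y]] by blast
      next
        case True
        obtain y' where y': "y' \<in> Y t" using Y_nonempty by blast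
        then have y'T: "y' \<in> Y T" using Y_le[OF True] by blast
        have "y \<ominus> y' \<in> L T" by (rule Y_diff[OF y y'T])
        moreover have "y \<ominus> y' = (y \<ominus> y') \<oplus> \<zero>" using Yc[OF y] Yc[OF y'] by simp
        ultimately have "y \<ominus> y' \<in> D T"
          using additive_subgroup.zero_closed[OF ideal.axioms(1)[OF Kid]] D_iff by blast
        then obtain l k where lk: "l \<in> L t" "k \<in> K n" "y \<ominus> y' = l \<oplus> k" using T[OF True] D_iff by blast
        \<comment> \<open>The part l of the difference that lies in \<open>L t\<close> is absorbed
          by moving y' within \<open>Y t\<close>; the rest k lies in K n.\<close>
        have "y \<ominus> (y' \<oplus> l) = (y \<ominus> y') \<ominus> l" using Yc[OF y] Yc[OF y'] Lc[OF lk(1)] by algebra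
        also have "\<dots> = k" unfolding lk(3) using Lc[OF lk(1)] Kc[OF lk(2)] by algebra
        finally have "y \<ominus> (y' \<oplus> l) \<in> K n" using lk(2) by simp
        then show ?thesis using Y_L[OF y' lk(1)] by blast
      qed
      then show ?thesis using Yc[OF y] by (simp add: C_def)
    qed
    then show ?thesis by blast
  qed
  have CD: "y \<in> carrier R" "\<exists>y'\<in>Y t. y \<ominus> y' \<in> K n" if "y \<in> C n" for y n t using that by (auto simp: C_def)
  have C_nonempty: "\<exists>y. y \<in> C n" for n using stable[of n] Y_nonempty by blast
  have C_step: "\<exists>y'. y' \<in> C (Suc n) \<and> y \<ominus> y' \<in> K n" if "y \<in> C n" for y n
    using stable[of "Suc n"] CD(2)[OF that] by blast
  \<comment> \<open>Consecutive terms are congruent modulo K n, which lies in the n-th power of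
    \<open>\<mm>\<close>, so the sequence has a limit y.\<close>
  obtain w where w: "\<And>n. w n \<in> C n" "\<And>n. w n \<ominus> w (Suc n) \<in> K n"
    using dependent_nat_choice[of "\<lambda>n y. y \<in> C n" "\<lambda>n y y'. y \<ominus> y' \<in> K n"] C_nonempty C_step by blast
  have wc: "w n \<in> carrier R" for n by (rule CD(1)[OF w(1)])
  obtain y where y: "y \<in> carrier R" "\<And>n. w n \<ominus> y \<in> ideal_power R \<mm> n"
  proof -
    have "\<exists>y\<in>carrier R. \<forall>n. w n \<ominus> y \<in> ideal_power R \<mm> n"
    proof (rule complete[OF wc])
      show "w (Suc n) \<ominus> w n \<in> ideal_power R \<mm> n" for n
        using ideal.diff_sym[OF Kid wc wc w(2)] K_power by blast
    qed
    then show ?thesis using that by blast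
  qed
  have yY: "y \<in> Y t" for t
  proof -
    \<comment> \<open>The limit has to be compared with w n modulo K t, but completeness controls
      only powers of \<open>\<mm>\<close>; K t contains such a power. The maximum with t also makes
      K n a part of K t. As K t is inside \<open>L t\<close>, the limit stays in the coset
      \<open>Y t\<close>.\<close>
    obtain k where k: "ideal_power R \<mm> k \<subseteq> K t"
      using ideal_power_subset_if_nil[OF is_cring m.is_ideal Kid K(3)] by blast
    define n where "n = max t k"
    have "ideal_power R \<mm> n \<subseteq> K t"
      using ideal_power_antimono[OF m.is_ideal, of k n] k by (auto simp: n_def)
    then have 1: "w n \<ominus> y \<in> K t" using y(2) by blast
    obtain y' where y': "y' \<in> Y t" "w n \<ominus> y' \<in> K n" using CD(2)[OF w(1)] by blast
    have 2: "w n \<ominus> y' \<in> K t" using y'(2) K_le[of t n] by (auto simp: n_def)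
    have "(w n \<ominus> y') \<ominus> (w n \<ominus> y) \<in> K t" by (rule ideal.minus_closed_ideal[OF Kid 2 1])
    moreover have "(w n \<ominus> y') \<ominus> (w n \<ominus> y) = y \<ominus> y'" using wc[of n] y(1) Yc[OF y'(1)] by algebra
    ultimately have "y \<ominus> y' \<in> L t" using K_L by auto
    then have "y' \<oplus> (y \<ominus> y') \<in> Y t" by (rule Y_L[OF y'(1)])
    moreover have "y' \<oplus> (y \<ominus> y') = y" using y(1) Yc[OF y'(1)] by algebra
    ultimately show ?thesis by simp
  qed
  have "y' \<oplus> r \<otimes> y \<in> K t" if "(x', y') \<in> G" "r \<in> carrier R" "x' \<oplus>\<^bsub>M\<^esub> r \<odot>\<^bsub>M\<^esub> b \<in> N t" for x' y' r t
    by (rule YD[OF yY]) (use that in \<open>auto simp: adm_def\<close>)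
  then show ?thesis using y(1) by blast
qed

section \<open>Traces of algebras and contracted ideals\<close>

lemma (in algebra) algebra_map_closed: "r \<in> carrier R \<Longrightarrow> algebra_map M r \<in> carrier M"
  by (simp add: algebra_map_def)

lemma (in algebra) smult_eq_mult: "r \<in> carrier R \<Longrightarrow> x \<in> carrier M \<Longrightarrow> algebra_map M r \<otimes>\<^bsub>M\<^esub> x = r \<odot>\<^bsub>M\<^esub> x"
  by (simp add: algebra_map_def smult_assoc2)

lemma (in algebra) ideal_submodule:
  assumes "ideal I M"
  shows "submodule I R M"
proof (rule submoduleI')
  show "I \<subseteq> carrier M" using ideal.Icarr[OF assms] by blast
  show "\<zero>\<^bsub>M\<^esub> \<in> I" "\<And>a b. a \<in> I \<Longrightarrow> b \<in> I \<Longrightarrow> a \<oplus>\<^bsub>M\<^esub> b \<in> I"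
    using additive_subgroup.zero_closed[OF ideal.axioms(1)[OF assms]]
      additive_subgroup.a_closed[OF ideal.axioms(1)[OF assms]] by auto
  show "r \<odot>\<^bsub>M\<^esub> a \<in> I" if "r \<in> carrier R" "a \<in> I" for r a
    using ideal.I_l_closed[OF assms that(2) algebra_map_closed[OF that(1)]]
      smult_eq_mult[OF that(1) ideal.Icarr[OF assms that(2)]] by simp
qed

lemma mod_hom_self_moduleD:
  assumes "\<phi> \<in> mod_hom R M (self_module R)"
  shows "\<And>x. x \<in> carrier M \<Longrightarrow> \<phi> x \<in> carrier R"
    "\<And>x y. x \<in> carrier M \<Longrightarrow> y \<in> carrier M \<Longrightarrow> \<phi> (x \<oplus>\<^bsub>M\<^esub> y) = \<phi> x \<oplus>\<^bsub>R\<^esub> \<phi> y"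
    "\<And>r x. r \<in> carrier R \<Longrightarrow> x \<in> carrier M \<Longrightarrow> \<phi> (r \<odot>\<^bsub>M\<^esub> x) = r \<otimes>\<^bsub>R\<^esub> \<phi> x"
  using assms by (auto simp: mod_hom_def)

text \<open>An R-linear \<open>\<phi>\<close> carries IB into I. For x in the contraction of IB this
  gives x \<open>\<phi>\<close>(1) = \<open>\<phi>\<close>(x 1) in I.\<close>

lemma trace_ideal_subset_colon:
  fixes R (structure)
  assumes "algebra R B" "ideal I R"
  shows "trace_ideal R B \<subseteq> colon R (self_module R) I (ext_contr R B I)"
proof
  interpret R: cring R by (rule algebra.R_cring[OF assms(1)])
  interpret Bc: cring B by (rule algebra.M_cring[OF assms(1)])
  interpret B: algebra R B by fact
  fix c assume "c \<in> trace_ideal R B"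
  then obtain \<phi> where \<phi>: "\<phi> \<in> mod_hom R B (self_module R)" "c = \<phi> \<one>\<^bsub>B\<^esub>" by (auto simp: trace_ideal_def)
  note \<phi>' = mod_hom_self_moduleD[OF \<phi>(1)]
  have cc: "c \<in> carrier R" using \<phi>'(1) \<phi>(2) by simp
  have "c \<otimes> x \<in> I" if x: "x \<in> ext_contr R B I" for x
  proof -
    have xc: "x \<in> carrier R" and x_Idl: "algebra_map B x \<in> Idl\<^bsub>B\<^esub> (algebra_map B ` I)"
      using x by (auto simp: ext_contr_def)
    \<comment> \<open>The largest ideal of B on which \<open>\<phi>\<close> takes values in I.
      Testing all multiples b' b makes it an ideal, although \<open>\<phi>\<close> is only
      R-linear.\<close>
    define D where "D = {b \<in> carrier B. \<forall>b'\<in>carrier B. \<phi> (b' \<otimes>\<^bsub>B\<^esub> b) \<in> I}"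
    have "ideal D B"
    proof (rule Bc.idealI_cring)
      show "D \<subseteq> carrier B" by (auto simp: D_def)
      have "\<phi> \<zero>\<^bsub>B\<^esub> = \<zero>" using \<phi>'(3)[OF R.zero_closed Bc.zero_closed] \<phi>'(1)[OF Bc.zero_closed] by simp
      then show "\<zero>\<^bsub>B\<^esub> \<in> D" using additive_subgroup.zero_closed[OF ideal.axioms(1)[OF assms(2)]] by (simp add: D_def)
      show "u \<oplus>\<^bsub>B\<^esub> v \<in> D" if "u \<in> D" "v \<in> D" for u v
        using that \<phi>'(2) additive_subgroup.a_closed[OF ideal.axioms(1)[OF assms(2)]] by (simp add: D_def Bc.r_distr)
      show "s \<otimes>\<^bsub>B\<^esub> u \<in> D" if "u \<in> D" "s \<in> carrier B" for u s
        using that by (simp add: D_def flip: Bc.m_assoc)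
    qed
    moreover have "algebra_map B ` I \<subseteq> D"
    proof
      fix b assume "b \<in> algebra_map B ` I"
      then obtain i where i: "i \<in> I" "b = algebra_map B i" by blast
      have ic: "i \<in> carrier R" using ideal.Icarr[OF assms(2) i(1)] .
      have "\<phi> (b' \<otimes>\<^bsub>B\<^esub> b) \<in> I" if "b' \<in> carrier B" for b'
      proof -
        have "b' \<otimes>\<^bsub>B\<^esub> b = i \<odot>\<^bsub>B\<^esub> b'"
          using Bc.m_comm[OF that B.algebra_map_closed[OF ic]] B.smult_eq_mult[OF ic that] i(2) by simp
        then show ?thesis using \<phi>'(3)[OF ic that] ideal.I_r_closed[OF assms(2) i(1) \<phi>'(1)[OF that]] by simp
      qed
      then show "b \<in> D" using B.algebra_map_closed[OF ic] i(2) by (simp add: D_def)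
    qed
    ultimately have "algebra_map B x \<in> D" using Bc.genideal_minimal x_Idl by blast
    then have "\<phi> (\<one>\<^bsub>B\<^esub> \<otimes>\<^bsub>B\<^esub> algebra_map B x) \<in> I"
      using Bc.one_closed unfolding D_def by blast
    then have "\<phi> (x \<odot>\<^bsub>B\<^esub> \<one>\<^bsub>B\<^esub>) \<in> I" using B.algebra_map_closed[OF xc] by (simp add: algebra_map_def)
    then show ?thesis using \<phi>'(3)[OF xc Bc.one_closed] \<phi>(2) cc xc by (simp add: R.m_comm)
  qed
  then show "c \<in> colon R (self_module R) I (ext_contr R B I)" using cc by (simp add: colon_def)
qed

lemma linear_graph_multiples:
  assumes "module R M" "module R P" "u \<in> carrier M" "c \<in> carrier P"
  shows "linear_graph R M P {(r \<odot>\<^bsub>M\<^esub> u, r \<odot>\<^bsub>P\<^esub> c) | r. r \<in> carrier R}" (is "linear_graph R M P ?G")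
  unfolding linear_graph_def
proof (intro conjI allI impI)
  interpret M: module R M by fact
  interpret P: module R P by fact
  have I: "(r \<odot>\<^bsub>M\<^esub> u, r \<odot>\<^bsub>P\<^esub> c) \<in> ?G" if "r \<in> carrier R" for r using that by blast
  show "(\<zero>\<^bsub>M\<^esub>, \<zero>\<^bsub>P\<^esub>) \<in> ?G" using I[OF M.R.zero_closed] assms(3,4) by simp
  fix x y assume "(x, y) \<in> ?G"
  then obtain r where r: "r \<in> carrier R" "x = r \<odot>\<^bsub>M\<^esub> u" "y = r \<odot>\<^bsub>P\<^esub> c" by blast
  show "(t \<odot>\<^bsub>M\<^esub> x, t \<odot>\<^bsub>P\<^esub> y) \<in> ?G" if t: "t \<in> carrier R" for t
    using I[OF M.R.m_closed[OF t r(1)]] r t assms(3,4) by (simp add: M.smult_assoc1 P.smult_assoc1)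
  fix x' y' assume "(x', y') \<in> ?G"
  then obtain r' where r': "r' \<in> carrier R" "x' = r' \<odot>\<^bsub>M\<^esub> u" "y' = r' \<odot>\<^bsub>P\<^esub> c" by blast
  show "(x \<oplus>\<^bsub>M\<^esub> x', y \<oplus>\<^bsub>P\<^esub> y') \<in> ?G"
    using I[OF M.R.a_closed[OF r(1) r'(1)]] r r' assms(3,4) by (simp add: M.smult_l_distr P.smult_l_distr)
qed

theorem trace_ideal_complete:
  fixes R :: "('a, 'x) ring_scheme" (structure) and B :: "('a, 'b) module"
  assumes "noetherian_domain R" "approx_gorenstein R" "complete_local_ring R" and B: "algebra R B"
  shows "trace_ideal R B = (\<Inter>I\<in>{I. ideal I R}. colon R (self_module R) I (ext_contr R B I))"
proof
  show "trace_ideal R B \<subseteq> (\<Inter>I\<in>{I. ideal I R}. colon R (self_module R) I (ext_contr R B I))"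
    using trace_ideal_subset_colon[OF B] by blast
  show "(\<Inter>I\<in>{I. ideal I R}. colon R (self_module R) I (ext_contr R B I)) \<subseteq> trace_ideal R B"
  proof
    interpret noetherian_domain R by fact
    obtain \<mm> where \<mm>: "local_ring R \<mm>" and complete: "\<And>x. (\<And>n. x n \<in> carrier R) \<Longrightarrow>
        (\<And>n. x (Suc n) \<ominus> x n \<in> ideal_power R \<mm> n) \<Longrightarrow>
        \<exists>!y. y \<in> carrier R \<and> (\<forall>n. x n \<ominus> y \<in> ideal_power R \<mm> n)"
    proof -
      obtain \<mm> where \<mm>: "local_ring R \<mm>" and c: "\<forall>x. (\<forall>n. x n \<in> carrier R) \<and>
        (\<forall>n. x (Suc n) \<ominus> x n \<in> ideal_power R \<mm> n) \<longrightarrow>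
        (\<exists>!y. y \<in> carrier R \<and> (\<forall>n. x n \<ominus> y \<in> ideal_power R \<mm> n))"
        using assms(3) unfolding complete_local_ring_def by (elim exE conjE) (rule that)
      show thesis by (rule that[OF \<mm>], rule c[rule_format]) simp
    qed
    interpret L: noetherian_local R \<mm>
      by (intro noetherian_local.intro noetherian_local_axioms.intro noetherian_ring_axioms is_cring \<mm>)
    interpret Bc: cring B by (rule algebra.M_cring[OF B])
    interpret B: algebra R B by (rule B)
    have Bm: "module R B" by (rule B.module)
    have mid: "ideal \<mm> R" by (rule L.m.is_ideal)
    fix c assume c: "c \<in> (\<Inter>I\<in>{I. ideal I R}. colon R (self_module R) I (ext_contr R B I))"
    have c_colon: "c \<in> carrier R" "\<And>x. x \<in> ext_contr R B I \<Longrightarrow> c \<otimes> x \<in> I" if "ideal I R" for I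
      using c that by (auto simp: colon_def)
    have cc: "c \<in> carrier R" by (rule c_colon(1)[OF oneideal])
    define good where "good t K \<longleftrightarrow> ideal K R \<and> K \<subseteq> ideal_power R \<mm> t \<and> \<one> \<notin> K \<and>
        self_injective_quotient R K \<and> (\<forall>x\<in>\<mm>. \<exists>k::nat. x [^] k \<in> K)" for t K
    \<comment> \<open>Intersecting with a power of \<open>\<mm>\<close> keeps the nil condition. The
      ideals can therefore be chosen as a descending sequence with K t inside the t-th
      power.\<close>
    have ex: "\<exists>K'. good t K' \<and> K' \<subseteq> K" if K: "ideal K R" "\<forall>x\<in>\<mm>. \<exists>k::nat. x [^] k \<in> K" for t K
    proof -
      have P: "ideal (ideal_power R \<mm> t) R" by (rule ideal_power_ideal[OF mid])
      have "\<exists>k::nat. x [^] k \<in> K \<inter> ideal_power R \<mm> t" if x: "x \<in> \<mm>" for x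
      proof -
        obtain k :: nat where k: "x [^] k \<in> K" using K(2) x by blast
        have xc: "x \<in> carrier R" using L.m.Icarr[OF x] .
        have "x [^] k \<otimes> x [^] t \<in> K" by (rule ideal.I_r_closed[OF K(1) k]) (simp add: xc)
        moreover have "x [^] k \<otimes> x [^] t \<in> ideal_power R \<mm> t"
          by (rule ideal.I_l_closed[OF P pow_in_ideal_power[OF mid x]]) (simp add: xc)
        ultimately show ?thesis using nat_pow_mult[OF xc, of k t] by (intro exI[of _ "k + t"]) simp
      qed
      then show ?thesis
        using approx_gorenstein_self_injective_quotient[OF assms(1,2) L.maximal i_intersect[OF K(1) P]]
        unfolding good_def by blast
    qed
    have "\<exists>K. \<forall>t. good t (K t) \<and> K (Suc t) \<subseteq> K t"
    proof (rule dependent_nat_choice)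
      show "\<exists>K. good 0 K" using ex[OF oneideal] nat_pow_closed L.m.Icarr by blast
      show "\<exists>K'. good (Suc t) K' \<and> K' \<subseteq> K" if "good t K" for K t
        using that by (intro ex) (auto simp: good_def)
    qed
    then obtain K where K: "\<And>t. good t (K t)" "\<And>t. K (Suc t) \<subseteq> K t" by blast
    have Kid: "ideal (K t) R" and K_pow: "K t \<subseteq> ideal_power R \<mm> t" and K_one: "\<one> \<notin> K t"
      and K_si: "self_injective_quotient R (K t)" and K_nil: "\<And>x. x \<in> \<mm> \<Longrightarrow> \<exists>k::nat. x [^] k \<in> K t" for t
      using K(1)[of t] by (auto simp: good_def)
    \<comment> \<open>The uniqueness half of completeness, for the zero sequence: both y and 0 are
      limits of it.\<close>
    have separated: "y = \<zero>" if y: "\<And>t. y \<in> K t" for y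
    proof -
      have yc: "y \<in> carrier R" using ideal.Icarr[OF Kid y] .
      have zP: "\<zero> \<in> ideal_power R \<mm> n" for n
        using additive_subgroup.zero_closed[OF ideal.axioms(1)[OF ideal_power_ideal[OF mid]]] .
      have "\<exists>!y. y \<in> carrier R \<and> (\<forall>n. \<zero> \<ominus> y \<in> ideal_power R \<mm> n)"
        by (rule complete) (use zP in \<open>simp_all add: minus_eq\<close>)
      moreover have "\<zero> \<ominus> y \<in> ideal_power R \<mm> n" for n
        using ideal.minus_closed_ideal[OF ideal_power_ideal[OF mid] zP] y K_pow by blast
      moreover have "\<zero> \<ominus> \<zero> \<in> ideal_power R \<mm> n" for n using zP by (simp add: minus_eq)
      ultimately show ?thesis using yc zero_closed by blast
    qed
    define N where "N t = Idl\<^bsub>B\<^esub> (algebra_map B ` K t)" for t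
    have map_sub: "algebra_map B ` K t \<subseteq> carrier B" for t
      using B.algebra_map_closed ideal.Icarr[OF Kid] by blast
    have Nid: "ideal (N t) B" for t unfolding N_def by (rule Bc.genideal_ideal[OF map_sub])
    have NI: "algebra_map B k \<in> N t" if "k \<in> K t" for k t
      using Bc.genideal_self[OF map_sub] that unfolding N_def by blast
    have N_sub: "submodule (N t) R B" for t by (rule B.ideal_submodule[OF Nid])
    have N_K: "j \<odot>\<^bsub>B\<^esub> x \<in> N t" if "j \<in> K t" "x \<in> carrier B" for j x t
      using ideal.I_r_closed[OF Nid NI[OF that(1)] that(2)] B.smult_eq_mult[OF ideal.Icarr[OF Kid that(1)] that(2)] by simp
    have N_Suc: "s \<odot>\<^bsub>B\<^esub> x \<in> N (Suc t)"
      if s: "s \<in> carrier R" "\<And>a. a \<in> K t \<Longrightarrow> s \<otimes> a \<in> K (Suc t)" and x: "x \<in> N t" for s x t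
    proof -
      \<comment> \<open>The elements that s carries into K (t + 1) B form an ideal of B. It contains
        the image of K t, hence all of K t B.\<close>
      define D where "D = {b \<in> carrier B. s \<odot>\<^bsub>B\<^esub> b \<in> N (Suc t)}"
      note N' = submoduleD[OF N_sub[of "Suc t"]]
      have "ideal D B"
      proof (rule Bc.idealI_cring)
        show "D \<subseteq> carrier B" by (auto simp: D_def)
        show "\<zero>\<^bsub>B\<^esub> \<in> D" using N'(2) s(1) by (simp add: D_def)
        show "u \<oplus>\<^bsub>B\<^esub> v \<in> D" if "u \<in> D" "v \<in> D" for u v using that N'(3) s(1) by (simp add: D_def B.smult_r_distr)
        show "w \<otimes>\<^bsub>B\<^esub> u \<in> D" if "u \<in> D" "w \<in> carrier B" for u w
        proof -
          have "s \<odot>\<^bsub>B\<^esub> (w \<otimes>\<^bsub>B\<^esub> u) = (s \<odot>\<^bsub>B\<^esub> u) \<otimes>\<^bsub>B\<^esub> w"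
            using that s(1) B.smult_assoc2[OF s(1)] Bc.m_comm[of w u] by (simp add: D_def)
          then show ?thesis using that ideal.I_r_closed[OF Nid, of "s \<odot>\<^bsub>B\<^esub> u" "Suc t" w] by (simp add: D_def)
        qed
      qed
      moreover have "algebra_map B ` K t \<subseteq> D"
      proof
        fix b assume "b \<in> algebra_map B ` K t"
        then obtain k where k: "k \<in> K t" "b = algebra_map B k" by blast
        have kc: "k \<in> carrier R" using ideal.Icarr[OF Kid k(1)] .
        have "s \<odot>\<^bsub>B\<^esub> b = algebra_map B (s \<otimes> k)" using s(1) kc k(2) by (simp add: algebra_map_def B.smult_assoc1)
        then show "b \<in> D" using NI[OF s(2)[OF k(1)]] B.algebra_map_closed[OF kc] k(2) by (simp add: D_def)
      qed
      ultimately have "N t \<subseteq> D" unfolding N_def[of t] by (rule Bc.genideal_minimal)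
      then show ?thesis using x by (auto simp: D_def)
    qed
    \<comment> \<open>The partial map r 1 |-> r c. It is compatible with K t because r 1 in K t B
      means that r is in the contraction of K t B, and c multiplies that contraction into K
      t.\<close>
    define G0 where "G0 = {(r \<odot>\<^bsub>B\<^esub> \<one>\<^bsub>B\<^esub>, r \<odot>\<^bsub>self_module R\<^esub> c) | r. r \<in> carrier R}"
    obtain G where G: "linear_graph R B (self_module R) G" "G \<subseteq> carrier B \<times> carrier (self_module R)" "G0 \<subseteq> G"
      "\<And>x y. (x, y) \<in> G \<Longrightarrow> \<forall>t. x \<in> N t \<longrightarrow> y \<in> K t" "\<And>b. b \<in> carrier B \<Longrightarrow> \<exists>y. (b, y) \<in> G"
    proof (rule linear_graph_extension[OF Bm self_module B.carrier_is_submodule module.carrier_is_submodule[OF self_module],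
          where P = "\<lambda>x y. \<forall>t. x \<in> N t \<longrightarrow> y \<in> K t" and ?G0.0 = G0])
      show "linear_graph R B (self_module R) G0"
        unfolding G0_def by (rule linear_graph_multiples[OF Bm self_module]) (simp_all add: cc)
      show "G0 \<subseteq> carrier B \<times> carrier (self_module R)" using cc by (auto simp: G0_def)
      show "\<forall>t. x \<in> N t \<longrightarrow> y \<in> K t" if xy: "(x, y) \<in> G0" for x y
      proof (intro allI impI)
        fix t assume x: "x \<in> N t"
        obtain r where r: "r \<in> carrier R" "x = algebra_map B r" "y = r \<otimes> c"
          using xy unfolding G0_def algebra_map_def by auto
        have "r \<in> ext_contr R B (K t)" using r x by (simp add: ext_contr_def N_def)
        then show "y \<in> K t" using c_colon(2)[OF Kid] r cc by (simp add: m_comm)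
      qed
    next
      fix G b assume G: "linear_graph R B (self_module R) G" "G \<subseteq> carrier B \<times> carrier (self_module R)"
        and P: "\<And>x y. (x, y) \<in> G \<Longrightarrow> \<forall>t. x \<in> N t \<longrightarrow> y \<in> K t" and b: "b \<in> carrier B"
      have "\<exists>y\<in>carrier R. \<forall>(x', y')\<in>G. \<forall>r\<in>carrier R. \<forall>t. x' \<oplus>\<^bsub>B\<^esub> r \<odot>\<^bsub>B\<^esub> b \<in> N t \<longrightarrow> y' \<oplus> r \<otimes> y \<in> K t"
      proof (rule L.complete_graph_extend[where K = K and N = N and M = B and G = G and b = b, OF _ K_si K_one K_nil K_pow K(2) Bm N_sub N_K N_Suc G(1) _ _ b])
        show "\<exists>y\<in>carrier R. \<forall>n. x n \<ominus> y \<in> ideal_power R \<mm> n"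
          if "\<And>n. x n \<in> carrier R" "\<And>n. x (Suc n) \<ominus> x n \<in> ideal_power R \<mm> n" for x
          using complete[OF that] by blast
      qed (use G(2) P in auto)
      then show "\<exists>y\<in>carrier (self_module R). \<forall>(x', y')\<in>G. \<forall>r\<in>carrier R. \<forall>t. x' \<oplus>\<^bsub>B\<^esub> r \<odot>\<^bsub>B\<^esub> b \<in> N t \<longrightarrow>
          y' \<oplus>\<^bsub>self_module R\<^esub> r \<odot>\<^bsub>self_module R\<^esub> y \<in> K t" by simp
    qed (rule that; assumption)
    \<comment> \<open>Two values at b differ by a value at 0. Since 0 lies in every N t, this value
      lies in every K t and vanishes.\<close>
    have uniq: "y = y'" if "(b, y) \<in> G" "(b, y') \<in> G" for b y y'
    proof -
      have "(b \<ominus>\<^bsub>B\<^esub> b, y \<ominus>\<^bsub>self_module R\<^esub> y') \<in> G" by (rule linear_graph_minus[OF Bm self_module G(1,2) that])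
      moreover have "b \<in> carrier B" "y \<in> carrier R" "y' \<in> carrier R" using that G(2) by auto
      moreover have "b \<ominus>\<^bsub>B\<^esub> b \<in> N t" for t
        using submoduleD(2)[OF N_sub] \<open>b \<in> carrier B\<close> by (simp add: Bc.minus_eq Bc.r_neg)
      ultimately have "y \<ominus>\<^bsub>self_module R\<^esub> y' = \<zero>" using separated G(4) by blast
      then have "y \<ominus>\<^bsub>self_module R\<^esub> y' = \<zero>\<^bsub>self_module R\<^esub>" by simp
      then show ?thesis
        using abelian_group.minus_eq_zero_iff[OF module.axioms(2)[OF self_module]] \<open>y \<in> carrier R\<close> \<open>y' \<in> carrier R\<close> by simp
    qed
    define \<phi> where "\<phi> b = (THE y. (b, y) \<in> G)" for b
    have \<phi>: "\<phi> b = y" if "(b, y) \<in> G" for b y 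
      unfolding \<phi>_def using that uniq by (intro the_equality) blast+
    have \<phi>G: "(b, \<phi> b) \<in> G" if "b \<in> carrier B" for b using G(5)[OF that] \<phi> by auto
    have "\<phi> \<in> mod_hom R B (self_module R)"
      unfolding mod_hom_def
    proof (intro CollectI conjI ballI funcsetI)
      show "\<phi> b \<in> carrier (self_module R)" if "b \<in> carrier B" for b using \<phi>G[OF that] G(2) by auto
      show "\<phi> (x \<oplus>\<^bsub>B\<^esub> y) = \<phi> x \<oplus>\<^bsub>self_module R\<^esub> \<phi> y" if "x \<in> carrier B" "y \<in> carrier B" for x y
        by (rule \<phi>[OF linear_graphD(2)[OF G(1) \<phi>G[OF that(1)] \<phi>G[OF that(2)]]])
      show "\<phi> (r \<odot>\<^bsub>B\<^esub> x) = r \<odot>\<^bsub>self_module R\<^esub> \<phi> x" if "r \<in> carrier R" "x \<in> carrier B" for r x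
        by (rule \<phi>[OF linear_graphD(3)[OF G(1) that(1) \<phi>G[OF that(2)]]])
    qed
    moreover have "\<phi> \<one>\<^bsub>B\<^esub> = c"
    proof (rule \<phi>)
      have "(\<one> \<odot>\<^bsub>B\<^esub> \<one>\<^bsub>B\<^esub>, \<one> \<odot>\<^bsub>self_module R\<^esub> c) \<in> G0" unfolding G0_def by blast
      then show "(\<one>\<^bsub>B\<^esub>, c) \<in> G" using G(3) cc by auto
    qed
    ultimately show "c \<in> trace_ideal R B" unfolding trace_ideal_def by blast
  qed
qed

section \<open>Linear systems and Krull's intersection theorem\<close>

definition span_elt :: "('a, 'x) ring_scheme \<Rightarrow> ('a, 'b, 'y) module_scheme \<Rightarrow> 'b set \<Rightarrow> 'b \<Rightarrow> 'b set"
  where "span_elt R M D g = {d \<oplus>\<^bsub>M\<^esub> r \<odot>\<^bsub>M\<^esub> g | d r. d \<in> D \<and> r \<in> carrier R}"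

lemma (in module) span_elt:
  assumes D: "submodule D R M" and g: "g \<in> carrier M"
  shows "submodule (span_elt R M D g) R M" "D \<subseteq> span_elt R M D g" "g \<in> span_elt R M D g"
    and "\<And>N. submodule N R M \<Longrightarrow> D \<subseteq> N \<Longrightarrow> g \<in> N \<Longrightarrow> span_elt R M D g \<subseteq> N"
proof -
  note D' = submoduleD[OF D]
  have Dc: "d \<in> carrier M" if "d \<in> D" for d using D'(1) that by blast
  have I: "d \<oplus>\<^bsub>M\<^esub> r \<odot>\<^bsub>M\<^esub> g \<in> span_elt R M D g" if "d \<in> D" "r \<in> carrier R" for d r
    using that unfolding span_elt_def by blast
  show sub: "D \<subseteq> span_elt R M D g"
  proof
    fix d assume d: "d \<in> D"
    have "d = d \<oplus>\<^bsub>M\<^esub> \<zero> \<odot>\<^bsub>M\<^esub> g" using Dc[OF d] g by simp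
    then show "d \<in> span_elt R M D g" using I[OF d R.zero_closed] by simp
  qed
  have "g = \<zero>\<^bsub>M\<^esub> \<oplus>\<^bsub>M\<^esub> \<one> \<odot>\<^bsub>M\<^esub> g" using g by simp
  then show "g \<in> span_elt R M D g" using I[OF D'(2) R.one_closed] by simp
  show "submodule (span_elt R M D g) R M"
  proof (rule submoduleI')
    show "span_elt R M D g \<subseteq> carrier M" using Dc g by (auto simp: span_elt_def)
    show "\<zero>\<^bsub>M\<^esub> \<in> span_elt R M D g" using sub D'(2) by blast
  next
    fix x y assume "x \<in> span_elt R M D g" "y \<in> span_elt R M D g"
    then obtain d r d' r' where *: "x = d \<oplus>\<^bsub>M\<^esub> r \<odot>\<^bsub>M\<^esub> g" "d \<in> D" "r \<in> carrier R"
      "y = d' \<oplus>\<^bsub>M\<^esub> r' \<odot>\<^bsub>M\<^esub> g" "d' \<in> D" "r' \<in> carrier R" unfolding span_elt_def by blast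
    have "x \<oplus>\<^bsub>M\<^esub> y = (d \<oplus>\<^bsub>M\<^esub> d') \<oplus>\<^bsub>M\<^esub> (r \<oplus> r') \<odot>\<^bsub>M\<^esub> g"
      using * Dc g by (simp add: smult_l_distr M.a_ac)
    then show "x \<oplus>\<^bsub>M\<^esub> y \<in> span_elt R M D g" using I[OF D'(3)[OF *(2,5)] R.a_closed[OF *(3,6)]] by simp
  next
    fix s x assume s: "s \<in> carrier R" and "x \<in> span_elt R M D g"
    then obtain d r where *: "x = d \<oplus>\<^bsub>M\<^esub> r \<odot>\<^bsub>M\<^esub> g" "d \<in> D" "r \<in> carrier R" unfolding span_elt_def by blast
    have "s \<odot>\<^bsub>M\<^esub> x = s \<odot>\<^bsub>M\<^esub> d \<oplus>\<^bsub>M\<^esub> (s \<otimes> r) \<odot>\<^bsub>M\<^esub> g"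
      using * Dc g s by (simp add: smult_r_distr smult_assoc1)
    then show "s \<odot>\<^bsub>M\<^esub> x \<in> span_elt R M D g" using I[OF D'(4)[OF s *(2)] R.m_closed[OF s *(3)]] by simp
  qed
  show "span_elt R M D g \<subseteq> N" if N: "submodule N R M" "D \<subseteq> N" "g \<in> N" for N
    using submoduleD(3,4)[OF N(1)] N(2,3) unfolding span_elt_def by blast
qed

section \<open>Noetherian modules, with chain conditions stated inside an ambient module\<close>

definition noetherian_submodule :: "('a, 'x) ring_scheme \<Rightarrow> ('a, 'b, 'y) module_scheme \<Rightarrow> 'b set \<Rightarrow> bool"
  where "noetherian_submodule R M D \<longleftrightarrow> submodule D R M \<and>
    (\<forall>N. (\<forall>n::nat. submodule (N n) R M \<and> N n \<subseteq> D \<and> N n \<subseteq> N (Suc n)) \<longrightarrow> (\<exists>k. \<forall>n\<ge>k. N n = N k))"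

lemma noetherian_submoduleD:
  assumes "noetherian_submodule R M D" "\<And>n::nat. submodule (N n) R M" "\<And>n. N n \<subseteq> D" "\<And>n. N n \<subseteq> N (Suc n)"
  obtains k where "\<And>n. n \<ge> k \<Longrightarrow> N n = N k"
  using assms unfolding noetherian_submodule_def by blast

text \<open>A chain in D + Rg is governed by its intersections with D and by the ideals of
  coefficients of g. Both become stationary, and together they determine the chain.\<close>

lemma (in noetherian_ring) noetherian_submodule_span_elt:
  assumes M: "module R M" and D: "noetherian_submodule R M D" and g: "g \<in> carrier M"
  shows "noetherian_submodule R M (span_elt R M D g)"
proof -
  interpret M: module R M by fact
  have Dsub: "submodule D R M" using D by (simp add: noetherian_submodule_def)
  note span = M.span_elt[OF Dsub g] and D' = submoduleD[OF Dsub]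
  have "\<exists>k. \<forall>n\<ge>k. N n = N k"
    if N: "\<forall>n::nat. submodule (N n) R M \<and> N n \<subseteq> span_elt R M D g \<and> N n \<subseteq> N (Suc n)" for N
  proof -
    have Nsub: "submodule (N n) R M" and NS: "N n \<subseteq> span_elt R M D g" and NSuc: "N n \<subseteq> N (Suc n)" for n using N by auto
    have N_le: "N m \<subseteq> N n" if "m \<le> n" for m n by (rule lift_Suc_mono_le[of N, OF NSuc that])
    note N' = submoduleD[OF Nsub]
    have "submodule (N n \<inter> D) R M" for n
      by (rule M.submoduleI') (use N' D' in auto)
    then obtain k1 where k1: "\<And>n. n \<ge> k1 \<Longrightarrow> N n \<inter> D = N k1 \<inter> D"
      using noetherian_submoduleD[OF D, of "\<lambda>n. N n \<inter> D"] NSuc by blast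
    define I where "I n = {r \<in> carrier R. \<exists>d\<in>D. d \<oplus>\<^bsub>M\<^esub> r \<odot>\<^bsub>M\<^esub> g \<in> N n}" for n
    have Dc: "d \<in> carrier M" if "d \<in> D" for d using D'(1) that by blast
    have I: "ideal (I n) R" for n
    proof (rule M.R.idealI_cring)
      show "I n \<subseteq> carrier R" by (auto simp: I_def)
      have "\<zero>\<^bsub>M\<^esub> \<oplus>\<^bsub>M\<^esub> \<zero> \<odot>\<^bsub>M\<^esub> g \<in> N n" using g N'(2) by simp
      then show "\<zero> \<in> I n" using D'(2) by (auto simp: I_def)
    next
      fix r s assume "r \<in> I n" "s \<in> I n"
      then obtain d e where *: "r \<in> carrier R" "d \<in> D" "d \<oplus>\<^bsub>M\<^esub> r \<odot>\<^bsub>M\<^esub> g \<in> N n"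
        "s \<in> carrier R" "e \<in> D" "e \<oplus>\<^bsub>M\<^esub> s \<odot>\<^bsub>M\<^esub> g \<in> N n" unfolding I_def by blast
      have "(d \<oplus>\<^bsub>M\<^esub> r \<odot>\<^bsub>M\<^esub> g) \<oplus>\<^bsub>M\<^esub> (e \<oplus>\<^bsub>M\<^esub> s \<odot>\<^bsub>M\<^esub> g) = (d \<oplus>\<^bsub>M\<^esub> e) \<oplus>\<^bsub>M\<^esub> (r \<oplus> s) \<odot>\<^bsub>M\<^esub> g"
        using * Dc g by (simp add: M.smult_l_distr M.M.a_ac)
      then have "(d \<oplus>\<^bsub>M\<^esub> e) \<oplus>\<^bsub>M\<^esub> (r \<oplus> s) \<odot>\<^bsub>M\<^esub> g \<in> N n" using N'(3)[OF *(3,6)] by simp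
      then show "r \<oplus> s \<in> I n" using D'(3)[OF *(2,5)] *(1,4) unfolding I_def by blast
    next
      fix r s assume "r \<in> I n" and s: "s \<in> carrier R"
      then obtain d where *: "r \<in> carrier R" "d \<in> D" "d \<oplus>\<^bsub>M\<^esub> r \<odot>\<^bsub>M\<^esub> g \<in> N n" unfolding I_def by blast
      have "s \<odot>\<^bsub>M\<^esub> (d \<oplus>\<^bsub>M\<^esub> r \<odot>\<^bsub>M\<^esub> g) = s \<odot>\<^bsub>M\<^esub> d \<oplus>\<^bsub>M\<^esub> (s \<otimes> r) \<odot>\<^bsub>M\<^esub> g"
        using * Dc g s by (simp add: M.smult_r_distr M.smult_assoc1)
      then have "s \<odot>\<^bsub>M\<^esub> d \<oplus>\<^bsub>M\<^esub> (s \<otimes> r) \<odot>\<^bsub>M\<^esub> g \<in> N n" using N'(4)[OF s *(3)] by simp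
      then show "s \<otimes> r \<in> I n" using D'(4)[OF s *(2)] *(1) s unfolding I_def by blast
    qed
    have "\<exists>M\<in>range I. \<forall>K\<in>range I. M \<subseteq> K \<longrightarrow> K = M"
      by (rule maximal_element_ideals) (use I in auto)
    then obtain k2 where k2: "\<And>n. I k2 \<subseteq> I n \<Longrightarrow> I n = I k2" by auto
    have I_le: "I m \<subseteq> I n" if "m \<le> n" for m n using N_le[OF that] unfolding I_def by blast
    define k where "k = max k1 k2"
    have "N n \<subseteq> N k" if n: "n \<ge> k" for n
    proof
      fix x assume x: "x \<in> N n"
      then obtain d r where dr: "x = d \<oplus>\<^bsub>M\<^esub> r \<odot>\<^bsub>M\<^esub> g" "d \<in> D" "r \<in> carrier R" using NS unfolding span_elt_def by blast
      then have "r \<in> I n" using x unfolding I_def by blast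
      moreover have "I n = I k" using k2[OF I_le, of n] k2[OF I_le, of k] n by (simp add: k_def)
      ultimately obtain d' where d': "d' \<in> D" "d' \<oplus>\<^bsub>M\<^esub> r \<odot>\<^bsub>M\<^esub> g \<in> N k" unfolding I_def by blast
      \<comment> \<open>Subtracting an element of N k with the same coefficient r of g leaves an
        element of N n that lies in D, and N n and N k have the same intersection with D.\<close>
      have "x \<ominus>\<^bsub>M\<^esub> (d' \<oplus>\<^bsub>M\<^esub> r \<odot>\<^bsub>M\<^esub> g) \<in> N n"
        using M.submodule_minus[OF Nsub x] d'(2) N_le[OF n] by blast
      moreover have eq: "x \<ominus>\<^bsub>M\<^esub> (d' \<oplus>\<^bsub>M\<^esub> r \<odot>\<^bsub>M\<^esub> g) = d \<ominus>\<^bsub>M\<^esub> d'"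
        unfolding dr(1) using dr(3) Dc[OF dr(2)] Dc[OF d'(1)] g by (simp add: M.module_simps)
      ultimately have "d \<ominus>\<^bsub>M\<^esub> d' \<in> N n \<inter> D" using M.submodule_minus[OF Dsub dr(2) d'(1)] by simp
      also have "N n \<inter> D = N k \<inter> D" using k1[of n] k1[of k] n by (simp add: k_def)
      finally have "x \<ominus>\<^bsub>M\<^esub> (d' \<oplus>\<^bsub>M\<^esub> r \<odot>\<^bsub>M\<^esub> g) \<in> N k" using eq by simp
      then have "(x \<ominus>\<^bsub>M\<^esub> (d' \<oplus>\<^bsub>M\<^esub> r \<odot>\<^bsub>M\<^esub> g)) \<oplus>\<^bsub>M\<^esub> (d' \<oplus>\<^bsub>M\<^esub> r \<odot>\<^bsub>M\<^esub> g) \<in> N k" by (rule N'(3)[OF _ d'(2)])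
      moreover have "x \<in> carrier M" "d' \<oplus>\<^bsub>M\<^esub> r \<odot>\<^bsub>M\<^esub> g \<in> carrier M" using x d'(2) N'(1) by auto
      ultimately show "x \<in> N k" by (simp add: M.M.minus_eq M.M.a_assoc M.M.l_neg)
    qed
    then have "\<forall>n\<ge>k. N n = N k" using N_le by blast
    then show ?thesis by blast
  qed
  then show ?thesis using span(1) by (simp add: noetherian_submodule_def)
qed

lemma (in noetherian_ring) noetherian_submodule_finite:
  assumes M: "module R M" and "finite U" "U \<subseteq> carrier M"
  shows "\<exists>D. noetherian_submodule R M D \<and> U \<subseteq> D"
  using assms(2,3)
proof (induction U)
  case empty
  interpret M: module R M by fact
  have "submodule {\<zero>\<^bsub>M\<^esub>} R M" by (rule M.submoduleI') auto
  moreover have "N n = {\<zero>\<^bsub>M\<^esub>}" if "submodule (N n) R M" "N n \<subseteq> {\<zero>\<^bsub>M\<^esub>}" for N and n :: nat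
    using submoduleD(2)[OF that(1)] that(2) by auto
  ultimately have "noetherian_submodule R M {\<zero>\<^bsub>M\<^esub>}" unfolding noetherian_submodule_def by blast
  then show ?case by blast
next
  case (insert u U)
  interpret M: module R M by fact
  obtain D where D: "noetherian_submodule R M D" "U \<subseteq> D" using insert by auto
  have u: "u \<in> carrier M" using insert.prems by simp
  have Dsub: "submodule D R M" using D(1) by (simp add: noetherian_submodule_def)
  show ?case
    using noetherian_submodule_span_elt[OF M D(1) u] M.span_elt(2,3)[OF Dsub u] D(2) by blast
qed

lemma (in noetherian_ring) noetherian_submodule_carrier:
  assumes "finite_module R M"
  shows "noetherian_submodule R M (carrier M)"
proof -
  have M: "module R M" using assms by (simp add: finite_module_def)
  obtain U where U: "finite U" "U \<subseteq> carrier M" "\<And>N. submodule N R M \<Longrightarrow> U \<subseteq> N \<Longrightarrow> N = carrier M"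
    using assms unfolding finite_module_def by blast
  obtain D where "noetherian_submodule R M D" "U \<subseteq> D" using noetherian_submodule_finite[OF M U(1,2)] by blast
  then show ?thesis using U(3) by (metis noetherian_submodule_def)
qed

lemma noetherian_submodule_maximal:
  assumes D: "noetherian_submodule R M D" and "\<A> \<noteq> {}" and sub: "\<And>N. N \<in> \<A> \<Longrightarrow> submodule N R M \<and> N \<subseteq> D"
  shows "\<exists>N\<in>\<A>. \<forall>N'\<in>\<A>. N \<subseteq> N' \<longrightarrow> N' = N"
proof (rule ccontr)
  assume *: "\<not> ?thesis"
  have "\<exists>N. \<forall>n::nat. N n \<in> \<A> \<and> N n \<subset> N (Suc n)"
  proof (rule dependent_nat_choice)
    show "\<exists>N. N \<in> \<A>" using assms(2) by blast
    show "\<exists>N'. N' \<in> \<A> \<and> N \<subset> N'" if "N \<in> \<A>" for N using * that by blast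
  qed
  then obtain N where N: "\<And>n::nat. N n \<in> \<A>" "\<And>n. N n \<subset> N (Suc n)" by blast
  obtain k where "\<And>n. n \<ge> k \<Longrightarrow> N n = N k"
    by (rule noetherian_submoduleD[OF D, of N]) (use sub N(1) psubset_imp_subset[OF N(2)] in auto)
  from this[of "Suc k"] show False using N(2)[of k] by simp
qed

text \<open>A maximal finitely generated submodule of K exhausts K, since any further element could
  be adjoined. That U generates is expressed by minimality: each submodule containing U contains
  K.\<close>

lemma (in module) noetherian_submodule_fg:
  assumes D: "noetherian_submodule R M D" and K: "submodule K R M" "K \<subseteq> D"
  shows "\<exists>U. finite U \<and> U \<subseteq> K \<and> (\<forall>N. submodule N R M \<longrightarrow> U \<subseteq> N \<longrightarrow> K \<subseteq> N)"
proof -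
  define \<A> where "\<A> = {L. submodule L R M \<and> L \<subseteq> K \<and>
    (\<exists>U. finite U \<and> U \<subseteq> L \<and> (\<forall>N. submodule N R M \<longrightarrow> U \<subseteq> N \<longrightarrow> L \<subseteq> N))}"
  have "submodule {\<zero>\<^bsub>M\<^esub>} R M" by (rule submoduleI') auto
  then have "{\<zero>\<^bsub>M\<^esub>} \<in> \<A>" unfolding \<A>_def using submoduleD(2) submoduleD(2)[OF K(1)] by auto
  then obtain L where L: "L \<in> \<A>" and max: "\<And>N. N \<in> \<A> \<Longrightarrow> L \<subseteq> N \<Longrightarrow> N = L"
  proof -
    have "\<exists>N\<in>\<A>. \<forall>N'\<in>\<A>. N \<subseteq> N' \<longrightarrow> N' = N"
    proof (rule noetherian_submodule_maximal[OF D])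
      show "\<A> \<noteq> {}" using \<open>{\<zero>\<^bsub>M\<^esub>} \<in> \<A>\<close> by blast
      show "submodule N R M \<and> N \<subseteq> D" if "N \<in> \<A>" for N using that K(2) by (auto simp: \<A>_def)
    qed
    then show thesis using that by blast
  qed
  have Lsub: "submodule L R M" and LK: "L \<subseteq> K" using L by (auto simp: \<A>_def)
  obtain U where U: "finite U" "U \<subseteq> L" "\<And>N. submodule N R M \<Longrightarrow> U \<subseteq> N \<Longrightarrow> L \<subseteq> N"
    using L unfolding \<A>_def by blast
  have "K \<subseteq> L"
  proof
    fix g assume g: "g \<in> K"
    have gc: "g \<in> carrier M" using submoduleD(1)[OF K(1)] g by blast
    note span = span_elt[OF Lsub gc]
    have "span_elt R M L g \<subseteq> N" if "submodule N R M" "insert g U \<subseteq> N" for N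
      using span(4)[OF that(1) U(3)[OF that(1)]] that(2) by blast
    moreover have "finite (insert g U)" "insert g U \<subseteq> span_elt R M L g" using U(1,2) span(2,3) by auto
    ultimately have "span_elt R M L g \<in> \<A>"
      unfolding \<A>_def using span(1) span(4)[OF K(1) LK g] by blast
    then show "g \<in> L" using max span(2,3) by blast
  qed
  then have "L = K" using LK by blast
  then show ?thesis using U by blast
qed

text \<open>The free module on A. The value zero outside A makes equality of functions the same as
  equality of coordinate vectors.\<close>

definition fun_module :: "('a, 'x) ring_scheme \<Rightarrow> 'i set \<Rightarrow> ('a, 'i \<Rightarrow> 'a) module"
  where "fun_module R A = \<lparr>carrier = {f. (\<forall>i\<in>A. f i \<in> carrier R) \<and> (\<forall>i. i \<notin> A \<longrightarrow> f i = \<zero>\<^bsub>R\<^esub>)},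
    monoid.mult = (\<lambda>f g. f), one = (\<lambda>_. \<zero>\<^bsub>R\<^esub>), ring.zero = (\<lambda>_. \<zero>\<^bsub>R\<^esub>),
    add = (\<lambda>f g i. f i \<oplus>\<^bsub>R\<^esub> g i), smult = (\<lambda>r f i. r \<otimes>\<^bsub>R\<^esub> f i)\<rparr>"

lemma fun_module_simps [simp]:
  "\<zero>\<^bsub>fun_module R A\<^esub> = (\<lambda>_. \<zero>\<^bsub>R\<^esub>)"
  "f \<oplus>\<^bsub>fun_module R A\<^esub> g = (\<lambda>i. f i \<oplus>\<^bsub>R\<^esub> g i)"
  "r \<odot>\<^bsub>fun_module R A\<^esub> f = (\<lambda>i. r \<otimes>\<^bsub>R\<^esub> f i)"
  by (simp_all add: fun_module_def)

lemma fun_module_carrier: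
  "f \<in> carrier (fun_module R A) \<longleftrightarrow> (\<forall>i\<in>A. f i \<in> carrier R) \<and> (\<forall>i. i \<notin> A \<longrightarrow> f i = \<zero>\<^bsub>R\<^esub>)"
  by (simp add: fun_module_def)

context cring
begin

lemma fun_module_closed: "f \<in> carrier (fun_module R A) \<Longrightarrow> f i \<in> carrier R"
  by (cases "i \<in> A") (auto simp: fun_module_carrier)

lemma fun_module: "module R (fun_module R A)"
proof (rule moduleI[OF is_cring])
  show "abelian_group (fun_module R A)"
  proof (rule abelian_groupI)
    fix f assume f: "f \<in> carrier (fun_module R A)"
    show "\<exists>g\<in>carrier (fun_module R A). g \<oplus>\<^bsub>fun_module R A\<^esub> f = \<zero>\<^bsub>fun_module R A\<^esub>"
      by (rule bexI[of _ "\<lambda>i. \<ominus> f i"])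
        (use f fun_module_closed[OF f] in \<open>auto simp: fun_module_carrier l_neg\<close>)
  next
    fix f g h assume "f \<in> carrier (fun_module R A)" "g \<in> carrier (fun_module R A)" "h \<in> carrier (fun_module R A)"
    note c = this[THEN fun_module_closed]
    show "f \<oplus>\<^bsub>fun_module R A\<^esub> g \<oplus>\<^bsub>fun_module R A\<^esub> h = f \<oplus>\<^bsub>fun_module R A\<^esub> (g \<oplus>\<^bsub>fun_module R A\<^esub> h)"
      using c by (auto simp: a_assoc)
  next
    fix f g assume "f \<in> carrier (fun_module R A)" "g \<in> carrier (fun_module R A)"
    note c = this[THEN fun_module_closed]
    show "f \<oplus>\<^bsub>fun_module R A\<^esub> g = g \<oplus>\<^bsub>fun_module R A\<^esub> f" using c by (auto simp: a_comm)
  next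
    fix f assume "f \<in> carrier (fun_module R A)"
    note c = fun_module_closed[OF this]
    show "\<zero>\<^bsub>fun_module R A\<^esub> \<oplus>\<^bsub>fun_module R A\<^esub> f = f" using c by auto
  qed (auto simp: fun_module_carrier)
next
  fix f g a b assume a: "a \<in> carrier R" and "f \<in> carrier (fun_module R A)" "g \<in> carrier (fun_module R A)"
  note c = this(2,3)[THEN fun_module_closed]
  show "a \<odot>\<^bsub>fun_module R A\<^esub> (f \<oplus>\<^bsub>fun_module R A\<^esub> g) = a \<odot>\<^bsub>fun_module R A\<^esub> f \<oplus>\<^bsub>fun_module R A\<^esub> a \<odot>\<^bsub>fun_module R A\<^esub> g"
    using a c by (auto simp: r_distr)
next
  fix f a b assume a: "a \<in> carrier R" "b \<in> carrier R" and "f \<in> carrier (fun_module R A)"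
  note c = fun_module_closed[OF this(3)]
  show "(a \<oplus> b) \<odot>\<^bsub>fun_module R A\<^esub> f = a \<odot>\<^bsub>fun_module R A\<^esub> f \<oplus>\<^bsub>fun_module R A\<^esub> b \<odot>\<^bsub>fun_module R A\<^esub> f"
    using a c by (auto simp: l_distr)
  show "(a \<otimes> b) \<odot>\<^bsub>fun_module R A\<^esub> f = a \<odot>\<^bsub>fun_module R A\<^esub> (b \<odot>\<^bsub>fun_module R A\<^esub> f)"
    using a c by (auto simp: m_assoc)
next
  fix f assume "f \<in> carrier (fun_module R A)"
  note c = fun_module_closed[OF this]
  show "\<one> \<odot>\<^bsub>fun_module R A\<^esub> f = f" using c by auto
qed (auto simp: fun_module_carrier)

definition unit_fun :: "'i \<Rightarrow> 'i \<Rightarrow> 'a"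
  where "unit_fun a i = (if i = a then \<one> else \<zero>)"

lemma unit_fun_closed: "a \<in> A \<Longrightarrow> unit_fun a \<in> carrier (fun_module R A)"
  by (auto simp: fun_module_carrier unit_fun_def)

lemma fun_module_mem_submodule:
  assumes "finite A" "submodule N R (fun_module R A)" and f: "f \<in> carrier (fun_module R A)"
    and N: "\<And>a. a \<in> A \<Longrightarrow> f a \<odot>\<^bsub>fun_module R A\<^esub> unit_fun a \<in> N"
  shows "f \<in> N"
proof -
  note N' = submoduleD[OF assms(2)]
  have fc: "f i \<in> carrier R" for i by (rule fun_module_closed[OF f])
  \<comment> \<open>The partial sums over B of the expansion of f in the standard basis, built up
    one coordinate at a time.\<close>
  have "(\<lambda>i. if i \<in> B then f i else \<zero>) \<in> N" if "B \<subseteq> A" for B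
    using finite_subset[OF that assms(1)] that
  proof (induction B)
    case empty
    then show ?case using N'(2) by simp
  next
    case (insert b B)
    then have "(\<lambda>i. if i \<in> B then f i else \<zero>) \<in> N" "f b \<odot>\<^bsub>fun_module R A\<^esub> unit_fun b \<in> N" using N by auto
    from N'(3)[OF this] have *: "(\<lambda>i. (if i \<in> B then f i else \<zero>) \<oplus> f b \<otimes> unit_fun b i) \<in> N" by simp
    have "(\<lambda>i. (if i \<in> B then f i else \<zero>) \<oplus> f b \<otimes> unit_fun b i) = (\<lambda>i. if i \<in> insert b B then f i else \<zero>)"
    proof
      fix i
      show "(if i \<in> B then f i else \<zero>) \<oplus> f b \<otimes> unit_fun b i = (if i \<in> insert b B then f i else \<zero>)"
        using insert.hyps(2) fc[of b] fc[of i] by (cases "i = b") (auto simp: unit_fun_def)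
    qed
    with * show ?case by simp
  qed
  from this[of A] have "(\<lambda>i. if i \<in> A then f i else \<zero>) \<in> N" by simp
  moreover have "(\<lambda>i. if i \<in> A then f i else \<zero>) = f" using f by (auto simp: fun_module_carrier)
  ultimately show ?thesis by simp
qed

lemma finite_fun_module:
  assumes "finite A"
  shows "finite_module R (fun_module R A)"
  unfolding finite_module_def
proof (intro conjI fun_module exI[of _ "unit_fun ` A"] allI impI)
  show "unit_fun ` A \<subseteq> carrier (fun_module R A)" using unit_fun_closed by auto
  show "finite (unit_fun ` A)" using assms by simp
  fix N assume N: "submodule N R (fun_module R A) \<and> unit_fun ` A \<subseteq> N"
  have "f \<in> N" if "f \<in> carrier (fun_module R A)" for f
  proof (rule fun_module_mem_submodule[OF assms conjunct1[OF N] that])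
    fix a assume "a \<in> A"
    then show "f a \<odot>\<^bsub>fun_module R A\<^esub> unit_fun a \<in> N"
      using submoduleD(4)[OF conjunct1[OF N] fun_module_closed[OF that]] N by blast
  qed
  then show "N = carrier (fun_module R A)" using submoduleD(1)[OF conjunct1[OF N]] by blast
qed

end

lemma (in module) finsum_self_linear:
  assumes "finite U" "U \<subseteq> carrier M"
  defines "L \<equiv> \<lambda>k. \<Oplus>\<^bsub>M\<^esub>u\<in>U. k u \<odot>\<^bsub>M\<^esub> u"
  shows "\<And>k. k \<in> carrier (fun_module R U) \<Longrightarrow> L k \<in> carrier M"
    and "\<And>k l. k \<in> carrier (fun_module R U) \<Longrightarrow> l \<in> carrier (fun_module R U) \<Longrightarrow>
      L (k \<oplus>\<^bsub>fun_module R U\<^esub> l) = L k \<oplus>\<^bsub>M\<^esub> L l"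
    and "\<And>r k. r \<in> carrier R \<Longrightarrow> k \<in> carrier (fun_module R U) \<Longrightarrow>
      L (r \<odot>\<^bsub>fun_module R U\<^esub> k) = r \<odot>\<^bsub>M\<^esub> L k"
proof -
  have Uc: "u \<in> carrier M" if "u \<in> U" for u using assms(2) that by blast
  note c = R.fun_module_closed
  show "L k \<in> carrier M" if "k \<in> carrier (fun_module R U)" for k
    unfolding L_def by (rule M.finsum_closed) (use Uc c[OF that] in auto)
  show "L (k \<oplus>\<^bsub>fun_module R U\<^esub> l) = L k \<oplus>\<^bsub>M\<^esub> L l"
    if k: "k \<in> carrier (fun_module R U)" and l: "l \<in> carrier (fun_module R U)" for k l
  proof -
    have "(\<Oplus>\<^bsub>M\<^esub>u\<in>U. (k u \<oplus> l u) \<odot>\<^bsub>M\<^esub> u) = (\<Oplus>\<^bsub>M\<^esub>u\<in>U. k u \<odot>\<^bsub>M\<^esub> u \<oplus>\<^bsub>M\<^esub> l u \<odot>\<^bsub>M\<^esub> u)"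
      by (rule M.finsum_cong') (use Uc c[OF k] c[OF l] in \<open>auto simp: smult_l_distr\<close>)
    also have "\<dots> = L k \<oplus>\<^bsub>M\<^esub> L l"
      unfolding L_def by (rule M.finsum_addf) (use Uc c[OF k] c[OF l] in auto)
    finally show ?thesis by (simp add: L_def)
  qed
  show "L (r \<odot>\<^bsub>fun_module R U\<^esub> k) = r \<odot>\<^bsub>M\<^esub> L k"
    if r: "r \<in> carrier R" and k: "k \<in> carrier (fun_module R U)" for r k
  proof -
    have "(\<Oplus>\<^bsub>M\<^esub>u\<in>U. (r \<otimes> k u) \<odot>\<^bsub>M\<^esub> u) = (\<Oplus>\<^bsub>M\<^esub>u\<in>U. r \<odot>\<^bsub>M\<^esub> (k u \<odot>\<^bsub>M\<^esub> u))"
      by (rule M.finsum_cong') (use Uc c[OF k] r in \<open>auto simp: smult_assoc1\<close>)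
    also have "\<dots> = r \<odot>\<^bsub>M\<^esub> L k"
      unfolding L_def by (rule finsum_smult_ldistr[symmetric]) (use Uc c[OF k] r assms(1) in auto)
    finally show ?thesis by (simp add: L_def)
  qed
qed

lemma (in cring) finsum_pairing:
  assumes "finite U"
  defines "P \<equiv> \<lambda>k v. \<Oplus>u\<in>U. k u \<otimes> v u"
  assumes v: "v \<in> carrier (fun_module R U)" and k: "k \<in> carrier (fun_module R U)"
  shows "P k v \<in> carrier R" "P k v = P v k"
    and "\<And>l. l \<in> carrier (fun_module R U) \<Longrightarrow> P (k \<oplus>\<^bsub>fun_module R U\<^esub> l) v = P k v \<oplus> P l v"
    and "\<And>r. r \<in> carrier R \<Longrightarrow> P (r \<odot>\<^bsub>fun_module R U\<^esub> k) v = r \<otimes> P k v"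
proof -
  note c = fun_module_closed
  show "P k v \<in> carrier R" unfolding P_def by (rule finsum_closed) (use c[OF v] c[OF k] in auto)
  show "P k v = P v k" unfolding P_def
    by (rule finsum_cong') (use c[OF v] c[OF k] in \<open>auto simp: m_comm\<close>)
  show "P (k \<oplus>\<^bsub>fun_module R U\<^esub> l) v = P k v \<oplus> P l v" if l: "l \<in> carrier (fun_module R U)" for l
  proof -
    have "(\<Oplus>u\<in>U. (k u \<oplus> l u) \<otimes> v u) = (\<Oplus>u\<in>U. k u \<otimes> v u \<oplus> l u \<otimes> v u)"
      by (rule finsum_cong') (use c[OF v] c[OF k] c[OF l] in \<open>auto simp: l_distr\<close>)
    also have "\<dots> = P k v \<oplus> P l v"
      unfolding P_def by (rule finsum_addf) (use c[OF v] c[OF k] c[OF l] in auto)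
    finally show ?thesis by (simp add: P_def)
  qed
  show "P (r \<odot>\<^bsub>fun_module R U\<^esub> k) v = r \<otimes> P k v" if r: "r \<in> carrier R" for r
  proof -
    have "(\<Oplus>u\<in>U. (r \<otimes> k u) \<otimes> v u) = (\<Oplus>u\<in>U. r \<otimes> (k u \<otimes> v u))"
      by (rule finsum_cong') (use c[OF v] c[OF k] r in \<open>auto simp: m_assoc\<close>)
    also have "\<dots> = r \<otimes> P k v"
      unfolding P_def by (rule finsum_rdistr[symmetric]) (use c[OF v] c[OF k] r assms(1) in auto)
    finally show ?thesis by (simp add: P_def)
  qed
qed

text \<open>The form in which Krull's intersection theorem is used for \<open>M/W\<close> localized at \<open>\<mm>\<close>.\<close>

lemma (in noetherian_ring) maximal_submodule_avoiding:
  assumes "cring R" and \<mm>: "maximalideal \<mm> R" and M: "module R M" "noetherian_submodule R M (carrier M)"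
    and W: "submodule W R M" and w: "w \<in> carrier M" "\<And>r. r \<in> carrier R \<Longrightarrow> r \<odot>\<^bsub>M\<^esub> w \<in> W \<Longrightarrow> r \<in> \<mm>"
  obtains W' where "submodule W' R M" "W \<subseteq> W'" "w \<notin> W'"
    "\<And>x. x \<in> \<mm> \<Longrightarrow> \<exists>n::nat. \<forall>f\<in>carrier M. x [^] n \<odot>\<^bsub>M\<^esub> f \<in> W'"
proof -
  interpret cring R by fact
  interpret M: module R M by fact
  interpret m: maximalideal \<mm> R by fact
  \<comment> \<open>The condition says that w is nonzero in M/W' localized at \<open>\<mm>\<close>.
    A maximal W' of this kind makes every nonzero submodule of M/W' contain r w for some r outside
    \<open>\<mm>\<close>.\<close>
  define \<A> where "\<A> = {W'. submodule W' R M \<and> W \<subseteq> W' \<and> (\<forall>r\<in>carrier R. r \<odot>\<^bsub>M\<^esub> w \<in> W' \<longrightarrow> r \<in> \<mm>)}"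
  have "\<exists>N\<in>\<A>. \<forall>N'\<in>\<A>. N \<subseteq> N' \<longrightarrow> N' = N"
  proof (rule noetherian_submodule_maximal[OF M(2)])
    show "\<A> \<noteq> {}" using W w by (auto simp: \<A>_def)
    show "submodule N R M \<and> N \<subseteq> carrier M" if "N \<in> \<A>" for N
      using that submoduleD(1) by (auto simp: \<A>_def)
  qed
  then obtain W' where W'A: "W' \<in> \<A>" and max: "\<And>N. N \<in> \<A> \<Longrightarrow> W' \<subseteq> N \<Longrightarrow> N = W'" by blast
  have W': "submodule W' R M" "W \<subseteq> W'" and W'm: "\<And>r. r \<in> carrier R \<Longrightarrow> r \<odot>\<^bsub>M\<^esub> w \<in> W' \<Longrightarrow> r \<in> \<mm>"
    using W'A by (auto simp: \<A>_def)
  note sub = submoduleD[OF W'(1)]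
  have bigger: "\<exists>r\<in>carrier R. r \<notin> \<mm> \<and> (\<exists>w'\<in>W'. \<exists>b\<in>carrier R. r \<odot>\<^bsub>M\<^esub> w = w' \<oplus>\<^bsub>M\<^esub> b \<odot>\<^bsub>M\<^esub> g)"
    if g: "g \<in> carrier M" "g \<notin> W'" for g
  proof -
    note span = M.span_elt[OF W'(1) g(1)]
    have "span_elt R M W' g \<notin> \<A>" using max[OF _ span(2)] span(3) g(2) by blast
    then obtain r where "r \<in> carrier R" "r \<odot>\<^bsub>M\<^esub> w \<in> span_elt R M W' g" "r \<notin> \<mm>"
      using span(1,2) W'(2) unfolding \<A>_def by blast
    then show ?thesis unfolding span_elt_def by blast
  qed
  have one_m: "\<one> \<notin> \<mm>" using m.one_imp_carrier m.I_notcarr by blast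
  \<comment> \<open>Otherwise r w would be b x w modulo W' with r outside \<open>\<mm>\<close>. Then
    (r - b x) w would lie in W', although r - b x is outside \<open>\<mm>\<close>.\<close>
  have xw: "x \<odot>\<^bsub>M\<^esub> w \<in> W'" if x: "x \<in> \<mm>" for x
  proof (rule ccontr)
    have xc: "x \<in> carrier R" using m.Icarr[OF x] .
    assume "x \<odot>\<^bsub>M\<^esub> w \<notin> W'"
    then obtain r w' b where r: "r \<in> carrier R" "r \<notin> \<mm>" and w': "w' \<in> W'" and b: "b \<in> carrier R"
      and eq: "r \<odot>\<^bsub>M\<^esub> w = w' \<oplus>\<^bsub>M\<^esub> b \<odot>\<^bsub>M\<^esub> (x \<odot>\<^bsub>M\<^esub> w)"
      using bigger[OF M.smult_closed[OF xc w(1)]] by blast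
    have w'c: "w' \<in> carrier M" using w' sub(1) by blast
    have "(r \<ominus> b \<otimes> x) \<odot>\<^bsub>M\<^esub> w = r \<odot>\<^bsub>M\<^esub> w \<ominus>\<^bsub>M\<^esub> b \<odot>\<^bsub>M\<^esub> (x \<odot>\<^bsub>M\<^esub> w)"
      using r(1) b xc w(1) by (simp add: M.module_simps)
    also have "\<dots> = w'" unfolding eq using w'c b xc w(1) by (simp add: M.M.minus_eq M.M.a_assoc M.M.r_neg)
    finally have "r \<ominus> b \<otimes> x \<in> \<mm>" using W'm[of "r \<ominus> b \<otimes> x"] w' r(1) b xc by simp
    moreover have "b \<otimes> x \<in> \<mm>" by (rule m.I_l_closed[OF x b])
    ultimately have "(r \<ominus> b \<otimes> x) \<oplus> b \<otimes> x \<in> \<mm>" by (rule m.a_closed)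
    moreover have "(r \<ominus> b \<otimes> x) \<oplus> b \<otimes> x = r" using r(1) b xc by algebra
    ultimately show False using r(2) by simp
  qed
  have pow: "\<exists>n::nat. \<forall>f\<in>carrier M. x [^] n \<odot>\<^bsub>M\<^esub> f \<in> W'" if x: "x \<in> \<mm>" for x
  proof -
    have xc: "x \<in> carrier R" using m.Icarr[OF x] .
    \<comment> \<open>The kernels of x^n on M/W' are stationary at some k. If x^k f were outside W',
      some r w with r outside \<open>\<mm>\<close> would equal b x^k f modulo W'. As x kills w, b f
      is in N (k + 1) = N k, so r w would lie in W'.\<close>
    define N where "N n = {f \<in> carrier M. x [^] (n::nat) \<odot>\<^bsub>M\<^esub> f \<in> W'}" for n
    have xs: "x [^] Suc n \<odot>\<^bsub>M\<^esub> f = x \<odot>\<^bsub>M\<^esub> (x [^] n \<odot>\<^bsub>M\<^esub> f)" if "f \<in> carrier M" for n f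
      using xc that m_comm[of "x [^] n" x] by (simp add: M.smult_assoc1)
    have Nsub: "submodule (N n) R M" for n
    proof (rule M.submoduleI')
      show "N n \<subseteq> carrier M" by (auto simp: N_def)
      show "\<zero>\<^bsub>M\<^esub> \<in> N n" using sub(2) xc by (simp add: N_def)
      show "a \<oplus>\<^bsub>M\<^esub> b \<in> N n" if "a \<in> N n" "b \<in> N n" for a b
        using that sub(3) xc by (simp add: N_def M.smult_r_distr)
      show "r \<odot>\<^bsub>M\<^esub> a \<in> N n" if "r \<in> carrier R" "a \<in> N n" for r a
        using that sub(4) xc M.smult_left_commute[of "x [^] n" r a] by (simp add: N_def)
    qed
    obtain k where k: "\<And>n. n \<ge> k \<Longrightarrow> N n = N k"
    proof (rule noetherian_submoduleD[OF M(2), of N])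
      show "N n \<subseteq> carrier M" for n by (auto simp: N_def)
      show "N n \<subseteq> N (Suc n)" for n
        using sub(4)[OF xc] xs by (auto simp: N_def simp del: nat_pow_Suc)
    qed (use Nsub in auto)
    have "x [^] k \<odot>\<^bsub>M\<^esub> f \<in> W'" if f: "f \<in> carrier M" for f
    proof (rule ccontr)
      assume *: "x [^] k \<odot>\<^bsub>M\<^esub> f \<notin> W'"
      have kc: "x [^] k \<in> carrier R" using xc by simp
      obtain r w' b where r: "r \<in> carrier R" "r \<notin> \<mm>" and w': "w' \<in> W'" and b: "b \<in> carrier R"
        and eq: "r \<odot>\<^bsub>M\<^esub> w = w' \<oplus>\<^bsub>M\<^esub> b \<odot>\<^bsub>M\<^esub> (x [^] k \<odot>\<^bsub>M\<^esub> f)"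
        using bigger[OF M.smult_closed[OF kc f] *] by blast
      have w'c: "w' \<in> carrier M" using w' sub(1) by blast
      have kf: "x [^] k \<odot>\<^bsub>M\<^esub> f \<in> carrier M" using kc f by simp
      have "x \<odot>\<^bsub>M\<^esub> (b \<odot>\<^bsub>M\<^esub> (x [^] k \<odot>\<^bsub>M\<^esub> f)) = x \<odot>\<^bsub>M\<^esub> (r \<odot>\<^bsub>M\<^esub> w) \<ominus>\<^bsub>M\<^esub> x \<odot>\<^bsub>M\<^esub> w'"
        unfolding eq using xc b kf w'c by (simp add: M.smult_r_distr M.M.minus_eq M.M.a_comm[of "x \<odot>\<^bsub>M\<^esub> w'"] M.M.a_assoc M.M.r_neg)
      also have "x \<odot>\<^bsub>M\<^esub> (r \<odot>\<^bsub>M\<^esub> w) = r \<odot>\<^bsub>M\<^esub> (x \<odot>\<^bsub>M\<^esub> w)" by (rule M.smult_left_commute[OF xc r(1) w(1)])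
      also have "r \<odot>\<^bsub>M\<^esub> (x \<odot>\<^bsub>M\<^esub> w) \<ominus>\<^bsub>M\<^esub> x \<odot>\<^bsub>M\<^esub> w' \<in> W'"
        by (rule M.submodule_minus[OF W'(1) sub(4)[OF r(1) xw[OF x]] sub(4)[OF xc w']])
      also have "x \<odot>\<^bsub>M\<^esub> (b \<odot>\<^bsub>M\<^esub> (x [^] k \<odot>\<^bsub>M\<^esub> f)) = x [^] Suc k \<odot>\<^bsub>M\<^esub> (b \<odot>\<^bsub>M\<^esub> f)"
        using xs[OF M.smult_closed[OF b f], of k] M.smult_left_commute[OF b kc f] by simp
      finally have "b \<odot>\<^bsub>M\<^esub> f \<in> N (Suc k)" using b f by (simp add: N_def)
      moreover have "N (Suc k) = N k" by (rule k) simp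
      ultimately have "b \<odot>\<^bsub>M\<^esub> f \<in> N k" by blast
      then have "x [^] k \<odot>\<^bsub>M\<^esub> (b \<odot>\<^bsub>M\<^esub> f) \<in> W'" by (simp add: N_def)
      then have "b \<odot>\<^bsub>M\<^esub> (x [^] k \<odot>\<^bsub>M\<^esub> f) \<in> W'" using M.smult_left_commute[OF b kc f] by simp
      then have "r \<odot>\<^bsub>M\<^esub> w \<in> W'" unfolding eq using sub(3) w' by blast
      then show False using W'm r by blast
    qed
    then show ?thesis by blast
  qed
  have "w \<notin> W'" using W'm[OF one_closed] w(1) one_m by auto
  then show ?thesis using that[OF W' _ pow] by blast
qed

text \<open>With \<open>M\<close> presented by generators \<open>U\<close> and finitely many relations \<open>KG\<close>, the homomorphisms
  \<open>M \<rightarrow> R\<close> with \<open>s \<mapsto> c\<close> are the solutions of a linear system over \<open>R\<close>, with right hand side \<open>w\<close>.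
  By Krull's theorem it suffices to solve it modulo enough ideals at each maximal ideal.\<close>

theorem hom_exists_if_self_injective:
  fixes R :: "('a, 'x) ring_scheme" (structure) and M :: "('a, 'b) module"
  assumes "noetherian_domain R" "approx_gorenstein R" and fin: "finite_module R M"
    and s: "s \<in> carrier M" and c: "c \<in> carrier R"
    and N: "\<And>J. ideal J R \<Longrightarrow> submodule (N J) R M"
      "\<And>J j x. ideal J R \<Longrightarrow> j \<in> J \<Longrightarrow> x \<in> carrier M \<Longrightarrow> j \<odot>\<^bsub>M\<^esub> x \<in> N J"
    and cond: "\<And>J r. ideal J R \<Longrightarrow> r \<in> carrier R \<Longrightarrow> r \<odot>\<^bsub>M\<^esub> s \<in> N J \<Longrightarrow> r \<otimes> c \<in> J"
  shows "\<exists>\<phi>\<in>mod_hom R M (self_module R). \<phi> s = c"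
proof -
  interpret noetherian_domain R by fact
  have Mm: "module R M" using fin by (simp add: finite_module_def)
  interpret M: module R M by (rule Mm)
  obtain U where U: "finite U" "U \<subseteq> carrier M" "\<And>N. submodule N R M \<Longrightarrow> U \<subseteq> N \<Longrightarrow> N = carrier M"
    using fin unfolding finite_module_def by blast
  define F where "F = fun_module R U"
  have Fm: "module R F" unfolding F_def by (rule fun_module)
  interpret F: module R F by (rule Fm)
  \<comment> \<open>L is the presentation of M by the free module on U. The pairing P k v evaluates
    at L k the prospective homomorphism with values v u on the generators.\<close>
  define L where "L k = (\<Oplus>\<^bsub>M\<^esub>u\<in>U. k u \<odot>\<^bsub>M\<^esub> u)" for k
  define P where "P k v = (\<Oplus>u\<in>U. k u \<otimes> v u)" for k v
  note L = M.finsum_self_linear[OF U(1,2), folded L_def F_def]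
  note P = finsum_pairing[OF U(1), folded P_def F_def]
  have L_unit: "L (unit_fun u) = u" if "u \<in> U" for u
  proof -
    have "L (unit_fun u) = (\<Oplus>\<^bsub>M\<^esub>u'\<in>U. if u = u' then u' else \<zero>\<^bsub>M\<^esub>)"
      unfolding L_def by (rule M.M.finsum_cong') (use U(2) in \<open>auto simp: unit_fun_def\<close>)
    also have "\<dots> = u" by (rule M.M.finsum_singleton[OF that U(1)]) (use U(2) in auto)
    finally show ?thesis .
  qed
  have L_surj: "\<exists>k\<in>carrier F. L k = x" if "x \<in> carrier M" for x
  proof -
    have "submodule (L ` carrier F) R M"
    proof (rule M.submoduleI')
      show "L ` carrier F \<subseteq> carrier M" using L(1) by blast
      have "L (\<zero> \<odot>\<^bsub>F\<^esub> \<zero>\<^bsub>F\<^esub>) = \<zero>\<^bsub>M\<^esub>" using L(3)[OF zero_closed F.M.zero_closed] L(1)[OF F.M.zero_closed] by simp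
      then show "\<zero>\<^bsub>M\<^esub> \<in> L ` carrier F" using F.M.zero_closed by (intro rev_image_eqI[of "\<zero>\<^bsub>F\<^esub>"]) auto
      show "a \<oplus>\<^bsub>M\<^esub> b \<in> L ` carrier F" if "a \<in> L ` carrier F" "b \<in> L ` carrier F" for a b
        using that L(2) F.M.a_closed by (metis (no_types, lifting) imageE image_eqI)
      show "r \<odot>\<^bsub>M\<^esub> a \<in> L ` carrier F" if "r \<in> carrier R" "a \<in> L ` carrier F" for r a
        using that L(3) F.smult_closed by (metis (no_types, lifting) imageE image_eqI)
    qed
    moreover have "U \<subseteq> L ` carrier F"
      using L_unit unit_fun_closed[of _ U] unfolding F_def by (metis image_eqI subsetI)
    ultimately have "L ` carrier F = carrier M" by (rule U(3))
    then show ?thesis using that by (metis imageE)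
  qed
  obtain \<epsilon> where \<epsilon>: "\<epsilon> \<in> carrier F" "L \<epsilon> = s" using L_surj[OF s] by blast
  define Ker where "Ker = {k \<in> carrier F. L k = \<zero>\<^bsub>M\<^esub>}"
  have L_zero: "L \<zero>\<^bsub>F\<^esub> = \<zero>\<^bsub>M\<^esub>"
    using L(3)[OF zero_closed F.M.zero_closed] L(1)[OF F.M.zero_closed] F.smult_l_null[OF F.M.zero_closed] by simp
  have Ker: "submodule Ker R F"
    by (rule F.submoduleI') (use L L_zero in \<open>auto simp: Ker_def\<close>)
  have Fn: "noetherian_submodule R F (carrier F)"
    unfolding F_def by (rule noetherian_submodule_carrier[OF finite_fun_module[OF U(1)]])
  obtain KG where KG: "finite KG" "KG \<subseteq> Ker" "\<And>N. submodule N R F \<Longrightarrow> KG \<subseteq> N \<Longrightarrow> Ker \<subseteq> N"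
    using F.noetherian_submodule_fg[OF Fn Ker submoduleD(1)[OF Ker]] by blast
  have KGc: "k \<in> carrier F" if "k \<in> KG" for k using KG(2) that by (auto simp: Ker_def)
  \<comment> \<open>The rows of the system: \<open>None\<close> stands for the equation P
    \<open>\<epsilon>\<close> v = c at s, and \<open>Some k\<close> for the equation P k v = 0 at
    the relation k. T is the coefficient map, and W is its image.\<close>
  define Ix where "Ix = insert None (Some ` KG)"
  define H where "H = fun_module R Ix"
  have finI: "finite Ix" using KG(1) by (simp add: Ix_def)
  have Hm: "module R H" unfolding H_def by (rule fun_module)
  interpret H: module R H by (rule Hm)
  have Hn: "noetherian_submodule R H (carrier H)"
    unfolding H_def by (rule noetherian_submodule_carrier[OF finite_fun_module[OF finI]])
  define T where "T v i = (case i of None \<Rightarrow> P \<epsilon> v | Some k \<Rightarrow> if k \<in> KG then P k v else \<zero>)" for v i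
  have T_c: "T v \<in> carrier H" if "v \<in> carrier F" for v
    using P(1)[OF that] \<epsilon>(1) KGc by (auto simp: H_def fun_module_carrier T_def Ix_def split: option.splits)
  have P_add: "P k (v \<oplus>\<^bsub>F\<^esub> v') = P k v \<oplus> P k v'" if "k \<in> carrier F" "v \<in> carrier F" "v' \<in> carrier F" for k v v'
    using P(3)[OF that] P(2)[OF that(1,2)] P(2)[OF that(1,3)] P(2)[OF that(1) F.M.a_closed[OF that(2,3)]] by simp
  have P_smult: "P k (r \<odot>\<^bsub>F\<^esub> v) = r \<otimes> P k v" if "k \<in> carrier F" "v \<in> carrier F" "r \<in> carrier R" for k v r
    using P(4)[OF that] P(2)[OF that(1,2)] P(2)[OF that(1) F.smult_closed[OF that(3,2)]] by simp
  have T_add: "T (v \<oplus>\<^bsub>F\<^esub> v') = T v \<oplus>\<^bsub>H\<^esub> T v'" if "v \<in> carrier F" "v' \<in> carrier F" for v v'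
    using P_add[OF \<epsilon>(1) that] P_add[OF KGc that] by (auto simp: T_def H_def split: option.splits)
  have T_smult: "T (r \<odot>\<^bsub>F\<^esub> v) = r \<odot>\<^bsub>H\<^esub> T v" if "v \<in> carrier F" "r \<in> carrier R" for r v
    using P_smult[OF \<epsilon>(1) that] P_smult[OF KGc that] that(2) by (auto simp: T_def H_def split: option.splits)
  define W where "W = T ` carrier F"
  have WI: "T v \<in> W" if "v \<in> carrier F" for v using that by (simp add: W_def)
  have W: "submodule W R H"
  proof (rule H.submoduleI')
    show "W \<subseteq> carrier H" using T_c by (auto simp: W_def)
    have "T (\<zero> \<odot>\<^bsub>F\<^esub> \<zero>\<^bsub>F\<^esub>) = \<zero>\<^bsub>H\<^esub>" using T_smult[OF F.M.zero_closed zero_closed] T_c[OF F.M.zero_closed] by simp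
    then show "\<zero>\<^bsub>H\<^esub> \<in> W" using WI[OF F.M.zero_closed] by simp
    show "a \<oplus>\<^bsub>H\<^esub> b \<in> W" if "a \<in> W" "b \<in> W" for a b
      using that T_add F.M.a_closed unfolding W_def by (metis (no_types, lifting) imageE image_eqI)
    show "r \<odot>\<^bsub>H\<^esub> a \<in> W" if "r \<in> carrier R" "a \<in> W" for r a
      using that T_smult F.smult_closed unfolding W_def by (metis (no_types, lifting) imageE image_eqI)
  qed
  define w where "w = (\<lambda>i::('b \<Rightarrow> 'a) option. if i = None then c else \<zero>)"
  have w: "w \<in> carrier H" using c by (auto simp: w_def H_def fun_module_carrier Ix_def)
  have "w \<in> W"
  proof (rule ccontr)
    assume wW: "w \<notin> W"
    \<comment> \<open>An unsolvable system makes (W : w) a proper ideal, and the obstruction is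
      studied at a maximal ideal above it.\<close>
    define I where "I = {r \<in> carrier R. r \<odot>\<^bsub>H\<^esub> w \<in> W}"
    have "ideal I R"
      by (rule idealI_cring) (use submoduleD[OF W] w in \<open>auto simp: I_def H.smult_l_distr H.smult_assoc1\<close>)
    moreover have "\<one> \<notin> I" using wW w by (simp add: I_def)
    ultimately obtain \<mm> where \<mm>: "maximalideal \<mm> R" "I \<subseteq> \<mm>" using exists_maximalideal by blast
    interpret m: maximalideal \<mm> R by (rule \<mm>(1))
    obtain W' where W': "submodule W' R H" "W \<subseteq> W'" "w \<notin> W'"
      "\<And>x. x \<in> \<mm> \<Longrightarrow> \<exists>n::nat. \<forall>f\<in>carrier H. x [^] n \<odot>\<^bsub>H\<^esub> f \<in> W'"
    proof (rule maximal_submodule_avoiding[OF is_cring \<mm>(1) Hm Hn W w])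
      show "r \<in> \<mm>" if "r \<in> carrier R" "r \<odot>\<^bsub>H\<^esub> w \<in> W" for r using that \<mm>(2) by (auto simp: I_def)
    qed blast
    note sub = submoduleD[OF W'(1)]
    \<comment> \<open>The annihilator of H/W'. It contains a power of every element of
      \<open>\<mm>\<close>, so a self-injective K exists inside it, and vectors with all coordinates
      in K lie in W'.\<close>
    define Q where "Q = {r \<in> carrier R. \<forall>f\<in>carrier H. r \<odot>\<^bsub>H\<^esub> f \<in> W'}"
    have Q: "ideal Q R"
      by (rule idealI_cring) (use sub in \<open>auto simp: Q_def H.smult_l_distr H.smult_assoc1\<close>)
    have "\<exists>k::nat. x [^] k \<in> Q" if "x \<in> \<mm>" for x
      using W'(4)[OF that] m.Icarr[OF that] by (auto simp: Q_def)
    then obtain K where K: "ideal K R" "K \<subseteq> Q" "self_injective_quotient R K"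
      using approx_gorenstein_self_injective_quotient[OF assms(1,2) \<mm>(1) Q] by blast
    have K_zero: "\<zero> \<in> K" by (rule additive_subgroup.zero_closed[OF ideal.axioms(1)[OF K(1)]])
    define G0 where "G0 = {(r \<odot>\<^bsub>M\<^esub> s, r \<odot>\<^bsub>self_module R\<^esub> c) | r. r \<in> carrier R}"
    obtain G where G: "linear_graph R M (self_module R) G" "G \<subseteq> carrier M \<times> carrier (self_module R)" "G0 \<subseteq> G"
      "\<And>x y. (x, y) \<in> G \<Longrightarrow> x \<in> N K \<longrightarrow> y \<in> K" "\<And>b. b \<in> carrier M \<Longrightarrow> \<exists>y. (b, y) \<in> G"
    proof (rule linear_graph_extension[OF Mm self_module M.carrier_is_submodule module.carrier_is_submodule[OF self_module],
          where P = "\<lambda>x y. x \<in> N K \<longrightarrow> y \<in> K" and ?G0.0 = G0])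
      show "linear_graph R M (self_module R) G0"
        unfolding G0_def by (rule linear_graph_multiples[OF Mm self_module s]) (simp add: c)
      show "G0 \<subseteq> carrier M \<times> carrier (self_module R)" using s c by (auto simp: G0_def)
      show "x \<in> N K \<longrightarrow> y \<in> K" if "(x, y) \<in> G0" for x y
        using that cond[OF K(1)] by (auto simp: G0_def)
    next
      fix G b assume G: "linear_graph R M (self_module R) G" "G \<subseteq> carrier M \<times> carrier (self_module R)"
        and PG: "\<And>x y. (x, y) \<in> G \<Longrightarrow> x \<in> N K \<longrightarrow> y \<in> K" and b: "b \<in> carrier M"
      have "\<exists>y\<in>carrier R. \<forall>x' y' r. (x', y') \<in> G \<longrightarrow> r \<in> carrier R \<longrightarrow> x' \<oplus>\<^bsub>M\<^esub> r \<odot>\<^bsub>M\<^esub> b \<in> N K \<longrightarrow> y' \<oplus> r \<otimes> y \<in> K"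
        by (rule self_injective_quotient_extend[where N = "N K", OF Mm K(3) N(1)[OF K(1)] N(2)[OF K(1)] G(1) _ _ b])
          (use G(2) PG in auto)
      then show "\<exists>y\<in>carrier (self_module R). \<forall>(x', y')\<in>G. \<forall>r\<in>carrier R. x' \<oplus>\<^bsub>M\<^esub> r \<odot>\<^bsub>M\<^esub> b \<in> N K \<longrightarrow>
          y' \<oplus>\<^bsub>self_module R\<^esub> r \<odot>\<^bsub>self_module R\<^esub> y \<in> K" by auto
    qed (rule that; assumption)
    \<comment> \<open>One of the possible values at each generator. The vector v solves the system
      only modulo K, because the values of G are determined only up to K.\<close>
    define v where "v u = (if u \<in> U then SOME y. (u, y) \<in> G else \<zero>)" for u
    have vG: "(u, v u) \<in> G" if "u \<in> U" for u
    proof -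
      have "u \<in> carrier M" using U(2) that by blast
      then show ?thesis using someI_ex[OF G(5)] that by (simp add: v_def)
    qed
    have vc: "v \<in> carrier F"
      using vG G(2) by (auto simp: F_def fun_module_carrier) (auto simp: v_def)
    have LP: "(L k, P k v) \<in> G" if k: "k \<in> carrier F" for k
    proof -
      have kc: "k u \<in> carrier R" "v u \<in> carrier R" for u
        using fun_module_closed[OF k[unfolded F_def]] fun_module_closed[OF vc[unfolded F_def]] by blast+
      have "((\<Oplus>\<^bsub>M\<^esub>u\<in>A. k u \<odot>\<^bsub>M\<^esub> u), (\<Oplus>u\<in>A. k u \<otimes> v u)) \<in> G" if "A \<subseteq> U" for A
        using finite_subset[OF that U(1)] that
      proof (induction A)
        case empty
        then show ?case using linear_graphD(1)[OF G(1)] by simp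
      next
        case (insert u A)
        have Ac: "u' \<in> carrier M" if "u' \<in> insert u A" for u' using insert.prems U(2) that by blast
        have "(k u \<odot>\<^bsub>M\<^esub> u, k u \<otimes> v u) \<in> G"
          using linear_graphD(3)[OF G(1) kc(1)[of u] vG[of u]] insert.prems by simp
        from linear_graphD(2)[OF G(1) this insert.IH] insert.prems
        have "(k u \<odot>\<^bsub>M\<^esub> u \<oplus>\<^bsub>M\<^esub> (\<Oplus>\<^bsub>M\<^esub>u\<in>A. k u \<odot>\<^bsub>M\<^esub> u), k u \<otimes> v u \<oplus> (\<Oplus>u\<in>A. k u \<otimes> v u)) \<in> G" by simp
        moreover have "(\<Oplus>\<^bsub>M\<^esub>u\<in>insert u A. k u \<odot>\<^bsub>M\<^esub> u) = k u \<odot>\<^bsub>M\<^esub> u \<oplus>\<^bsub>M\<^esub> (\<Oplus>\<^bsub>M\<^esub>u\<in>A. k u \<odot>\<^bsub>M\<^esub> u)"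
          by (rule M.M.finsum_insert[OF insert.hyps]) (use kc Ac in auto)
        moreover have "(\<Oplus>u\<in>insert u A. k u \<otimes> v u) = k u \<otimes> v u \<oplus> (\<Oplus>u\<in>A. k u \<otimes> v u)"
          by (rule finsum_insert[OF insert.hyps]) (use kc in auto)
        ultimately show ?case by simp
      qed
      then show ?thesis by (simp add: L_def P_def)
    qed
    have 0: "y \<in> K" if "(\<zero>\<^bsub>M\<^esub>, y) \<in> G" for y using G(4)[OF that] submoduleD(2)[OF N(1)[OF K(1)]] by blast
    have PK: "P k v \<in> K" if "k \<in> KG" for k
      using 0 LP[OF KGc[OF that]] KG(2) that by (auto simp: Ker_def)
    have "(s, c) \<in> G"
    proof -
      have "(\<one> \<odot>\<^bsub>M\<^esub> s, \<one> \<odot>\<^bsub>self_module R\<^esub> c) \<in> G0" unfolding G0_def by blast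
      then show ?thesis using G(3) s c by auto
    qed
    from linear_graph_minus[OF Mm self_module G(1,2) LP[OF \<epsilon>(1)] this]
    have "(\<zero>\<^bsub>M\<^esub>, P \<epsilon> v \<ominus>\<^bsub>self_module R\<^esub> c) \<in> G" using \<epsilon>(2) s by (simp add: M.M.minus_eq M.M.r_neg)
    then have P\<epsilon>: "P \<epsilon> v \<ominus>\<^bsub>self_module R\<^esub> c \<in> K" by (rule 0)
    have self_minus: "a \<ominus>\<^bsub>self_module R\<^esub> b = a \<ominus> b" if "a \<in> carrier R" "b \<in> carrier R" for a b
    proof -
      interpret S: module R "self_module R" by (rule self_module)
      have "a \<ominus>\<^bsub>self_module R\<^esub> b = a \<oplus>\<^bsub>self_module R\<^esub> (\<ominus> \<one>) \<odot>\<^bsub>self_module R\<^esub> b"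
        using that by (simp only: S.smult_l_minus one_closed self_module_simps(1) S.smult_one S.M.minus_eq)
      then show ?thesis using that by (simp add: l_minus minus_eq)
    qed
    have Pc: "P \<epsilon> v \<in> carrier R" by (rule P(1)[OF vc \<epsilon>(1)])
    \<comment> \<open>The error T v - w of the approximate solution has its coordinates in K, hence
      lies in W'. As T v lies in W and so in W', also w would lie in W', a contradiction.\<close>
    define t where "t = T v \<oplus>\<^bsub>H\<^esub> (\<ominus> \<one>) \<odot>\<^bsub>H\<^esub> w"
    have Tc: "T v \<in> carrier H" by (rule T_c[OF vc])
    have tc: "t \<in> carrier H" unfolding t_def using Tc w by simp
    have tK: "t i \<in> K" for i
    proof (cases i)
      case None
      have "t i = P \<epsilon> v \<ominus> c" unfolding t_def H_def w_def T_def using None Pc c by (simp add: l_minus minus_eq)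
      then show ?thesis using P\<epsilon> self_minus[OF Pc c] by simp
    next
      case (Some k)
      then have "t i = (if k \<in> KG then P k v else \<zero>)"
        unfolding t_def H_def w_def T_def using P(1)[OF vc KGc] by simp
      then show ?thesis using PK K_zero by simp
    qed
    have "t \<in> W'"
    proof (rule fun_module_mem_submodule[OF finI W'(1)[unfolded H_def] tc[unfolded H_def]])
      fix a assume "a \<in> Ix"
      then have "unit_fun a \<in> carrier H" unfolding H_def by (rule unit_fun_closed)
      moreover have "t a \<in> Q" using tK K(2) by blast
      ultimately show "t a \<odot>\<^bsub>fun_module R Ix\<^esub> unit_fun a \<in> W'" unfolding Q_def H_def by blast
    qed
    moreover have "T v \<in> W'" using WI[OF vc] W'(2) by blast
    ultimately have "T v \<ominus>\<^bsub>H\<^esub> t \<in> W'" by (intro H.submodule_minus[OF W'(1)])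
    moreover have "T v \<ominus>\<^bsub>H\<^esub> t = w"
      unfolding t_def using Tc w by (simp add: H.module_simps)
    ultimately show False using W'(3) by simp
  qed
  then obtain v where v: "v \<in> carrier F" "T v = w" unfolding W_def by (metis imageE)
  have P\<epsilon>: "P \<epsilon> v = c" using fun_cong[OF v(2), of None] by (simp add: T_def w_def)
  have PKG: "P k v = \<zero>" if "k \<in> KG" for k using fun_cong[OF v(2), of "Some k"] that by (simp add: T_def w_def)
  have Pz: "P \<zero>\<^bsub>F\<^esub> v = \<zero>"
    using P(4)[OF v(1) F.M.zero_closed zero_closed] P(1)[OF v(1) F.M.zero_closed] F.smult_l_null[OF F.M.zero_closed] by simp
  have "submodule {k \<in> carrier F. P k v = \<zero>} R F"
    by (rule F.submoduleI') (use P(3,4)[OF v(1)] Pz in auto)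
  then have PKer: "P k v = \<zero>" if "k \<in> Ker" for k using KG(3)[of "{k \<in> carrier F. P k v = \<zero>}"] PKG KGc that by auto
  \<comment> \<open>An exact solution v annihilates the generators of the kernel of L, hence the
    whole kernel, so P k v depends on L k alone.\<close>
  have well: "P k v = P l v" if kl: "k \<in> carrier F" "l \<in> carrier F" "L k = L l" for k l
  proof -
    define k' where "k' = k \<oplus>\<^bsub>F\<^esub> (\<ominus> \<one>) \<odot>\<^bsub>F\<^esub> l"
    have ml: "(\<ominus> \<one>) \<odot>\<^bsub>F\<^esub> l \<in> carrier F" using kl(2) by simp
    have "L k' = L k \<oplus>\<^bsub>M\<^esub> (\<ominus> \<one>) \<odot>\<^bsub>M\<^esub> L l" unfolding k'_def using L(2)[OF kl(1) ml] L(3)[OF _ kl(2)] by simp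
    then have "L k' = \<zero>\<^bsub>M\<^esub>" using kl(3) L(1)[OF kl(2)] by (simp add: M.smult_l_minus M.M.r_neg)
    then have "k' \<in> Ker" using kl(1) ml by (simp add: Ker_def k'_def)
    then have "P k v \<oplus> (\<ominus> \<one>) \<otimes> P l v = \<zero>"
      using PKer P(3)[OF v(1) kl(1) ml] P(4)[OF v(1) kl(2)] by (simp add: k'_def)
    then have "P k v \<ominus> P l v = \<zero>" using P(1)[OF v(1) kl(2)] by (simp add: l_minus minus_eq)
    then show ?thesis using P(1)[OF v(1)] kl minus_eq_zero_iff by blast
  qed
  define \<phi> where "\<phi> x = P (SOME k. k \<in> carrier F \<and> L k = x) v" for x
  have \<phi>: "\<phi> (L k) = P k v" if k: "k \<in> carrier F" for k
  proof -
    have "(SOME l. l \<in> carrier F \<and> L l = L k) \<in> carrier F \<and> L (SOME l. l \<in> carrier F \<and> L l = L k) = L k"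
      by (rule someI[of _ k]) (use k in simp)
    then show ?thesis unfolding \<phi>_def using well k by blast
  qed
  have "\<phi> \<in> mod_hom R M (self_module R)"
    unfolding mod_hom_def
  proof (intro CollectI conjI ballI funcsetI)
    fix x assume x: "x \<in> carrier M"
    obtain k where k: "k \<in> carrier F" "L k = x" using L_surj[OF x] by blast
    show "\<phi> x \<in> carrier (self_module R)" using \<phi>[OF k(1)] k(2) P(1)[OF v(1) k(1)] by simp
    fix y assume y: "y \<in> carrier M"
    obtain l where l: "l \<in> carrier F" "L l = y" using L_surj[OF y] by blast
    show "\<phi> (x \<oplus>\<^bsub>M\<^esub> y) = \<phi> x \<oplus>\<^bsub>self_module R\<^esub> \<phi> y"
      using \<phi>[OF k(1)] \<phi>[OF l(1)] \<phi>[OF F.M.a_closed[OF k(1) l(1)]] L(2)[OF k(1) l(1)] P(3)[OF v(1) k(1) l(1)] k(2) l(2) by simp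
  next
    fix r x assume r: "r \<in> carrier R" and x: "x \<in> carrier M"
    obtain k where k: "k \<in> carrier F" "L k = x" using L_surj[OF x] by blast
    show "\<phi> (r \<odot>\<^bsub>M\<^esub> x) = r \<odot>\<^bsub>self_module R\<^esub> \<phi> x"
      using \<phi>[OF k(1)] \<phi>[OF F.smult_closed[OF r k(1)]] L(3)[OF r k(1)] P(4)[OF v(1) k(1) r] k(2) by simp
  qed
  moreover have "\<phi> s = c" using \<phi>[OF \<epsilon>(1)] \<epsilon>(2) P\<epsilon> by simp
  ultimately show ?thesis by blast
qed

section \<open>The absolute integral closure\<close>

definition finite_submodule :: "('a, 'x) ring_scheme \<Rightarrow> ('a, 'b, 'y) module_scheme \<Rightarrow> 'b set \<Rightarrow> bool"
  where "finite_submodule R M D \<longleftrightarrow> submodule D R M \<and>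
    (\<exists>U. finite U \<and> U \<subseteq> D \<and> (\<forall>N. submodule N R M \<longrightarrow> U \<subseteq> N \<longrightarrow> D \<subseteq> N))"

lemma (in module) submodule_of_submodule_iff:
  assumes "submodule D R M"
  shows "submodule N R (M\<lparr>carrier := D\<rparr>) \<longleftrightarrow> submodule N R M \<and> N \<subseteq> D"
proof
  interpret DM: module R "M\<lparr>carrier := D\<rparr>" by (rule submodule.submodule_is_module[OF assms module_axioms])
  {
    assume N: "submodule N R (M\<lparr>carrier := D\<rparr>)"
    have "submodule N R M"
      by (rule submoduleI') (use submoduleD[OF N] submoduleD(1)[OF assms] in auto)
    then show "submodule N R M \<and> N \<subseteq> D" using submoduleD(1)[OF N] by simp
  next
    assume N: "submodule N R M \<and> N \<subseteq> D"
    show "submodule N R (M\<lparr>carrier := D\<rparr>)"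
      by (rule DM.submoduleI') (use submoduleD[of N R M] N in auto)
  }
qed

lemma (in module) finite_submodule_imp_finite_module:
  assumes "finite_submodule R M D"
  shows "finite_module R (M\<lparr>carrier := D\<rparr>)"
proof -
  have D: "submodule D R M" using assms by (simp add: finite_submodule_def)
  obtain U where U: "finite U" "U \<subseteq> D" "\<And>N. submodule N R M \<Longrightarrow> U \<subseteq> N \<Longrightarrow> D \<subseteq> N"
    using assms unfolding finite_submodule_def by blast
  have "module R (M\<lparr>carrier := D\<rparr>)" by (rule submodule.submodule_is_module[OF D module_axioms])
  moreover have "N = D" if "submodule N R (M\<lparr>carrier := D\<rparr>)" "U \<subseteq> N" for N
    using that U(3)[of N] submodule_of_submodule_iff[OF D] by blast
  ultimately show ?thesis using U(1,2) unfolding finite_module_def by auto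
qed

lemma (in noetherian_ring) finite_submodule_imp_noetherian:
  assumes M: "module R M" and D: "finite_submodule R M D"
  shows "noetherian_submodule R M D"
proof -
  have Dsub: "submodule D R M" using D by (simp add: finite_submodule_def)
  obtain U where U: "finite U" "U \<subseteq> D" "\<And>N. submodule N R M \<Longrightarrow> U \<subseteq> N \<Longrightarrow> D \<subseteq> N"
    using D unfolding finite_submodule_def by blast
  obtain D' where D': "noetherian_submodule R M D'" "U \<subseteq> D'"
    using noetherian_submodule_finite[OF M U(1)] U(2) submoduleD(1)[OF Dsub] by blast
  then have "D \<subseteq> D'" using U(3) by (simp add: noetherian_submodule_def)
  then show ?thesis using D'(1) Dsub unfolding noetherian_submodule_def by (meson order_trans)
qed

section \<open>Integral elements and finite intermediate rings\<close>

locale noetherian_base_algebra = Lc: cring L + A: algebra R L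
  for R :: "('a, 'x) ring_scheme" and L :: "('a, 'l) module" +
  assumes noetherian: "noetherian_ring R" and nontrivial: "\<one>\<^bsub>L\<^esub> \<noteq> \<zero>\<^bsub>L\<^esub>"
begin

abbreviation img where "img \<equiv> algebra_map L ` carrier R"

definition finite_subring :: "'l set \<Rightarrow> bool"
  where "finite_subring S \<longleftrightarrow> subring S L \<and> img \<subseteq> S \<and> finite_submodule R L S"

lemma R_cring: "cring R" by (rule A.R_cring)

lemma L_module: "module R L" by (rule A.module)

lemma img_closed: "img \<subseteq> carrier L" using A.algebra_map_closed by blast

lemma one_img: "\<one>\<^bsub>L\<^esub> \<in> img"
proof -
  have "algebra_map L \<one>\<^bsub>R\<^esub> = \<one>\<^bsub>L\<^esub>" by (simp add: algebra_map_def)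
  then show ?thesis using cring.cring_simprules(6)[OF R_cring] by (metis image_eqI)
qed

lemma subring_submodule:
  assumes "subring S L" "img \<subseteq> S"
  shows "submodule S R L"
proof (rule A.submoduleI')
  note S = subringE[OF assms(1)]
  show "r \<odot>\<^bsub>L\<^esub> a \<in> S" if "r \<in> carrier R" "a \<in> S" for r a
  proof -
    have "algebra_map L r \<otimes>\<^bsub>L\<^esub> a \<in> S" using S(6) assms(2) that by blast
    then show ?thesis using A.smult_eq_mult[OF that(1)] S(1) that(2) by auto
  qed
qed (use subringE[OF assms(1)] in auto)

text \<open>The submodules spanned by the powers of x below n ascend in S, which is noetherian. Once
  they are stationary, x^k is a combination of lower powers, and this is a monic equation.\<close>

lemma integral_over_if_finite_subring:
  assumes S: "finite_subring S" and x: "x \<in> S"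
  shows "integral_over R L x"
proof -
  have Sr: "subring S L" "img \<subseteq> S" "finite_submodule R L S" using S by (auto simp: finite_subring_def)
  note S' = subringE[OF Sr(1)]
  have xc: "x \<in> carrier L" using S'(1) x by blast
  have pow: "x [^]\<^bsub>L\<^esub> (n::nat) \<in> S" for n by (induction n) (use x S' in auto)
  have powc: "x [^]\<^bsub>L\<^esub> (n::nat) \<in> carrier L" for n using xc by simp
  define N where "N = rec_nat {\<zero>\<^bsub>L\<^esub>} (\<lambda>n D. span_elt R L D (x [^]\<^bsub>L\<^esub> n))"
  have N0: "N 0 = {\<zero>\<^bsub>L\<^esub>}" and NS: "N (Suc n) = span_elt R L (N n) (x [^]\<^bsub>L\<^esub> n)" for n
    by (simp_all add: N_def)
  have Nsub: "submodule (N n) R L" for n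
  proof (induction n)
    case 0
    show ?case unfolding N0 by (rule A.submoduleI') auto
  next
    case (Suc n)
    then show ?case unfolding NS by (rule A.span_elt(1)[OF _ powc])
  qed
  have Ssub: "submodule S R L" by (rule subring_submodule[OF Sr(1,2)])
  have NSS: "N n \<subseteq> S" for n
  proof (induction n)
    case 0
    show ?case unfolding N0 using S'(2) by blast
  next
    case (Suc n)
    show ?case unfolding NS by (rule A.span_elt(4)[OF Nsub powc Ssub Suc pow])
  qed
  obtain k where k: "\<And>n. n \<ge> k \<Longrightarrow> N n = N k"
  proof (rule noetherian_submoduleD[OF noetherian_ring.finite_submodule_imp_noetherian[OF noetherian L_module Sr(3)], of N])
    show "N n \<subseteq> N (Suc n)" for n unfolding NS by (rule A.span_elt(2)[OF Nsub powc])
  qed (use Nsub NSS in auto)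
  have "x [^]\<^bsub>L\<^esub> k \<in> N (Suc k)" unfolding NS by (rule A.span_elt(3)[OF Nsub powc])
  then have "x [^]\<^bsub>L\<^esub> k \<in> N k" using k[of "Suc k"] by simp
  then have mk: "\<ominus>\<^bsub>L\<^esub> (x [^]\<^bsub>L\<^esub> k) \<in> N k" using A.submoduleE(3)[OF Nsub] by blast
  \<comment> \<open>Coefficient lists start with the highest power. The length exactly n, leading
    zeros included, places the coefficient 1 prepended below at degree k.\<close>
  have rep: "\<exists>q. set q \<subseteq> img \<and> length q = n \<and> Lc.eval q x = b" if "b \<in> N n" for n b
    using that
  proof (induction n arbitrary: b)
    case 0
    then show ?case unfolding N0 by auto
  next
    case (Suc n)
    then obtain d r where dr: "d \<in> N n" "r \<in> carrier R" "b = d \<oplus>\<^bsub>L\<^esub> r \<odot>\<^bsub>L\<^esub> x [^]\<^bsub>L\<^esub> n"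
      unfolding NS span_elt_def by blast
    obtain q where q: "set q \<subseteq> img" "length q = n" "Lc.eval q x = d" using Suc.IH[OF dr(1)] by blast
    have dc: "d \<in> carrier L" using NSS S'(1) dr(1) by blast
    have "Lc.eval (algebra_map L r # q) x = algebra_map L r \<otimes>\<^bsub>L\<^esub> x [^]\<^bsub>L\<^esub> n \<oplus>\<^bsub>L\<^esub> d"
      using q by simp
    also have "\<dots> = b" unfolding dr(3) A.smult_eq_mult[OF dr(2) powc]
      by (rule Lc.a_comm) (use dc dr(2) powc A.smult_closed in auto)
    finally show ?case using q dr(2) by (intro exI[of _ "algebra_map L r # q"]) auto
  qed
  obtain q where q: "set q \<subseteq> img" "length q = k" "Lc.eval q x = \<ominus>\<^bsub>L\<^esub> (x [^]\<^bsub>L\<^esub> k)" using rep[OF mk] by blast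
  have "Lc.eval (\<one>\<^bsub>L\<^esub> # q) x = \<zero>\<^bsub>L\<^esub>" using q powc by (simp add: Lc.r_neg)
  \<comment> \<open>A \<open>polynomial\<close> must have a nonzero leading coefficient, which is
    where \<open>nontrivial\<close> enters.\<close>
  moreover have "polynomial\<^bsub>L\<^esub> img (\<one>\<^bsub>L\<^esub> # q)" using q(1) one_img nontrivial by (simp add: polynomial_def)
  ultimately show ?thesis unfolding integral_over_def by (intro exI[of _ "\<one>\<^bsub>L\<^esub> # q"]) simp
qed

text \<open>For a monic equation of degree n the ring S[x] is spanned over S by the powers of x
  below n. Products of these with generators of S over R generate it over R.\<close>

lemma finite_subring_adjoin:
  assumes S: "finite_subring S" and x: "x \<in> carrier L" "integral_over R L x"
  shows "\<exists>S'. finite_subring S' \<and> S \<subseteq> S' \<and> x \<in> S'"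
proof -
  have Sr: "subring S L" "img \<subseteq> S" "finite_submodule R L S" using S by (auto simp: finite_subring_def)
  note S' = subringE[OF Sr(1)]
  have Sc: "a \<in> carrier L" if "a \<in> S" for a using S'(1) that by blast
  obtain p where p: "polynomial\<^bsub>L\<^esub> img p" "p \<noteq> []" "hd p = \<one>\<^bsub>L\<^esub>" "Lc.eval p x = \<zero>\<^bsub>L\<^esub>"
    using x(2) unfolding integral_over_def by blast
  define q where "q = tl p"
  have pq: "p = \<one>\<^bsub>L\<^esub> # q" using p(2,3) by (cases p) (auto simp: q_def)
  have q: "set q \<subseteq> S" using p(1) Sr(2) pq by (auto simp: polynomial_def)
  define n where "n = length q"
  have powc: "x [^]\<^bsub>L\<^esub> (i::nat) \<in> carrier L" for i using x(1) by simp
  have ev: "x [^]\<^bsub>L\<^esub> n \<oplus>\<^bsub>L\<^esub> Lc.eval q x = \<zero>\<^bsub>L\<^esub>" using p(4) powc by (simp add: pq n_def)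
  \<comment> \<open>P i is the S-span of the powers of x below i. Multiplication by x raises the
    index by one, and the equation for x lowers n + 1 to n, so P n is closed under
    multiplication.\<close>
  define P where "P = rec_nat {\<zero>\<^bsub>L\<^esub>} (\<lambda>i D. {s \<otimes>\<^bsub>L\<^esub> x [^]\<^bsub>L\<^esub> i \<oplus>\<^bsub>L\<^esub> b | s b. s \<in> S \<and> b \<in> D})"
  have P0: "P 0 = {\<zero>\<^bsub>L\<^esub>}" and PS: "P (Suc i) = {s \<otimes>\<^bsub>L\<^esub> x [^]\<^bsub>L\<^esub> i \<oplus>\<^bsub>L\<^esub> b | s b. s \<in> S \<and> b \<in> P i}" for i
    by (simp_all add: P_def)
  have PSI: "s \<otimes>\<^bsub>L\<^esub> x [^]\<^bsub>L\<^esub> i \<oplus>\<^bsub>L\<^esub> b \<in> P (Suc i)" if "s \<in> S" "b \<in> P i" for s b i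
    using that unfolding PS by blast
  have PSE: "\<exists>s b. a = s \<otimes>\<^bsub>L\<^esub> x [^]\<^bsub>L\<^esub> i \<oplus>\<^bsub>L\<^esub> b \<and> s \<in> S \<and> b \<in> P i" if "a \<in> P (Suc i)" for a i
    using that unfolding PS by blast
  have Pc: "a \<in> carrier L" if "a \<in> P i" for a i
    using that
  proof (induction i arbitrary: a)
    case (Suc i)
    then show ?case using PSE[OF Suc.prems] Sc powc by blast
  qed (simp add: P0)
  have P_zero: "\<zero>\<^bsub>L\<^esub> \<in> P i" for i
  proof (induction i)
    case (Suc i)
    then show ?case using PSI[OF S'(2) Suc] powc by simp
  qed (simp add: P0)
  have P_add: "a \<oplus>\<^bsub>L\<^esub> b \<in> P i" if "a \<in> P i" "b \<in> P i" for a b i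
    using that
  proof (induction i arbitrary: a b)
    case (Suc i)
    obtain s a' where a: "a = s \<otimes>\<^bsub>L\<^esub> x [^]\<^bsub>L\<^esub> i \<oplus>\<^bsub>L\<^esub> a'" "s \<in> S" "a' \<in> P i" using PSE[OF Suc.prems(1)] by blast
    obtain t b' where b: "b = t \<otimes>\<^bsub>L\<^esub> x [^]\<^bsub>L\<^esub> i \<oplus>\<^bsub>L\<^esub> b'" "t \<in> S" "b' \<in> P i" using PSE[OF Suc.prems(2)] by blast
    have "a \<oplus>\<^bsub>L\<^esub> b = (s \<oplus>\<^bsub>L\<^esub> t) \<otimes>\<^bsub>L\<^esub> x [^]\<^bsub>L\<^esub> i \<oplus>\<^bsub>L\<^esub> (a' \<oplus>\<^bsub>L\<^esub> b')"
      using a b Sc Pc powc[of i] by (simp add: Lc.l_distr Lc.a_ac)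
    then show ?case using PSI[OF S'(7)[OF a(2) b(2)] Suc.IH[OF a(3) b(3)]] by simp
  qed (simp add: P0)
  have P_S: "s \<otimes>\<^bsub>L\<^esub> a \<in> P i" if "s \<in> S" "a \<in> P i" for s a i
    using that(2)
  proof (induction i arbitrary: a)
    case 0
    then show ?case using Sc[OF that(1)] by (simp add: P0)
  next
    case (Suc i)
    obtain t b where a: "a = t \<otimes>\<^bsub>L\<^esub> x [^]\<^bsub>L\<^esub> i \<oplus>\<^bsub>L\<^esub> b" "t \<in> S" "b \<in> P i" using PSE[OF Suc.prems] by blast
    have "s \<otimes>\<^bsub>L\<^esub> a = (s \<otimes>\<^bsub>L\<^esub> t) \<otimes>\<^bsub>L\<^esub> x [^]\<^bsub>L\<^esub> i \<oplus>\<^bsub>L\<^esub> s \<otimes>\<^bsub>L\<^esub> b"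
      using a Sc that(1) Pc powc[of i] by (simp add: Lc.r_distr Lc.m_assoc)
    then show ?case using PSI[OF S'(6)[OF that(1) a(2)] Suc.IH[OF a(3)]] by simp
  qed
  have P_mono: "P i \<subseteq> P (Suc i)" for i
  proof
    fix a assume a: "a \<in> P i"
    show "a \<in> P (Suc i)" using PSI[OF S'(2) a] Pc[OF a] powc[of i] by simp
  qed
  have P_x: "x \<otimes>\<^bsub>L\<^esub> a \<in> P (Suc i)" if "a \<in> P i" for a i
    using that
  proof (induction i arbitrary: a)
    case 0
    then show ?case using P_zero x(1) by (simp add: P0)
  next
    case (Suc i)
    obtain t b where a: "a = t \<otimes>\<^bsub>L\<^esub> x [^]\<^bsub>L\<^esub> i \<oplus>\<^bsub>L\<^esub> b" "t \<in> S" "b \<in> P i" using PSE[OF Suc.prems] by blast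
    have "x \<otimes>\<^bsub>L\<^esub> a = t \<otimes>\<^bsub>L\<^esub> x [^]\<^bsub>L\<^esub> Suc i \<oplus>\<^bsub>L\<^esub> x \<otimes>\<^bsub>L\<^esub> b"
      using a Sc[OF a(2)] x(1) Pc[OF a(3)] powc[of i] by (simp add: Lc.r_distr Lc.m_ac)
    then show ?case using PSI[OF a(2) Suc.IH[OF a(3)]] by simp
  qed
  have eval_P: "Lc.eval q' x \<in> P (length q')" if "set q' \<subseteq> S" for q'
    using that
  proof (induction q')
    case (Cons a q')
    then show ?case using PSI[of a "Lc.eval q' x" "length q'"] by simp
  qed (simp add: P0)
  have P_uminus: "\<ominus>\<^bsub>L\<^esub> a \<in> P i" if "a \<in> P i" for a i
    using P_S[OF S'(5)[OF S'(3)] that] Pc[OF that] by (simp add: Lc.l_minus)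
  have xn: "x [^]\<^bsub>L\<^esub> n \<in> P n"
  proof -
    have eP: "Lc.eval q x \<in> P n" unfolding n_def by (rule eval_P[OF q])
    have "x [^]\<^bsub>L\<^esub> n = \<ominus>\<^bsub>L\<^esub> (Lc.eval q x)"
      using ev Lc.minus_equality[OF ev Pc[OF eP] powc] by simp
    then show ?thesis using P_uminus[OF eP] by simp
  qed
  have PSn: "P (Suc n) \<subseteq> P n"
  proof
    fix a assume "a \<in> P (Suc n)"
    then obtain s b where "a = s \<otimes>\<^bsub>L\<^esub> x [^]\<^bsub>L\<^esub> n \<oplus>\<^bsub>L\<^esub> b" "s \<in> S" "b \<in> P n" using PSE by blast
    then show "a \<in> P n" using P_add P_S xn by simp
  qed
  have P_pow: "x [^]\<^bsub>L\<^esub> (i::nat) \<otimes>\<^bsub>L\<^esub> b \<in> P n" if "b \<in> P n" for b i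
  proof (induction i)
    case 0
    then show ?case using that Pc[OF that] by simp
  next
    case (Suc i)
    have "x \<otimes>\<^bsub>L\<^esub> (x [^]\<^bsub>L\<^esub> i \<otimes>\<^bsub>L\<^esub> b) \<in> P n" using P_x[OF Suc] PSn by blast
    then show ?case using x(1) powc[of i] Pc[OF that] by (simp add: Lc.m_ac)
  qed
  have P_mult: "a \<otimes>\<^bsub>L\<^esub> b \<in> P n" if "a \<in> P i" "b \<in> P n" for a b i
    using that(1)
  proof (induction i arbitrary: a)
    case 0
    then show ?case using P_zero Pc[OF that(2)] by (simp add: P0)
  next
    case (Suc i)
    obtain s a' where a: "a = s \<otimes>\<^bsub>L\<^esub> x [^]\<^bsub>L\<^esub> i \<oplus>\<^bsub>L\<^esub> a'" "s \<in> S" "a' \<in> P i" using PSE[OF Suc.prems] by blast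
    have "a \<otimes>\<^bsub>L\<^esub> b = s \<otimes>\<^bsub>L\<^esub> (x [^]\<^bsub>L\<^esub> i \<otimes>\<^bsub>L\<^esub> b) \<oplus>\<^bsub>L\<^esub> a' \<otimes>\<^bsub>L\<^esub> b"
      using a Sc[OF a(2)] Pc[OF a(3)] Pc[OF that(2)] powc[of i] by (simp add: Lc.l_distr Lc.m_assoc)
    then show ?case using P_add[OF P_S[OF a(2) P_pow[OF that(2)]] Suc.IH[OF a(3)]] by simp
  qed
  \<comment> \<open>For n = 0 the equation would read 1 = 0. A positive degree is required for S,
    which lies in P 1, to be contained in P n.\<close>
  have "n \<noteq> 0"
  proof
    assume "n = 0"
    then show False using ev nontrivial by (simp add: n_def)
  qed
  then have P1n: "P 1 \<subseteq> P n" using lift_Suc_mono_le[of P, OF P_mono, of 1 n] by simp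
  have SP: "S \<subseteq> P n"
  proof
    fix s assume s: "s \<in> S"
    have "s \<in> P 1" using PSI[OF s P_zero, of 0] Sc[OF s] by simp
    then show "s \<in> P n" using P1n by blast
  qed
  have ring_P: "subring (P n) L"
    by (rule Lc.subringI) (use Pc SP S'(3) P_uminus P_mult P_add in auto)
  have img_P: "img \<subseteq> P n" using Sr(2) SP by blast
  have "x \<otimes>\<^bsub>L\<^esub> \<one>\<^bsub>L\<^esub> \<in> P n" using P_x[OF subsetD[OF SP S'(3)]] PSn by blast
  then have xP: "x \<in> P n" using x(1) by simp
  obtain U where U: "finite U" "U \<subseteq> S" "\<And>N. submodule N R L \<Longrightarrow> U \<subseteq> N \<Longrightarrow> S \<subseteq> N"
    using Sr(3) unfolding finite_submodule_def by blast
  have gens: "\<exists>U'. finite U' \<and> U' \<subseteq> P i \<and> (\<forall>N. submodule N R L \<longrightarrow> U' \<subseteq> N \<longrightarrow> P i \<subseteq> N)" for i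
  proof (induction i)
    case 0
    show ?case using submoduleD(2) by (intro exI[of _ "{}"]) (auto simp: P0)
  next
    case (Suc i)
    then obtain U' where U': "finite U'" "U' \<subseteq> P i" "\<And>N. submodule N R L \<Longrightarrow> U' \<subseteq> N \<Longrightarrow> P i \<subseteq> N" by blast
    define V where "V = U' \<union> (\<lambda>u. u \<otimes>\<^bsub>L\<^esub> x [^]\<^bsub>L\<^esub> i) ` U"
    have "u \<otimes>\<^bsub>L\<^esub> x [^]\<^bsub>L\<^esub> i \<in> P (Suc i)" if "u \<in> S" for u
      using PSI[OF that P_zero, of i] Sc[OF that] powc[of i] by simp
    then have "V \<subseteq> P (Suc i)" using U'(2) P_mono U(2) unfolding V_def by blast
    moreover have "finite V" using U(1) U'(1) by (simp add: V_def)
    moreover have "P (Suc i) \<subseteq> N" if N: "submodule N R L" "V \<subseteq> N" for N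
    proof
      fix a assume "a \<in> P (Suc i)"
      then obtain s b where a: "a = s \<otimes>\<^bsub>L\<^esub> x [^]\<^bsub>L\<^esub> i \<oplus>\<^bsub>L\<^esub> b" "s \<in> S" "b \<in> P i" using PSE by blast
      have "b \<in> N" using U'(3)[OF N(1)] N(2) a(3) by (auto simp: V_def)
      moreover have "s \<otimes>\<^bsub>L\<^esub> x [^]\<^bsub>L\<^esub> i \<in> N"
      proof -
        \<comment> \<open>The preimage of N under multiplication by x^i; it transfers generation of
          S by U to generation of S x^i.\<close>
        define N' where "N' = {t \<in> carrier L. t \<otimes>\<^bsub>L\<^esub> x [^]\<^bsub>L\<^esub> i \<in> N}"
        have "submodule N' R L"
        proof (rule A.submoduleI')
          show "N' \<subseteq> carrier L" by (auto simp: N'_def)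
          show "\<zero>\<^bsub>L\<^esub> \<in> N'" using submoduleD(2)[OF N(1)] powc by (simp add: N'_def)
          show "u \<oplus>\<^bsub>L\<^esub> v \<in> N'" if "u \<in> N'" "v \<in> N'" for u v
            using that submoduleD(3)[OF N(1)] powc by (simp add: N'_def Lc.l_distr)
          show "r \<odot>\<^bsub>L\<^esub> u \<in> N'" if "r \<in> carrier R" "u \<in> N'" for r u
            using that submoduleD(4)[OF N(1)] powc by (simp add: N'_def A.smult_assoc2)
        qed
        moreover have "U \<subseteq> N'" using N(2) U(2) Sc by (auto simp: N'_def V_def)
        ultimately show ?thesis using U(3) a(2) by (auto simp: N'_def)
      qed
      ultimately show "a \<in> N" unfolding a(1) by (intro submoduleD(3)[OF N(1)])
    qed
    ultimately show ?case by blast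
  qed
  have "finite_submodule R L (P n)"
    unfolding finite_submodule_def using gens subring_submodule[OF ring_P img_P] by blast
  then show ?thesis using ring_P img_P SP xP unfolding finite_subring_def by blast
qed

lemma finite_subring_img: "finite_subring img"
proof -
  have R: "cring R" by (rule R_cring)
  have map_add: "algebra_map L r \<oplus>\<^bsub>L\<^esub> algebra_map L s = algebra_map L (r \<oplus>\<^bsub>R\<^esub> s)"
    if "r \<in> carrier R" "s \<in> carrier R" for r s
    using that by (simp add: algebra_map_def A.smult_l_distr)
  have map_mult: "algebra_map L r \<otimes>\<^bsub>L\<^esub> algebra_map L s = algebra_map L (r \<otimes>\<^bsub>R\<^esub> s)"
    if "r \<in> carrier R" "s \<in> carrier R" for r s
    using A.smult_eq_mult[OF that(1) A.algebra_map_closed[OF that(2)]] that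
    by (simp add: algebra_map_def A.smult_assoc1)
  have map_uminus: "\<ominus>\<^bsub>L\<^esub> algebra_map L r = algebra_map L (\<ominus>\<^bsub>R\<^esub> r)" if "r \<in> carrier R" for r
    using that by (simp add: algebra_map_def A.smult_l_minus)
  have ring: "subring img L"
  proof (rule Lc.subringI)
    show "\<ominus>\<^bsub>L\<^esub> h \<in> img" if "h \<in> img" for h
      using that map_uminus cring.cring_simprules(3)[OF R] by auto
    show "h \<otimes>\<^bsub>L\<^esub> h' \<in> img" if "h \<in> img" "h' \<in> img" for h h'
      using that map_mult cring.cring_simprules(5)[OF R] by auto
    show "h \<oplus>\<^bsub>L\<^esub> h' \<in> img" if "h \<in> img" "h' \<in> img" for h h'
      using that map_add cring.cring_simprules(1)[OF R] by auto
  qed (use img_closed one_img in auto)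
  have "img \<subseteq> N" if "submodule N R L" "{\<one>\<^bsub>L\<^esub>} \<subseteq> N" for N
    using submoduleD(4)[OF that(1)] that(2) by (auto simp: algebra_map_def)
  then have "finite_submodule R L img"
    unfolding finite_submodule_def using one_img subring_submodule[OF ring subset_refl]
    by (intro conjI exI[of _ "{\<one>\<^bsub>L\<^esub>}"]) auto
  then show ?thesis using ring by (simp add: finite_subring_def)
qed

lemma finite_subring_exists:
  assumes "finite T" "T \<subseteq> {x \<in> carrier L. integral_over R L x}"
  shows "\<exists>S. finite_subring S \<and> T \<subseteq> S"
  using assms
proof (induction T)
  case empty
  then show ?case using finite_subring_img by blast
next
  case (insert x T)
  then obtain S where "finite_subring S" "T \<subseteq> S" by auto
  moreover have "x \<in> carrier L" "integral_over R L x" using insert.prems by auto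
  ultimately show ?case using finite_subring_adjoin[of S x] by blast
qed

text \<open>Any two integral elements lie in a common finite intermediate ring, all of whose
  elements are integral.\<close>

lemma subring_abs_int_closure: "subring (carrier (abs_int_closure R L)) L"
proof (rule Lc.subringI)
  have car: "carrier (abs_int_closure R L) = {x \<in> carrier L. integral_over R L x}"
    by (simp add: abs_int_closure_def)
  have in_car: "y \<in> carrier (abs_int_closure R L)" if "finite_subring S" "y \<in> S" for S y
    using integral_over_if_finite_subring[OF that] that subringE(1) by (auto simp: car finite_subring_def)
  show "carrier (abs_int_closure R L) \<subseteq> carrier L" by (auto simp: car)
  show "\<one>\<^bsub>L\<^esub> \<in> carrier (abs_int_closure R L)" by (rule in_car[OF finite_subring_img one_img])
  fix x assume x: "x \<in> carrier (abs_int_closure R L)"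
  then obtain S where S: "finite_subring S" "x \<in> S" using finite_subring_exists[of "{x}"] by (auto simp: car)
  show "\<ominus>\<^bsub>L\<^esub> x \<in> carrier (abs_int_closure R L)"
    by (rule in_car[OF S(1)]) (use S subringE(5) in \<open>auto simp: finite_subring_def\<close>)
  fix y assume y: "y \<in> carrier (abs_int_closure R L)"
  obtain S where S: "finite_subring S" "x \<in> S" "y \<in> S"
    using finite_subring_exists[of "{x, y}"] x y by (auto simp: car)
  show "x \<otimes>\<^bsub>L\<^esub> y \<in> carrier (abs_int_closure R L)"
    by (rule in_car[OF S(1)]) (use S subringE(6) in \<open>auto simp: finite_subring_def\<close>)
  show "x \<oplus>\<^bsub>L\<^esub> y \<in> carrier (abs_int_closure R L)"
    by (rule in_car[OF S(1)]) (use S subringE(7) in \<open>auto simp: finite_subring_def\<close>)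
qed

lemma finite_subring_subset: "finite_subring S \<Longrightarrow> S \<subseteq> carrier (abs_int_closure R L)"
  using integral_over_if_finite_subring subringE(1)
  by (fastforce simp: abs_int_closure_def finite_subring_def)

lemma abs_int_closure_eq: "abs_int_closure R L = L\<lparr>carrier := carrier (abs_int_closure R L)\<rparr>"
  by (simp add: abs_int_closure_def)

lemma abs_int_closure_cring: "cring (abs_int_closure R L)"
  using Lc.subcring_iff[of "carrier (abs_int_closure R L)"] Lc.subcringI'[OF subring_abs_int_closure]
    subringE(1)[OF subring_abs_int_closure] abs_int_closure_eq by simp

lemma img_abs_int_closure: "img \<subseteq> carrier (abs_int_closure R L)"
  by (rule finite_subring_subset[OF finite_subring_img])

lemma abs_int_closure_module: "module R (abs_int_closure R L)"
  by (subst abs_int_closure_eq)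
    (rule submodule.submodule_is_module[OF subring_submodule[OF subring_abs_int_closure img_abs_int_closure] L_module])

lemma finite_subring_in_finite_subalgebras:
  assumes "finite_subring S"
  shows "L\<lparr>carrier := S\<rparr> \<in> finite_subalgebras R (abs_int_closure R L)"
proof -
  define P where "P = abs_int_closure R L"
  have S: "subring S L" "img \<subseteq> S" "finite_submodule R L S" using assms by (auto simp: finite_subring_def)
  interpret P: cring P unfolding P_def by (rule abs_int_closure_cring)
  have ops: "\<one>\<^bsub>P\<^esub> = \<one>\<^bsub>L\<^esub>" "a \<oplus>\<^bsub>P\<^esub> b = a \<oplus>\<^bsub>L\<^esub> b" "a \<otimes>\<^bsub>P\<^esub> b = a \<otimes>\<^bsub>L\<^esub> b" "\<zero>\<^bsub>P\<^esub> = \<zero>\<^bsub>L\<^esub>" for a b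
    by (simp_all add: P_def abs_int_closure_def)
  have SP: "S \<subseteq> carrier P" unfolding P_def by (rule finite_subring_subset[OF assms])
  have "\<ominus>\<^bsub>P\<^esub> h = \<ominus>\<^bsub>L\<^esub> h" if "h \<in> S" for h
  proof (rule P.minus_equality)
    have hc: "h \<in> carrier L" using subringE(1)[OF S(1)] that by blast
    show "\<ominus>\<^bsub>L\<^esub> h \<oplus>\<^bsub>P\<^esub> h = \<zero>\<^bsub>P\<^esub>" using hc by (simp add: ops Lc.l_neg)
    show "h \<in> carrier P" "\<ominus>\<^bsub>L\<^esub> h \<in> carrier P" using SP that subringE(5)[OF S(1)] by auto
  qed
  then have "subring S P"
    by (intro P.subringI) (use SP subringE[OF S(1)] in \<open>auto simp: ops\<close>)
  moreover have "L\<lparr>carrier := S\<rparr> = P\<lparr>carrier := S\<rparr>" by (simp add: P_def abs_int_closure_def)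
  moreover have "algebra_map P ` carrier R \<subseteq> S" using S(2) by (simp add: P_def abs_int_closure_def algebra_map_def)
  moreover have "finite_module R (P\<lparr>carrier := S\<rparr>)"
    using A.finite_submodule_imp_finite_module[OF S(3)] by (simp add: P_def abs_int_closure_def)
  ultimately show ?thesis unfolding finite_subalgebras_def P_def by blast
qed

end

section \<open>Plus closure\<close>

lemma keys_diff_subset: "Poly_Mapping.keys a \<subseteq> A \<Longrightarrow> Poly_Mapping.keys b \<subseteq> A \<Longrightarrow> Poly_Mapping.keys (a - b) \<subseteq> A"
  using keys_diff[of a b] by blast

text \<open>Elements of the generated subgroup are supported in the carriers. The steps for
  negatives and sums may assume this, since homomorphisms out of the free abelian group are additive
  only on elements supported there.\<close>

lemma tensor_rel_induct:
  assumes P: "module R P" and M: "module R M" and z: "z \<in> tensor_rel R P M"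
    and "Q 0"
    and "\<And>p q m. p \<in> carrier P \<Longrightarrow> q \<in> carrier P \<Longrightarrow> m \<in> carrier M \<Longrightarrow>
      Q (frag_of (p \<oplus>\<^bsub>P\<^esub> q, m) - frag_of (p, m) - frag_of (q, m))"
    and "\<And>p m n. p \<in> carrier P \<Longrightarrow> m \<in> carrier M \<Longrightarrow> n \<in> carrier M \<Longrightarrow>
      Q (frag_of (p, m \<oplus>\<^bsub>M\<^esub> n) - frag_of (p, m) - frag_of (p, n))"
    and "\<And>r p m. r \<in> carrier R \<Longrightarrow> p \<in> carrier P \<Longrightarrow> m \<in> carrier M \<Longrightarrow>
      Q (frag_of (r \<odot>\<^bsub>P\<^esub> p, m) - frag_of (p, r \<odot>\<^bsub>M\<^esub> m))"
    and uminus: "\<And>x. Poly_Mapping.keys x \<subseteq> carrier P \<times> carrier M \<Longrightarrow> Q x \<Longrightarrow> Q (- x)"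
    and plus: "\<And>x y. Poly_Mapping.keys x \<subseteq> carrier P \<times> carrier M \<Longrightarrow> Poly_Mapping.keys y \<subseteq> carrier P \<times> carrier M \<Longrightarrow>
      Q x \<Longrightarrow> Q y \<Longrightarrow> Q (x + y)"
  shows "Q z" "Poly_Mapping.keys z \<subseteq> carrier P \<times> carrier M"
proof -
  interpret P: module R P by fact
  interpret M: module R M by fact
  have "Q z \<and> Poly_Mapping.keys z \<subseteq> carrier P \<times> carrier M"
    using z unfolding tensor_rel_def
  proof (induction rule: generate.induct)
    case one
    then show ?case using assms(4) by simp
  next
    case (incl h)
    then show ?case
      by (elim UnE CollectE exE conjE) (simp_all add: assms(5-7) keys_diff_subset)
  next
    case (inv h)
    then have h: "Q h \<and> Poly_Mapping.keys h \<subseteq> carrier P \<times> carrier M"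
      by (elim UnE CollectE exE conjE) (simp_all add: assms(5-7) keys_diff_subset)
    then show ?case using uminus[of h] by simp
  next
    case (eng h1 h2)
    then show ?case using plus[of h1 h2] keys_add[of h1 h2] by auto
  qed
  then show "Q z" "Poly_Mapping.keys z \<subseteq> carrier P \<times> carrier M" by auto
qed

lemma tensor_rel_intros:
  "p \<in> carrier P \<Longrightarrow> q \<in> carrier P \<Longrightarrow> m \<in> carrier M \<Longrightarrow>
    frag_of (p \<oplus>\<^bsub>P\<^esub> q, m) - frag_of (p, m) - frag_of (q, m) \<in> tensor_rel R P M"
  "p \<in> carrier P \<Longrightarrow> m \<in> carrier M \<Longrightarrow> n \<in> carrier M \<Longrightarrow>
    frag_of (p, m \<oplus>\<^bsub>M\<^esub> n) - frag_of (p, m) - frag_of (p, n) \<in> tensor_rel R P M"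
  "r \<in> carrier R \<Longrightarrow> p \<in> carrier P \<Longrightarrow> m \<in> carrier M \<Longrightarrow>
    frag_of (r \<odot>\<^bsub>P\<^esub> p, m) - frag_of (p, r \<odot>\<^bsub>M\<^esub> m) \<in> tensor_rel R P M"
  unfolding tensor_rel_def by (rule generate.incl; blast)+

lemma tensor_rel_zero: "0 \<in> tensor_rel R P M"
  using generate.one[of "free_Abelian_group (carrier P \<times> carrier M)"] by (simp add: tensor_rel_def)

lemma tensor_rel_add: "x \<in> tensor_rel R P M \<Longrightarrow> y \<in> tensor_rel R P M \<Longrightarrow> x + y \<in> tensor_rel R P M"
  unfolding tensor_rel_def using generate.eng by fastforce

lemma tensor_rel_uminus:
  assumes P: "module R P" and M: "module R M" and z: "z \<in> tensor_rel R P M"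
  shows "- z \<in> tensor_rel R P M"
proof -
  interpret P: module R P by fact
  interpret M: module R M by fact
  let ?G = "free_Abelian_group (carrier P \<times> carrier M)"
  let ?T = "{frag_of (p \<oplus>\<^bsub>P\<^esub> q, m) - frag_of (p, m) - frag_of (q, m) | p q m.
        p \<in> carrier P \<and> q \<in> carrier P \<and> m \<in> carrier M} \<union>
     {frag_of (p, m \<oplus>\<^bsub>M\<^esub> n) - frag_of (p, m) - frag_of (p, n) | p m n.
        p \<in> carrier P \<and> m \<in> carrier M \<and> n \<in> carrier M} \<union>
     {frag_of (r \<odot>\<^bsub>P\<^esub> p, m) - frag_of (p, r \<odot>\<^bsub>M\<^esub> m) | r p m.
        r \<in> carrier R \<and> p \<in> carrier P \<and> m \<in> carrier M}"
  have "x \<in> carrier ?G" if "x \<in> ?T" for x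
    using that
    by (elim UnE CollectE exE conjE) (simp_all add: keys_diff_subset)
  then have "?T \<subseteq> carrier ?G" by (rule subsetI)
  from group.generate_m_inv_closed[OF group_free_Abelian_group this z[unfolded tensor_rel_def]]
  have "inv\<^bsub>?G\<^esub> z \<in> tensor_rel R P M" unfolding tensor_rel_def .
  moreover have "Poly_Mapping.keys z \<subseteq> carrier P \<times> carrier M"
    by (rule tensor_rel_induct(2)[OF P M z, of "\<lambda>_. True"]) auto
  ultimately show ?thesis by simp
qed

lemma tensor_rel_minus:
  assumes "module R P" "module R M" "x \<in> tensor_rel R P M" "y \<in> tensor_rel R P M"
  shows "x - y \<in> tensor_rel R P M"
  using tensor_rel_add[OF assms(3) tensor_rel_uminus[OF assms(1,2,4)]] by simp

lemma tensor_rel_submodule_mono: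
  assumes P: "module R P" and M: "module R M" and N: "submodule N R M"
  shows "tensor_rel R P (M\<lparr>carrier := N\<rparr>) \<subseteq> tensor_rel R P M"
proof
  have N': "module R (M\<lparr>carrier := N\<rparr>)" by (rule submodule.submodule_is_module[OF N M])
  note NM = submoduleD(1)[OF N]
  fix z assume "z \<in> tensor_rel R P (M\<lparr>carrier := N\<rparr>)"
  then show "z \<in> tensor_rel R P M"
  proof (induction rule: tensor_rel_induct(1)[OF P N', consumes 1])
    case (2 p q m)
    then show ?case using tensor_rel_intros(1)[of p P q m M R] NM by auto
  next
    case (3 p m n)
    then show ?case using tensor_rel_intros(2)[of p P m M n R] NM by auto
  next
    case (4 r p m)
    then show ?case using tensor_rel_intros(3)[of r R p P m M] NM by auto
  qed (use tensor_rel_zero tensor_rel_add tensor_rel_uminus[OF P M] in auto)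
qed

text \<open>T collects the elements of P occurring in the finitely many generating relations.
  Because the claim covers every submodule S containing T, the sets for two summands can simply be
  united.\<close>

lemma tensor_rel_finitary:
  assumes P: "module R P" and M: "module R M" and z: "z \<in> tensor_rel R P M"
  shows "\<exists>T. finite T \<and> T \<subseteq> carrier P \<and>
    (\<forall>S. submodule S R P \<longrightarrow> T \<subseteq> S \<longrightarrow> z \<in> tensor_rel R (P\<lparr>carrier := S\<rparr>) M)"
  using z
proof (induction rule: tensor_rel_induct(1)[OF P M, consumes 1])
  case 1
  show ?case using tensor_rel_zero by blast
next
  case (2 p q m)
  have "frag_of (p \<oplus>\<^bsub>P\<^esub> q, m) - frag_of (p, m) - frag_of (q, m) \<in> tensor_rel R (P\<lparr>carrier := S\<rparr>) M"
    if "{p, q} \<subseteq> S" for S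
    using tensor_rel_intros(1)[of p "P\<lparr>carrier := S\<rparr>" q m M R] that 2 by simp
  then show ?case using 2 by (intro exI[of _ "{p, q}"]) auto
next
  case (3 p m n)
  have "frag_of (p, m \<oplus>\<^bsub>M\<^esub> n) - frag_of (p, m) - frag_of (p, n) \<in> tensor_rel R (P\<lparr>carrier := S\<rparr>) M"
    if "{p} \<subseteq> S" for S
    using tensor_rel_intros(2)[of p "P\<lparr>carrier := S\<rparr>" m M n R] that 3 by simp
  then show ?case using 3 by (intro exI[of _ "{p}"]) auto
next
  case (4 r p m)
  have "frag_of (r \<odot>\<^bsub>P\<^esub> p, m) - frag_of (p, r \<odot>\<^bsub>M\<^esub> m) \<in> tensor_rel R (P\<lparr>carrier := S\<rparr>) M"
    if "{p} \<subseteq> S" for S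
    using tensor_rel_intros(3)[of r R p "P\<lparr>carrier := S\<rparr>" m M] that 4 by simp
  then show ?case using 4 by (intro exI[of _ "{p}"]) auto
next
  case (5 x)
  obtain T where T: "finite T" "T \<subseteq> carrier P"
    "\<forall>S. submodule S R P \<longrightarrow> T \<subseteq> S \<longrightarrow> x \<in> tensor_rel R (P\<lparr>carrier := S\<rparr>) M"
    using 5(2) by (elim exE conjE)
  have "- x \<in> tensor_rel R (P\<lparr>carrier := S\<rparr>) M" if S: "submodule S R P" "T \<subseteq> S" for S
    by (rule tensor_rel_uminus[OF submodule.submodule_is_module[OF S(1) P] M T(3)[rule_format, OF S]])
  then show ?case using T(1,2) by (intro exI[of _ T] conjI allI impI)
next
  case (6 x y)
  obtain T where T: "finite T" "T \<subseteq> carrier P"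
    "\<forall>S. submodule S R P \<longrightarrow> T \<subseteq> S \<longrightarrow> x \<in> tensor_rel R (P\<lparr>carrier := S\<rparr>) M"
    using 6(3) by (elim exE conjE)
  obtain T' where T': "finite T'" "T' \<subseteq> carrier P"
    "\<forall>S. submodule S R P \<longrightarrow> T' \<subseteq> S \<longrightarrow> y \<in> tensor_rel R (P\<lparr>carrier := S\<rparr>) M"
    using 6(4) by (elim exE conjE)
  have "x + y \<in> tensor_rel R (P\<lparr>carrier := S\<rparr>) M" if S: "submodule S R P" "T \<union> T' \<subseteq> S" for S
  proof (rule tensor_rel_add)
    show "x \<in> tensor_rel R (P\<lparr>carrier := S\<rparr>) M" using T(3) S by simp
    show "y \<in> tensor_rel R (P\<lparr>carrier := S\<rparr>) M" using T'(3) S by simp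
  qed
  moreover have "finite (T \<union> T')" "T \<union> T' \<subseteq> carrier P" using T T' by auto
  ultimately show ?case by (intro exI[of _ "T \<union> T'"] conjI allI impI)
qed

text \<open>The homomorphism h on the free abelian group with (p, x) |-> \<open>\<phi>\<close>(p) x
  kills the tensor relations, so it represents the map from the tensor product of S and M to M
  induced by \<open>\<phi>\<close>. It sends elements supported on S x N into N.\<close>

lemma tensor_rel_evaluation:
  assumes S: "module R S" and M: "module R M" and N: "submodule N R M"
    and \<phi>: "\<phi> \<in> mod_hom R S (self_module R)" and s: "s \<in> carrier S" and m: "m \<in> carrier M"
    and z: "Poly_Mapping.keys z \<subseteq> carrier S \<times> N" "frag_of (s, m) - z \<in> tensor_rel R S M"
  shows "\<phi> s \<odot>\<^bsub>M\<^esub> m \<in> N"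
proof -
  interpret S: module R S by fact
  interpret M: module R M by fact
  note \<phi>' = mod_hom_self_moduleD[OF \<phi>]
  have comm: "comm_group (add_monoid M)" by (rule M.M.a_comm_group)
  have NM: "N \<subseteq> carrier M" by (rule submoduleD(1)[OF N])
  let ?G = "free_Abelian_group (carrier S \<times> carrier M)"
  have "(\<lambda>(p, x). \<phi> p \<odot>\<^bsub>M\<^esub> x) ` (carrier S \<times> carrier M) \<subseteq> carrier (add_monoid M)"
    using \<phi>'(1) by auto
  then obtain h where h: "h \<in> hom ?G (add_monoid M)"
    and hf: "\<And>x. x \<in> carrier S \<times> carrier M \<Longrightarrow> h (frag_of x) = (case x of (p, x) \<Rightarrow> \<phi> p \<odot>\<^bsub>M\<^esub> x)"
    using comm_group.free_Abelian_group_universal[OF comm] by blast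
  have hf': "h (frag_of (p, x)) = \<phi> p \<odot>\<^bsub>M\<^esub> x" if "p \<in> carrier S" "x \<in> carrier M" for p x
    using hf[of "(p, x)"] that by simp
  interpret h: group_hom ?G "add_monoid M" h
    by (intro group_hom.intro group_hom_axioms.intro group_free_Abelian_group h M.M.a_group)
  have hc: "h x \<in> carrier M" if "Poly_Mapping.keys x \<subseteq> carrier S \<times> carrier M" for x
    using h.hom_closed[of x] that by simp
  have h0: "h 0 = \<zero>\<^bsub>M\<^esub>" using h.hom_one by simp
  have h_add: "h (x + y) = h x \<oplus>\<^bsub>M\<^esub> h y"
    if "Poly_Mapping.keys x \<subseteq> carrier S \<times> carrier M" "Poly_Mapping.keys y \<subseteq> carrier S \<times> carrier M" for x y
    using h.hom_mult[of x y] that by simp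
  have h_uminus: "h (- x) = \<ominus>\<^bsub>M\<^esub> h x" if "Poly_Mapping.keys x \<subseteq> carrier S \<times> carrier M" for x
    using h.hom_inv[of x] that by (simp add: a_inv_def)
  have h_diff: "h (x - y) = h x \<ominus>\<^bsub>M\<^esub> h y"
    if "Poly_Mapping.keys x \<subseteq> carrier S \<times> carrier M" "Poly_Mapping.keys y \<subseteq> carrier S \<times> carrier M" for x y
    using h_add[of x "- y"] h_uminus[OF that(2)] that by (simp add: M.M.minus_eq)
  have h_rel: "h x = \<zero>\<^bsub>M\<^esub>" if "x \<in> tensor_rel R S M" for x
    using that
  proof (induction rule: tensor_rel_induct(1)[OF S M, consumes 1])
    case 1
    show ?case by (rule h0)
  next
    case (2 p q x)
    have "h (frag_of (p \<oplus>\<^bsub>S\<^esub> q, x) - frag_of (p, x) - frag_of (q, x))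
      = \<phi> (p \<oplus>\<^bsub>S\<^esub> q) \<odot>\<^bsub>M\<^esub> x \<ominus>\<^bsub>M\<^esub> \<phi> p \<odot>\<^bsub>M\<^esub> x \<ominus>\<^bsub>M\<^esub> \<phi> q \<odot>\<^bsub>M\<^esub> x"
      using 2 by (simp add: h_diff hf' keys_diff_subset)
    then show ?case using 2 \<phi>' by (simp add: M.module_simps)
  next
    case (3 p x y)
    have "h (frag_of (p, x \<oplus>\<^bsub>M\<^esub> y) - frag_of (p, x) - frag_of (p, y))
      = \<phi> p \<odot>\<^bsub>M\<^esub> (x \<oplus>\<^bsub>M\<^esub> y) \<ominus>\<^bsub>M\<^esub> \<phi> p \<odot>\<^bsub>M\<^esub> x \<ominus>\<^bsub>M\<^esub> \<phi> p \<odot>\<^bsub>M\<^esub> y"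
      using 3 by (simp add: h_diff hf' keys_diff_subset)
    then show ?case using 3 \<phi>' by (simp add: M.module_simps)
  next
    case (4 r p x)
    have "h (frag_of (r \<odot>\<^bsub>S\<^esub> p, x) - frag_of (p, r \<odot>\<^bsub>M\<^esub> x)) = \<phi> (r \<odot>\<^bsub>S\<^esub> p) \<odot>\<^bsub>M\<^esub> x \<ominus>\<^bsub>M\<^esub> \<phi> p \<odot>\<^bsub>M\<^esub> (r \<odot>\<^bsub>M\<^esub> x)"
      using 4 by (simp add: h_diff hf')
    then show ?case using 4 \<phi>' by (simp add: M.module_simps)
  next
    case (5 x)
    then show ?case using h_uminus by simp
  next
    case (6 x y)
    then show ?case using h_add by simp
  qed
  have h_N: "h x \<in> N" if "Poly_Mapping.keys x \<subseteq> carrier S \<times> N" for x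
  proof (rule free_Abelian_group_induct[OF that])
    show "h 0 \<in> N" using h0 submoduleD(2)[OF N] by simp
    show "h (x - y) \<in> N" if xy: "Poly_Mapping.keys x \<subseteq> carrier S \<times> N" "Poly_Mapping.keys y \<subseteq> carrier S \<times> N"
      "h x \<in> N" "h y \<in> N" for x y
    proof -
      have "Poly_Mapping.keys x \<subseteq> carrier S \<times> carrier M" "Poly_Mapping.keys y \<subseteq> carrier S \<times> carrier M" using xy(1,2) NM by auto
      then show ?thesis using h_diff M.submodule_minus[OF N xy(3,4)] by simp
    qed
    show "h (frag_of a) \<in> N" if "a \<in> carrier S \<times> N" for a
      using that hf' NM \<phi>'(1) submoduleD(4)[OF N] by auto
  qed
  have zk: "Poly_Mapping.keys z \<subseteq> carrier S \<times> carrier M" using z(1) NM by blast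
  have "h (frag_of (s, m)) = h ((frag_of (s, m) - z) + z)" by simp
  also have "\<dots> = h (frag_of (s, m) - z) \<oplus>\<^bsub>M\<^esub> h z"
    by (rule h_add[OF keys_diff_subset zk]) (use s m zk in auto)
  also have "\<dots> = h z" using h_rel[OF z(2)] hc[OF zk] by simp
  finally show ?thesis using h_N[OF z(1)] hf'[OF s m] by simp
qed

text \<open>Cosets are replaced by representatives. The relations over N are among those over M, so
  the induced map sends the coset of z over N to the coset of z over M, and equality of cosets
  becomes a difference in the relations.\<close>

lemma plus_closure_iff:
  assumes P: "module R (abs_int_closure R L)" and M: "module R M" and N: "submodule N R M"
  shows "m \<in> plus_closure R L M N \<longleftrightarrow> m \<in> carrier M \<and>
    (\<exists>z. Poly_Mapping.keys z \<subseteq> carrier (abs_int_closure R L) \<times> N \<and>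
      frag_of (\<one>\<^bsub>abs_int_closure R L\<^esub>, m) - z \<in> tensor_rel R (abs_int_closure R L) M)"
proof -
  define P where "P = abs_int_closure R L"
  have Pm: "module R P" unfolding P_def by (rule P)
  define rel where "rel = tensor_rel R P M"
  define relN where "relN = tensor_rel R P (M\<lparr>carrier := N\<rparr>)"
  have relN_rel: "relN \<subseteq> rel" unfolding rel_def relN_def by (rule tensor_rel_submodule_mono[OF Pm M N])
  have zero: "0 \<in> rel" "0 \<in> relN" unfolding rel_def relN_def by (rule tensor_rel_zero)+
  have add: "x + y \<in> rel" if "x \<in> rel" "y \<in> rel" for x y using that unfolding rel_def by (rule tensor_rel_add)
  have diff: "x - y \<in> rel" if "x \<in> rel" "y \<in> rel" for x y using that unfolding rel_def by (rule tensor_rel_minus[OF Pm M])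
  have pure: "pure_tensor R P M p x = {\<rho> + frag_of (p, x) | \<rho>. \<rho> \<in> rel}" for p x
    by (auto simp: pure_tensor_def r_coset_def rel_def)
  have incl: "tensor_incl R P M (relN #>\<^bsub>free_Abelian_group (carrier P \<times> N)\<^esub> z) = {\<rho> + (\<rho>' + z) | \<rho> \<rho>'. \<rho> \<in> rel \<and> \<rho>' \<in> relN}" for z
    by (auto simp: tensor_incl_def r_coset_def set_mult_def rel_def)
  have car: "carrier (tensor_product R P (M\<lparr>carrier := N\<rparr>)) =
      {relN #>\<^bsub>free_Abelian_group (carrier P \<times> N)\<^esub> z | z. Poly_Mapping.keys z \<subseteq> carrier P \<times> N}"
    by (auto simp: tensor_product_def FactGroup_def RCOSETS_def relN_def)
  have eq: "pure_tensor R P M p x = tensor_incl R P M (relN #>\<^bsub>free_Abelian_group (carrier P \<times> N)\<^esub> z) \<longleftrightarrow>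
      frag_of (p, x) - z \<in> rel" for p x z
  proof
    assume "pure_tensor R P M p x = tensor_incl R P M (relN #>\<^bsub>free_Abelian_group (carrier P \<times> N)\<^esub> z)"
    moreover have "0 + frag_of (p, x) \<in> pure_tensor R P M p x" unfolding pure using zero by blast
    ultimately obtain \<rho> \<rho>' where \<rho>: "frag_of (p, x) = \<rho> + (\<rho>' + z)" "\<rho> \<in> rel" "\<rho>' \<in> relN" unfolding incl by auto
    then have "frag_of (p, x) - z = \<rho> + \<rho>'" by (simp add: algebra_simps)
    then show "frag_of (p, x) - z \<in> rel" using add[OF \<rho>(2)] \<rho>(3) relN_rel by auto
  next
    assume *: "frag_of (p, x) - z \<in> rel"
    show "pure_tensor R P M p x = tensor_incl R P M (relN #>\<^bsub>free_Abelian_group (carrier P \<times> N)\<^esub> z)"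
      unfolding pure incl
    proof (intro equalityI subsetI)
      fix y assume "y \<in> {\<rho> + frag_of (p, x) | \<rho>. \<rho> \<in> rel}"
      then obtain \<rho> where \<rho>: "\<rho> \<in> rel" "y = \<rho> + frag_of (p, x)" by blast
      have "y = (\<rho> + (frag_of (p, x) - z)) + (0 + z)" using \<rho> by simp
      then show "y \<in> {\<rho> + (\<rho>' + z) | \<rho> \<rho>'. \<rho> \<in> rel \<and> \<rho>' \<in> relN}" using add[OF \<rho>(1) *] zero(2) by blast
    next
      fix y assume "y \<in> {\<rho> + (\<rho>' + z) | \<rho> \<rho>'. \<rho> \<in> rel \<and> \<rho>' \<in> relN}"
      then obtain \<rho> \<rho>' where \<rho>: "\<rho> \<in> rel" "\<rho>' \<in> relN" "y = \<rho> + (\<rho>' + z)" by blast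
      have "y = (\<rho> + \<rho>' - (frag_of (p, x) - z)) + frag_of (p, x)" using \<rho>(3) by simp
      moreover have "\<rho> + \<rho>' - (frag_of (p, x) - z) \<in> rel" using diff[OF add[OF \<rho>(1)] *] \<rho>(2) relN_rel by auto
      ultimately show "y \<in> {\<rho> + frag_of (p, x) | \<rho>. \<rho> \<in> rel}" by blast
    qed
  qed
  have "pure_tensor R P M \<one>\<^bsub>P\<^esub> m \<in> tensor_incl R P M ` carrier (tensor_product R P (M\<lparr>carrier := N\<rparr>)) \<longleftrightarrow>
      (\<exists>z. Poly_Mapping.keys z \<subseteq> carrier P \<times> N \<and> frag_of (\<one>\<^bsub>P\<^esub>, m) - z \<in> rel)"
    unfolding car using eq by blast
  then show ?thesis by (simp add: plus_closure_def Let_def P_def rel_def)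
qed

section \<open>Comparison of trace ideals, the plus closure test ideal and colon ideals\<close>

context noetherian_base_algebra
begin

lemma plus_trace_ideal_subset_test_ideal: "plus_trace_ideal R L \<subseteq> big_plus_test_ideal TYPE('m) R L"
proof
  fix c assume c: "c \<in> plus_trace_ideal R L"
  define P where "P = abs_int_closure R L"
  have Pm: "module R P" unfolding P_def by (rule abs_int_closure_module)
  have sub: "L\<lparr>carrier := S\<rparr> = P\<lparr>carrier := S\<rparr>" for S by (simp add: P_def abs_int_closure_def)
  have one: "\<one>\<^bsub>P\<^esub> = \<one>\<^bsub>L\<^esub>" by (simp add: P_def abs_int_closure_def)
  have ex: "\<exists>\<phi>\<in>mod_hom R (P\<lparr>carrier := S\<rparr>) (self_module R). c = \<phi> \<one>\<^bsub>P\<^esub>" if "finite_subring S" for S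
  proof -
    have "c \<in> trace_ideal R (L\<lparr>carrier := S\<rparr>)"
      using c finite_subring_in_finite_subalgebras[OF that] unfolding plus_trace_ideal_def by blast
    then show ?thesis unfolding trace_ideal_def sub by auto
  qed
  have one_S: "\<one>\<^bsub>P\<^esub> \<in> S" if "finite_subring S" for S
    using that subringE(3) by (auto simp: finite_subring_def one)
  have cc: "c \<in> carrier R"
  proof -
    obtain \<phi> where "\<phi> \<in> mod_hom R (P\<lparr>carrier := img\<rparr>) (self_module R)" "c = \<phi> \<one>\<^bsub>P\<^esub>"
      using ex[OF finite_subring_img] by blast
    then show ?thesis using mod_hom_self_moduleD(1)[of \<phi> R "P\<lparr>carrier := img\<rparr>" "\<one>\<^bsub>P\<^esub>"] one_S[OF finite_subring_img] by simp
  qed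
  have "c \<odot>\<^bsub>M\<^esub> m \<in> N" if M: "module R M" "submodule N R M" and m: "m \<in> plus_closure R L M N" for M :: "('a, 'm) module" and N m
  proof -
    obtain z where mc: "m \<in> carrier M" and z: "Poly_Mapping.keys z \<subseteq> carrier P \<times> N"
      and rel: "frag_of (\<one>\<^bsub>P\<^esub>, m) - z \<in> tensor_rel R P M"
      using m plus_closure_iff[OF abs_int_closure_module M] unfolding P_def by blast
    obtain T where T: "finite T" "T \<subseteq> carrier P"
      "\<And>S. submodule S R P \<Longrightarrow> T \<subseteq> S \<Longrightarrow> frag_of (\<one>\<^bsub>P\<^esub>, m) - z \<in> tensor_rel R (P\<lparr>carrier := S\<rparr>) M"
      using tensor_rel_finitary[OF Pm M(1) rel] by blast
    \<comment> \<open>Besides the elements needed for the relation, S must contain the first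
      components of z, so that z itself is supported on S x N.\<close>
    define T' where "T' = T \<union> fst ` Poly_Mapping.keys z"
    have "finite T'" using T(1) by (simp add: T'_def)
    moreover have "T' \<subseteq> {x \<in> carrier L. integral_over R L x}"
      using T(2) z by (auto simp: T'_def P_def abs_int_closure_def)
    ultimately obtain S where S: "finite_subring S" "T' \<subseteq> S" using finite_subring_exists by blast
    have "finite_module R (P\<lparr>carrier := S\<rparr>)"
      using A.finite_submodule_imp_finite_module[of S] S(1) by (simp add: finite_subring_def sub)
    then have Sm: "module R (P\<lparr>carrier := S\<rparr>)" by (simp add: finite_module_def)
    have SP: "S \<subseteq> carrier P" unfolding P_def by (rule finite_subring_subset[OF S(1)])
    have Ssub: "submodule S R P" by (rule module.module_incl_imp_submodule[OF Pm SP Sm])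
    obtain \<phi> where \<phi>: "\<phi> \<in> mod_hom R (P\<lparr>carrier := S\<rparr>) (self_module R)" "c = \<phi> \<one>\<^bsub>P\<^esub>" using ex[OF S(1)] by blast
    have "fst ` Poly_Mapping.keys z \<subseteq> S" using S(2) by (simp add: T'_def)
    then have "Poly_Mapping.keys z \<subseteq> carrier (P\<lparr>carrier := S\<rparr>) \<times> N" using z by auto
    moreover have "frag_of (\<one>\<^bsub>P\<^esub>, m) - z \<in> tensor_rel R (P\<lparr>carrier := S\<rparr>) M"
      by (rule T(3)[OF Ssub]) (use S(2) in \<open>simp add: T'_def\<close>)
    ultimately show ?thesis
      using tensor_rel_evaluation[OF Sm M \<phi>(1) _ mc, of "\<one>\<^bsub>P\<^esub>" z] one_S[OF S(1)] \<phi>(2) by simp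
  qed
  then show "c \<in> big_plus_test_ideal TYPE('m) R L"
    unfolding big_plus_test_ideal_def colon_def using cc by blast
qed

text \<open>The test ideal is evaluated at M = R and N = I: the plus closure of I in R contains the
  contraction of I R^+, because a sum of p i gives an element of the image of the tensor product of
  R^+ and I.\<close>

lemma test_ideal_subset_colon:
  assumes I: "ideal I R"
  shows "big_plus_test_ideal TYPE('a + 'm) R L \<subseteq> colon R (self_module R) I (ext_contr R (abs_int_closure R L) I)"
proof
  fix c assume c: "c \<in> big_plus_test_ideal TYPE('a + 'm) R L"
  define P where "P = abs_int_closure R L"
  have Pm: "module R P" unfolding P_def by (rule abs_int_closure_module)
  interpret Pc: cring P unfolding P_def by (rule abs_int_closure_cring)
  interpret P: module R P by (rule Pm)
  \<comment> \<open>A copy of R on the left summand, since the test modules live on the sum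
    type.\<close>
  define M :: "('a, 'a + 'm) module" where "M = \<lparr>carrier = Inl ` carrier R,
    monoid.mult = (\<lambda>u v. u), one = Inl \<one>\<^bsub>R\<^esub>, ring.zero = Inl \<zero>\<^bsub>R\<^esub>, add = (\<lambda>u v. Inl (projl u \<oplus>\<^bsub>R\<^esub> projl v)),
    smult = (\<lambda>a u. Inl (a \<otimes>\<^bsub>R\<^esub> projl u))\<rparr>"
  have M_simps: "carrier M = Inl ` carrier R" "Inl a \<oplus>\<^bsub>M\<^esub> Inl b = Inl (a \<oplus>\<^bsub>R\<^esub> b)" "r \<odot>\<^bsub>M\<^esub> Inl a = Inl (r \<otimes>\<^bsub>R\<^esub> a)"
    "\<zero>\<^bsub>M\<^esub> = Inl \<zero>\<^bsub>R\<^esub>" for a b r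
    by (simp_all add: M_def)
  have Mm: "module R M"
  proof (rule moduleI[OF R_cring])
    show "abelian_group M"
    proof (rule abelian_groupI)
      fix u assume "u \<in> carrier M"
      then obtain a where "u = Inl a" "a \<in> carrier R" by (auto simp: M_simps)
      then show "\<exists>v\<in>carrier M. v \<oplus>\<^bsub>M\<^esub> u = \<zero>\<^bsub>M\<^esub>"
        by (intro bexI[of _ "Inl (\<ominus>\<^bsub>R\<^esub> a)"]) (auto simp: M_simps A.R.l_neg)
    qed (auto simp: M_simps A.R.a_ac)
  qed (auto simp: M_simps A.R.l_distr A.R.r_distr A.R.m_assoc)
  interpret M: module R M by (rule Mm)
  have Ic: "i \<in> carrier R" if "i \<in> I" for i using ideal.Icarr[OF I that] .
  have N: "submodule (Inl ` I) R M"
    by (rule M.submoduleI')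
      (use Ic additive_subgroup.zero_closed[OF ideal.axioms(1)[OF I]]
        additive_subgroup.a_closed[OF ideal.axioms(1)[OF I]] ideal.I_l_closed[OF I] in \<open>auto simp: M_simps\<close>)
  have c_colon: "c \<in> colon R M (Inl ` I) (plus_closure R L M (Inl ` I))"
    using c Mm N unfolding big_plus_test_ideal_def by blast
  then have cc: "c \<in> carrier R" by (simp add: colon_def)
  define rel where "rel = tensor_rel R P M"
  have add: "x + y \<in> rel" if "x \<in> rel" "y \<in> rel" for x y using that unfolding rel_def by (rule tensor_rel_add)
  have diff: "x - y \<in> rel" if "x \<in> rel" "y \<in> rel" for x y using that unfolding rel_def by (rule tensor_rel_minus[OF Pm Mm])
  have smult_mult: "(r \<odot>\<^bsub>P\<^esub> p) \<otimes>\<^bsub>P\<^esub> q = r \<odot>\<^bsub>P\<^esub> (p \<otimes>\<^bsub>P\<^esub> q)" if "r \<in> carrier R" "p \<in> carrier P" "q \<in> carrier P" for r p q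
    using that A.smult_assoc2[of r p q] by (simp add: P_def abs_int_closure_def)
  let ?e = "Inl \<one>\<^bsub>R\<^esub> :: 'a + 'm"
  have eM: "?e \<in> carrier M" by (simp add: M_simps)
  \<comment> \<open>The elements p for which every multiple q p, tensored with 1, comes from I. The
    factor q makes D closed under multiplication, so that it contains I R^+ once it contains the
    image of I.\<close>
  define D where "D = {p \<in> carrier P. \<forall>q\<in>carrier P. \<exists>z. Poly_Mapping.keys z \<subseteq> carrier P \<times> Inl ` I \<and>
    frag_of (q \<otimes>\<^bsub>P\<^esub> p, ?e) - z \<in> rel}"
  have DE: "\<exists>z. Poly_Mapping.keys z \<subseteq> carrier P \<times> Inl ` I \<and> frag_of (q \<otimes>\<^bsub>P\<^esub> p, ?e) - z \<in> rel"
    if "p \<in> D" "q \<in> carrier P" for p q using that by (simp add: D_def)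
  have D: "ideal D P"
  proof (rule Pc.idealI_cring)
    show "D \<subseteq> carrier P" by (auto simp: D_def)
    \<comment> \<open>The additivity relation for 0 + 0 = 0 collapses to minus the tensor of 0 and
      1, so the latter is a relation.\<close>
    have "- (frag_of (\<zero>\<^bsub>P\<^esub> \<oplus>\<^bsub>P\<^esub> \<zero>\<^bsub>P\<^esub>, ?e) - frag_of (\<zero>\<^bsub>P\<^esub>, ?e) - frag_of (\<zero>\<^bsub>P\<^esub>, ?e)) \<in> rel"
      unfolding rel_def by (intro tensor_rel_uminus[OF Pm Mm] tensor_rel_intros(1)) (simp_all add: eM)
    then have "frag_of (\<zero>\<^bsub>P\<^esub>, ?e) - 0 \<in> rel" by simp
    then show "\<zero>\<^bsub>P\<^esub> \<in> D" unfolding D_def by (intro CollectI conjI ballI exI[of _ 0]) simp_all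
  next
    fix p p' assume p: "p \<in> D" "p' \<in> D"
    then have pc: "p \<in> carrier P" "p' \<in> carrier P" by (auto simp: D_def)
    have "\<exists>z. Poly_Mapping.keys z \<subseteq> carrier P \<times> Inl ` I \<and> frag_of (q \<otimes>\<^bsub>P\<^esub> (p \<oplus>\<^bsub>P\<^esub> p'), ?e) - z \<in> rel" if q: "q \<in> carrier P" for q
    proof -
      obtain z where z: "Poly_Mapping.keys z \<subseteq> carrier P \<times> Inl ` I" "frag_of (q \<otimes>\<^bsub>P\<^esub> p, ?e) - z \<in> rel" using DE[OF p(1) q] by blast
      obtain z' where z': "Poly_Mapping.keys z' \<subseteq> carrier P \<times> Inl ` I" "frag_of (q \<otimes>\<^bsub>P\<^esub> p', ?e) - z' \<in> rel" using DE[OF p(2) q] by blast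
      have 1: "frag_of (q \<otimes>\<^bsub>P\<^esub> p \<oplus>\<^bsub>P\<^esub> q \<otimes>\<^bsub>P\<^esub> p', ?e) - frag_of (q \<otimes>\<^bsub>P\<^esub> p, ?e) - frag_of (q \<otimes>\<^bsub>P\<^esub> p', ?e) \<in> rel"
        unfolding rel_def by (rule tensor_rel_intros(1)) (use q pc eM in auto)
      have "(frag_of (q \<otimes>\<^bsub>P\<^esub> p \<oplus>\<^bsub>P\<^esub> q \<otimes>\<^bsub>P\<^esub> p', ?e) - frag_of (q \<otimes>\<^bsub>P\<^esub> p, ?e) - frag_of (q \<otimes>\<^bsub>P\<^esub> p', ?e))
          + ((frag_of (q \<otimes>\<^bsub>P\<^esub> p, ?e) - z) + (frag_of (q \<otimes>\<^bsub>P\<^esub> p', ?e) - z')) \<in> rel"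
        by (intro add 1 z(2) z'(2))
      then have "frag_of (q \<otimes>\<^bsub>P\<^esub> (p \<oplus>\<^bsub>P\<^esub> p'), ?e) - (z + z') \<in> rel"
        using q pc by (simp add: Pc.r_distr algebra_simps)
      moreover have "Poly_Mapping.keys (z + z') \<subseteq> carrier P \<times> Inl ` I" using keys_add[of z z'] z(1) z'(1) by blast
      ultimately show ?thesis by blast
    qed
    then show "p \<oplus>\<^bsub>P\<^esub> p' \<in> D" using pc by (simp add: D_def)
  next
    fix p s assume p: "p \<in> D" and s: "s \<in> carrier P"
    then have pc: "p \<in> carrier P" by (auto simp: D_def)
    have "q \<otimes>\<^bsub>P\<^esub> (s \<otimes>\<^bsub>P\<^esub> p) = (q \<otimes>\<^bsub>P\<^esub> s) \<otimes>\<^bsub>P\<^esub> p" if "q \<in> carrier P" for q using that pc s by (simp add: Pc.m_assoc)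
    then show "s \<otimes>\<^bsub>P\<^esub> p \<in> D" using DE[OF p Pc.m_closed[OF _ s]] pc s by (simp add: D_def)
  qed
  have map_D: "algebra_map P ` I \<subseteq> D"
  proof
    fix b assume "b \<in> algebra_map P ` I"
    then obtain i where i: "i \<in> I" "b = i \<odot>\<^bsub>P\<^esub> \<one>\<^bsub>P\<^esub>" by (auto simp: algebra_map_def)
    have bc: "b \<in> carrier P" using i Ic by simp
    have "\<exists>z. Poly_Mapping.keys z \<subseteq> carrier P \<times> Inl ` I \<and> frag_of (q \<otimes>\<^bsub>P\<^esub> b, ?e) - z \<in> rel" if q: "q \<in> carrier P" for q
    proof -
      have "q \<otimes>\<^bsub>P\<^esub> b = i \<odot>\<^bsub>P\<^esub> q"
        using Pc.m_comm[OF q bc] smult_mult[OF Ic[OF i(1)] Pc.one_closed q] i(2) q by simp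
      moreover have "frag_of (i \<odot>\<^bsub>P\<^esub> q, ?e) - frag_of (q, i \<odot>\<^bsub>M\<^esub> ?e) \<in> rel"
        unfolding rel_def by (rule tensor_rel_intros(3)[OF Ic[OF i(1)] q eM])
      moreover have "i \<odot>\<^bsub>M\<^esub> ?e = Inl i" using Ic[OF i(1)] by (simp add: M_simps)
      ultimately show ?thesis using q i(1) by (intro exI[of _ "frag_of (q, Inl i)"]) auto
    qed
    then show "b \<in> D" using bc by (simp add: D_def)
  qed
  have "c \<otimes>\<^bsub>R\<^esub> r \<in> I" if r: "r \<in> ext_contr R P I" for r
  proof -
    have rc: "r \<in> carrier R" and "algebra_map P r \<in> Idl\<^bsub>P\<^esub> (algebra_map P ` I)" using r by (auto simp: ext_contr_def)
    then have "algebra_map P r \<in> D" using Pc.genideal_minimal[OF D map_D] by blast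
    then obtain z where z: "Poly_Mapping.keys z \<subseteq> carrier P \<times> Inl ` I"
      "frag_of (\<one>\<^bsub>P\<^esub> \<otimes>\<^bsub>P\<^esub> algebra_map P r, ?e) - z \<in> rel" using DE[OF _ Pc.one_closed] by blast
    have eq: "\<one>\<^bsub>P\<^esub> \<otimes>\<^bsub>P\<^esub> algebra_map P r = r \<odot>\<^bsub>P\<^esub> \<one>\<^bsub>P\<^esub>" using rc by (simp add: algebra_map_def)
    have "frag_of (r \<odot>\<^bsub>P\<^esub> \<one>\<^bsub>P\<^esub>, ?e) - frag_of (\<one>\<^bsub>P\<^esub>, r \<odot>\<^bsub>M\<^esub> ?e) \<in> rel"
      unfolding rel_def by (rule tensor_rel_intros(3)[OF rc Pc.one_closed eM])
    then have "frag_of (r \<odot>\<^bsub>P\<^esub> \<one>\<^bsub>P\<^esub>, ?e) - frag_of (\<one>\<^bsub>P\<^esub>, Inl r) \<in> rel" using rc by (simp add: M_simps)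
    from diff[OF z(2)[unfolded eq] this] have "frag_of (\<one>\<^bsub>P\<^esub>, Inl r) - z \<in> rel" by simp
    then have "Inl r \<in> plus_closure R L M (Inl ` I)"
      using plus_closure_iff[OF abs_int_closure_module Mm N] z(1) rc unfolding P_def rel_def by (auto simp: M_simps)
    then have "c \<odot>\<^bsub>M\<^esub> Inl r \<in> Inl ` I" using c_colon by (simp add: colon_def)
    then show ?thesis by (auto simp: M_simps)
  qed
  then show "c \<in> colon R (self_module R) I (ext_contr R (abs_int_closure R L) I)"
    using cc by (simp add: colon_def P_def)
qed

text \<open>For each finite subalgebra S the linear-system theorem yields a map S -> R with 1 |-> c,
  its congruence hypothesis being what membership of c in all colon ideals provides.\<close>

lemma colon_subset_plus_trace_ideal:
  assumes R: "noetherian_domain R" "approx_gorenstein R"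
  shows "(\<Inter>I\<in>{I. ideal I R}. colon R (self_module R) I (ext_contr R (abs_int_closure R L) I)) \<subseteq> plus_trace_ideal R L"
proof
  define P where "P = abs_int_closure R L"
  have Pm: "module R P" unfolding P_def by (rule abs_int_closure_module)
  interpret Pc: cring P unfolding P_def by (rule abs_int_closure_cring)
  interpret P: module R P by (rule Pm)
  interpret Pa: algebra R P
    by (rule algebraI[OF R_cring Pc.is_cring])
      (use P.smult_closed P.smult_l_distr P.smult_r_distr P.smult_assoc1 A.smult_assoc2 in \<open>auto simp: P_def abs_int_closure_def\<close>)
  fix c assume c: "c \<in> (\<Inter>I\<in>{I. ideal I R}. colon R (self_module R) I (ext_contr R (abs_int_closure R L) I))"
  have c_colon: "c \<in> carrier R" "\<And>x. x \<in> ext_contr R P I \<Longrightarrow> c \<otimes>\<^bsub>R\<^esub> x \<in> I" if "ideal I R" for I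
    using c that by (auto simp: colon_def P_def)
  have cc: "c \<in> carrier R" by (rule c_colon(1)[OF A.R.oneideal])
  have "c \<in> trace_ideal R B" if B: "B \<in> finite_subalgebras R P" for B
  proof -
    obtain S where S: "B = P\<lparr>carrier := S\<rparr>" "subring S P" "algebra_map P ` carrier R \<subseteq> S" "finite_module R (P\<lparr>carrier := S\<rparr>)"
      using B unfolding finite_subalgebras_def by blast
    have Sm: "module R (P\<lparr>carrier := S\<rparr>)" using S(4) by (simp add: finite_module_def)
    interpret Sm: module R "P\<lparr>carrier := S\<rparr>" by (rule Sm)
    note S' = subringE[OF S(2)]
    \<comment> \<open>The trace on S of J R^+, instead of JS. Membership of r 1 in it says that r
      lies in the contraction from R^+, which is all that the colon ideals control.\<close>
    define N where "N J = S \<inter> Idl\<^bsub>P\<^esub> (algebra_map P ` J)" for J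
    have map_sub: "algebra_map P ` J \<subseteq> carrier P" if "ideal J R" for J
      using Pa.algebra_map_closed ideal.Icarr[OF that] by blast
    have Nid: "ideal (Idl\<^bsub>P\<^esub> (algebra_map P ` J)) P" if "ideal J R" for J
      by (rule Pc.genideal_ideal[OF map_sub[OF that]])
    have "\<exists>\<phi>\<in>mod_hom R (P\<lparr>carrier := S\<rparr>) (self_module R). \<phi> \<one>\<^bsub>P\<^esub> = c"
    proof (rule hom_exists_if_self_injective[OF R S(4) _ cc, of _ N])
      show "\<one>\<^bsub>P\<^esub> \<in> carrier (P\<lparr>carrier := S\<rparr>)" using S'(3) by simp
      fix J assume J: "ideal J R"
      note NP = submoduleD[OF Pa.ideal_submodule[OF Nid[OF J]]]
      show "submodule (N J) R (P\<lparr>carrier := S\<rparr>)"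
      proof (rule Sm.submoduleI')
        show "r \<odot>\<^bsub>P\<lparr>carrier := S\<rparr>\<^esub> a \<in> N J" if "r \<in> carrier R" "a \<in> N J" for r a
          using that NP(4) Sm.smult_closed[of r a] by (simp add: N_def)
      qed (use NP S' in \<open>auto simp: N_def\<close>)
      show "j \<odot>\<^bsub>P\<lparr>carrier := S\<rparr>\<^esub> x \<in> N J" if j: "j \<in> J" and x: "x \<in> carrier (P\<lparr>carrier := S\<rparr>)" for j x
      proof -
        have xS: "x \<in> S" "x \<in> carrier P" using x S'(1) by auto
        have jc: "j \<in> carrier R" using ideal.Icarr[OF J j] .
        have "algebra_map P j \<in> Idl\<^bsub>P\<^esub> (algebra_map P ` J)" using Pc.genideal_self[OF map_sub[OF J]] j by blast
        then have "algebra_map P j \<otimes>\<^bsub>P\<^esub> x \<in> Idl\<^bsub>P\<^esub> (algebra_map P ` J)" using ideal.I_r_closed[OF Nid[OF J]] xS(2) by blast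
        then show ?thesis using Pa.smult_eq_mult[OF jc xS(2)] Sm.smult_closed[OF jc x] by (simp add: N_def)
      qed
      show "r \<otimes>\<^bsub>R\<^esub> c \<in> J" if r: "r \<in> carrier R" "r \<odot>\<^bsub>P\<lparr>carrier := S\<rparr>\<^esub> \<one>\<^bsub>P\<^esub> \<in> N J" for r
      proof -
        have "r \<in> ext_contr R P J" using r by (simp add: ext_contr_def N_def algebra_map_def)
        then show ?thesis using c_colon(2)[OF J] A.R.m_comm[OF r(1) cc] by simp
      qed
    qed
    then show ?thesis unfolding S(1) trace_ideal_def by (auto intro: rev_image_eqI)
  qed
  then show "c \<in> plus_trace_ideal R L" unfolding plus_trace_ideal_def P_def by blast
qed

end

theorem proposition1p0p3:
  fixes R :: "('a, 'x) ring_scheme"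
  assumes "noetherian_domain R" and "approx_gorenstein R"
  shows "(\<forall>L :: ('a, 'l) module. alg_closure_of_fractions R L \<longrightarrow>
            plus_trace_ideal R L = big_plus_test_ideal TYPE('a + 'm) R L \<and>
            big_plus_test_ideal TYPE('a + 'm) R L =
              (\<Inter>I\<in>{I. ideal I R}. colon R (self_module R) I (ext_contr R (abs_int_closure R L) I)))
       \<and> (\<forall>B :: ('a, 'b) module. complete_local_ring R \<and> algebra R B \<longrightarrow>
            trace_ideal R B = (\<Inter>I\<in>{I. ideal I R}. colon R (self_module R) I (ext_contr R B I)))"
proof (intro conjI allI impI)
  fix L :: "('a, 'l) module" assume L: "alg_closure_of_fractions R L"
  have LA: "algebra R L" using L by (simp add: alg_closure_of_fractions_def)
  have "field L" using L unfolding alg_closure_of_fractions_def algebraic_closure_def by blast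
  then have "\<one>\<^bsub>L\<^esub> \<noteq> \<zero>\<^bsub>L\<^esub>" using domain.one_not_zero field.axioms(1) by blast
  then interpret noetherian_base_algebra R L
    using assms(1) by (intro noetherian_base_algebra.intro noetherian_base_algebra_axioms.intro
        algebra.M_cring[OF LA] LA noetherian_domain.axioms(1))
  \<comment> \<open>The three inclusions form a cycle, so both equalities follow from them.\<close>
  have 1: "plus_trace_ideal R L \<subseteq> big_plus_test_ideal TYPE('a + 'm) R L"
    by (rule plus_trace_ideal_subset_test_ideal)
  have 2: "big_plus_test_ideal TYPE('a + 'm) R L \<subseteq>
      (\<Inter>I\<in>{I. ideal I R}. colon R (self_module R) I (ext_contr R (abs_int_closure R L) I))"
    using test_ideal_subset_colon by blast
  note 3 = colon_subset_plus_trace_ideal[OF assms]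
  show "plus_trace_ideal R L = big_plus_test_ideal TYPE('a + 'm) R L" using 1 2 3 by blast
  show "big_plus_test_ideal TYPE('a + 'm) R L =
      (\<Inter>I\<in>{I. ideal I R}. colon R (self_module R) I (ext_contr R (abs_int_closure R L) I))" using 1 2 3 by blast
next
  fix B :: "('a, 'b) module" assume "complete_local_ring R \<and> algebra R B"
  then show "trace_ideal R B = (\<Inter>I\<in>{I. ideal I R}. colon R (self_module R) I (ext_contr R B I))"
    using trace_ideal_complete[OF assms] by blast
qed

end
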